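(* Let $p$ be a prime and $R$ a local ring which is finite as a $\mathbb{Z}_p$-module, with $\mathbb{Z}_p\subset R$ and residue field $\mathbb{F}_R$. For $N\geq 1$ let $\mu_{R,N}$ be the pushforward of the Haar probability measure on $\mathrm{End}_R(R^N)$ under the map $G\mapsto\mathrm{Coker}\,G$ to the set $S_R$ of isomorphism classes of finite $R$-modules; the endomorphisms with infinite cokernel form a set of measure zero. Then the $\mu_{R,N}$ converge in the weak-* topology, as $N\to\infty$, to a probability measure $\mu_R$ supported on $T_R$. For every $M\in T_R$, $$\mu_R(M)=\frac{c_R}{\#\mathrm{Aut}_R(M)},\qquad c_R=\lim_{n\to\infty}\frac{|\mathrm{GL}_n(\mathbb{F}_R)|}{|M_n(\mathbb{F}_R)|}=\prod_{i=1}^\infty\big(1-|\mathbb{F}_R|^{-i}\big).$$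
   Context: $T_R\subseteq S_R$ is the set of finite $R$-modules isomorphic to the cokernel of some $R$-linear endomorphism of $R^N$ for some $N$. *)

theory Defs
  imports "HOL-Algebra.QuotRing" "HOL-Algebra.Module" "HOL-Probability.Probability"
begin

definition padic_int :: "nat \<Rightarrow> (nat \<Rightarrow> int) ring" where
  "padic_int p = \<lparr> partial_object.carrier = {x. \<forall>k. 0 \<le> x k \<and> x k < int p ^ k \<and> x (Suc k) mod (int p ^ k) = x k},
                   monoid.mult = (\<lambda>x y k. (x k * y k) mod (int p ^ k)),
                   monoid.one = (\<lambda>k. 1 mod (int p ^ k)),
                   ring.zero = (\<lambda>k. 0),
                   ring.add = (\<lambda>x y k. (x k + y k) mod (int p ^ k)) \<rparr>"

definition local_ring :: "('a, 'b) ring_scheme \<Rightarrow> bool" where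
  "local_ring R \<longleftrightarrow> cring R \<and> (\<exists>!m. maximalideal m R)"

definition finite_Zp_algebra :: "nat \<Rightarrow> ('a, 'b) ring_scheme \<Rightarrow> bool" where
  "finite_Zp_algebra p R \<longleftrightarrow>
     (\<exists>\<iota>. \<iota> \<in> ring_hom (padic_int p) R \<and> inj_on \<iota> (carrier (padic_int p)) \<and>
        (\<exists>S. finite S \<and> S \<subseteq> carrier R \<and>
           (\<forall>r\<in>carrier R. \<exists>a. (\<forall>s\<in>S. a s \<in> carrier (padic_int p)) \<and>
                r = finsum R (\<lambda>s. \<iota> (a s) \<otimes>\<^bsub>R\<^esub> s) S)))"

definition residue_field :: "('a, 'b) ring_scheme \<Rightarrow> 'a set ring" where
  "residue_field R = R Quot (THE m. maximalideal m R)"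

definition vecs :: "('a, 'b) ring_scheme \<Rightarrow> nat \<Rightarrow> (nat \<Rightarrow> 'a) set" where
  "vecs R N = {v. (\<forall>i<N. v i \<in> carrier R) \<and> (\<forall>i. N \<le> i \<longrightarrow> v i = \<zero>\<^bsub>R\<^esub>)}"

definition mats :: "('a, 'b) ring_scheme \<Rightarrow> nat \<Rightarrow> (nat \<Rightarrow> nat \<Rightarrow> 'a) set" where
  "mats R N = {A. \<forall>i j. (i < N \<and> j < N \<longrightarrow> A i j \<in> carrier R) \<and>
                        (\<not> (i < N \<and> j < N) \<longrightarrow> A i j = \<zero>\<^bsub>R\<^esub>)}"

definition vec_add :: "('a, 'b) ring_scheme \<Rightarrow> (nat \<Rightarrow> 'a) \<Rightarrow> (nat \<Rightarrow> 'a) \<Rightarrow> nat \<Rightarrow> 'a" where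
  "vec_add R u v = (\<lambda>i. u i \<oplus>\<^bsub>R\<^esub> v i)"

definition vec_smult :: "('a, 'b) ring_scheme \<Rightarrow> 'a \<Rightarrow> (nat \<Rightarrow> 'a) \<Rightarrow> nat \<Rightarrow> 'a" where
  "vec_smult R r v = (\<lambda>i. r \<otimes>\<^bsub>R\<^esub> v i)"

definition mat_add :: "('a, 'b) ring_scheme \<Rightarrow> (nat \<Rightarrow> nat \<Rightarrow> 'a) \<Rightarrow> (nat \<Rightarrow> nat \<Rightarrow> 'a) \<Rightarrow> nat \<Rightarrow> nat \<Rightarrow> 'a" where
  "mat_add R A B = (\<lambda>i j. A i j \<oplus>\<^bsub>R\<^esub> B i j)"

definition mat_mult :: "('a, 'b) ring_scheme \<Rightarrow> nat \<Rightarrow> (nat \<Rightarrow> nat \<Rightarrow> 'a) \<Rightarrow> (nat \<Rightarrow> nat \<Rightarrow> 'a) \<Rightarrow> nat \<Rightarrow> nat \<Rightarrow> 'a" where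
  "mat_mult R N A B = (\<lambda>i j. if i < N \<and> j < N then finsum R (\<lambda>l. A i l \<otimes>\<^bsub>R\<^esub> B l j) {..<N} else \<zero>\<^bsub>R\<^esub>)"

definition mat_one :: "('a, 'b) ring_scheme \<Rightarrow> nat \<Rightarrow> nat \<Rightarrow> nat \<Rightarrow> 'a" where
  "mat_one R N = (\<lambda>i j. if i < N \<and> j < N \<and> i = j then \<one>\<^bsub>R\<^esub> else \<zero>\<^bsub>R\<^esub>)"

definition mat_vec :: "('a, 'b) ring_scheme \<Rightarrow> nat \<Rightarrow> (nat \<Rightarrow> nat \<Rightarrow> 'a) \<Rightarrow> (nat \<Rightarrow> 'a) \<Rightarrow> nat \<Rightarrow> 'a" where
  "mat_vec R N G v = (\<lambda>i. if i < N then finsum R (\<lambda>j. G i j \<otimes>\<^bsub>R\<^esub> v j) {..<N} else \<zero>\<^bsub>R\<^esub>)"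

definition GL :: "('a, 'b) ring_scheme \<Rightarrow> nat \<Rightarrow> (nat \<Rightarrow> nat \<Rightarrow> 'a) set" where
  "GL K n = {A \<in> mats K n. \<exists>B\<in>mats K n. mat_mult K n A B = mat_one K n \<and> mat_mult K n B A = mat_one K n}"

text \<open>p^k M_N(R)-cosets: a countable base of clopen sets of the (p-adic) topology.\<close>
definition pcoset :: "('a, 'b) ring_scheme \<Rightarrow> nat \<Rightarrow> nat \<Rightarrow> nat \<Rightarrow> (nat \<Rightarrow> nat \<Rightarrow> 'a) \<Rightarrow> (nat \<Rightarrow> nat \<Rightarrow> 'a) set" where
  "pcoset R p N k A = {mat_add R A (\<lambda>i j. ([p] \<cdot>\<^bsub>R\<^esub> \<one>\<^bsub>R\<^esub>) [^]\<^bsub>R\<^esub> k \<otimes>\<^bsub>R\<^esub> H i j) | H. H \<in> mats R N}"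

definition is_haar :: "('a, 'b) ring_scheme \<Rightarrow> nat \<Rightarrow> nat \<Rightarrow> (nat \<Rightarrow> nat \<Rightarrow> 'a) measure \<Rightarrow> bool" where
  "is_haar R p N \<mu> \<longleftrightarrow> prob_space \<mu> \<and> space \<mu> = mats R N \<and>
     sets \<mu> = sigma_sets (mats R N) {pcoset R p N k A | k A. A \<in> mats R N} \<and>
     (\<forall>A\<in>mats R N. \<forall>E\<in>sets \<mu>. mat_add R A ` E \<in> sets \<mu> \<and> emeasure \<mu> (mat_add R A ` E) = emeasure \<mu> E)"

definition haar :: "('a, 'b) ring_scheme \<Rightarrow> nat \<Rightarrow> nat \<Rightarrow> (nat \<Rightarrow> nat \<Rightarrow> 'a) measure" where
  "haar R p N = (THE \<mu>. is_haar R p N \<mu>)"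

definition mod_linear :: "('a, 'b) ring_scheme \<Rightarrow> ('a, 'c, 'd) module_scheme \<Rightarrow> ('a, 'e, 'f) module_scheme \<Rightarrow> ('c \<Rightarrow> 'e) \<Rightarrow> bool" where
  "mod_linear R M M' \<phi> \<longleftrightarrow> \<phi> ` carrier M \<subseteq> carrier M' \<and>
     (\<forall>x\<in>carrier M. \<forall>y\<in>carrier M. \<phi> (x \<oplus>\<^bsub>M\<^esub> y) = \<phi> x \<oplus>\<^bsub>M'\<^esub> \<phi> y) \<and>
     (\<forall>r\<in>carrier R. \<forall>x\<in>carrier M. \<phi> (r \<odot>\<^bsub>M\<^esub> x) = r \<odot>\<^bsub>M'\<^esub> \<phi> x)"

definition mod_iso :: "('a, 'b) ring_scheme \<Rightarrow> ('a, 'c, 'd) module_scheme \<Rightarrow> ('a, 'e, 'f) module_scheme \<Rightarrow> bool" where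
  "mod_iso R M M' \<longleftrightarrow> (\<exists>\<phi>. mod_linear R M M' \<phi> \<and> bij_betw \<phi> (carrier M) (carrier M'))"

definition aut :: "('a, 'b) ring_scheme \<Rightarrow> ('a, 'c, 'd) module_scheme \<Rightarrow> ('c \<Rightarrow> 'c) set" where
  "aut R M = {\<phi>. \<phi> \<in> extensional (carrier M) \<and> mod_linear R M M \<phi> \<and> bij_betw \<phi> (carrier M) (carrier M)}"

definition coker_iso :: "('a, 'b) ring_scheme \<Rightarrow> nat \<Rightarrow> (nat \<Rightarrow> nat \<Rightarrow> 'a) \<Rightarrow> ('a, 'c, 'd) module_scheme \<Rightarrow> bool" where
  "coker_iso R N G M \<longleftrightarrow> (\<exists>\<phi>. \<phi> ` vecs R N = carrier M \<and>
     (\<forall>u\<in>vecs R N. \<forall>v\<in>vecs R N. \<phi> (vec_add R u v) = \<phi> u \<oplus>\<^bsub>M\<^esub> \<phi> v) \<and>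
     (\<forall>r\<in>carrier R. \<forall>v\<in>vecs R N. \<phi> (vec_smult R r v) = r \<odot>\<^bsub>M\<^esub> \<phi> v) \<and>
     {v \<in> vecs R N. \<phi> v = \<zero>\<^bsub>M\<^esub>} = mat_vec R N G ` vecs R N)"

definition coker_set :: "('a, 'b) ring_scheme \<Rightarrow> nat \<Rightarrow> (nat \<Rightarrow> nat \<Rightarrow> 'a) \<Rightarrow> (nat \<Rightarrow> 'a) set set" where
  "coker_set R N G = (\<lambda>v. {w \<in> vecs R N. \<exists>u\<in>vecs R N. w = vec_add R v (mat_vec R N G u)}) ` vecs R N"

text \<open>Representative carrier type: every finite R-module is isomorphic to one whose
  carrier consists of cosets in R^n, i.e. of type (nat => 'a) set.\<close>
type_synonym 'a rmod = "('a, (nat \<Rightarrow> 'a) set) module"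

definition fin_module :: "('a, 'b) ring_scheme \<Rightarrow> ('a, 'c, 'd) module_scheme \<Rightarrow> bool" where
  "fin_module R M \<longleftrightarrow> Module.module R M \<and> finite (carrier M)"

definition iso_class :: "('a, 'b) ring_scheme \<Rightarrow> ('a, 'c, 'd) module_scheme \<Rightarrow> 'a rmod set" where
  "iso_class R M = {M'. fin_module R M' \<and> mod_iso R M M'}"

definition S_classes :: "('a, 'b) ring_scheme \<Rightarrow> 'a rmod set set" where
  "S_classes R = {iso_class R M | M :: 'a rmod. fin_module R M}"

definition in_T :: "('a, 'b) ring_scheme \<Rightarrow> ('a, 'c, 'd) module_scheme \<Rightarrow> bool" where
  "in_T R M \<longleftrightarrow> fin_module R M \<and> (\<exists>N. \<exists>G\<in>mats R N. coker_iso R N G M)"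

end

theory Submission
  imports Defs
begin

text \<open>
  For a surjection \<open>\<phi>\<close> of \<open>R\<^sup>N\<close> onto a finite module \<open>M\<close> whose kernel \<open>K\<close> is the image of a square
  matrix \<open>G\<close>, the columns of a random matrix lie in \<open>K\<close> with probability \<open>|M|\<^sup>-\<^sup>N\<close>, and then the matrix is
  \<open>G H\<close> with \<open>H\<close> random. As \<open>K\<close> has finite index, the kernel of \<open>G\<close> has entries in the maximal ideal, so by
  Nakayama's lemma \<open>G H\<close> has image \<open>K\<close> exactly if \<open>H\<close> is invertible over the residue field. Summing over
  the surjections, on which the automorphisms of \<open>M\<close> act freely, the cokernel is \<open>M\<close> with
  probability \<open>c\<^sub>N \<beta>\<^sub>N / |Aut M|\<close>, where \<open>c\<^sub>N\<close> is the proportion of invertible matrices over the residue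
  field and \<open>\<beta>\<^sub>N\<close> the proportion of the \<open>N\<close>-tuples in \<open>M\<close> that define a surjection with such a kernel. If \<open>M\<close>
  is a cokernel at all, then \<open>\<beta>\<^sub>N\<close> tends to 1, since a tuple that contains one fixed such block is itself
  of this kind. Each probability is at most \<open>1 / |Aut M|\<close>, which is summable by Fatou's lemma, so
  dominated convergence gives the limit and shows that no mass is lost.

  Infinite cokernels have measure zero because for every \<open>G\<close> only boundedly many of the translates
  \<open>G + t\<close> with \<open>t\<close> a natural number have an infinite cokernel, while all translates of a set have the same
  measure.
\<close>

section \<open>Vectors and matrices over a commutative ring\<close>

text \<open>The overview leaves open why few shifts have an infinite cokernel. \<open>R\<close> may
  have zero divisors and torsion, so the argument counts residues instead of zeros of a determinant.
  A shift with infinite cokernel keeps 2^j vectors apart modulo its image and p^j. Distinct shifts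
  differ by nonzero integers, which are units up to a power of p, so a Chinese remainder argument
  multiplies these numbers, with a loss in the exponent that does not depend on j. Since
  \<open>R^N\<close> has at most p^(D N j) residues modulo p^j, where D is the number of generators
  of \<open>R\<close> over the p-adic integers, the number of such shifts is bounded. A count of
  residues also puts the kernel of \<open>G\<close> into the maximal ideal. Domination rests on c >
  0: the limit c / |Aut M| is summable, and division by c turns it into the dominating function.
  \<open>haar\<close> is a definite description, so both existence and uniqueness have to be shown.
  As the generators of \<open>R\<close> may satisfy relations, invariance of the constructed measure
  comes from counting the coefficient families that represent a coset.\<close>

definition unit_vec :: "('a, 'b) ring_scheme \<Rightarrow> nat \<Rightarrow> nat \<Rightarrow> 'a" where
  "unit_vec R j = (\<lambda>i. if i = j then \<one>\<^bsub>R\<^esub> else \<zero>\<^bsub>R\<^esub>)"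

text \<open>The fields \<open>mult\<close> and \<open>one\<close> of a module record carry no meaning and are filled arbitrarily.\<close>

definition vec_mod :: "('a, 'b) ring_scheme \<Rightarrow> nat \<Rightarrow> ('a, nat \<Rightarrow> 'a) module" where
  "vec_mod R N = \<lparr>carrier = vecs R N, monoid.mult = (\<lambda>u v. u), monoid.one = (\<lambda>i. \<zero>\<^bsub>R\<^esub>),
     ring.zero = (\<lambda>i. \<zero>\<^bsub>R\<^esub>), ring.add = vec_add R, module.smult = vec_smult R\<rparr>"

lemma vec_mod_simps [simp]:
  "carrier (vec_mod R N) = vecs R N" "\<zero>\<^bsub>vec_mod R N\<^esub> = (\<lambda>i. \<zero>\<^bsub>R\<^esub>)"
  "u \<oplus>\<^bsub>vec_mod R N\<^esub> v = vec_add R u v" "r \<odot>\<^bsub>vec_mod R N\<^esub> v = vec_smult R r v"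
  by (simp_all add: vec_mod_def)

lemma vec_add_apply [simp]: "vec_add R u v i = u i \<oplus>\<^bsub>R\<^esub> v i"
  by (simp add: vec_add_def)

lemma vec_smult_apply [simp]: "vec_smult R r v i = r \<otimes>\<^bsub>R\<^esub> v i"
  by (simp add: vec_smult_def)

lemma mat_add_apply [simp]: "mat_add R A B i j = A i j \<oplus>\<^bsub>R\<^esub> B i j"
  by (simp add: mat_add_def)

context cring begin

lemma vecs_carrier: "v \<in> vecs R N \<Longrightarrow> v i \<in> carrier R"
  by (cases "i < N") (auto simp: vecs_def)

lemma vecs_zero: "v \<in> vecs R N \<Longrightarrow> N \<le> i \<Longrightarrow> v i = \<zero>"
  by (auto simp: vecs_def)

lemma vecsI: "(\<And>i. i < N \<Longrightarrow> v i \<in> carrier R) \<Longrightarrow> (\<And>i. N \<le> i \<Longrightarrow> v i = \<zero>) \<Longrightarrow> v \<in> vecs R N"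
  by (auto simp: vecs_def)

lemma mats_carrier: "A \<in> mats R N \<Longrightarrow> A i j \<in> carrier R"
  by (cases "i < N \<and> j < N") (auto simp: mats_def)

lemma mats_zero: "A \<in> mats R N \<Longrightarrow> \<not> (i < N \<and> j < N) \<Longrightarrow> A i j = \<zero>"
  by (auto simp: mats_def)

lemma matsI: "(\<And>i j. i < N \<Longrightarrow> j < N \<Longrightarrow> A i j \<in> carrier R) \<Longrightarrow> (\<And>i j. \<not> (i < N \<and> j < N) \<Longrightarrow> A i j = \<zero>)
  \<Longrightarrow> A \<in> mats R N"
  by (auto simp: mats_def)

lemma module_vec_mod: "Module.module R (vec_mod R N)"
proof (rule moduleI)
  show "abelian_group (vec_mod R N)"
  proof (rule abelian_groupI)
    fix x assume x: "x \<in> carrier (vec_mod R N)"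
    show "\<exists>y\<in>carrier (vec_mod R N). y \<oplus>\<^bsub>vec_mod R N\<^esub> x = \<zero>\<^bsub>vec_mod R N\<^esub>"
      using x by (intro bexI[of _ "\<lambda>i. \<ominus> x i"])
        (auto simp: fun_eq_iff vecs_carrier l_neg intro!: vecsI dest: vecs_zero)
  qed (auto simp: fun_eq_iff vecs_carrier a_ac vecs_zero intro!: vecsI)
qed (auto simp: fun_eq_iff vecs_carrier l_distr r_distr m_assoc is_cring vecs_zero intro!: vecsI)

lemma vec_add_closed [simp]: "u \<in> vecs R N \<Longrightarrow> v \<in> vecs R N \<Longrightarrow> vec_add R u v \<in> vecs R N"
  by (auto simp: vecs_carrier vecs_zero intro!: vecsI)

lemma vec_smult_closed [simp]: "r \<in> carrier R \<Longrightarrow> v \<in> vecs R N \<Longrightarrow> vec_smult R r v \<in> vecs R N"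
  by (auto simp: vecs_carrier vecs_zero intro!: vecsI)

lemma vec_zero_closed [simp]: "(\<lambda>i. \<zero>) \<in> vecs R N"
  by (auto intro!: vecsI)

lemma unit_vec_closed [simp]: "j < N \<Longrightarrow> unit_vec R j \<in> vecs R N"
  by (auto simp: unit_vec_def intro!: vecsI)

lemma mat_add_closed [simp]: "A \<in> mats R N \<Longrightarrow> B \<in> mats R N \<Longrightarrow> mat_add R A B \<in> mats R N"
  by (rule matsI) (auto simp: mats_carrier mats_zero)

lemma mat_vec_closed [simp]: "G \<in> mats R N \<Longrightarrow> v \<in> vecs R N \<Longrightarrow> mat_vec R N G v \<in> vecs R N"
  by (rule vecsI) (auto simp: mat_vec_def vecs_carrier mats_carrier intro!: finsum_closed)

lemma mat_vec_add:
  assumes "G \<in> mats R N" "u \<in> vecs R N" "v \<in> vecs R N"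
  shows "mat_vec R N G (vec_add R u v) = vec_add R (mat_vec R N G u) (mat_vec R N G v)"
  using assms by (auto simp: fun_eq_iff mat_vec_def r_distr vecs_carrier mats_carrier finsum_addf Pi_def)

lemma mat_vec_smult:
  assumes "G \<in> mats R N" "r \<in> carrier R" "v \<in> vecs R N"
  shows "mat_vec R N G (vec_smult R r v) = vec_smult R r (mat_vec R N G v)"
  using assms by (auto simp: fun_eq_iff mat_vec_def finsum_rdistr vecs_carrier mats_carrier Pi_def m_lcomm
      intro!: finsum_cong')

lemma mat_vec_mat_add:
  assumes "G \<in> mats R N" "H \<in> mats R N" "v \<in> vecs R N"
  shows "mat_vec R N (mat_add R G H) v = vec_add R (mat_vec R N G v) (mat_vec R N H v)"
  using assms by (auto simp: fun_eq_iff mat_vec_def l_distr vecs_carrier mats_carrier finsum_addf Pi_def)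

lemma mat_vec_zero [simp]: "G \<in> mats R N \<Longrightarrow> mat_vec R N G (\<lambda>i. \<zero>) = (\<lambda>i. \<zero>)"
  by (auto simp: fun_eq_iff mat_vec_def mats_carrier finsum_zero)

lemma finsum_delta:
  assumes "finite A" "j \<in> A" "\<And>i. i \<in> A \<Longrightarrow> f i \<in> carrier R"
  shows "finsum R (\<lambda>i. f i \<otimes> (if i = j then \<one> else \<zero>)) A = f j"
proof -
  have "finsum R (\<lambda>i. f i \<otimes> (if i = j then \<one> else \<zero>)) A = finsum R (\<lambda>i. if j = i then f i else \<zero>) A"
    using assms by (intro finsum_cong') auto
  also have "\<dots> = f j" using assms by (intro finsum_singleton) auto
  finally show ?thesis .
qed

lemma mat_vec_unit:
  assumes "G \<in> mats R N" "j < N"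
  shows "mat_vec R N G (unit_vec R j) = (\<lambda>i. G i j)"
  using assms by (auto simp: fun_eq_iff mat_vec_def unit_vec_def finsum_delta mats_carrier mats_zero)

lemma mat_mult_closed [simp]: "A \<in> mats R N \<Longrightarrow> B \<in> mats R N \<Longrightarrow> mat_mult R N A B \<in> mats R N"
  by (rule matsI) (auto simp: mat_mult_def mats_carrier intro!: finsum_closed)

lemma mat_one_closed [simp]: "mat_one R N \<in> mats R N"
  by (rule matsI) (auto simp: mat_one_def)

lemma mat_vec_one [simp]: 
  assumes "v \<in> vecs R N" shows "mat_vec R N (mat_one R N) v = v"
proof (rule ext)
  fix i show "mat_vec R N (mat_one R N) v i = v i"
  proof (cases "i < N")
    case True
    have "finsum R (\<lambda>j. mat_one R N i j \<otimes> v j) {..<N} = finsum R (\<lambda>j. v j \<otimes> (if j = i then \<one> else \<zero>)) {..<N}"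
      using True assms by (intro finsum_cong') (auto simp: mat_one_def vecs_carrier)
    also have "\<dots> = v i" using True assms by (intro finsum_delta) (auto simp: vecs_carrier)
    finally show ?thesis using True by (simp add: mat_vec_def)
  qed (use assms in \<open>auto simp: mat_vec_def vecs_zero\<close>)
qed

end

section \<open>Linear maps from \<open>R^N\<close> to a module and the tuples that encode
  them\<close>

context Module.module begin

text \<open>The linearity conditions of \<open>coker_iso\<close> together with closure; as there,
  they are imposed on \<open>vecs R N\<close> only.\<close>

definition linear_on :: "nat \<Rightarrow> ((nat \<Rightarrow> 'a) \<Rightarrow> 'c) \<Rightarrow> bool" where
  "linear_on N \<phi> \<longleftrightarrow> (\<forall>v\<in>vecs R N. \<phi> v \<in> carrier M) \<and>
     (\<forall>u\<in>vecs R N. \<forall>v\<in>vecs R N. \<phi> (vec_add R u v) = \<phi> u \<oplus>\<^bsub>M\<^esub> \<phi> v) \<and>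
     (\<forall>r\<in>carrier R. \<forall>v\<in>vecs R N. \<phi> (vec_smult R r v) = r \<odot>\<^bsub>M\<^esub> \<phi> v)"

text \<open>Through this map a tuple of N elements of \<open>M\<close> stands for a linear map from
  \<open>R^N\<close>. A finite module has finitely many extensional tuples, so surjections can be
  counted.\<close>

definition lincomb :: "nat \<Rightarrow> (nat \<Rightarrow> 'c) \<Rightarrow> (nat \<Rightarrow> 'a) \<Rightarrow> 'c" where
  "lincomb N x v = finsum M (\<lambda>i. v i \<odot>\<^bsub>M\<^esub> x i) {..<N}"

lemma linear_onD:
  assumes "linear_on N \<phi>"
  shows "v \<in> vecs R N \<Longrightarrow> \<phi> v \<in> carrier M"
    "u \<in> vecs R N \<Longrightarrow> v \<in> vecs R N \<Longrightarrow> \<phi> (vec_add R u v) = \<phi> u \<oplus>\<^bsub>M\<^esub> \<phi> v"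
    "r \<in> carrier R \<Longrightarrow> v \<in> vecs R N \<Longrightarrow> \<phi> (vec_smult R r v) = r \<odot>\<^bsub>M\<^esub> \<phi> v"
  using assms by (auto simp: linear_on_def)

lemma linear_on_zero:
  assumes "linear_on N \<phi>" shows "\<phi> (\<lambda>i. \<zero>) = \<zero>\<^bsub>M\<^esub>"
proof -
  have "\<phi> (vec_smult R \<zero> (\<lambda>i. \<zero>)) = \<zero> \<odot>\<^bsub>M\<^esub> \<phi> (\<lambda>i. \<zero>)"
    by (rule linear_onD(3)[OF assms]) auto
  also have "\<dots> = \<zero>\<^bsub>M\<^esub>" by (rule smult_l_null) (auto intro: linear_onD(1)[OF assms])
  also have "vec_smult R \<zero> (\<lambda>i. \<zero>) = (\<lambda>i. \<zero>)" by (auto simp: fun_eq_iff)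
  finally show ?thesis .
qed

lemma lincomb_linear:
  assumes "\<And>i. i < N \<Longrightarrow> x i \<in> carrier M"
  shows "linear_on N (lincomb N x)"
  unfolding linear_on_def
proof (intro conjI ballI)
  fix u v assume u: "u \<in> vecs R N" and v: "v \<in> vecs R N"
  show "lincomb N x v \<in> carrier M"
    unfolding lincomb_def using v assms by (intro M.finsum_closed) (auto simp: R.vecs_carrier)
  have "lincomb N x (vec_add R u v) = finsum M (\<lambda>i. u i \<odot>\<^bsub>M\<^esub> x i \<oplus>\<^bsub>M\<^esub> v i \<odot>\<^bsub>M\<^esub> x i) {..<N}"
    unfolding lincomb_def using u v assms
    by (intro M.finsum_cong') (auto simp: R.vecs_carrier smult_l_distr)
  then show "lincomb N x (vec_add R u v) = lincomb N x u \<oplus>\<^bsub>M\<^esub> lincomb N x v"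
    unfolding lincomb_def using u v assms by (subst (asm) M.finsum_addf) (auto simp: R.vecs_carrier)
next
  fix r v assume r: "r \<in> carrier R" and v: "v \<in> vecs R N"
  show "lincomb N x (vec_smult R r v) = r \<odot>\<^bsub>M\<^esub> lincomb N x v"
    unfolding lincomb_def using r v assms
    by (subst finsum_smult_ldistr) (auto simp: R.vecs_carrier smult_assoc1 intro!: M.finsum_cong')
qed

text \<open>Linearity speaks of sums of two vectors, so \<open>v\<close> is built up one coordinate
  at a time: the induction runs over the truncations of \<open>v\<close> to its first n
  entries.\<close>

lemma linear_on_expand:
  assumes lin: "linear_on N \<phi>" and v: "v \<in> vecs R N"
  shows "\<phi> v = lincomb N (\<lambda>i. \<phi> (unit_vec R i)) v"
proof -
  have cl: "\<phi> (unit_vec R i) \<in> carrier M" if "i < N" for i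
    using that by (intro linear_onD(1)[OF lin]) auto
  have "n \<le> N \<Longrightarrow> \<phi> (\<lambda>i. if i < n then v i else \<zero>) = finsum M (\<lambda>i. v i \<odot>\<^bsub>M\<^esub> \<phi> (unit_vec R i)) {..<n}" for n
  proof (induction n)
    case 0
    then show ?case using linear_on_zero[OF lin] by simp
  next
    case (Suc n)
    let ?w = "\<lambda>i. if i < n then v i else \<zero>"
    have w: "?w \<in> vecs R N" using v by (auto intro!: R.vecsI simp: R.vecs_carrier R.vecs_zero)
    have "(\<lambda>i. if i < Suc n then v i else \<zero>) = vec_add R ?w (vec_smult R (v n) (unit_vec R n))"
      using R.vecs_carrier[OF v] by (auto simp: fun_eq_iff unit_vec_def less_Suc_eq)
    then have "\<phi> (\<lambda>i. if i < Suc n then v i else \<zero>) = \<phi> ?w \<oplus>\<^bsub>M\<^esub> v n \<odot>\<^bsub>M\<^esub> \<phi> (unit_vec R n)"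
      using Suc.prems w v by (simp add: linear_onD[OF lin] R.vecs_carrier)
    also have "\<phi> ?w = finsum M (\<lambda>i. v i \<odot>\<^bsub>M\<^esub> \<phi> (unit_vec R i)) {..<n}"
      using Suc by simp
    finally show ?case using Suc.prems cl v
      by (simp add: lessThan_Suc M.finsum_insert Pi_def R.vecs_carrier M.a_comm M.finsum_closed)
  qed
  from this[of N] have "\<phi> (\<lambda>i. if i < N then v i else \<zero>) = lincomb N (\<lambda>i. \<phi> (unit_vec R i)) v"
    by (simp add: lincomb_def)
  also have "(\<lambda>i. if i < N then v i else \<zero>) = v" using v by (auto simp: fun_eq_iff R.vecs_zero)
  finally show ?thesis .
qed

lemma lincomb_unit_vec:
  assumes "\<And>i. i < N \<Longrightarrow> x i \<in> carrier M" "j < N"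
  shows "lincomb N x (unit_vec R j) = x j"
proof -
  have "lincomb N x (unit_vec R j) = finsum M (\<lambda>i. if j = i then x i else \<zero>\<^bsub>M\<^esub>) {..<N}"
    unfolding lincomb_def using assms
    by (intro M.finsum_cong') (auto simp: unit_vec_def)
  also have "\<dots> = x j" using assms by (intro M.finsum_singleton) auto
  finally show ?thesis .
qed

lemma lincomb_cong: "(\<And>i. i < N \<Longrightarrow> x i = y i) \<Longrightarrow> (\<And>i. i < N \<Longrightarrow> x i \<in> carrier M) \<Longrightarrow> v \<in> vecs R N \<Longrightarrow> lincomb N x v = lincomb N y v"
  unfolding lincomb_def by (intro M.finsum_cong') (auto simp: R.vecs_carrier)

end

lemma (in cring) linear_eqI:
  assumes "Module.module R M" "module.linear_on R M N f" "module.linear_on R M N g"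
    "\<And>j. j < N \<Longrightarrow> f (unit_vec R j) = g (unit_vec R j)" "v \<in> vecs R N"
  shows "f v = g v"
proof -
  interpret M: Module.module R M by fact
  have "f v = M.lincomb N (\<lambda>i. f (unit_vec R i)) v" using assms by (intro M.linear_on_expand)
  also have "\<dots> = M.lincomb N (\<lambda>i. g (unit_vec R i)) v"
    using assms by (intro M.lincomb_cong) (auto intro: M.linear_onD(1)[OF assms(3)])
  also have "\<dots> = g v" using assms by (intro M.linear_on_expand[symmetric])
  finally show ?thesis .
qed

context cring begin

lemma linear_mat_vec: "G \<in> mats R N \<Longrightarrow> module.linear_on R (vec_mod R N) N (mat_vec R N G)"
  by (simp add: module.linear_on_def[OF module_vec_mod] mat_vec_add mat_vec_smult)

lemma linear_matrix:
  assumes "module.linear_on R (vec_mod R N) N f"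
  shows "\<exists>G\<in>mats R N. \<forall>v\<in>vecs R N. mat_vec R N G v = f v"
proof -
  define G where "G = (\<lambda>i j. if j < N then f (unit_vec R j) i else \<zero>)"
  have fu: "f (unit_vec R j) \<in> vecs R N" if "j < N" for j
    using module.linear_onD(1)[OF module_vec_mod assms, of "unit_vec R j"] that by simp
  have G: "G \<in> mats R N"
    by (rule matsI) (auto simp: G_def vecs_carrier[OF fu] vecs_zero[OF fu])
  moreover have "mat_vec R N G v = f v" if "v \<in> vecs R N" for v
  proof (rule linear_eqI[OF module_vec_mod linear_mat_vec[OF G] assms _ that])
    fix j assume "j < N"
    then show "mat_vec R N G (unit_vec R j) = f (unit_vec R j)"
      unfolding mat_vec_unit[OF G \<open>j < N\<close>] by (simp add: G_def)
  qed
  ultimately show ?thesis by blast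
qed

lemma linear_comp:
  assumes "Module.module R M" "module.linear_on R M K g" "module.linear_on R (vec_mod R K) N f"
  shows "module.linear_on R M N (\<lambda>v. g (f v))"
  using assms(2,3) by (simp add: module.linear_on_def[OF assms(1)] module.linear_on_def[OF module_vec_mod])

lemma mat_vec_mult:
  assumes "A \<in> mats R N" "B \<in> mats R N" "v \<in> vecs R N"
  shows "mat_vec R N (mat_mult R N A B) v = mat_vec R N A (mat_vec R N B v)"
proof (rule linear_eqI[OF module_vec_mod linear_mat_vec _ _ assms(3)])
  show "module.linear_on R (vec_mod R N) N (\<lambda>v. mat_vec R N A (mat_vec R N B v))"
    using linear_comp[OF module_vec_mod linear_mat_vec[OF assms(1)] linear_mat_vec[OF assms(2)]] .
  fix j assume j: "j < N"
  show "mat_vec R N (mat_mult R N A B) (unit_vec R j) = mat_vec R N A (mat_vec R N B (unit_vec R j))"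
    unfolding mat_vec_unit[OF assms(2) j] mat_vec_unit[OF mat_mult_closed[OF assms(1,2)] j]
    unfolding mat_mult_def mat_vec_def using j by (intro ext) simp
qed (use assms in simp)

text \<open>Turns identities between matrices into identities between maps on vectors, where a
  product acts by composition and double sums do not occur.\<close>

lemma mat_eqI:
  assumes "A \<in> mats R N" "B \<in> mats R N" "\<And>v. v \<in> vecs R N \<Longrightarrow> mat_vec R N A v = mat_vec R N B v"
  shows "A = B"
proof (intro ext)
  fix i j show "A i j = B i j"
  proof (cases "j < N")
    case True
    then show ?thesis using assms(3)[of "unit_vec R j"] assms(1,2) by (simp add: mat_vec_unit fun_eq_iff)
  qed (use assms(1,2) in \<open>simp add: mats_zero\<close>)
qed

end

section \<open>Local rings finite over the p-adic integers\<close>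

context cring begin

text \<open>Krull's theorem: Zorn's lemma among the ideals that contain \<open>x\<close> and omit 1.
  The principal ideal of \<open>x\<close> is one of them because \<open>x\<close> is not a unit. As
  locality means that there is a single maximal ideal, every element outside it becomes a
  unit.\<close>

lemma nonunit_in_maximal:
  assumes x: "x \<in> carrier R" "x \<notin> Units R"
  shows "\<exists>I. maximalideal I R \<and> x \<in> I"
proof -
  define \<A> where "\<A> = {I. ideal I R \<and> x \<in> I \<and> \<one> \<notin> I}"
  have ne: "PIdl x \<in> \<A>"
  proof -
    have "\<one> \<notin> PIdl x"
      using x by (auto simp: cgenideal_def Units_def m_comm)
    then show ?thesis unfolding \<A>_def using cgenideal_ideal[OF x(1)] cgenideal_self[OF x(1)] by auto
  qed
  have "\<exists>I\<in>\<A>. \<forall>X\<in>\<A>. I \<subseteq> X \<longrightarrow> X = I"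
  proof (rule subset_Zorn_nonempty)
    fix C assume C: "C \<noteq> {}" "subset.chain \<A> C"
    have id: "ideal I R" if "I \<in> C" for I using C(2) that unfolding pred_on.chain_def \<A>_def by auto
    have ch: "I \<subseteq> J \<or> J \<subseteq> I" if "I \<in> C" "J \<in> C" for I J
      using C(2) that unfolding pred_on.chain_def by auto
    have "ideal (\<Union>C) R"
    proof (rule idealI)
      show "subgroup (\<Union>C) (add_monoid R)"
      proof
        show "\<Union>C \<subseteq> carrier (add_monoid R)"
          using id ideal.Icarr by fastforce
        show "\<one>\<^bsub>add_monoid R\<^esub> \<in> \<Union>C"
          using C(1) id additive_subgroup.zero_closed[OF ideal.axioms(1)] by fastforce
        fix a b assume a: "a \<in> \<Union>C"
        then obtain I where I: "I \<in> C" "a \<in> I" by blast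
        have "inv\<^bsub>add_monoid R\<^esub> a \<in> I"
          using additive_subgroup.a_inv_closed[OF ideal.axioms(1)[OF id[OF I(1)]] I(2)] by (simp add: a_inv_def)
        then show "inv\<^bsub>add_monoid R\<^esub> a \<in> \<Union>C" using I(1) by blast
        assume "b \<in> \<Union>C"
        then obtain J where J: "J \<in> C" "a \<in> J" "b \<in> J" using I ch by blast
        have "a \<otimes>\<^bsub>add_monoid R\<^esub> b \<in> J"
          using additive_subgroup.a_closed[OF ideal.axioms(1)[OF id[OF J(1)]] J(2,3)] by simp
        then show "a \<otimes>\<^bsub>add_monoid R\<^esub> b \<in> \<Union>C" using J(1) by blast
      qed
    next
      fix a r assume "a \<in> \<Union>C" and r: "r \<in> carrier R"
      then obtain I where I: "I \<in> C" "a \<in> I" by blast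
      then show "r \<otimes> a \<in> \<Union>C" "a \<otimes> r \<in> \<Union>C"
        using ideal.I_l_closed[OF id I(2) r] ideal.I_r_closed[OF id I(2) r] by auto
    qed (rule ring_axioms)
    then show "\<Union>C \<in> \<A>" using C unfolding \<A>_def pred_on.chain_def by auto
  qed (use ne in blast)
  then obtain I where I: "I \<in> \<A>" and max: "\<And>X. X \<in> \<A> \<Longrightarrow> I \<subseteq> X \<Longrightarrow> X = I" by blast
  have idI: "ideal I R" using I by (simp add: \<A>_def)
  have "maximalideal I R"
  proof (rule maximalidealI)
    show "carrier R \<noteq> I" using I by (auto simp: \<A>_def)
    fix J assume J: "ideal J R" "I \<subseteq> J" "J \<subseteq> carrier R"
    show "J = I \<or> J = carrier R"
    proof (cases "\<one> \<in> J")
      case True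
      then show ?thesis using ideal.one_imp_carrier[OF J(1)] by simp
    next
      case False
      then show ?thesis using max[of J] J I by (auto simp: \<A>_def)
    qed
  qed (rule idI)
  then show ?thesis using I by (auto simp: \<A>_def)
qed

end

text \<open>The facts about \<open>R\<close> on which the measure computation rests. The exponent
  \<open>k * D\<close> is linear in k with a fixed \<open>D\<close>, the number of module generators
  in the application; this growth rate bounds the number of shifts with infinite cokernel. That p is
  not nilpotent reflects the inclusion of the p-adic integers in \<open>R\<close>.\<close>

locale local_zp = cring R for R (structure) +
  fixes p :: nat and D :: nat and mm :: "'a set"
  assumes prime_p: "prime p"
    and mm_max: "maximalideal mm R"
    and mm_unique: "\<And>I. maximalideal I R \<Longrightarrow> I = mm"
    and p_in_mm: "[p] \<cdot> \<one> \<in> mm"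
    and residues: "\<And>k. \<exists>S. finite S \<and> S \<subseteq> carrier R \<and> card S \<le> p ^ (k * D) \<and>
        (\<forall>r\<in>carrier R. \<exists>s\<in>S. \<exists>x\<in>carrier R. r = s \<oplus> ([p] \<cdot> \<one>) [^] k \<otimes> x)"
    and p_not_nilpotent: "\<And>k::nat. ([p] \<cdot> \<one>) [^] k \<noteq> \<zero>"
begin

abbreviation pip :: "nat \<Rightarrow> 'a" where "pip k \<equiv> ([p] \<cdot> \<one>) [^] k"

lemma pi_closed [simp]: "[p] \<cdot> \<one> \<in> carrier R" by simp

lemma pip_closed [simp]: "pip k \<in> carrier R" by simp

lemma pip_add: "pip (j + k) = pip j \<otimes> pip k" by (simp add: nat_pow_mult)

lemma pip_Suc: "pip (Suc k) = pip k \<otimes> [p] \<cdot> \<one>" by simp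

sublocale mm: maximalideal mm R by (rule mm_max)

lemma mm_closed [simp]: "x \<in> mm \<Longrightarrow> x \<in> carrier R"
  using mm.a_subset by blast

lemma unit_if_not_mm: "x \<in> carrier R \<Longrightarrow> x \<notin> mm \<Longrightarrow> x \<in> Units R"
  using nonunit_in_maximal mm_unique by blast

lemma one_not_mm: "\<one> \<notin> mm"
  using mm.one_imp_carrier mm.I_notcarr by blast

lemma one_minus_mm_unit: "x \<in> mm \<Longrightarrow> \<one> \<ominus> x \<in> Units R"
proof (rule unit_if_not_mm)
  assume x: "x \<in> mm"
  show "\<one> \<ominus> x \<notin> mm"
  proof
    assume "\<one> \<ominus> x \<in> mm"
    then have "(\<one> \<ominus> x) \<oplus> x \<in> mm" using x by (rule mm.a_closed)
    moreover have "(\<one> \<ominus> x) \<oplus> x = \<one>" using mm_closed[OF x] by algebra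
    ultimately show False using one_not_mm by simp
  qed
qed auto

lemma of_int_mult: "[(a * b :: int)] \<cdot> \<one> = ([a] \<cdot> \<one>) \<otimes> ([b] \<cdot> \<one>)"
proof -
  have "([a] \<cdot> \<one>) \<otimes> ([b] \<cdot> \<one>) = [a] \<cdot> ([b] \<cdot> \<one>)"
    using add_pow_ldistr_int[of \<one> "[b] \<cdot> \<one>" a] by simp
  also have "\<dots> = [(a * b)] \<cdot> \<one>"
    by (metis add.int_pow_pow mult.commute one_closed)
  finally show ?thesis by simp
qed

lemma of_int_add: "[(a + b :: int)] \<cdot> \<one> = ([a] \<cdot> \<one>) \<oplus> ([b] \<cdot> \<one>)"
  by (rule add.int_pow_mult) simp

lemma of_nat_int: "[int n] \<cdot> \<one> = [n] \<cdot> \<one>"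
  by (simp add: add_pow_int_ge)

lemma of_int_pow: "[(int p ^ v)] \<cdot> \<one> = pip v"
proof (induction v)
  case 0
  then show ?case using of_nat_int[of 1] by simp
next
  case (Suc v)
  then show ?case using of_int_mult[of "int p" "int p ^ v"] by (simp add: of_nat_int m_comm)
qed

text \<open>Bezout: if \<open>n\<close> were in the maximal ideal, so would be 1, which is a
  combination of \<open>n\<close> and p.\<close>

lemma of_int_unit:
  assumes "coprime n (int p)" shows "[n] \<cdot> \<one> \<in> Units R"
proof (rule unit_if_not_mm)
  show "[n] \<cdot> \<one> \<notin> mm"
  proof
    assume n: "[n] \<cdot> \<one> \<in> mm"
    obtain u v where uv: "u * n + v * int p = 1"
      using assms bezout_int[of n "int p"] by auto
    have "\<one> = [(u * n + v * int p)] \<cdot> \<one>" using uv of_nat_int[of 1] by simp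
    also have "\<dots> = ([u] \<cdot> \<one>) \<otimes> ([n] \<cdot> \<one>) \<oplus> ([v] \<cdot> \<one>) \<otimes> ([p] \<cdot> \<one>)"
      by (simp only: of_int_add of_int_mult of_nat_int)
    also have "\<dots> \<in> mm" using n p_in_mm by (intro mm.a_closed mm.I_l_closed) auto
    finally show False using one_not_mm by simp
  qed
qed simp

text \<open>Splits off the power of p in \<open>n\<close>; the remaining factor is prime to p and
  hence a unit. Differences of distinct integer shifts can thus be cancelled at the cost of a power
  of p.\<close>

lemma of_int_dvd_pip:
  assumes "n \<noteq> (0::int)" shows "\<exists>y\<in>carrier R. \<exists>v. y \<otimes> ([n] \<cdot> \<one>) = pip v"
proof -
  have p: "prime (int p)" using prime_p by simp
  define v where "v = multiplicity (int p) n"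
  obtain u where u: "n = int p ^ v * u" "\<not> int p dvd u"
    using multiplicity_decompose'[of n "int p"] assms p prime_elem_not_unit unfolding v_def
    by (metis not_prime_unit)
  have "coprime u (int p)" using u(2) p by (metis coprime_commute prime_imp_coprime)
  then have U: "[u] \<cdot> \<one> \<in> Units R" by (rule of_int_unit)
  have "inv ([u] \<cdot> \<one>) \<otimes> ([n] \<cdot> \<one>) = inv ([u] \<cdot> \<one>) \<otimes> (pip v \<otimes> ([u] \<cdot> \<one>))"
    by (simp only: u(1) of_int_mult of_int_pow)
  also have "\<dots> = pip v" using U by (simp add: m_comm[of "pip v"] flip: m_assoc)
  finally show ?thesis using U by blast
qed

end

definition mvecs :: "('a, 'b) ring_scheme \<Rightarrow> 'a set \<Rightarrow> nat \<Rightarrow> (nat \<Rightarrow> 'a) set" where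
  "mvecs R I N = {v \<in> vecs R N. \<forall>i<N. v i \<in> I}"

context local_zp begin

text \<open>Gaussian elimination: modulo \<open>L\<close> every unit vector is congruent to a vector over the maximal ideal, so
  the pivot that eliminates it has the form \<open>1 - x\<close> with \<open>x\<close> in the maximal ideal and is a unit.\<close>

lemma nakayama_vecs:
  assumes sub: "submodule L R (vec_mod R N)"
    and L: "\<And>v. v \<in> vecs R N \<Longrightarrow> \<exists>l\<in>L. (\<lambda>i. v i \<ominus> l i) \<in> mvecs R mm N"
  shows "L = vecs R N"
proof -
  interpret V: Module.module R "vec_mod R N" by (rule module_vec_mod)
  have Lsub: "L \<subseteq> vecs R N" using V.submoduleE(1)[OF sub] by simp
  have Lc: "l i \<in> carrier R" if "l \<in> L" for l i using that Lsub vecs_carrier by blast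
  have Lz: "l i = \<zero>" if "l \<in> L" "N \<le> i" for l i using that Lsub vecs_zero by blast
  have Ladd: "vec_add R u v \<in> L" if "u \<in> L" "v \<in> L" for u v
    using V.submoduleE(5)[OF sub that] by simp
  have Lsm: "vec_smult R r v \<in> L" if "r \<in> carrier R" "v \<in> L" for r v
    using V.submoduleE(4)[OF sub that] by simp
  have mmc: "x \<in> mm" if "x \<ominus> y \<in> mm" "y \<in> mm" "x \<in> carrier R" for x y
  proof -
    have "(x \<ominus> y) \<oplus> y = x" using that mm_closed[OF that(2)] by algebra
    then show ?thesis using mm.a_closed[OF that(1,2)] by simp
  qed
  \<comment> \<open>The second claim keeps the induction going: a vector over the maximal ideal is
    matched by an element of \<open>L\<close> that is itself over the maximal ideal, so a correction
    by it does not disturb residues.\<close>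
  have "n \<le> N \<Longrightarrow> (\<forall>v\<in>vecs R N. \<exists>l\<in>L. \<forall>i<n. v i = l i) \<and>
      (\<forall>v\<in>mvecs R mm N. \<exists>l\<in>L. (\<forall>i<n. v i = l i) \<and> (\<forall>i<N. l i \<in> mm))" for n
  proof (induction n)
    case 0
    obtain l where l: "l \<in> L" using V.submoduleE(2)[OF sub] by blast
    have "(\<lambda>i. \<zero>) = vec_smult R \<zero> l" using Lc[OF l] by (auto simp: fun_eq_iff)
    then have "(\<lambda>i. \<zero>) \<in> L" using Lsm[of \<zero> l] l by simp
    then show ?case by (auto intro!: bexI[of _ "\<lambda>i. \<zero>"])
  next
    case (Suc n)
    then have n: "n < N" and IH1: "\<And>v. v \<in> vecs R N \<Longrightarrow> \<exists>l\<in>L. \<forall>i<n. v i = l i"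
      and IH2: "\<And>v. v \<in> mvecs R mm N \<Longrightarrow> \<exists>l\<in>L. (\<forall>i<n. v i = l i) \<and> (\<forall>i<N. l i \<in> mm)" by auto
    obtain l where l: "l \<in> L" "(\<lambda>i. unit_vec R n i \<ominus> l i) \<in> mvecs R mm N"
      using L[of "unit_vec R n"] n by auto
    obtain l' where l': "l' \<in> L" "\<And>i. i < n \<Longrightarrow> unit_vec R n i \<ominus> l i = l' i" "\<And>i. i < N \<Longrightarrow> l' i \<in> mm"
      using IH2[OF l(2)] by blast
    \<comment> \<open>\<open>l'\<close> cancels the first n entries of \<open>l\<close> and lies
      over the maximal ideal, so \<open>u\<close> vanishes below n and is still congruent to the
      n-th unit vector.\<close>
    define u where "u = vec_add R l l'"
    have uL: "u \<in> L" unfolding u_def using l l' by (intro Ladd) 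
    have u0: "u i = \<zero>" if "i < n" for i
    proof -
      have "l' i = \<zero> \<ominus> l i" using l'(2)[OF that] that by (simp add: unit_vec_def)
      then show ?thesis unfolding u_def using Lc[OF l(1), of i] by (simp add: minus_eq r_neg)
    qed
    have um: "unit_vec R n i \<ominus> u i \<in> mm" if "i < N" for i
    proof -
      have e: "unit_vec R n i \<in> carrier R" by (simp add: unit_vec_def)
      have "unit_vec R n i \<ominus> u i = (unit_vec R n i \<ominus> l i) \<ominus> l' i"
        unfolding u_def vec_add_apply using e Lc[OF l(1), of i] Lc[OF l'(1), of i] by algebra
      moreover have "(unit_vec R n i \<ominus> l i) \<in> mm" using l(2) that by (auto simp: mvecs_def)
      ultimately show ?thesis using l'(3)[OF that] by (simp add: minus_eq mm.a_closed)
    qed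
    have unU: "u n \<in> Units R"
    proof -
      have "\<one> \<ominus> (\<one> \<ominus> u n) \<in> Units R"
        using um[OF n] by (intro one_minus_mm_unit) (simp add: unit_vec_def)
      moreover have "\<one> \<ominus> (\<one> \<ominus> u n) = u n" using Lc[OF uL, of n] by algebra
      ultimately show ?thesis by simp
    qed
    have um': "u i \<in> mm" if "i < N" "i \<noteq> n" for i
    proof -
      have "\<ominus> (\<zero> \<ominus> u i) \<in> mm" using um[OF that(1)] that by (simp add: unit_vec_def)
      moreover have "\<ominus> (\<zero> \<ominus> u i) = u i" using Lc[OF uL, of i] by algebra
      ultimately show ?thesis by simp
    qed
    \<comment> \<open>Adding the multiple of \<open>u\<close> that repairs entry n leaves the
      entries below n alone. If all entries of \<open>v\<close> and \<open>l1\<close> lie in the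
      maximal ideal, so does the factor \<open>c\<close>.\<close>
    have fixup: "\<exists>l2\<in>L. (\<forall>i<Suc n. v i = l2 i) \<and> ((\<forall>i<N. v i \<in> mm) \<longrightarrow> (\<forall>i<N. l1 i \<in> mm) \<longrightarrow> (\<forall>i<N. l2 i \<in> mm))"
      if v: "v \<in> vecs R N" and l1: "l1 \<in> L" "\<And>i. i < n \<Longrightarrow> v i = l1 i" for v l1
    proof -
      define c where "c = inv (u n) \<otimes> (v n \<ominus> l1 n)"
      have cc: "v n \<ominus> l1 n \<in> carrier R" using v l1 Lc[OF l1(1)] vecs_carrier by auto
      then have c: "c \<in> carrier R" unfolding c_def using unU by auto
      have un: "c \<otimes> u n = v n \<ominus> l1 n" unfolding c_def using unU cc Lc[OF uL, of n]
        by (simp add: m_ac Units_r_inv[of "u n"] flip: m_assoc)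
      let ?l2 = "vec_add R l1 (vec_smult R c u)"
      have "?l2 \<in> L" using l1 uL c by (intro Ladd Lsm)
      moreover have "v i = ?l2 i" if "i < Suc n" for i
      proof (cases "i = n")
        case True
        have "l1 n \<oplus> (v n \<ominus> l1 n) = v n" using vecs_carrier[OF v, of n] Lc[OF l1(1), of n] by algebra
        then show ?thesis using True un by simp
      next
        case False
        then show ?thesis using that l1 u0[of i] c Lc[OF l1(1), of i] by simp
      qed
      moreover have "?l2 i \<in> mm" if "\<forall>i<N. v i \<in> mm" "\<forall>i<N. l1 i \<in> mm" "i < N" for i
      proof -
        have "v n \<ominus> l1 n \<in> mm" using that n by (simp add: minus_eq mm.a_closed)
        then have "c \<in> mm" unfolding c_def using unU by (intro mm.I_l_closed) auto
        then have "c \<otimes> u i \<in> mm" using Lc[OF uL] by (intro mm.I_r_closed) auto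
        then show ?thesis using that by (simp add: mm.a_closed)
      qed
      ultimately show ?thesis by blast
    qed
    have "\<exists>l\<in>L. \<forall>i<Suc n. v i = l i" if "v \<in> vecs R N" for v
    proof -
      obtain l1 where l1: "l1 \<in> L" "\<forall>i<n. v i = l1 i" using IH1 \<open>v \<in> vecs R N\<close> by blast
      show ?thesis using fixup[of v l1] l1 \<open>v \<in> vecs R N\<close> by blast
    qed
    moreover have "\<exists>l\<in>L. (\<forall>i<Suc n. v i = l i) \<and> (\<forall>i<N. l i \<in> mm)" if "v \<in> mvecs R mm N" for v
    proof -
      have "v \<in> vecs R N" "\<forall>i<N. v i \<in> mm" using that by (auto simp: mvecs_def)
      moreover obtain l1 where l1: "l1 \<in> L" "\<forall>i<n. v i = l1 i" "\<forall>i<N. l1 i \<in> mm"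
        using IH2[OF \<open>v \<in> mvecs R mm N\<close>] by blast
      ultimately show ?thesis using fixup[of v l1] by blast
    qed
    ultimately show ?case by blast
  qed
  note main = this[of N]
  have "v \<in> L" if v: "v \<in> vecs R N" for v
  proof -
    obtain l where "l \<in> L" "\<forall>i<N. v i = l i" using main v by auto
    then have "v = l" using vecs_zero[OF v] Lz[OF \<open>l \<in> L\<close>] by (metis ext not_le)
    then show ?thesis using \<open>l \<in> L\<close> by simp
  qed
  then show ?thesis using Lsub by blast
qed

end

section \<open>Few integer shifts of an endomorphism have infinite cokernel\<close>

context Module.module begin

lemma submodule_cancel:
  assumes X: "submodule X R M" and "a \<oplus>\<^bsub>M\<^esub> b \<in> X" "b \<in> X" "a \<in> carrier M"
  shows "a \<in> X"
proof -
  have b: "b \<in> carrier M" using submoduleE(1)[OF X] assms by blast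
  have "(a \<oplus>\<^bsub>M\<^esub> b) \<oplus>\<^bsub>M\<^esub> (\<ominus>\<^bsub>M\<^esub> b) \<in> X" using submoduleE(3,5)[OF X] assms by blast
  also have "(a \<oplus>\<^bsub>M\<^esub> b) \<oplus>\<^bsub>M\<^esub> (\<ominus>\<^bsub>M\<^esub> b) = a" using assms b by (simp add: M.a_assoc M.r_neg)
  finally show ?thesis .
qed

lemma submodule_zero: "submodule X R M \<Longrightarrow> \<zero>\<^bsub>M\<^esub> \<in> X"
  using submoduleE(1,2,4) smult_l_null by (metis R.zero_closed all_not_in_conv subset_iff)

text \<open>Equal points have difference zero, and zero lies in every submodule. This turns
  separation into a count of distinct points.\<close>

lemma separated_inj:
  assumes X: "\<And>t. t \<in> T \<Longrightarrow> submodule (X t) R M" and m: "m \<in> carrier R"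
    and g: "\<And>i. i \<in> I \<Longrightarrow> g i \<in> carrier M"
    and sep: "\<And>i k. i \<in> I \<Longrightarrow> k \<in> I \<Longrightarrow> i \<noteq> k \<Longrightarrow> \<exists>t\<in>T. m \<odot>\<^bsub>M\<^esub> (g i \<ominus>\<^bsub>M\<^esub> g k) \<notin> X t"
  shows "inj_on g I"
proof (rule inj_onI)
  fix i k assume ik: "i \<in> I" "k \<in> I" "g i = g k"
  show "i = k"
  proof (rule ccontr)
    assume "i \<noteq> k"
    then obtain t where t: "t \<in> T" "m \<odot>\<^bsub>M\<^esub> (g i \<ominus>\<^bsub>M\<^esub> g k) \<notin> X t" using sep ik by blast
    have "m \<odot>\<^bsub>M\<^esub> (g i \<ominus>\<^bsub>M\<^esub> g k) = \<zero>\<^bsub>M\<^esub>" using ik g m by (simp add: M.minus_eq M.r_neg)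
    then show False using t submodule_zero[OF X] by simp
  qed
qed

end

locale zp_endo = local_zp R p D mm + V: Module.module R M
  for R (structure) and p D mm and M (structure) +
  fixes G
  assumes G_closed: "v \<in> carrier M \<Longrightarrow> G v \<in> carrier M"
    and G_add: "u \<in> carrier M \<Longrightarrow> v \<in> carrier M \<Longrightarrow> G (u \<oplus>\<^bsub>M\<^esub> v) = G u \<oplus>\<^bsub>M\<^esub> G v"
    and G_smult: "r \<in> carrier R \<Longrightarrow> v \<in> carrier M \<Longrightarrow> G (r \<odot>\<^bsub>M\<^esub> v) = r \<odot>\<^bsub>M\<^esub> G v"
begin

definition shift :: "int \<Rightarrow> 'c \<Rightarrow> 'c" where
  "shift t v = G v \<oplus>\<^bsub>M\<^esub> ([t] \<cdot>\<^bsub>R\<^esub> \<one>\<^bsub>R\<^esub>) \<odot>\<^bsub>M\<^esub> v"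

text \<open>The image of G + t, thickened by p^J M because residues are counted modulo p^J.\<close>

definition img :: "int \<Rightarrow> nat \<Rightarrow> 'c set" where
  "img t J = {shift t a \<oplus>\<^bsub>M\<^esub> pip J \<odot>\<^bsub>M\<^esub> b | a b. a \<in> carrier M \<and> b \<in> carrier M}"

lemma shift_closed [simp]: "v \<in> carrier M \<Longrightarrow> shift t v \<in> carrier M"
  by (simp add: shift_def G_closed)

lemma shift_add: "u \<in> carrier M \<Longrightarrow> v \<in> carrier M \<Longrightarrow> shift t (u \<oplus>\<^bsub>M\<^esub> v) = shift t u \<oplus>\<^bsub>M\<^esub> shift t v"
  by (simp add: shift_def G_closed G_add V.smult_r_distr V.M.a_ac)

lemma shift_smult: "r \<in> carrier R \<Longrightarrow> v \<in> carrier M \<Longrightarrow> shift t (r \<odot>\<^bsub>M\<^esub> v) = r \<odot>\<^bsub>M\<^esub> shift t v"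
  by (simp add: shift_def G_closed G_smult V.smult_r_distr m_comm flip: V.smult_assoc1)

lemma shift_zero [simp]: "shift t \<zero>\<^bsub>M\<^esub> = \<zero>\<^bsub>M\<^esub>"
  using shift_smult[of \<zero> "\<zero>\<^bsub>M\<^esub>" t] by simp

lemma shift_comm: "v \<in> carrier M \<Longrightarrow> shift s (shift t v) = shift t (shift s v)"
  by (simp add: shift_def G_closed G_smult G_add V.smult_r_distr m_comm V.M.a_ac flip: V.smult_assoc1)

lemma shift_change:
  "v \<in> carrier M \<Longrightarrow> shift l v = shift t v \<oplus>\<^bsub>M\<^esub> ([(l - t)] \<cdot>\<^bsub>R\<^esub> \<one>\<^bsub>R\<^esub>) \<odot>\<^bsub>M\<^esub> v"
  using of_int_add[of t "l - t"] by (simp add: shift_def G_closed V.smult_l_distr V.M.a_assoc)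

lemma foldr_shift_closed [simp]: "v \<in> carrier M \<Longrightarrow> foldr shift ls v \<in> carrier M"
  by (induction ls) auto

lemma foldr_shift_add: "u \<in> carrier M \<Longrightarrow> v \<in> carrier M \<Longrightarrow>
    foldr shift ls (u \<oplus>\<^bsub>M\<^esub> v) = foldr shift ls u \<oplus>\<^bsub>M\<^esub> foldr shift ls v"
  by (induction ls) (auto simp: shift_add)

text \<open>The shifts commute, so any factor of the product can be moved to the front.\<close>

lemma foldr_shift_in_range:
  assumes "l \<in> set ls" "v \<in> carrier M"
  shows "\<exists>w\<in>carrier M. foldr shift ls v = shift l w"
  using assms(1)
proof (induction ls)
  case (Cons k ls)
  show ?case
  proof (cases "l = k")
    case True
    then show ?thesis using assms by auto
  next
    case False
    then obtain w where w: "w \<in> carrier M" "foldr shift ls v = shift l w" using Cons by auto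
    then have "foldr shift (k # ls) v = shift l (shift k w)" by (simp add: shift_comm)
    then show ?thesis using w by auto
  qed
qed simp

text \<open>Modulo the image of G + t the endomorphism G acts as -t, hence G + l as l - t and the
  product of the shifts as the product of these integers. This is the remainder theorem for
  polynomials in G.\<close>

lemma foldr_shift_residue:
  assumes v: "v \<in> carrier M"
  shows "\<exists>w\<in>carrier M. foldr shift ls v = ([(\<Prod>l\<leftarrow>ls. l - t)] \<cdot>\<^bsub>R\<^esub> \<one>\<^bsub>R\<^esub>) \<odot>\<^bsub>M\<^esub> v \<oplus>\<^bsub>M\<^esub> shift t w"
proof (induction ls)
  case Nil
  have "[(1::int)] \<cdot>\<^bsub>R\<^esub> \<one>\<^bsub>R\<^esub> = \<one>\<^bsub>R\<^esub>" using of_nat_int[of 1] by simp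
  then show ?case using v by (auto intro!: bexI[of _ "\<zero>\<^bsub>M\<^esub>"])
next
  case (Cons l ls)
  define d where "d = [(\<Prod>l\<leftarrow>ls. l - t)] \<cdot>\<^bsub>R\<^esub> \<one>\<^bsub>R\<^esub>"
  define e where "e = [(l - t)] \<cdot>\<^bsub>R\<^esub> \<one>\<^bsub>R\<^esub>"
  have d: "d \<in> carrier R" and e: "e \<in> carrier R" by (auto simp: d_def e_def)
  obtain w where w: "w \<in> carrier M" "foldr shift ls v = d \<odot>\<^bsub>M\<^esub> v \<oplus>\<^bsub>M\<^esub> shift t w"
    using Cons by (auto simp: d_def)
  have "foldr shift (l # ls) v = shift t (d \<odot>\<^bsub>M\<^esub> v \<oplus>\<^bsub>M\<^esub> shift t w) \<oplus>\<^bsub>M\<^esub> e \<odot>\<^bsub>M\<^esub> (d \<odot>\<^bsub>M\<^esub> v \<oplus>\<^bsub>M\<^esub> shift t w)"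
    using w v d by (simp add: shift_change[of _ l t] e_def)
  also have "\<dots> = (e \<otimes> d) \<odot>\<^bsub>M\<^esub> v \<oplus>\<^bsub>M\<^esub> shift t (d \<odot>\<^bsub>M\<^esub> v \<oplus>\<^bsub>M\<^esub> shift t w \<oplus>\<^bsub>M\<^esub> e \<odot>\<^bsub>M\<^esub> w)"
    using w v d e by (simp add: V.smult_r_distr V.smult_assoc1 shift_add shift_smult V.M.a_ac)
  finally show ?case using w v d e
    by (auto simp: of_int_mult d_def e_def)
qed

lemma submodule_img: "submodule (img t J) R M"
proof (rule V.submoduleI)
  show "img t J \<subseteq> carrier M" by (auto simp: img_def)
  show "\<zero>\<^bsub>M\<^esub> \<in> img t J" unfolding img_def
    by (auto intro!: exI[of _ "\<zero>\<^bsub>M\<^esub>"])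
  show sm: "r \<odot>\<^bsub>M\<^esub> x \<in> img t J" if rx: "r \<in> carrier R" "x \<in> img t J" for r x
  proof -
    obtain a b where ab: "a \<in> carrier M" "b \<in> carrier M" "x = shift t a \<oplus>\<^bsub>M\<^esub> pip J \<odot>\<^bsub>M\<^esub> b"
      using rx by (auto simp: img_def)
    then have "r \<odot>\<^bsub>M\<^esub> x = shift t (r \<odot>\<^bsub>M\<^esub> a) \<oplus>\<^bsub>M\<^esub> pip J \<odot>\<^bsub>M\<^esub> (r \<odot>\<^bsub>M\<^esub> b)"
      using rx by (simp add: shift_smult V.smult_r_distr m_comm flip: V.smult_assoc1)
    then show ?thesis using ab rx unfolding img_def by blast
  qed
  show "x \<oplus>\<^bsub>M\<^esub> y \<in> img t J" if xy: "x \<in> img t J" "y \<in> img t J" for x y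
  proof -
    obtain a b a' b' where ab: "a \<in> carrier M" "b \<in> carrier M" "x = shift t a \<oplus>\<^bsub>M\<^esub> pip J \<odot>\<^bsub>M\<^esub> b"
        "a' \<in> carrier M" "b' \<in> carrier M" "y = shift t a' \<oplus>\<^bsub>M\<^esub> pip J \<odot>\<^bsub>M\<^esub> b'"
      using xy by (auto simp: img_def)
    then have "x \<oplus>\<^bsub>M\<^esub> y = shift t (a \<oplus>\<^bsub>M\<^esub> a') \<oplus>\<^bsub>M\<^esub> pip J \<odot>\<^bsub>M\<^esub> (b \<oplus>\<^bsub>M\<^esub> b')"
      by (simp add: shift_add V.smult_r_distr V.M.a_ac)
    then show ?thesis using ab unfolding img_def by blast
  qed
  show "\<ominus>\<^bsub>M\<^esub> x \<in> img t J" if "x \<in> img t J" for x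
  proof -
    have "x \<in> carrier M" using that by (auto simp: img_def)
    then have "\<ominus>\<^bsub>M\<^esub> x = (\<ominus> \<one>) \<odot>\<^bsub>M\<^esub> x" by (simp add: V.smult_l_minus)
    then show ?thesis using sm[of "\<ominus> \<one>" x] that by simp
  qed
qed

lemma img_shift: "w \<in> carrier M \<Longrightarrow> shift t w \<in> img t J"
  unfolding img_def by (rule CollectI, rule exI[of _ w], rule exI[of _ "\<zero>\<^bsub>M\<^esub>"]) simp

lemma img_pip: "w \<in> carrier M \<Longrightarrow> pip J \<odot>\<^bsub>M\<^esub> w \<in> img t J"
  unfolding img_def by (rule CollectI, rule exI[of _ "\<zero>\<^bsub>M\<^esub>"], rule exI[of _ w]) simp

lemma img_smult_diff:
  assumes "m \<in> carrier R" "a \<in> img t J" "b \<in> img t J"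
  shows "m \<odot>\<^bsub>M\<^esub> (a \<ominus>\<^bsub>M\<^esub> b) \<in> img t J"
proof -
  have "a \<ominus>\<^bsub>M\<^esub> b \<in> img t J"
    unfolding V.M.minus_eq
    by (rule V.submoduleE(5)[OF submodule_img assms(2) V.submoduleE(3)[OF submodule_img assms(3)]])
  then show ?thesis by (rule V.submoduleE(4)[OF submodule_img assms(1)])
qed

lemma img_antimono: assumes "J \<le> J'" shows "img t J' \<subseteq> img t J"
proof
  fix x assume "x \<in> img t J'"
  then obtain a b where ab: "a \<in> carrier M" "b \<in> carrier M" "x = shift t a \<oplus>\<^bsub>M\<^esub> pip J' \<odot>\<^bsub>M\<^esub> b"
    by (auto simp: img_def)
  have "pip J' = pip J \<otimes> pip (J' - J)" using assms pip_add[of J "J' - J"] by simp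
  then have "x = shift t a \<oplus>\<^bsub>M\<^esub> pip J \<odot>\<^bsub>M\<^esub> (pip (J' - J) \<odot>\<^bsub>M\<^esub> b)"
    using ab by (simp add: V.smult_assoc1)
  then show "x \<in> img t J" using ab unfolding img_def by blast
qed

text \<open>For the cokernel Q of G + t this says that p^i Q differs from p^(i+1) Q for every i. In
  this form infiniteness of Q can be fed into a count of residues.\<close>

definition strict :: "int \<Rightarrow> bool" where
  "strict t \<longleftrightarrow> (\<forall>i. \<exists>a\<in>carrier M. pip i \<odot>\<^bsub>M\<^esub> a \<notin> img t (Suc i))"

text \<open>Strictness at level j + v provides \<open>b\<close> such that p^v b lies in
  \<open>img t (j + v)\<close> but not in \<open>img t (Suc (j + v))\<close>. The points of
  \<open>S\<close> and their translates by \<open>b\<close> are then pairwise separated at the next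
  level, which doubles the family. The factor p^v makes room for the later cancellation of
  integers.\<close>

lemma separated_single:
  assumes t: "strict t"
  shows "\<exists>S\<subseteq>carrier M. finite S \<and> card S = 2 ^ j \<and>
    (\<forall>x\<in>S. \<forall>y\<in>S. x \<noteq> y \<longrightarrow> pip v \<odot>\<^bsub>M\<^esub> (x \<ominus>\<^bsub>M\<^esub> y) \<notin> img t (j + v))"
proof (induction j)
  case 0
  then show ?case by (intro exI[of _ "{\<zero>\<^bsub>M\<^esub>}"]) auto
next
  case (Suc j)
  note im = submodule_img
  obtain S where S: "S \<subseteq> carrier M" "finite S" "card S = 2 ^ j"
    and sep: "\<And>x y. x \<in> S \<Longrightarrow> y \<in> S \<Longrightarrow> x \<noteq> y \<Longrightarrow> pip v \<odot>\<^bsub>M\<^esub> (x \<ominus>\<^bsub>M\<^esub> y) \<notin> img t (j + v)"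
    using Suc by blast
  obtain a where a: "a \<in> carrier M" "pip (j + v) \<odot>\<^bsub>M\<^esub> a \<notin> img t (Suc (j + v))"
    using t unfolding strict_def by blast
  define b where "b = pip j \<odot>\<^bsub>M\<^esub> a"
  have b: "b \<in> carrier M" using a by (simp add: b_def)
  have vb: "pip v \<odot>\<^bsub>M\<^esub> b = pip (j + v) \<odot>\<^bsub>M\<^esub> a"
    using a by (simp add: b_def pip_add m_comm flip: V.smult_assoc1)
  have mono: "x \<in> img t (Suc (j + v)) \<Longrightarrow> x \<in> img t (j + v)" for x
    using img_antimono[of "j + v" "Suc (j + v)" t] by auto
  have neg: "pip v \<odot>\<^bsub>M\<^esub> (y \<ominus>\<^bsub>M\<^esub> x) = \<ominus>\<^bsub>M\<^esub> (pip v \<odot>\<^bsub>M\<^esub> (x \<ominus>\<^bsub>M\<^esub> y))"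
    if "x \<in> carrier M" "y \<in> carrier M" for x y
    using that by (simp add: V.M.minus_eq V.smult_r_distr V.smult_r_minus V.M.minus_add V.M.a_comm)
  \<comment> \<open>For x = y the difference is p^v b itself. Otherwise p^v b is invisible at level
    j + v, and membership would contradict the separation of x and y there.\<close>
  have cross: "pip v \<odot>\<^bsub>M\<^esub> ((x \<oplus>\<^bsub>M\<^esub> b) \<ominus>\<^bsub>M\<^esub> y) \<notin> img t (Suc (j + v))" if xy: "x \<in> S" "y \<in> S" for x y
  proof
    assume h: "pip v \<odot>\<^bsub>M\<^esub> ((x \<oplus>\<^bsub>M\<^esub> b) \<ominus>\<^bsub>M\<^esub> y) \<in> img t (Suc (j + v))"
    have c: "x \<in> carrier M" "y \<in> carrier M" using xy S by auto
    have e: "pip v \<odot>\<^bsub>M\<^esub> ((x \<oplus>\<^bsub>M\<^esub> b) \<ominus>\<^bsub>M\<^esub> y) = pip v \<odot>\<^bsub>M\<^esub> (x \<ominus>\<^bsub>M\<^esub> y) \<oplus>\<^bsub>M\<^esub> pip v \<odot>\<^bsub>M\<^esub> b"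
      using c b by (simp add: V.M.minus_eq V.smult_r_distr V.M.a_ac)
    show False
    proof (cases "x = y")
      case True
      then have "pip v \<odot>\<^bsub>M\<^esub> (x \<ominus>\<^bsub>M\<^esub> y) = \<zero>\<^bsub>M\<^esub>" using c by (simp add: V.M.minus_eq V.M.r_neg)
      then show False using h e a b by (simp add: vb)
    next
      case False
      have "pip v \<odot>\<^bsub>M\<^esub> (x \<ominus>\<^bsub>M\<^esub> y) \<in> img t (j + v)"
        by (rule V.submodule_cancel[OF im, where b = "pip v \<odot>\<^bsub>M\<^esub> b"])
          (use e h mono a c in \<open>auto simp: vb img_pip\<close>)
      then show False using sep[OF xy False] by simp
    qed
  qed
  have cross': "pip v \<odot>\<^bsub>M\<^esub> (y \<ominus>\<^bsub>M\<^esub> (x \<oplus>\<^bsub>M\<^esub> b)) \<notin> img t (Suc (j + v))" if xy: "x \<in> S" "y \<in> S" for x y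
  proof
    assume "pip v \<odot>\<^bsub>M\<^esub> (y \<ominus>\<^bsub>M\<^esub> (x \<oplus>\<^bsub>M\<^esub> b)) \<in> img t (Suc (j + v))"
    then have "\<ominus>\<^bsub>M\<^esub> (pip v \<odot>\<^bsub>M\<^esub> (y \<ominus>\<^bsub>M\<^esub> (x \<oplus>\<^bsub>M\<^esub> b))) \<in> img t (Suc (j + v))"
      using V.submoduleE(3)[OF im] by blast
    moreover have "y \<in> carrier M" "x \<oplus>\<^bsub>M\<^esub> b \<in> carrier M" using xy S b by auto
    ultimately show False using cross[OF xy] neg[of y "x \<oplus>\<^bsub>M\<^esub> b"] by simp
  qed
  define g where "g = (\<lambda>(x, s::bool). if s then x \<oplus>\<^bsub>M\<^esub> b else x)"
  have gc: "g i \<in> carrier M" if "i \<in> S \<times> UNIV" for i using that S b by (auto simp: g_def)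
  have gsep: "pip v \<odot>\<^bsub>M\<^esub> (g i \<ominus>\<^bsub>M\<^esub> g k) \<notin> img t (Suc (j + v))"
    if "i \<in> S \<times> UNIV" "k \<in> S \<times> UNIV" "i \<noteq> k" for i k
  proof -
    obtain x s y s' where i: "i = (x, s)" "k = (y, s')" by (cases i, cases k)
    have xy: "x \<in> S" "y \<in> S" "x \<in> carrier M" "y \<in> carrier M" using that i S by auto
    have "(x \<oplus>\<^bsub>M\<^esub> b) \<ominus>\<^bsub>M\<^esub> (y \<oplus>\<^bsub>M\<^esub> b) = (x \<ominus>\<^bsub>M\<^esub> y) \<oplus>\<^bsub>M\<^esub> (b \<oplus>\<^bsub>M\<^esub> \<ominus>\<^bsub>M\<^esub> b)"
      using xy b by (simp add: V.M.minus_eq V.M.minus_add V.M.a_ac del: V.M.r_neg)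
    also have "\<dots> = x \<ominus>\<^bsub>M\<^esub> y" using xy b by (simp add: V.M.r_neg)
    finally have bb: "(x \<oplus>\<^bsub>M\<^esub> b) \<ominus>\<^bsub>M\<^esub> (y \<oplus>\<^bsub>M\<^esub> b) = x \<ominus>\<^bsub>M\<^esub> y" .
    have "pip v \<odot>\<^bsub>M\<^esub> (x \<ominus>\<^bsub>M\<^esub> y) \<notin> img t (Suc (j + v))" if "x \<noteq> y"
      using sep[OF xy(1,2) that] mono by blast
    then show ?thesis using that i bb cross[OF xy(1,2)] cross'[OF xy(2,1)]
      by (cases s; cases s') (auto simp: g_def)
  qed
  have inj: "inj_on g (S \<times> UNIV)"
    by (rule V.separated_inj[where T = "{t}" and X = "\<lambda>t. img t (Suc (j + v))" and m = "pip v"])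
      (use gc gsep im in auto)
  have "card (g ` (S \<times> UNIV)) = 2 ^ Suc j"
    using card_image[OF inj] S by (simp add: card_cartesian_product)
  moreover have "finite (g ` (S \<times> UNIV))" "g ` (S \<times> UNIV) \<subseteq> carrier M" using S gc by auto
  moreover have "\<forall>x\<in>g ` (S \<times> UNIV). \<forall>y\<in>g ` (S \<times> UNIV). x \<noteq> y \<longrightarrow> pip v \<odot>\<^bsub>M\<^esub> (x \<ominus>\<^bsub>M\<^esub> y) \<notin> img t (Suc j + v)"
    using gsep by (metis (no_types, lifting) add_Suc imageE)
  ultimately show ?case by blast
qed

text \<open>A Chinese remainder argument. Let \<open>P\<close> be the product of the shifts in \<open>ts\<close>. Modulo the image of each of
  these shifts \<open>P\<close> vanishes, and modulo the image of the shift by \<open>t\<close> it acts as the integer \<open>d\<close>. Hence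
  \<open>d x - P x + P y\<close> is congruent to \<open>d x\<close> and to \<open>d y\<close> respectively.\<close>

lemma separated_family:
  assumes "distinct ts" "\<And>t. t \<in> set ts \<Longrightarrow> strict t"
    and "m \<in> carrier R" "y \<in> carrier R" "y \<otimes> m = pip v"
  shows "\<exists>e. \<forall>j. \<exists>S\<subseteq>carrier M. finite S \<and> card S = 2 ^ (j * length ts) \<and>
    (\<forall>x\<in>S. \<forall>y\<in>S. x \<noteq> y \<longrightarrow> (\<exists>t\<in>set ts. m \<odot>\<^bsub>M\<^esub> (x \<ominus>\<^bsub>M\<^esub> y) \<notin> img t (j + e)))"
  using assms
proof (induction ts arbitrary: m y v)
  case Nil
  then show ?case by (intro exI[of _ 0] allI exI[of _ "{\<zero>\<^bsub>M\<^esub>}"]) auto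
next
  case (Cons t ts)
  note im = submodule_img
  let ?P = "foldr shift ts"
  \<comment> \<open>The integer by which the product of the shifts in \<open>ts\<close> acts modulo
    the image of the shift by \<open>t\<close>. It is nonzero because the list is distinct.\<close>
  define n where "n = (\<Prod>l\<leftarrow>ts. l - t)"
  define d where "d = [n] \<cdot>\<^bsub>R\<^esub> \<one>\<^bsub>R\<^esub>"
  have d: "d \<in> carrier R" by (simp add: d_def)
  have "n \<noteq> 0" using Cons.prems(1) unfolding n_def by (auto simp: prod_list_zero_iff)
  then obtain z w where z: "z \<in> carrier R" "z \<otimes> d = pip w" unfolding d_def using of_int_dvd_pip by blast
  \<comment> \<open>In the points \<open>g\<close> below the first component enters multiplied by
    \<open>d\<close>, so the induction hypothesis is applied with m d in place of m. This is why the
    statement carries a factor \<open>m\<close> that divides a power of p.\<close>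
  define md where "md = m \<otimes> d"
  have md: "md \<in> carrier R" using d Cons.prems by (simp add: md_def)
  have "(y \<otimes> z) \<otimes> md = (y \<otimes> m) \<otimes> (z \<otimes> d)" using z(1) d Cons.prems(3,4) by (simp add: md_def m_ac)
  also have "\<dots> = pip (v + w)" using z Cons.prems by (simp add: pip_add)
  finally have ymd: "(y \<otimes> z) \<otimes> md = pip (v + w)" .
  obtain e1 where e1: "\<And>j. \<exists>S\<subseteq>carrier M. finite S \<and> card S = 2 ^ (j * length ts) \<and>
    (\<forall>x\<in>S. \<forall>y\<in>S. x \<noteq> y \<longrightarrow> (\<exists>t\<in>set ts. md \<odot>\<^bsub>M\<^esub> (x \<ominus>\<^bsub>M\<^esub> y) \<notin> img t (j + e1)))"
    using Cons.IH[of md "y \<otimes> z" "v + w"] Cons.prems md ymd z by auto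
  define e2 where "e2 = v + w"
  \<comment> \<open>Absorbs the losses from both components; it is chosen before j, as the later
    comparison of growth rates requires.\<close>
  define e where "e = max e1 e2"
  have "\<exists>S\<subseteq>carrier M. finite S \<and> card S = 2 ^ (j * length (t # ts)) \<and>
    (\<forall>x\<in>S. \<forall>y\<in>S. x \<noteq> y \<longrightarrow> (\<exists>t\<in>set (t # ts). m \<odot>\<^bsub>M\<^esub> (x \<ominus>\<^bsub>M\<^esub> y) \<notin> img t (j + e)))" for j
  proof -
    obtain A where A: "A \<subseteq> carrier M" "finite A" "card A = 2 ^ (j * length ts)"
      and Asep: "\<And>x y. x \<in> A \<Longrightarrow> y \<in> A \<Longrightarrow> x \<noteq> y \<Longrightarrow> \<exists>t\<in>set ts. md \<odot>\<^bsub>M\<^esub> (x \<ominus>\<^bsub>M\<^esub> y) \<notin> img t (j + e1)"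
      using e1[of j] by blast
    obtain B where B: "B \<subseteq> carrier M" "finite B" "card B = 2 ^ j"
      and Bsep: "\<And>x y. x \<in> B \<Longrightarrow> y \<in> B \<Longrightarrow> x \<noteq> y \<Longrightarrow> pip e2 \<odot>\<^bsub>M\<^esub> (x \<ominus>\<^bsub>M\<^esub> y) \<notin> img t (j + e2)"
      using separated_single[of t j e2] Cons.prems by auto
    \<comment> \<open>Multiplication by \<open>y \<otimes> z\<close> would turn membership for
      \<open>md\<close> into membership for p^(v+w), which the choice of \<open>B\<close>
      excludes.\<close>
    have Bsep': "md \<odot>\<^bsub>M\<^esub> (b \<ominus>\<^bsub>M\<^esub> b') \<notin> img t (j + e2)" if "b \<in> B" "b' \<in> B" "b \<noteq> b'" for b b'
    proof
      assume "md \<odot>\<^bsub>M\<^esub> (b \<ominus>\<^bsub>M\<^esub> b') \<in> img t (j + e2)"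
      then have "(y \<otimes> z) \<odot>\<^bsub>M\<^esub> (md \<odot>\<^bsub>M\<^esub> (b \<ominus>\<^bsub>M\<^esub> b')) \<in> img t (j + e2)"
        using V.submoduleE(4)[OF im] z Cons.prems by simp
      then have "((y \<otimes> z) \<otimes> md) \<odot>\<^bsub>M\<^esub> (b \<ominus>\<^bsub>M\<^esub> b') \<in> img t (j + e2)"
        using z Cons.prems md that B by (subst V.smult_assoc1) auto
      then show False using Bsep[OF that] unfolding ymd e2_def by simp
    qed
    define g where "g = (\<lambda>(a, b). (d \<odot>\<^bsub>M\<^esub> a \<ominus>\<^bsub>M\<^esub> ?P a) \<oplus>\<^bsub>M\<^esub> ?P b)"
    have gc: "g i \<in> carrier M" if "i \<in> A \<times> B" for i
      using that A B d by (auto simp: g_def subset_iff)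
    have gsep: "\<exists>s\<in>set (t # ts). m \<odot>\<^bsub>M\<^esub> (g i \<ominus>\<^bsub>M\<^esub> g k) \<notin> img s (j + e)"
      if ik: "i \<in> A \<times> B" "k \<in> A \<times> B" "i \<noteq> k" for i k
    proof (rule ccontr)
      assume neg: "\<not> ?thesis"
      obtain a b a' b' where i: "i = (a, b)" "k = (a', b')" by (cases i, cases k)
      have c: "a \<in> carrier M" "b \<in> carrier M" "a' \<in> carrier M" "b' \<in> carrier M"
        using ik i A B by auto
      define u where "u = a \<ominus>\<^bsub>M\<^esub> a'"
      define u' where "u' = b \<ominus>\<^bsub>M\<^esub> b'"
      have u: "u \<in> carrier M" "u' \<in> carrier M" using c by (auto simp: u_def u'_def)
      have aa: "a = u \<oplus>\<^bsub>M\<^esub> a'" "b = u' \<oplus>\<^bsub>M\<^esub> b'"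
        using c by (simp_all add: u_def u'_def V.M.minus_eq V.M.a_assoc V.M.l_neg)
      have gi: "g i = (d \<odot>\<^bsub>M\<^esub> u \<ominus>\<^bsub>M\<^esub> ?P u) \<oplus>\<^bsub>M\<^esub> ?P u' \<oplus>\<^bsub>M\<^esub> g k"
        unfolding i g_def aa prod.case using c u d
        by (simp add: foldr_shift_add V.smult_r_distr V.M.minus_eq V.M.minus_add V.M.a_ac)
      have gg: "g i \<ominus>\<^bsub>M\<^esub> g k = (d \<odot>\<^bsub>M\<^esub> u \<ominus>\<^bsub>M\<^esub> ?P u) \<oplus>\<^bsub>M\<^esub> ?P u'"
        unfolding gi using gc[OF ik(2)] u d by (simp add: V.M.minus_eq V.M.a_assoc V.M.r_neg)
      have "a = a'"
      proof (rule ccontr)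
        assume "a \<noteq> a'"
        then obtain s where s: "s \<in> set ts" "md \<odot>\<^bsub>M\<^esub> u \<notin> img s (j + e1)"
          using Asep ik i unfolding u_def by blast
        have "m \<odot>\<^bsub>M\<^esub> (g i \<ominus>\<^bsub>M\<^esub> g k) \<in> img s (j + e)" using neg s by auto
        then have h: "m \<odot>\<^bsub>M\<^esub> (g i \<ominus>\<^bsub>M\<^esub> g k) \<in> img s (j + e1)"
          using img_antimono[of "j + e1" "j + e" s] by (auto simp: e_def)
        have P: "?P x \<in> img s (j + e1)" if "x \<in> carrier M" for x
          using foldr_shift_in_range[OF s(1) that] img_shift by auto
        have d1: "m \<odot>\<^bsub>M\<^esub> (?P u' \<ominus>\<^bsub>M\<^esub> ?P u) \<in> img s (j + e1)"
          using P u Cons.prems by (intro img_smult_diff) auto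
        have d2: "m \<odot>\<^bsub>M\<^esub> (g i \<ominus>\<^bsub>M\<^esub> g k) = md \<odot>\<^bsub>M\<^esub> u \<oplus>\<^bsub>M\<^esub> m \<odot>\<^bsub>M\<^esub> (?P u' \<ominus>\<^bsub>M\<^esub> ?P u)"
          unfolding gg md_def using u d Cons.prems
          by (simp add: V.M.minus_eq V.smult_r_distr V.smult_assoc1 V.M.a_ac)
        have "md \<odot>\<^bsub>M\<^esub> u \<in> img s (j + e1)"
          using V.submodule_cancel[OF im h[unfolded d2] d1] u md by simp
        then show False using s by simp
      qed
      moreover have "b = b'"
      proof (rule ccontr)
        assume "b \<noteq> b'"
        then have nb: "md \<odot>\<^bsub>M\<^esub> u' \<notin> img t (j + e2)"
          using Bsep' ik i unfolding u'_def by blast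
        have "m \<odot>\<^bsub>M\<^esub> (g i \<ominus>\<^bsub>M\<^esub> g k) \<in> img t (j + e)" using neg by auto
        then have h: "m \<odot>\<^bsub>M\<^esub> (g i \<ominus>\<^bsub>M\<^esub> g k) \<in> img t (j + e2)"
          using img_antimono[of "j + e2" "j + e" t] by (auto simp: e_def)
        obtain w where w: "w \<in> carrier M" "?P u = d \<odot>\<^bsub>M\<^esub> u \<oplus>\<^bsub>M\<^esub> shift t w"
          using foldr_shift_residue[OF u(1), of ts t] unfolding d_def n_def by blast
        obtain w' where w': "w' \<in> carrier M" "?P u' = d \<odot>\<^bsub>M\<^esub> u' \<oplus>\<^bsub>M\<^esub> shift t w'"
          using foldr_shift_residue[OF u(2), of ts t] unfolding d_def n_def by blast
        have "d \<odot>\<^bsub>M\<^esub> u \<ominus>\<^bsub>M\<^esub> ?P u = (d \<odot>\<^bsub>M\<^esub> u \<oplus>\<^bsub>M\<^esub> \<ominus>\<^bsub>M\<^esub> (d \<odot>\<^bsub>M\<^esub> u)) \<oplus>\<^bsub>M\<^esub> \<ominus>\<^bsub>M\<^esub> shift t w"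
          unfolding w(2) using w u d by (simp add: V.M.minus_eq V.M.minus_add V.M.a_assoc)
        also have "\<dots> = \<ominus>\<^bsub>M\<^esub> shift t w" using w u d by (simp add: V.M.r_neg)
        finally have "g i \<ominus>\<^bsub>M\<^esub> g k = d \<odot>\<^bsub>M\<^esub> u' \<oplus>\<^bsub>M\<^esub> (shift t w' \<ominus>\<^bsub>M\<^esub> shift t w)"
          unfolding gg w'(2) using w w' u d by (simp add: V.M.minus_eq V.M.a_ac)
        then have d2: "m \<odot>\<^bsub>M\<^esub> (g i \<ominus>\<^bsub>M\<^esub> g k) = md \<odot>\<^bsub>M\<^esub> u' \<oplus>\<^bsub>M\<^esub> m \<odot>\<^bsub>M\<^esub> (shift t w' \<ominus>\<^bsub>M\<^esub> shift t w)"
          unfolding md_def using u d w w' Cons.prems by (simp add: V.smult_r_distr V.smult_assoc1)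
        have d1: "m \<odot>\<^bsub>M\<^esub> (shift t w' \<ominus>\<^bsub>M\<^esub> shift t w) \<in> img t (j + e2)"
          using w w' Cons.prems img_shift by (intro img_smult_diff) auto
        have "md \<odot>\<^bsub>M\<^esub> u' \<in> img t (j + e2)"
          using V.submodule_cancel[OF im h[unfolded d2] d1] u md by simp
        then show False using nb by simp
      qed
      ultimately show False using ik i by simp
    qed
    have inj: "inj_on g (A \<times> B)"
      using im Cons.prems(3) gc gsep
      by (rule V.separated_inj[where T = "set (t # ts)" and X = "\<lambda>t. img t (j + e)" and m = m])
    have "card (g ` (A \<times> B)) = 2 ^ (j * length (t # ts))"
      using card_image[OF inj] A B by (simp add: card_cartesian_product power_add algebra_simps)
    moreover have "finite (g ` (A \<times> B))" "g ` (A \<times> B) \<subseteq> carrier M" using A B gc by auto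
    moreover have "\<forall>x\<in>g ` (A \<times> B). \<forall>y\<in>g ` (A \<times> B). x \<noteq> y \<longrightarrow> (\<exists>t\<in>set (t # ts). m \<odot>\<^bsub>M\<^esub> (x \<ominus>\<^bsub>M\<^esub> y) \<notin> img t (j + e))"
      using gsep by blast
    ultimately show ?thesis by blast
  qed
  then show ?case by blast
qed

text \<open>There are 2^(j |T|) points that stay distinct modulo p^(j+e), but at most B^(j+e)
  residues. Since e is fixed while j grows, 2^|T| cannot exceed B; the bound |T| \<le> B is a
  convenient weakening.\<close>

lemma card_strict_le:
  assumes res: "\<And>J. \<exists>S\<subseteq>carrier M. finite S \<and> card S \<le> B ^ J \<and>
      (\<forall>v\<in>carrier M. \<exists>s\<in>S. \<exists>b\<in>carrier M. v = s \<oplus>\<^bsub>M\<^esub> pip J \<odot>\<^bsub>M\<^esub> b)"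
    and T: "finite T" "\<And>t. t \<in> T \<Longrightarrow> strict t"
  shows "card T \<le> B"
proof (rule ccontr)
  assume c: "\<not> card T \<le> B"
  obtain ts where ts: "set ts = T" "distinct ts" using T finite_distinct_list by blast
  then have len: "length ts = card T" using distinct_card by fastforce
  have ne: "ts \<noteq> []" using c len by auto
  obtain e where e: "\<And>j. \<exists>S\<subseteq>carrier M. finite S \<and> card S = 2 ^ (j * length ts) \<and>
    (\<forall>x\<in>S. \<forall>y\<in>S. x \<noteq> y \<longrightarrow> (\<exists>t\<in>set ts. \<one> \<odot>\<^bsub>M\<^esub> (x \<ominus>\<^bsub>M\<^esub> y) \<notin> img t (j + e)))"
    using separated_family[OF ts(2), of "\<one>" "\<one>" 0] ts T by auto
  have bound: "2 ^ (j * length ts) \<le> B ^ (j + e)" for j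
  proof -
    obtain S where S: "S \<subseteq> carrier M" "finite S" "card S = 2 ^ (j * length ts)"
      and sep: "\<And>x y. x \<in> S \<Longrightarrow> y \<in> S \<Longrightarrow> x \<noteq> y \<Longrightarrow> \<exists>t\<in>set ts. \<one> \<odot>\<^bsub>M\<^esub> (x \<ominus>\<^bsub>M\<^esub> y) \<notin> img t (j + e)"
      using e[of j] by blast
    obtain A where A: "A \<subseteq> carrier M" "finite A" "card A \<le> B ^ (j + e)"
       "\<And>v. v \<in> carrier M \<Longrightarrow> \<exists>s\<in>A. \<exists>b\<in>carrier M. v = s \<oplus>\<^bsub>M\<^esub> pip (j + e) \<odot>\<^bsub>M\<^esub> b"
      using res[of "j + e"] by blast
    from A(4) S(1) obtain h k where h: "\<And>x. x \<in> S \<Longrightarrow> h x \<in> A \<and> k x \<in> carrier M \<and> x = h x \<oplus>\<^bsub>M\<^esub> pip (j + e) \<odot>\<^bsub>M\<^esub> k x"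
      by (metis subset_iff)
    \<comment> \<open>Two points with the same residue differ by a multiple of p^(j+e), which lies
      in every \<open>img t (j + e)\<close>, against separation.\<close>
    have "inj_on h S"
    proof (rule inj_onI, rule ccontr)
      fix x y assume xy: "x \<in> S" "y \<in> S" "h x = h y" "x \<noteq> y"
      then obtain t where t: "\<one> \<odot>\<^bsub>M\<^esub> (x \<ominus>\<^bsub>M\<^esub> y) \<notin> img t (j + e)" using sep by blast
      define s where "s = h y"
      have c: "s \<in> carrier M" "k x \<in> carrier M" "k y \<in> carrier M" using h xy A(1) s_def by auto
      have x: "x = s \<oplus>\<^bsub>M\<^esub> pip (j + e) \<odot>\<^bsub>M\<^esub> k x" and y: "y = s \<oplus>\<^bsub>M\<^esub> pip (j + e) \<odot>\<^bsub>M\<^esub> k y"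
        using h[OF xy(1)] h[OF xy(2)] xy(3) by (auto simp: s_def)
      have "x \<ominus>\<^bsub>M\<^esub> y = (s \<oplus>\<^bsub>M\<^esub> \<ominus>\<^bsub>M\<^esub> s) \<oplus>\<^bsub>M\<^esub> pip (j + e) \<odot>\<^bsub>M\<^esub> (k x \<ominus>\<^bsub>M\<^esub> k y)"
        by (subst x, subst y) (use c in \<open>simp add: V.M.minus_eq V.M.minus_add V.smult_r_distr V.smult_r_minus V.M.a_ac\<close>)
      also have "\<dots> = pip (j + e) \<odot>\<^bsub>M\<^esub> (k x \<ominus>\<^bsub>M\<^esub> k y)" using c by (simp add: V.M.r_neg)
      finally show False using t c img_pip[of "k x \<ominus>\<^bsub>M\<^esub> k y" "j + e" t] by simp
    qed
    then have "card S \<le> card A" using h A by (intro card_inj_on_le[of h]) auto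
    then show ?thesis using A S by simp
  qed
  have "B < 2 ^ length ts" using c len less_exp[of "length ts"] by linarith
  then have B1: "real B + 1 \<le> 2 ^ length ts"
    by (metis Suc_leI of_nat_Suc of_nat_le_iff of_nat_numeral of_nat_power add.commute)
  have B0: "B > 0" using bound[of 1] by (cases "B = 0") auto
  \<comment> \<open>As B + 1 \<le> 2^|T|, the inequality \<open>bound\<close> makes the powers of (B
    + 1) / B bounded, which is absurd.\<close>
  have "((real B + 1) / real B) ^ j \<le> real B ^ e" for j
  proof -
    have "(real B + 1) ^ j \<le> (2 ^ length ts) ^ j" using B1 by (intro power_mono) auto
    also have "\<dots> = real (2 ^ (j * length ts))" by (simp add: mult.commute flip: power_mult)
    also have "\<dots> \<le> real (B ^ (j + e))" using bound[of j] by linarith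
    finally show ?thesis using B0 by (simp add: power_add power_divide field_simps)
  qed
  moreover obtain j where "real B ^ e < ((real B + 1) / real B) ^ j"
    using real_arch_pow[of "(real B + 1) / real B" "real B ^ e"] B0 by auto
  ultimately show False by (meson not_le)
qed

end

section \<open>Haar measure of sets of matrices\<close>

context local_zp begin

definition pcong :: "nat \<Rightarrow> 'a \<Rightarrow> 'a \<Rightarrow> bool" where
  "pcong k a b \<longleftrightarrow> (\<exists>x\<in>carrier R. b = a \<oplus> pip k \<otimes> x)"

lemma pcong_refl: "a \<in> carrier R \<Longrightarrow> pcong k a a"
  unfolding pcong_def by (intro bexI[of _ \<zero>]) auto

lemma pcong_sym: assumes "a \<in> carrier R" "pcong k a b" shows "pcong k b a"
proof -
  obtain x where x: "x \<in> carrier R" "b = a \<oplus> pip k \<otimes> x" using assms by (auto simp: pcong_def)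
  define q where "q = pip k"
  have "q \<in> carrier R" by (simp add: q_def)
  then have "a = (a \<oplus> q \<otimes> x) \<oplus> q \<otimes> (\<ominus> x)" using x(1) assms(1) by algebra
  then show ?thesis using x unfolding pcong_def q_def by auto
qed

lemma pcong_trans: assumes "a \<in> carrier R" "pcong k a b" "pcong k b c" shows "pcong k a c"
proof -
  obtain x y where x: "x \<in> carrier R" "b = a \<oplus> pip k \<otimes> x" "y \<in> carrier R" "c = b \<oplus> pip k \<otimes> y"
    using assms by (auto simp: pcong_def)
  then have "c = a \<oplus> pip k \<otimes> (x \<oplus> y)" using assms(1) by (simp add: r_distr a_assoc)
  then show ?thesis using x unfolding pcong_def by auto
qed

lemma pcong_add: assumes "a \<in> carrier R" "a' \<in> carrier R" "pcong k a b" "pcong k a' b'" shows "pcong k (a \<oplus> a') (b \<oplus> b')"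
proof -
  obtain x y where x: "x \<in> carrier R" "b = a \<oplus> pip k \<otimes> x" "y \<in> carrier R" "b' = a' \<oplus> pip k \<otimes> y"
    using assms by (auto simp: pcong_def)
  then have "b \<oplus> b' = (a \<oplus> a') \<oplus> pip k \<otimes> (x \<oplus> y)" using assms(1,2) by (simp add: r_distr a_ac)
  then show ?thesis using x unfolding pcong_def by auto
qed

lemma pcong_mult: assumes "r \<in> carrier R" "a \<in> carrier R" "pcong k a b" shows "pcong k (r \<otimes> a) (r \<otimes> b)"
proof -
  obtain x where x: "x \<in> carrier R" "b = a \<oplus> pip k \<otimes> x" using assms by (auto simp: pcong_def)
  then have "r \<otimes> b = r \<otimes> a \<oplus> pip k \<otimes> (r \<otimes> x)" using assms(1,2) by (simp add: r_distr m_ac)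
  then show ?thesis using x assms unfolding pcong_def by auto
qed

lemma pcong_closed: "a \<in> carrier R \<Longrightarrow> pcong k a b \<Longrightarrow> b \<in> carrier R"
  by (auto simp: pcong_def)

lemma pcong_mono: assumes "pcong k a b" "j \<le> k" shows "pcong j a b"
proof -
  obtain x where x: "x \<in> carrier R" "b = a \<oplus> pip k \<otimes> x" using assms by (auto simp: pcong_def)
  have "pip k = pip j \<otimes> pip (k - j)" using assms pip_add[of j "k - j"] by simp
  then have "b = a \<oplus> pip j \<otimes> (pip (k - j) \<otimes> x)" using x by (simp add: m_assoc)
  then show ?thesis using x unfolding pcong_def by blast
qed

lemma pcoset_iff:
  assumes A: "A \<in> mats R N"
  shows "B \<in> pcoset R p N k A \<longleftrightarrow> B \<in> mats R N \<and> (\<forall>i<N. \<forall>j<N. pcong k (A i j) (B i j))"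
proof
  assume "B \<in> pcoset R p N k A"
  then obtain H where H: "H \<in> mats R N" "B = mat_add R A (\<lambda>i j. pip k \<otimes> H i j)"
    by (auto simp: pcoset_def)
  have "(\<lambda>i j. pip k \<otimes> H i j) \<in> mats R N"
    using H(1) by (intro matsI) (auto simp: mats_carrier mats_zero)
  then show "B \<in> mats R N \<and> (\<forall>i<N. \<forall>j<N. pcong k (A i j) (B i j))"
    using H A by (auto simp: pcong_def mats_carrier intro!: bexI[of _ "H _ _"])
next
  assume B: "B \<in> mats R N \<and> (\<forall>i<N. \<forall>j<N. pcong k (A i j) (B i j))"
  then have "\<forall>i j. \<exists>x. i < N \<and> j < N \<longrightarrow> x \<in> carrier R \<and> B i j = A i j \<oplus> pip k \<otimes> x"
    by (auto simp: pcong_def)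
  then obtain H where H: "\<And>i j. i < N \<Longrightarrow> j < N \<Longrightarrow> H i j \<in> carrier R \<and> B i j = A i j \<oplus> pip k \<otimes> H i j"
    by metis
  define H' where "H' = (\<lambda>i j. if i < N \<and> j < N then H i j else \<zero>)"
  have "H' \<in> mats R N" using H by (intro matsI) (auto simp: H'_def)
  moreover have "B = mat_add R A (\<lambda>i j. pip k \<otimes> H' i j)"
    using B A H by (auto simp: H'_def fun_eq_iff mats_zero)
  ultimately show "B \<in> pcoset R p N k A" unfolding pcoset_def by blast
qed

lemma pcoset_self: "A \<in> mats R N \<Longrightarrow> A \<in> pcoset R p N k A"
  by (simp add: pcoset_iff pcong_refl mats_carrier)

lemma pcoset_subset: "A \<in> mats R N \<Longrightarrow> pcoset R p N k A \<subseteq> mats R N"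
  by (auto simp: pcoset_iff)

lemma pcoset_eq:
  assumes "A \<in> mats R N" "B \<in> pcoset R p N k A" shows "pcoset R p N k B = pcoset R p N k A"
proof -
  have B: "B \<in> mats R N" using assms by (simp add: pcoset_iff)
  show ?thesis using assms B
    by (auto simp: pcoset_iff) (metis pcong_trans pcong_sym mats_carrier)+
qed

lemma pcoset_mono: "A \<in> mats R N \<Longrightarrow> j \<le> k \<Longrightarrow> pcoset R p N k A \<subseteq> pcoset R p N j A"
  using pcong_mono[of k _ _ j] by (auto simp: pcoset_iff)

definition mat_neg :: "(nat \<Rightarrow> nat \<Rightarrow> 'a) \<Rightarrow> nat \<Rightarrow> nat \<Rightarrow> 'a" where
  "mat_neg A = (\<lambda>i j. \<ominus> A i j)"

lemma mat_neg_closed [simp]: "A \<in> mats R N \<Longrightarrow> mat_neg A \<in> mats R N"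
  by (rule matsI) (auto simp: mat_neg_def mats_carrier mats_zero)

lemma mat_add_neg_cancel: "A \<in> mats R N \<Longrightarrow> B \<in> mats R N \<Longrightarrow> mat_add R (mat_neg A) (mat_add R A B) = B"
  by (auto simp: fun_eq_iff mats_carrier mat_neg_def a_assoc[symmetric] l_neg)

lemma mat_add_neg_cancel': "A \<in> mats R N \<Longrightarrow> B \<in> mats R N \<Longrightarrow> mat_add R A (mat_add R (mat_neg A) B) = B"
  by (auto simp: fun_eq_iff mats_carrier mat_neg_def a_assoc[symmetric] r_neg)

lemma translate_pcoset:
  assumes "A \<in> mats R N" "B \<in> mats R N"
  shows "mat_add R B ` pcoset R p N k A = pcoset R p N k (mat_add R B A)"
proof -
  have "mat_add R B ` pcoset R p N k A \<subseteq> pcoset R p N k (mat_add R B A)"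
    if "A \<in> mats R N" "B \<in> mats R N" for A B
  proof
    fix C assume "C \<in> mat_add R B ` pcoset R p N k A"
    then obtain D where D: "C = mat_add R B D" "D \<in> pcoset R p N k A" by auto
    then show "C \<in> pcoset R p N k (mat_add R B A)"
      using that by (auto simp: pcoset_iff mats_carrier pcong_refl intro!: pcong_add)
  qed
  note sub = this
  have "C \<in> mat_add R B ` pcoset R p N k A" if C: "C \<in> pcoset R p N k (mat_add R B A)" for C
  proof -
    have Cm: "C \<in> mats R N" using C assms by (simp add: pcoset_iff)
    have "mat_add R (mat_neg B) C \<in> pcoset R p N k (mat_add R (mat_neg B) (mat_add R B A))"
      using sub[of "mat_add R B A" "mat_neg B"] C assms by auto
    then have "mat_add R (mat_neg B) C \<in> pcoset R p N k A" using assms by (simp add: mat_add_neg_cancel)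
    moreover have "C = mat_add R B (mat_add R (mat_neg B) C)" using assms Cm by (simp add: mat_add_neg_cancel')
    ultimately show ?thesis by blast
  qed
  then show ?thesis using sub[OF assms] by blast
qed

lemma finite_pcosets: "finite (pcoset R p N k ` mats R N)"
proof -
  obtain S where S: "finite S" "S \<subseteq> carrier R" "\<forall>r\<in>carrier R. \<exists>s\<in>S. \<exists>x\<in>carrier R. r = s \<oplus> pip k \<otimes> x"
    using residues[of k] by blast
  let ?mk = "\<lambda>f i j. if i < N \<and> j < N then f (i, j) else \<zero>"
  have "pcoset R p N k ` mats R N \<subseteq> (\<lambda>f. pcoset R p N k (?mk f)) ` (({..<N} \<times> {..<N}) \<rightarrow>\<^sub>E S)"
  proof
    fix P assume "P \<in> pcoset R p N k ` mats R N"
    then obtain A where A: "A \<in> mats R N" "P = pcoset R p N k A" by blast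
    have "\<forall>i j. \<exists>s\<in>S. pcong k s (A i j)" using S A unfolding pcong_def by (metis mats_carrier)
    then obtain s where s: "\<And>i j. s i j \<in> S" "\<And>i j. pcong k (s i j) (A i j)" by metis
    define f where "f = restrict (\<lambda>(i, j). s i j) ({..<N} \<times> {..<N})"
    have f: "f \<in> ({..<N} \<times> {..<N}) \<rightarrow>\<^sub>E S" using s by (auto simp: f_def)
    have m: "?mk f \<in> mats R N" using s S by (intro matsI) (auto simp: f_def)
    have "A \<in> pcoset R p N k (?mk f)"
      unfolding pcoset_iff[OF m] using A s by (auto simp: f_def)
    then have "P = pcoset R p N k (?mk f)" using pcoset_eq[OF m] A by simp
    then show "P \<in> (\<lambda>f. pcoset R p N k (?mk f)) ` (({..<N} \<times> {..<N}) \<rightarrow>\<^sub>E S)" using f by blast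
  qed
  then show ?thesis by (rule finite_subset) (auto intro!: finite_imageI finite_PiE S)
qed

text \<open>Openness in the p-adic topology. The sigma-algebra of \<open>is_haar\<close> is given by
  generators, and events are shown to be measurable by showing that they are open.\<close>

definition padic_open :: "nat \<Rightarrow> (nat \<Rightarrow> nat \<Rightarrow> 'a) set \<Rightarrow> bool" where
  "padic_open N E \<longleftrightarrow> E \<subseteq> mats R N \<and> (\<forall>A\<in>E. \<exists>k. pcoset R p N k A \<subseteq> E)"

lemma countable_pcosets: "countable {pcoset R p N k A | k A. A \<in> mats R N}"
proof -
  have "{pcoset R p N k A | k A. A \<in> mats R N} = (\<Union>k. pcoset R p N k ` mats R N)" by blast
  then show ?thesis using finite_pcosets by (simp add: countable_finite)
qed

text \<open>An open set is the union of the cosets that it contains, and there are countably many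
  cosets in all, finitely many for each k.\<close>

lemma padic_open_sets:
  assumes H: "is_haar R p N \<mu>" and E: "padic_open N E"
  shows "E \<in> sets \<mu>"
proof -
  let ?P = "{P \<in> {pcoset R p N k A | k A. A \<in> mats R N}. P \<subseteq> E}"
  have "E \<subseteq> \<Union>?P"
  proof
    fix A assume A: "A \<in> E"
    then have Am: "A \<in> mats R N" using E by (auto simp: padic_open_def)
    obtain k where k: "pcoset R p N k A \<subseteq> E" using E A by (auto simp: padic_open_def)
    then have "pcoset R p N k A \<in> ?P" using Am by auto
    then show "A \<in> \<Union>?P" using pcoset_self[OF Am] by blast
  qed
  then have "E = \<Union>?P" by auto
  moreover have "countable ?P" by (rule countable_subset[OF _ countable_pcosets]) auto
  moreover have "P \<in> sets \<mu>" if "P \<in> ?P" for P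
  proof -
    have "P \<in> sigma_sets (mats R N) {pcoset R p N k A | k A. A \<in> mats R N}"
      using that by (intro sigma_sets.Basic) auto
    then show ?thesis using H by (simp add: is_haar_def)
  qed
  ultimately show ?thesis by (metis (no_types, lifting) sets.countable_Union subsetI)
qed

lemma padic_open_Un: "(\<And>i. i \<in> I \<Longrightarrow> padic_open N (E i)) \<Longrightarrow> padic_open N (\<Union>i\<in>I. E i)"
  unfolding padic_open_def by (meson SUP_upper UN_E UN_least subset_trans)

lemma measure_translate:
  assumes "is_haar R p N \<mu>" "A \<in> mats R N" "E \<in> sets \<mu>"
  shows "measure \<mu> (mat_add R A ` E) = measure \<mu> E"
  using assms unfolding is_haar_def measure_def by auto

lemma measure_equidistributed:
  assumes H: "is_haar R p N \<mu>" and B: "finite B" "B \<noteq> {}"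
    and E: "\<And>b. b \<in> B \<Longrightarrow> E b \<in> sets \<mu>" "disjoint_family_on E B"
    and b0: "b0 \<in> B"
    and tr: "\<And>b. b \<in> B \<Longrightarrow> \<exists>A\<in>mats R N. E b = mat_add R A ` E b0"
    and b: "b \<in> B"
  shows "measure \<mu> (E b) = measure \<mu> (\<Union>b\<in>B. E b) / card B"
proof -
  interpret prob_space \<mu> using H by (simp add: is_haar_def)
  have eq: "measure \<mu> (E b) = measure \<mu> (E b0)" if "b \<in> B" for b
    using tr[OF that] measure_translate[OF H _ E(1)[OF b0]] by metis
  have "measure \<mu> (\<Union>b\<in>B. E b) = (\<Sum>b\<in>B. measure \<mu> (E b))"
    using E B by (intro finite_measure_finite_Union) auto
  also have "\<dots> = card B * measure \<mu> (E b0)" using eq by simp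
  finally show ?thesis using eq[OF b] B by (simp add: field_simps)
qed

lemma measure_mats: "is_haar R p N \<mu> \<Longrightarrow> measure \<mu> (mats R N) = 1"
  unfolding is_haar_def using prob_space.prob_space by metis

text \<open>Here \<theta> behaves like a homomorphism onto a finite group, without a group structure
  on \<open>B\<close>: \<open>b0\<close> plays the neutral element, \<open>tr\<close> says that the
  fibre over it consists of the matrices by which translation preserves \<theta>, and
  \<open>op\<close> that \<theta> is locally constant. All fibres are translates of this one and
  share the total mass equally.\<close>

lemma measure_fiber:
  assumes H: "is_haar R p N \<mu>" and B: "finite B"
    and sur: "\<theta> ` mats R N = B"
    and op: "\<And>A C. A \<in> mats R N \<Longrightarrow> C \<in> pcoset R p N k A \<Longrightarrow> \<theta> C = \<theta> A"
    and tr: "\<And>A C. A \<in> mats R N \<Longrightarrow> C \<in> mats R N \<Longrightarrow> \<theta> C = b0 \<Longrightarrow> \<theta> (mat_add R A C) = \<theta> A"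
      "\<And>A C. A \<in> mats R N \<Longrightarrow> C \<in> mats R N \<Longrightarrow> \<theta> (mat_add R A C) = \<theta> A \<Longrightarrow> \<theta> C = b0"
    and b: "b \<in> B" "b0 \<in> B"
  shows "measure \<mu> {A \<in> mats R N. \<theta> A = b} = 1 / card B"
proof -
  define E where "E = (\<lambda>b. {A \<in> mats R N. \<theta> A = b})"
  have "padic_open N (E b)" for b
    unfolding padic_open_def E_def using op pcoset_subset by blast
  then have ms: "E b \<in> sets \<mu>" for b by (rule padic_open_sets[OF H])
  have "\<exists>A\<in>mats R N. E b = mat_add R A ` E b0" if b: "b \<in> B" for b
  proof -
    obtain A where A: "A \<in> mats R N" "\<theta> A = b" using sur b by blast
    have "E b = mat_add R A ` E b0"
    proof
      show "mat_add R A ` E b0 \<subseteq> E b" using A tr(1) by (auto simp: E_def)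
      show "E b \<subseteq> mat_add R A ` E b0"
      proof
        fix C assume C: "C \<in> E b"
        let ?D = "mat_add R (mat_neg A) C"
        have "C = mat_add R A ?D" using A C by (simp add: mat_add_neg_cancel' E_def)
        moreover have "?D \<in> E b0" using A C tr(2)[of A ?D] calculation by (auto simp: E_def)
        ultimately show "C \<in> mat_add R A ` E b0" by blast
      qed
    qed
    then show ?thesis using A by blast
  qed
  note translate = this
  have "measure \<mu> (E b) = measure \<mu> (\<Union>b\<in>B. E b) / card B"
  proof (rule measure_equidistributed[OF H B, where E = E and ?b0.0 = b0])
    show "disjoint_family_on E B" by (auto simp: E_def disjoint_family_on_def)
  qed (use b ms translate in auto)
  also have "(\<Union>b\<in>B. E b) = mats R N" using sur by (auto simp: E_def)
  finally show ?thesis using measure_mats[OF H] by (simp add: E_def)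
qed

end

section \<open>Counting invertible matrices over a finite field\<close>

context Module.module begin

lemma lincomb_Suc:
  assumes "\<And>i. i < Suc k \<Longrightarrow> x i \<in> carrier M" "v \<in> vecs R (Suc k)"
  shows "lincomb (Suc k) x v = v k \<odot>\<^bsub>M\<^esub> x k \<oplus>\<^bsub>M\<^esub> lincomb k x (\<lambda>i. if i < k then v i else \<zero>)"
proof -
  have "lincomb k x (\<lambda>i. if i < k then v i else \<zero>) = finsum M (\<lambda>i. v i \<odot>\<^bsub>M\<^esub> x i) {..<k}"
    unfolding lincomb_def using assms by (intro M.finsum_cong') (auto simp: R.vecs_carrier)
  then show ?thesis
    using assms by (simp add: lincomb_def lessThan_Suc M.finsum_insert Pi_def R.vecs_carrier)
qed

definition independent :: "nat \<Rightarrow> (nat \<Rightarrow> 'c) set" where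
  "independent k = {x \<in> {..<k} \<rightarrow>\<^sub>E carrier M. \<forall>v\<in>vecs R k. lincomb k x v = \<zero>\<^bsub>M\<^esub> \<longrightarrow> v = (\<lambda>i. \<zero>)}"

lemma linear_diff:
  assumes lin: "linear_on N \<phi>" and u: "u \<in> vecs R N" and v: "v \<in> vecs R N" and eq: "\<phi> u = \<phi> v"
  shows "\<phi> (\<lambda>i. u i \<ominus> v i) = \<zero>\<^bsub>M\<^esub>" "(\<lambda>i. u i \<ominus> v i) \<in> vecs R N"
proof -
  show w: "(\<lambda>i. u i \<ominus> v i) \<in> vecs R N"
    using u v by (auto simp: R.vecs_carrier R.vecs_zero R.minus_eq intro!: R.vecsI)
  have "(\<lambda>i. u i \<ominus> v i) = vec_add R u (vec_smult R (\<ominus> \<one>) v)"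
    using R.vecs_carrier[OF u] R.vecs_carrier[OF v] by (auto simp: fun_eq_iff R.minus_eq R.l_minus)
  then have "\<phi> (\<lambda>i. u i \<ominus> v i) = \<phi> u \<oplus>\<^bsub>M\<^esub> (\<ominus> \<one>) \<odot>\<^bsub>M\<^esub> \<phi> v"
    using linear_onD[OF lin] u v by simp
  then show "\<phi> (\<lambda>i. u i \<ominus> v i) = \<zero>\<^bsub>M\<^esub>"
    using linear_onD(1)[OF lin] u v eq by (simp add: smult_l_minus M.r_neg)
qed

lemma linear_inj_on:
  assumes lin: "linear_on N \<phi>" and ker: "\<And>v. v \<in> vecs R N \<Longrightarrow> \<phi> v = \<zero>\<^bsub>M\<^esub> \<Longrightarrow> v = (\<lambda>i. \<zero>)"
  shows "inj_on \<phi> (vecs R N)"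
proof (rule inj_onI)
  fix u v assume uv: "u \<in> vecs R N" "v \<in> vecs R N" "\<phi> u = \<phi> v"
  have "(\<lambda>i. u i \<ominus> v i) = (\<lambda>i. \<zero>)" using linear_diff[OF lin uv] ker by blast
  then have d: "u i \<ominus> v i = \<zero>" for i by (simp add: fun_eq_iff)
  show "u = v"
  proof
    fix i show "u i = v i"
      using d[of i] R.vecs_carrier[OF uv(1), of i] R.vecs_carrier[OF uv(2), of i]
        R.minus_equality[of "u i" "\<ominus> v i"] by (simp add: R.minus_eq)
  qed
qed

end

lemma (in cring) card_vecs: 
  assumes "finite (carrier R)"
  shows "finite (vecs R n)" "card (vecs R n) = card (carrier R) ^ n"
proof -
  have bij: "bij_betw (\<lambda>f i. if i < n then f i else \<zero>) ({..<n} \<rightarrow>\<^sub>E carrier R) (vecs R n)"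
  proof (rule bij_betw_byWitness[where f' = "\<lambda>v. restrict v {..<n}"])
    show "\<forall>f\<in>{..<n} \<rightarrow>\<^sub>E carrier R. restrict (\<lambda>i. if i < n then f i else \<zero>) {..<n} = f"
    proof
      fix f assume "f \<in> {..<n} \<rightarrow>\<^sub>E carrier R"
      then show "restrict (\<lambda>i. if i < n then f i else \<zero>) {..<n} = f"
        using PiE_arb[of f] by (intro ext) simp
    qed
    show "\<forall>v\<in>vecs R n. (\<lambda>i. if i < n then restrict v {..<n} i else \<zero>) = v"
      by (simp add: vecs_def fun_eq_iff)
    show "(\<lambda>f i. if i < n then f i else \<zero>) ` ({..<n} \<rightarrow>\<^sub>E carrier R) \<subseteq> vecs R n"
    proof (rule image_subsetI)
      fix f assume "f \<in> {..<n} \<rightarrow>\<^sub>E carrier R"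
      note f = PiE_mem[OF this]
      have "f i \<in> carrier R" if "i < n" for i using f[of i] that by simp
      then show "(\<lambda>i. if i < n then f i else \<zero>) \<in> vecs R n" by (simp add: vecs_def)
    qed
    show "(\<lambda>v. restrict v {..<n}) ` vecs R n \<subseteq> {..<n} \<rightarrow>\<^sub>E carrier R"
      by (rule image_subsetI, rule restrict_PiE_iff[THEN iffD2]) (simp add: vecs_def)
  qed
  show "finite (vecs R n)" 
    using bij_betw_finite[OF bij] finite_PiE[of "{..<n}" "\<lambda>_. carrier R"] assms by simp
  show "card (vecs R n) = card (carrier R) ^ n"
    using bij_betw_same_card[OF bij] by (simp add: card_PiE)
qed

lemma (in cring) card_mats: 
  assumes "finite (carrier R)"
  shows "finite (mats R n)" "card (mats R n) = card (carrier R) ^ (n * n)"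
proof -
  have bij: "bij_betw (\<lambda>f i j. if i < n \<and> j < n then f (i, j) else \<zero>) (({..<n} \<times> {..<n}) \<rightarrow>\<^sub>E carrier R) (mats R n)"
  proof (rule bij_betw_byWitness[where f' = "\<lambda>v. restrict (\<lambda>(i, j). v i j) ({..<n} \<times> {..<n})"])
    show "\<forall>f\<in>({..<n} \<times> {..<n}) \<rightarrow>\<^sub>E carrier R.
      restrict (\<lambda>(i, j). if i < n \<and> j < n then f (i, j) else \<zero>) ({..<n} \<times> {..<n}) = f"
    proof
      fix f assume "f \<in> ({..<n} \<times> {..<n}) \<rightarrow>\<^sub>E carrier R"
      then show "restrict (\<lambda>(i, j). if i < n \<and> j < n then f (i, j) else \<zero>) ({..<n} \<times> {..<n}) = f"
        using PiE_arb[of f] by (intro ext) auto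
    qed
    show "\<forall>v\<in>mats R n. (\<lambda>i j. if i < n \<and> j < n then restrict (\<lambda>(i, j). v i j) ({..<n} \<times> {..<n}) (i, j) else \<zero>) = v"
      by (simp add: mats_def fun_eq_iff)
    show "(\<lambda>f i j. if i < n \<and> j < n then f (i, j) else \<zero>) ` (({..<n} \<times> {..<n}) \<rightarrow>\<^sub>E carrier R) \<subseteq> mats R n"
    proof (rule image_subsetI)
      fix f assume "f \<in> ({..<n} \<times> {..<n}) \<rightarrow>\<^sub>E carrier R"
      note f = PiE_mem[OF this]
      have "f (i, j) \<in> carrier R" if "i < n" "j < n" for i j using f[of "(i, j)"] that by simp
      then show "(\<lambda>i j. if i < n \<and> j < n then f (i, j) else \<zero>) \<in> mats R n" by (simp add: mats_def)
    qed
    show "(\<lambda>v. restrict (\<lambda>(i, j). v i j) ({..<n} \<times> {..<n})) ` mats R n \<subseteq> ({..<n} \<times> {..<n}) \<rightarrow>\<^sub>E carrier R"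
      by (rule image_subsetI, rule restrict_PiE_iff[THEN iffD2]) (simp add: mats_def)
  qed
  show "finite (mats R n)" 
    using bij_betw_finite[OF bij] finite_PiE[of "{..<n} \<times> {..<n}" "\<lambda>_. carrier R"] assms by simp
  show "card (mats R n) = card (carrier R) ^ (n * n)"
    using bij_betw_same_card[OF bij] by (simp add: card_PiE card_cartesian_product)
qed

context field begin

text \<open>In a nontrivial relation either the coefficient of \<open>w\<close> vanishes, leaving a
  relation among the old vectors, or it is invertible and \<open>w\<close> lies in their
  span.\<close>

lemma independent_extend:
  fixes n k
  defines "V \<equiv> vec_mod R n"
  assumes x: "x \<in> module.independent R V k" and w: "w \<in> vecs R n"
  shows "x(k := w) \<in> module.independent R V (Suc k) \<longleftrightarrow> w \<notin> module.lincomb V k x ` vecs R k"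
proof -
  interpret V: Module.module R V unfolding V_def by (rule module_vec_mod)
  have xc: "\<And>i. i < k \<Longrightarrow> x i \<in> carrier V" using x by (auto simp: V.independent_def)
  have wc: "w \<in> carrier V" using w by (simp add: V_def)
  have ker: "v = (\<lambda>i. \<zero>)" if "v \<in> vecs R k" "V.lincomb k x v = \<zero>\<^bsub>V\<^esub>" for v
    using x that by (auto simp: V.independent_def)
  note lin = V.lincomb_linear[of k x, OF xc]
  have PiE: "x(k := w) \<in> {..<Suc k} \<rightarrow>\<^sub>E carrier V"
    using x wc by (auto simp: V.independent_def PiE_def extensional_def less_Suc_eq)
  have tr: "(\<lambda>i. if i < k then v i else \<zero>) \<in> vecs R k" if "v \<in> vecs R (Suc k)" for v
    using vecs_carrier[OF that] by (auto intro!: vecsI)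
  have expand: "V.lincomb (Suc k) (x(k := w)) v = v k \<odot>\<^bsub>V\<^esub> w \<oplus>\<^bsub>V\<^esub> V.lincomb k x (\<lambda>i. if i < k then v i else \<zero>)"
    if "v \<in> vecs R (Suc k)" for v
  proof -
    have "V.lincomb k (x(k := w)) (\<lambda>i. if i < k then v i else \<zero>) = V.lincomb k x (\<lambda>i. if i < k then v i else \<zero>)"
      using xc tr[OF that] by (intro V.lincomb_cong) auto
    moreover have "(x(k := w)) i \<in> carrier V" if "i < Suc k" for i
      using that xc wc by (cases "i = k") auto
    ultimately show ?thesis using V.lincomb_Suc[of k "x(k := w)" v] that by simp
  qed
  show ?thesis
  proof
    assume ind: "x(k := w) \<in> V.independent (Suc k)"
    show "w \<notin> V.lincomb k x ` vecs R k"
    proof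
      assume "w \<in> V.lincomb k x ` vecs R k"
      then obtain u where u: "u \<in> vecs R k" "w = V.lincomb k x u" by blast
      define v where "v = u(k := \<ominus> \<one>)"
      have v: "v \<in> vecs R (Suc k)" using u vecs_carrier[OF u(1)] vecs_zero[OF u(1)]
        by (auto simp: v_def intro!: vecsI)
      have "(\<lambda>i. if i < k then v i else \<zero>) = u"
        using vecs_zero[OF u(1)] by (auto simp: v_def fun_eq_iff)
      then have "V.lincomb (Suc k) (x(k := w)) v = \<zero>\<^bsub>V\<^esub>"
        unfolding expand[OF v] using u wc by (simp add: v_def V.smult_l_minus V.M.l_neg)
      then have "v = (\<lambda>i. \<zero>)" using ind v by (auto simp: V.independent_def)
      then have "\<ominus> \<one> = \<zero>" by (auto simp: v_def fun_eq_iff split: if_splits)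
      then show False using one_not_zero by (metis minus_minus minus_zero one_closed)
    qed
  next
    assume nin: "w \<notin> V.lincomb k x ` vecs R k"
    have "v = (\<lambda>i. \<zero>)" if v: "v \<in> vecs R (Suc k)" and 0: "V.lincomb (Suc k) (x(k := w)) v = \<zero>\<^bsub>V\<^esub>" for v
    proof -
      define u where "u = (\<lambda>i. if i < k then v i else \<zero>)"
      have u: "u \<in> vecs R k" unfolding u_def by (rule tr[OF v])
      have eq: "v k \<odot>\<^bsub>V\<^esub> w \<oplus>\<^bsub>V\<^esub> V.lincomb k x u = \<zero>\<^bsub>V\<^esub>" using 0 expand[OF v] by (simp add: u_def)
      have vk: "v k \<in> carrier R" using vecs_carrier[OF v] .
      have uc: "V.lincomb k x u \<in> carrier V" using V.linear_onD(1)[OF lin u] .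
      have "v k = \<zero>"
      proof (rule ccontr)
        assume "v k \<noteq> \<zero>"
        then have U: "v k \<in> Units R" using vk field_Units by auto
        define c where "c = \<ominus> (inv (v k))"
        have c: "c \<in> carrier R" using U by (simp add: c_def)
        have "c \<odot>\<^bsub>V\<^esub> (v k \<odot>\<^bsub>V\<^esub> w) = \<ominus>\<^bsub>V\<^esub> w"
        proof -
          have "c \<otimes> v k = \<ominus> \<one>" using U vk by (simp add: c_def l_minus)
          then show ?thesis using c vk wc by (simp add: V.smult_l_minus flip: V.smult_assoc1)
        qed
        moreover have "c \<odot>\<^bsub>V\<^esub> (v k \<odot>\<^bsub>V\<^esub> w \<oplus>\<^bsub>V\<^esub> V.lincomb k x u) = c \<odot>\<^bsub>V\<^esub> (v k \<odot>\<^bsub>V\<^esub> w) \<oplus>\<^bsub>V\<^esub> c \<odot>\<^bsub>V\<^esub> V.lincomb k x u"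
          using c vk wc uc by (intro V.smult_r_distr) auto
        ultimately have "\<ominus>\<^bsub>V\<^esub> w \<oplus>\<^bsub>V\<^esub> c \<odot>\<^bsub>V\<^esub> V.lincomb k x u = \<zero>\<^bsub>V\<^esub>" using eq c by simp
        then have "w = c \<odot>\<^bsub>V\<^esub> V.lincomb k x u" using wc uc c
          by (metis V.M.add.inv_closed V.M.minus_minus V.M.minus_equality V.M.a_comm V.smult_closed)
        also have "\<dots> = V.lincomb k x (vec_smult R c u)" using V.linear_onD(3)[OF lin c u] by simp
        finally show False using nin c u by auto
      qed
      then have "u = (\<lambda>i. \<zero>)" using eq wc uc by (intro ker[OF u]) simp
      then have "v i = \<zero>" for i using \<open>v k = \<zero>\<close> vecs_zero[OF v, of i]
        by (cases "i < k"; cases "i = k") (auto simp: u_def fun_eq_iff split: if_splits)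
      then show ?thesis by blast
    qed
    then show "x(k := w) \<in> V.independent (Suc k)" using PiE by (auto simp: V.independent_def)
  qed
qed

text \<open>The span of an independent k-tuple has exactly q^k elements, since
  \<open>lincomb\<close> is injective on coefficients, and the next vector is any of the q^n - q^k
  vectors outside it.\<close>

lemma card_independent:
  assumes fin: "finite (carrier R)" and "k \<le> n"
  shows "finite (module.independent R (vec_mod R n) k) \<and>
    card (module.independent R (vec_mod R n) k) = (\<Prod>i<k. card (carrier R) ^ n - card (carrier R) ^ i)"
  using assms(2)
proof (induction k)
  interpret V: Module.module R "vec_mod R n" by (rule module_vec_mod)
  {
    case 0
    have "V.independent 0 = {\<lambda>i. undefined}"
      by (auto simp: V.independent_def vecs_def)
    then show ?case by simp
  next
    case (Suc k)
    let ?I = "V.independent k" and ?q = "card (carrier R)"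
    let ?C = "\<lambda>x. vecs R n - V.lincomb k x ` vecs R k"
    have bij: "bij_betw (\<lambda>(x, w). x(k := w)) (Sigma ?I ?C) (V.independent (Suc k))"
    proof (rule bij_betw_byWitness[where f' = "\<lambda>x. (restrict x {..<k}, x k)"])
      show "\<forall>a\<in>Sigma ?I ?C. (restrict ((\<lambda>(x, w). x(k := w)) a) {..<k}, ((\<lambda>(x, w). x(k := w)) a) k) = a"
        by (auto simp: V.independent_def PiE_def extensional_def fun_eq_iff)
      show "\<forall>x\<in>V.independent (Suc k). (\<lambda>(x, w). x(k := w)) (restrict x {..<k}, x k) = x"
        by (auto simp: V.independent_def PiE_def extensional_def fun_eq_iff)
      show "(\<lambda>(x, w). x(k := w)) ` Sigma ?I ?C \<subseteq> V.independent (Suc k)"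
        using independent_extend by auto
      show "(\<lambda>x. (restrict x {..<k}, x k)) ` V.independent (Suc k) \<subseteq> Sigma ?I ?C"
      proof
        fix z assume "z \<in> (\<lambda>x. (restrict x {..<k}, x k)) ` V.independent (Suc k)"
        then obtain x where x: "x \<in> V.independent (Suc k)" "z = (restrict x {..<k}, x k)" by blast
        have xc: "x i \<in> vecs R n" if "i < Suc k" for i using x that by (auto simp: V.independent_def)
        let ?r = "restrict x {..<k}"
        have "?r \<in> ?I"
        proof -
          have "v = (\<lambda>i. \<zero>)" if v: "v \<in> vecs R k" and 0: "V.lincomb k ?r v = (\<lambda>i. \<zero>)" for v
          proof -
            have v': "v \<in> vecs R (Suc k)" using vecs_carrier[OF v] vecs_zero[OF v] by (auto intro!: vecsI)
            have e: "(\<lambda>i. if i < k then v i else \<zero>) = v" using vecs_zero[OF v] by (auto simp: fun_eq_iff)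
            have "V.lincomb k x v = V.lincomb k ?r v" using xc v by (intro V.lincomb_cong) auto
            then have "V.lincomb (Suc k) x v = vec_add R (vec_smult R \<zero> (x k)) (\<lambda>i. \<zero>)"
              using V.lincomb_Suc[of k x v] xc v' e 0 vecs_zero[OF v, of k] by simp
            also have "\<dots> = (\<lambda>i. \<zero>)" using vecs_carrier[OF xc, of k] by (auto simp: fun_eq_iff)
            finally show ?thesis using x v' by (auto simp: V.independent_def)
          qed
          then show ?thesis using xc by (auto simp: V.independent_def)
        qed
        moreover have "?r(k := x k) = x" using x by (auto simp: V.independent_def PiE_def extensional_def fun_eq_iff)
        ultimately show "z \<in> Sigma ?I ?C" using independent_extend[of ?r n k "x k"] xc x by auto
      qed
    qed
    have IH: "finite ?I" "card ?I = (\<Prod>i<k. ?q ^ n - ?q ^ i)" using Suc by auto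
    have cC: "card (?C x) = ?q ^ n - ?q ^ k" if x: "x \<in> ?I" for x
    proof -
      have lin: "V.linear_on k (V.lincomb k x)" using x by (intro V.lincomb_linear) (auto simp: V.independent_def)
      have "inj_on (V.lincomb k x) (vecs R k)"
        using x by (intro V.linear_inj_on[OF lin]) (auto simp: V.independent_def)
      then have "card (V.lincomb k x ` vecs R k) = ?q ^ k" using card_vecs(2)[OF fin] by (simp add: card_image)
      moreover have "V.lincomb k x ` vecs R k \<subseteq> vecs R n" using V.linear_onD(1)[OF lin] by auto
      ultimately show ?thesis using card_vecs[OF fin] by (simp add: card_Diff_subset finite_subset)
    qed
    have "finite (Sigma ?I ?C)" using IH card_vecs[OF fin] by auto
    then have "finite (V.independent (Suc k))" using bij bij_betw_finite by blast
    moreover have "card (V.independent (Suc k)) = (\<Sum>x\<in>?I. card (?C x))"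
      using bij_betw_same_card[OF bij] IH card_vecs[OF fin] by simp
    ultimately show ?case using IH cC by (simp add: mult.commute)
  }
qed

text \<open>An injective endomorphism of the finite set of vectors is surjective; its inverse is
  linear and hence given by a matrix.\<close>

lemma GL_iff_kernel:
  assumes fin: "finite (carrier R)" and A: "A \<in> mats R n"
  shows "A \<in> GL R n \<longleftrightarrow> (\<forall>v\<in>vecs R n. mat_vec R n A v = (\<lambda>i. \<zero>) \<longrightarrow> v = (\<lambda>i. \<zero>))"
proof
  assume "A \<in> GL R n"
  then obtain B where B: "B \<in> mats R n" "mat_mult R n B A = mat_one R n" by (auto simp: GL_def)
  then have "mat_vec R n B (mat_vec R n A v) = v" if "v \<in> vecs R n" for v
    using mat_vec_mult[OF B(1) A that] that by simp
  then show "\<forall>v\<in>vecs R n. mat_vec R n A v = (\<lambda>i. \<zero>) \<longrightarrow> v = (\<lambda>i. \<zero>)" using B by force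
next
  interpret V: Module.module R "vec_mod R n" by (rule module_vec_mod)
  assume ker: "\<forall>v\<in>vecs R n. mat_vec R n A v = (\<lambda>i. \<zero>) \<longrightarrow> v = (\<lambda>i. \<zero>)"
  let ?f = "mat_vec R n A" and ?V = "vecs R n"
  have inj: "inj_on ?f ?V" by (rule V.linear_inj_on[OF linear_mat_vec[OF A]]) (use ker in auto)
  have sub: "?f ` ?V \<subseteq> ?V" using A by auto
  have sur: "?f ` ?V = ?V" using endo_inj_surj[OF card_vecs(1)[OF fin] sub inj] .
  define g where "g = the_inv_into ?V ?f"
  have g: "g v \<in> ?V" "?f (g v) = v" if "v \<in> ?V" for v
    using the_inv_into_into[OF inj, of v ?V] f_the_inv_into_f[OF inj, of v] that sur by (auto simp: g_def)
  have gf: "g (?f v) = v" if "v \<in> ?V" for v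
    using the_inv_into_f_f[OF inj that] by (simp add: g_def)
  have "V.linear_on n g"
    unfolding V.linear_on_def
  proof (intro conjI ballI)
    fix u v assume uv: "u \<in> ?V" "v \<in> ?V"
    show "g u \<in> carrier (vec_mod R n)" using g uv by simp
    have "?f (vec_add R (g u) (g v)) = vec_add R u v" using g uv A by (simp add: mat_vec_add)
    then show "g (vec_add R u v) = g u \<oplus>\<^bsub>vec_mod R n\<^esub> g v" using gf[of "vec_add R (g u) (g v)"] g uv by simp
  next
    fix r v assume uv: "r \<in> carrier R" "v \<in> ?V"
    have "?f (vec_smult R r (g v)) = vec_smult R r v" using g uv A by (simp add: mat_vec_smult)
    then show "g (vec_smult R r v) = r \<odot>\<^bsub>vec_mod R n\<^esub> g v" using gf[of "vec_smult R r (g v)"] g uv by simp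
  qed
  then obtain B where B: "B \<in> mats R n" "\<And>v. v \<in> ?V \<Longrightarrow> mat_vec R n B v = g v"
    using linear_matrix by blast
  have "mat_mult R n A B = mat_one R n"
    by (rule mat_eqI[where N = n]) (use A B g in \<open>auto simp: mat_vec_mult\<close>)
  moreover have "mat_mult R n B A = mat_one R n"
    by (rule mat_eqI[where N = n]) (use A B gf in \<open>auto simp: mat_vec_mult\<close>)
  ultimately
  show "A \<in> GL R n" using A B by (auto simp: GL_def)
qed

text \<open>A matrix has trivial kernel exactly if its columns form an independent n-tuple.\<close>

lemma card_GL:
  assumes fin: "finite (carrier R)"
  shows "card (GL R n) = (\<Prod>i<n. card (carrier R) ^ n - card (carrier R) ^ i)"
proof -
  interpret V: Module.module R "vec_mod R n" by (rule module_vec_mod)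
  have lc: "V.lincomb n x v = mat_vec R n A v"
    if x: "\<And>j. j < n \<Longrightarrow> x j = (\<lambda>i. A i j)" and A: "A \<in> mats R n" and v: "v \<in> vecs R n" for x A v
  proof -
    have u: "(\<lambda>i. A i j) \<in> vecs R n" if "j < n" for j
      using A that mat_vec_closed[OF A unit_vec_closed[OF that]] by (simp add: mat_vec_unit)
    have "mat_vec R n A v = V.lincomb n (\<lambda>j. mat_vec R n A (unit_vec R j)) v"
      by (rule V.linear_on_expand[OF linear_mat_vec[OF A] v])
    also have "\<dots> = V.lincomb n x v" using x A v u by (intro V.lincomb_cong) (auto simp: mat_vec_unit)
    finally show ?thesis by simp
  qed
  have bij: "bij_betw (\<lambda>A. restrict (\<lambda>j i. A i j) {..<n}) (GL R n) (V.independent n)"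
  proof (rule bij_betw_byWitness[where f' = "\<lambda>x i j. if j < n then x j i else \<zero>"])
    have m: "(\<lambda>i j. if j < n then x j i else \<zero>) \<in> mats R n" if "x \<in> V.independent n" for x
    proof -
      have x: "x j \<in> vecs R n" if "j < n" for j using \<open>x \<in> _\<close> that by (auto simp: V.independent_def)
      show ?thesis by (intro matsI) (auto simp: vecs_carrier[OF x] vecs_zero[OF x])
    qed
    show "\<forall>A\<in>GL R n. (\<lambda>i j. if j < n then restrict (\<lambda>j i. A i j) {..<n} j i else \<zero>) = A"
      by (simp add: GL_def mats_def fun_eq_iff)
    show "\<forall>x\<in>V.independent n. restrict (\<lambda>j i. if j < n then x j i else \<zero>) {..<n} = x"
      by (auto simp: V.independent_def PiE_def extensional_def fun_eq_iff)
    show "(\<lambda>A. restrict (\<lambda>j i. A i j) {..<n}) ` GL R n \<subseteq> V.independent n"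
    proof clarify
      fix A assume A: "A \<in> GL R n"
      then have Am: "A \<in> mats R n" by (auto simp: GL_def)
      have "(\<lambda>i. A i j) \<in> vecs R n" if "j < n" for j
        using mat_vec_closed[OF Am unit_vec_closed[OF that]] Am that by (simp add: mat_vec_unit)
      then show "restrict (\<lambda>j i. A i j) {..<n} \<in> V.independent n"
        using A Am lc[of "restrict (\<lambda>j i. A i j) {..<n}" A] unfolding GL_iff_kernel[OF fin Am]
        by (auto simp: V.independent_def)
    qed
    show "(\<lambda>x i j. if j < n then x j i else \<zero>) ` V.independent n \<subseteq> GL R n"
    proof clarify
      fix x assume x: "x \<in> V.independent n"
      show "(\<lambda>i j. if j < n then x j i else \<zero>) \<in> GL R n"
        unfolding GL_iff_kernel[OF fin m[OF x]]
        using x lc[of x, OF _ m[OF x]] by (auto simp: V.independent_def)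
    qed
  qed
  show ?thesis using bij_betw_same_card[OF bij] card_independent[OF fin, of n n] by simp
qed

lemma GL_ratio:
  assumes fin: "finite (carrier R)"
  shows "real (card (GL R n)) / real (card (mats R n)) = (\<Prod>i<n. 1 - 1 / real (card (carrier R)) ^ Suc i)"
proof -
  let ?q = "card (carrier R)"
  have q: "?q > 0" using fin by (auto simp: card_gt_0_iff)
  have "real (card (GL R n)) = (\<Prod>i<n. real ?q ^ n - real ?q ^ i)"
    unfolding card_GL[OF fin] of_nat_prod using q
    by (intro prod.cong) (auto simp: of_nat_diff power_increasing)
  also have "\<dots> = (\<Prod>i<n. real ?q ^ n * (1 - 1 / real ?q ^ (n - i)))"
    using q by (intro prod.cong) (auto simp: right_diff_distrib power_diff)
  also have "\<dots> = real ?q ^ (n * n) * (\<Prod>i<n. 1 - 1 / real ?q ^ (n - i))"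
    by (simp add: prod.distrib power_mult)
  also have "(\<Prod>i<n. 1 - 1 / real ?q ^ (n - i)) = (\<Prod>i<n. 1 - 1 / real ?q ^ Suc i)"
    by (rule prod.reindex_bij_witness[of _ "\<lambda>i. n - Suc i" "\<lambda>i. n - Suc i"])
      (auto simp: Suc_diff_Suc simp flip: power_Suc)
  finally show ?thesis using q card_mats[OF fin] by simp
qed

text \<open>A field has at least two elements, so the geometric series in 1/q converges and the
  product converges absolutely. That its value is positive is what later allows division by
  c.\<close>

lemma GL_product:
  assumes fin: "finite (carrier R)"
  shows "\<exists>c::real. c > 0 \<and> (\<lambda>i. 1 - 1 / real (card (carrier R)) ^ Suc i) has_prod c"
proof -
  let ?q = "card (carrier R)" and ?f = "\<lambda>i. 1 - 1 / real (card (carrier R)) ^ Suc i"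
  have "{\<zero>, \<one>} \<subseteq> carrier R" by auto
  then have "card {\<zero>, \<one>} \<le> ?q" using fin by (intro card_mono)
  then have q: "?q \<ge> 2" using one_not_zero by simp
  have pos: "?f i > 0" for i
  proof -
    have "1 < real ?q ^ Suc i" using q by (intro one_less_power) auto
    then show ?thesis by simp
  qed
  have "summable (\<lambda>i. (1 / real ?q) ^ Suc i)" using q by (subst summable_Suc_iff) (auto intro!: summable_geometric)
  then have "summable (\<lambda>i. norm (?f i - 1))" by (simp add: power_one_over)
  then have "abs_convergent_prod ?f" by (simp add: abs_convergent_prod_conv_summable)
  then have "convergent_prod ?f" by (rule abs_convergent_prod_imp_convergent_prod)
  then have hp: "?f has_prod prodinf ?f" by (rule convergent_prod_has_prod)
  moreover have "prodinf ?f \<ge> 0"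
    using convergent_prod_LIMSEQ[OF \<open>convergent_prod ?f\<close>] 
    by (rule LIMSEQ_le_const) (intro exI[of _ 0] allI impI prod_nonneg less_imp_le[OF pos])
  moreover have "prodinf ?f \<noteq> 0"
    using prodinf_nonzero[OF \<open>convergent_prod ?f\<close>] pos by (metis less_irrefl)
  ultimately show ?thesis by (intro exI[of _ "prodinf ?f"]) auto
qed

end

section \<open>Matrices with a prescribed image of finite index\<close>

lemma (in Module.module) submodule_range:
  assumes lin: "linear_on N \<phi>" shows "submodule (\<phi> ` vecs R N) R M"
proof (rule submoduleI)
  note l = linear_onD[OF lin]
  show "\<phi> ` vecs R N \<subseteq> carrier M" using l(1) by auto
  show "\<zero>\<^bsub>M\<^esub> \<in> \<phi> ` vecs R N" using linear_on_zero[OF lin] R.vec_zero_closed by (metis imageI)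
  show "a \<oplus>\<^bsub>M\<^esub> b \<in> \<phi> ` vecs R N" if ab: "a \<in> \<phi> ` vecs R N" "b \<in> \<phi> ` vecs R N" for a b
  proof -
    obtain u v where "u \<in> vecs R N" "v \<in> vecs R N" "a = \<phi> u" "b = \<phi> v" using ab by blast
    then have "a \<oplus>\<^bsub>M\<^esub> b = \<phi> (vec_add R u v)" "vec_add R u v \<in> vecs R N" using l(2) by auto
    then show ?thesis by blast
  qed
  show sm: "r \<odot>\<^bsub>M\<^esub> b \<in> \<phi> ` vecs R N" if b: "r \<in> carrier R" "b \<in> \<phi> ` vecs R N" for r b
  proof -
    obtain v where "v \<in> vecs R N" "b = \<phi> v" using b by blast
    then have "r \<odot>\<^bsub>M\<^esub> b = \<phi> (vec_smult R r v)" "vec_smult R r v \<in> vecs R N" using l(3) b by auto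
    then show ?thesis by blast
  qed
  show "\<ominus>\<^bsub>M\<^esub> a \<in> \<phi> ` vecs R N" if "a \<in> \<phi> ` vecs R N" for a
  proof -
    have "a \<in> carrier M" using that l(1) by auto
    then have "\<ominus>\<^bsub>M\<^esub> a = (\<ominus> \<one>) \<odot>\<^bsub>M\<^esub> a" by (simp add: smult_l_minus)
    then show ?thesis using sm[of "\<ominus> \<one>" a] that by simp
  qed
qed

definition mat_smult :: "('a, 'b) ring_scheme \<Rightarrow> 'a \<Rightarrow> (nat \<Rightarrow> nat \<Rightarrow> 'a) \<Rightarrow> nat \<Rightarrow> nat \<Rightarrow> 'a" where
  "mat_smult R r A = (\<lambda>i j. r \<otimes>\<^bsub>R\<^esub> A i j)"

context cring begin

lemma mat_smult_closed [simp]: "r \<in> carrier R \<Longrightarrow> A \<in> mats R N \<Longrightarrow> mat_smult R r A \<in> mats R N"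
  by (simp add: mats_def mat_smult_def)

lemma mat_zero_closed [simp]: "(\<lambda>i j. \<zero>) \<in> mats R N"
  by (simp add: mats_def)

lemma mat_vec_mat_smult:
  assumes "r \<in> carrier R" "A \<in> mats R N" "v \<in> vecs R N"
  shows "mat_vec R N (mat_smult R r A) v = vec_smult R r (mat_vec R N A v)"
proof (rule ext)
  fix i
  show "mat_vec R N (mat_smult R r A) v i = vec_smult R r (mat_vec R N A v) i"
    using assms vecs_carrier[OF assms(3)] mats_carrier[OF assms(2)]
    by (simp add: mat_vec_def mat_smult_def finsum_rdistr Pi_def m_assoc)
qed

lemma mat_mult_add_right:
  assumes "A \<in> mats R N" "B \<in> mats R N" "C \<in> mats R N"
  shows "mat_mult R N A (mat_add R B C) = mat_add R (mat_mult R N A B) (mat_mult R N A C)"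
  by (rule mat_eqI[where N = N]) (use assms in \<open>simp_all add: mat_vec_mult mat_vec_mat_add mat_vec_add\<close>)

lemma mat_mult_smult_right:
  assumes "A \<in> mats R N" "B \<in> mats R N" "r \<in> carrier R"
  shows "mat_mult R N A (mat_smult R r B) = mat_smult R r (mat_mult R N A B)"
  by (rule mat_eqI[where N = N]) (use assms in \<open>simp_all add: mat_vec_mult mat_vec_mat_smult mat_vec_smult\<close>)

text \<open>\<open>R^N\<close> is free: each unit vector can be sent to a preimage under
  \<open>G0\<close> of the corresponding column of \<open>G\<close>.\<close>

lemma mat_factor:
  assumes G0: "G0 \<in> mats R N" and G: "G \<in> mats R N" and sub: "mat_vec R N G ` vecs R N \<subseteq> mat_vec R N G0 ` vecs R N"
  shows "\<exists>H\<in>mats R N. G = mat_mult R N G0 H"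
proof -
  have "\<exists>h. h \<in> vecs R N \<and> mat_vec R N G0 h = mat_vec R N G (unit_vec R j)" if "j < N" for j
    using sub unit_vec_closed[OF that] by (metis (no_types, lifting) imageE image_eqI subsetD)
  then obtain h where h: "\<And>j. j < N \<Longrightarrow> h j \<in> vecs R N"
      "\<And>j. j < N \<Longrightarrow> mat_vec R N G0 (h j) = mat_vec R N G (unit_vec R j)" by metis
  define H where "H = (\<lambda>i j. if j < N then h j i else \<zero>)"
  have H: "H \<in> mats R N" by (rule matsI) (auto simp: H_def vecs_carrier[OF h(1)] vecs_zero[OF h(1)])
  have Hu: "mat_vec R N H (unit_vec R j) = h j" if "j < N" for j
    unfolding mat_vec_unit[OF H that] by (simp add: H_def that)
  have "G = mat_mult R N G0 H"
  proof (rule mat_eqI[where N = N])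
    fix v assume v: "v \<in> vecs R N"
    show "mat_vec R N G v = mat_vec R N (mat_mult R N G0 H) v"
    proof (rule linear_eqI[OF module_vec_mod linear_mat_vec[OF G] linear_mat_vec[OF mat_mult_closed[OF G0 H]] _ v])
      fix j assume j: "j < N"
      show "mat_vec R N G (unit_vec R j) = mat_vec R N (mat_mult R N G0 H) (unit_vec R j)"
        using mat_vec_mult[OF G0 H unit_vec_closed[OF j]] h(2)[OF j] Hu[OF j] by simp
    qed
  qed (use G G0 H in auto)
  then show ?thesis using H by blast
qed

end

section \<open>Counting residues modulo powers of p\<close>

context local_zp begin

definition residue_class :: "nat \<Rightarrow> 'a \<Rightarrow> 'a set" where
  "residue_class k a = {b. pcong k a b}"

lemma residue_class_eq_iff: assumes "a \<in> carrier R" "b \<in> carrier R" shows "residue_class k a = residue_class k b \<longleftrightarrow> pcong k a b"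
proof
  assume "residue_class k a = residue_class k b"
  moreover have "b \<in> residue_class k b" using pcong_refl[OF assms(2)] by (simp add: residue_class_def)
  ultimately show "pcong k a b" by (auto simp: residue_class_def)
next
  assume ab: "pcong k a b"
  show "residue_class k a = residue_class k b"
    using pcong_trans[OF assms(1) ab] pcong_trans[OF assms(2) pcong_sym[OF assms(1) ab]] by (auto simp: residue_class_def)
qed

lemma finite_residue_classes: "finite (residue_class k ` carrier R)"
proof -
  obtain S where S: "finite S" "S \<subseteq> carrier R" "\<forall>r\<in>carrier R. \<exists>s\<in>S. \<exists>x\<in>carrier R. r = s \<oplus> pip k \<otimes> x"
    using residues[of k] by blast
  have "residue_class k ` carrier R \<subseteq> residue_class k ` S"
  proof
    fix c assume "c \<in> residue_class k ` carrier R"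
    then obtain a where a: "a \<in> carrier R" "c = residue_class k a" by blast
    then obtain s where s: "s \<in> S" "pcong k s a" using S(3) unfolding pcong_def by blast
    then have "c = residue_class k s" using a residue_class_eq_iff[of s a k] S(2) by auto
    then show "c \<in> residue_class k ` S" using s by blast
  qed
  then show ?thesis using S(1) by (rule finite_subset[OF _ finite_imageI])
qed

text \<open>A congruence of p^i with 0 modulo p^j reads p^i (1 + e) = 0 with e in the maximal ideal.
  As 1 + e is a unit, p would be nilpotent.\<close>

lemma not_pcong_pip:
  assumes "i < j" shows "\<not> pcong j (pip i) \<zero>"
proof
  assume "pcong j (pip i) \<zero>"
  then obtain x where x: "x \<in> carrier R" "\<zero> = pip i \<oplus> pip j \<otimes> x" by (auto simp: pcong_def)
  define e where "e = pip (j - i) \<otimes> x"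
  have "pip (j - i) = [p] \<cdot> \<one> \<otimes> pip (j - i - 1)"
  proof -
    have "j - i = Suc (j - i - 1)" using assms by simp
    then have "pip (j - i) = pip (j - i - 1) \<otimes> [p] \<cdot> \<one>" by (metis pip_Suc)
    then show ?thesis by (simp only: m_comm pi_closed pip_closed)
  qed
  then have em: "e \<in> mm" using x p_in_mm unfolding e_def by (auto intro!: mm.I_r_closed)
  have "pip j = pip i \<otimes> pip (j - i)" using assms pip_add[of i "j - i"] by simp
  then have z: "pip i \<otimes> (\<one> \<oplus> e) = \<zero>" using x by (simp add: e_def r_distr m_assoc)
  have U: "\<one> \<oplus> e \<in> Units R"
    using one_minus_mm_unit[of "\<ominus> e"] em by (simp add: minus_eq)
  have "pip i = pip i \<otimes> (\<one> \<oplus> e) \<otimes> inv (\<one> \<oplus> e)"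
    using U Units_closed[OF U] by (simp add: m_assoc)
  also have "\<dots> = \<zero>" unfolding z using U by simp
  finally have "pip i = \<zero>" .
  then show False using p_not_nilpotent by blast
qed

text \<open>The powers of p below the j-th are pairwise incongruent modulo p^j. The bound is crude;
  it serves to make the number of residues unbounded.\<close>

lemma card_residue_classes_ge: "j \<le> card (residue_class j ` carrier R)"
proof -
  have "inj_on (\<lambda>i. residue_class j (pip i)) {..<j}"
  proof (rule linorder_inj_onI')
    fix i l assume il: "i \<in> {..<j}" "l \<in> {..<j}" "i < l"
    show "residue_class j (pip i) \<noteq> residue_class j (pip l)"
    proof
      assume "residue_class j (pip i) = residue_class j (pip l)"
      then have "pcong j (pip i) (pip l)" by (simp add: residue_class_eq_iff)
      then have "pcong l (pip i) (pip l)" using il pcong_mono[of j _ _ l] by auto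
      moreover have "pcong l (pip l) \<zero>"
        unfolding pcong_def by (intro bexI[of _ "\<ominus> \<one>"]) (auto simp: r_minus r_neg)
      ultimately have "pcong l (pip i) \<zero>" using pcong_trans[of "pip i" l "pip l" \<zero>] by simp
      then show False using not_pcong_pip[OF il(3)] by simp
    qed
  qed
  then have "card {..<j} \<le> card (residue_class j ` carrier R)"
    by (intro card_inj_on_le[where f = "\<lambda>i. residue_class j (pip i)"]) (auto simp: finite_residue_classes)
  then show ?thesis by simp
qed

text \<open>A residue modulo p^j is determined by its class modulo p^k and by the class modulo p^j
  of its difference from a fixed representative of the former. This difference is a multiple of
  p^k.\<close>

lemma card_residue_classes_le: "card (residue_class j ` carrier R) \<le> card (residue_class k ` carrier R) * card (residue_class j ` ((\<otimes>) (pip k) ` carrier R))"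
proof -
  define \<rho> where "\<rho> = (\<lambda>c. SOME a. a \<in> carrier R \<and> residue_class k a = c)"
  have \<rho>: "\<rho> (residue_class k a) \<in> carrier R \<and> residue_class k (\<rho> (residue_class k a)) = residue_class k a" if "a \<in> carrier R" for a
    unfolding \<rho>_def by (rule someI_ex[where P = "\<lambda>b. b \<in> carrier R \<and> residue_class k b = residue_class k a"]) (use that in blast)
  define \<tau> where "\<tau> = (\<lambda>c. SOME a. a \<in> carrier R \<and> residue_class j a = c)"
  have \<tau>: "\<tau> c \<in> carrier R \<and> residue_class j (\<tau> c) = c" if c: "c \<in> residue_class j ` carrier R" for c
  proof -
    obtain a where "a \<in> carrier R" "c = residue_class j a" using c by blast
    then have "\<exists>b. b \<in> carrier R \<and> residue_class j b = c" by blast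
    from someI_ex[OF this] show ?thesis by (simp add: \<tau>_def)
  qed
  define f where "f = (\<lambda>c. (residue_class k (\<tau> c), residue_class j (\<tau> c \<ominus> \<rho> (residue_class k (\<tau> c)))))"
  have "inj_on f (residue_class j ` carrier R)"
  proof (rule inj_onI)
    fix c d assume cd: "c \<in> residue_class j ` carrier R" "d \<in> residue_class j ` carrier R" "f c = f d"
    define r where "r = \<rho> (residue_class k (\<tau> c))"
    have r: "r \<in> carrier R" "\<tau> c \<in> carrier R" "\<tau> d \<in> carrier R" using \<rho> \<tau> cd by (auto simp: r_def)
    have "residue_class j (\<tau> c \<ominus> r) = residue_class j (\<tau> d \<ominus> r)" using cd(3) unfolding f_def r_def by (metis prod.inject)
    then have "pcong j (\<tau> c \<ominus> r) (\<tau> d \<ominus> r)" using r by (simp add: residue_class_eq_iff)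
    then have "pcong j ((\<tau> c \<ominus> r) \<oplus> r) ((\<tau> d \<ominus> r) \<oplus> r)" using r by (intro pcong_add pcong_refl) auto
    moreover have "(\<tau> c \<ominus> r) \<oplus> r = \<tau> c" "(\<tau> d \<ominus> r) \<oplus> r = \<tau> d" using r by algebra+
    ultimately have "residue_class j (\<tau> c) = residue_class j (\<tau> d)" using r by (simp add: residue_class_eq_iff)
    then show "c = d" using \<tau> cd by simp
  qed
  moreover have "f ` (residue_class j ` carrier R) \<subseteq> (residue_class k ` carrier R) \<times> (residue_class j ` ((\<otimes>) (pip k) ` carrier R))"
  proof
    fix z assume "z \<in> f ` (residue_class j ` carrier R)"
    then obtain c where c: "c \<in> residue_class j ` carrier R" "z = f c" by blast
    define r where "r = \<rho> (residue_class k (\<tau> c))"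
    have r: "r \<in> carrier R" "\<tau> c \<in> carrier R" using \<rho> \<tau> c by (auto simp: r_def)
    have "pcong k r (\<tau> c)" using \<rho> \<tau> c r by (simp add: r_def flip: residue_class_eq_iff)
    then obtain x where x: "x \<in> carrier R" "\<tau> c = r \<oplus> pip k \<otimes> x" by (auto simp: pcong_def)
    have q: "pip k \<otimes> x \<in> carrier R" using x by simp
    have "\<tau> c \<ominus> r = pip k \<otimes> x" unfolding x(2) using q r(1) by algebra
    then show "z \<in> (residue_class k ` carrier R) \<times> (residue_class j ` ((\<otimes>) (pip k) ` carrier R))"
      unfolding c(2) f_def r_def[symmetric] using r(2) x(1) by (intro SigmaI imageI) simp_all
  qed
  moreover have "finite (residue_class j ` ((\<otimes>) (pip k) ` carrier R))"
    by (rule finite_subset[OF _ finite_residue_classes[of j]]) auto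
  ultimately show ?thesis
    using card_inj_on_le[of f] finite_residue_classes[of k] by (metis card_cartesian_product finite_cartesian_product)
qed

lemma pcong_finsum:
  assumes "finite A" "\<And>i. i \<in> A \<Longrightarrow> f i \<in> carrier R" "\<And>i. i \<in> A \<Longrightarrow> pcong k (f i) (g i)"
  shows "pcong k (finsum R f A) (finsum R g A)"
  using assms
proof (induction A rule: finite_induct)
  case empty
  then show ?case by (simp add: pcong_refl)
next
  case (insert a A)
  have g: "g i \<in> carrier R" if "i \<in> insert a A" for i using insert.prems pcong_closed that by blast
  show ?case using insert g by (simp add: Pi_def pcong_add finsum_closed)
qed

text \<open>If a kernel vector had a unit entry, then \<open>p\<^sup>k R\<^sup>N\<close> would lie in the image of \<open>R\<^sup>N\<^sup>-\<^sup>1\<close>. With \<open>r j\<close> the order of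
  \<open>R / p\<^sup>j R\<close>, counting residues modulo \<open>p\<^sup>j\<close> gives \<open>(r j / r k)\<^sup>N \<le> (r j)\<^sup>N\<^sup>-\<^sup>1\<close>, which fails for large \<open>j\<close>.\<close>

lemma kernel_in_mm:
  assumes G: "G \<in> mats R N" and k: "\<And>v. v \<in> vecs R N \<Longrightarrow> vec_smult R (pip k) v \<in> mat_vec R N G ` vecs R N"
    and v: "v \<in> vecs R N" "mat_vec R N G v = (\<lambda>i. \<zero>)"
  shows "v \<in> mvecs R mm N"
proof (rule ccontr)
  assume "v \<notin> mvecs R mm N"
  then obtain a where a: "a < N" "v a \<notin> mm" using v by (auto simp: mvecs_def)
  have va: "v a \<in> Units R" using unit_if_not_mm[OF vecs_carrier[OF v(1)] a(2)] .
  \<comment> \<open>A multiple of the kernel vector \<open>v\<close> clears entry \<open>a\<close>,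
    where \<open>v\<close> has a unit, without changing the image.\<close>
  have reduce: "\<exists>w\<in>vecs R N. w a = \<zero> \<and> mat_vec R N G w = mat_vec R N G u" if u: "u \<in> vecs R N" for u
  proof -
    define c where "c = \<ominus> (u a \<otimes> inv (v a))"
    have c: "c \<in> carrier R" using va vecs_carrier[OF u] by (simp add: c_def)
    let ?w = "vec_add R u (vec_smult R c v)"
    have "mat_vec R N G ?w = vec_add R (mat_vec R N G u) (vec_smult R c (\<lambda>i. \<zero>))"
      using u v c G by (simp add: mat_vec_add mat_vec_smult)
    also have "\<dots> = mat_vec R N G u" using vecs_carrier[OF mat_vec_closed[OF G u]] c by (auto simp: fun_eq_iff)
    finally have 1: "mat_vec R N G ?w = mat_vec R N G u" .
    have "c \<otimes> v a = \<ominus> u a" using va vecs_carrier[OF u, of a] by (simp add: c_def l_minus m_assoc Units_closed)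
    then have "?w a = \<zero>" using vecs_carrier[OF u, of a] by (simp add: r_neg)
    then show ?thesis using 1 u v c by (intro bexI[of _ ?w]) auto
  qed
  have pre: "\<exists>w\<in>vecs R N. w a = \<zero> \<and> mat_vec R N G w = vec_smult R (pip k) u" if u: "u \<in> vecs R N" for u
  proof -
    obtain u' where u': "u' \<in> vecs R N" "vec_smult R (pip k) u = mat_vec R N G u'" using k[OF u] by blast
    then show ?thesis using reduce[OF u'(1)] by simp
  qed
  define r where "r = (\<lambda>j. card (residue_class j ` carrier R))"
  define s where "s = (\<lambda>j. card (residue_class j ` ((\<otimes>) (pip k) ` carrier R)))"
  \<comment> \<open>For each family \<open>f\<close> of residues of elements of p^k R, a preimage
    \<open>W f\<close> with entry \<open>a\<close> equal to zero is chosen. Its remaining N - 1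
    residues determine \<open>f\<close>, because multiplication by \<open>G\<close> respects
    congruences.\<close>
  have bound: "s j ^ N \<le> r j ^ (N - 1)" for j
  proof -
    let ?S = "residue_class j ` ((\<otimes>) (pip k) ` carrier R)"
    have "\<exists>w\<in>vecs R N. w a = \<zero> \<and> (\<forall>i<N. residue_class j (mat_vec R N G w i) = f i)"
      if f: "f \<in> {..<N} \<rightarrow>\<^sub>E ?S" for f
    proof -
      have "\<exists>x\<in>carrier R. f i = residue_class j (pip k \<otimes> x)" if "i < N" for i
        using PiE_mem[OF f, of i] that by auto
      then obtain x where x: "\<And>i. i < N \<Longrightarrow> x i \<in> carrier R" "\<And>i. i < N \<Longrightarrow> f i = residue_class j (pip k \<otimes> x i)"
        by metis
      define u where "u = (\<lambda>i. if i < N then x i else \<zero>)"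
      have u: "u \<in> vecs R N" using x by (auto simp: u_def vecs_def)
      obtain w where w: "w \<in> vecs R N" "w a = \<zero>" "mat_vec R N G w = vec_smult R (pip k) u" using pre[OF u] by blast
      then show ?thesis using x by (intro bexI[of _ w]) (auto simp: u_def)
    qed
    then obtain W where W: "\<And>f. f \<in> {..<N} \<rightarrow>\<^sub>E ?S \<Longrightarrow>
        W f \<in> vecs R N \<and> W f a = \<zero> \<and> (\<forall>i<N. residue_class j (mat_vec R N G (W f) i) = f i)" by metis
    let ?g = "\<lambda>f. restrict (\<lambda>i. residue_class j (W f i)) ({..<N} - {a})"
    have "inj_on ?g ({..<N} \<rightarrow>\<^sub>E ?S)"
    proof (rule inj_onI)
      fix f f' assume ff: "f \<in> {..<N} \<rightarrow>\<^sub>E ?S" "f' \<in> {..<N} \<rightarrow>\<^sub>E ?S" "?g f = ?g f'"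
      note Wf = W[OF ff(1)] and Wf' = W[OF ff(2)]
      have c: "W f i \<in> carrier R" "W f' i \<in> carrier R" for i
        using Wf Wf' vecs_carrier by blast+
      have cgi: "pcong j (W f i) (W f' i)" if "i < N" for i
      proof (cases "i = a")
        case True
        then show ?thesis using Wf Wf' by (simp add: pcong_refl)
      next
        case False
        then show ?thesis using fun_cong[OF ff(3), of i] that c by (simp add: residue_class_eq_iff)
      qed
      have "f i = f' i" if i: "i < N" for i
      proof -
        have "pcong j (mat_vec R N G (W f) i) (mat_vec R N G (W f') i)"
          using i c cgi mats_carrier[OF G] by (auto simp: mat_vec_def intro!: pcong_finsum pcong_mult)
        then have "residue_class j (mat_vec R N G (W f) i) = residue_class j (mat_vec R N G (W f') i)"
          using Wf Wf' G by (subst residue_class_eq_iff) (auto intro!: vecs_carrier[of _ N])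
        then show ?thesis using Wf Wf' i by simp
      qed
      then show "f = f'" using ff(1,2) by (intro PiE_ext) auto
    qed
    moreover have "?g ` ({..<N} \<rightarrow>\<^sub>E ?S) \<subseteq> ({..<N} - {a}) \<rightarrow>\<^sub>E (residue_class j ` carrier R)"
    proof (rule image_subsetI)
      fix f assume "f \<in> {..<N} \<rightarrow>\<^sub>E ?S"
      then have "W f \<in> vecs R N" using W by blast
      then show "?g f \<in> ({..<N} - {a}) \<rightarrow>\<^sub>E (residue_class j ` carrier R)"
        using vecs_carrier[of "W f" N] by (simp add: restrict_PiE_iff)
    qed
    moreover have "finite (({..<N} - {a}) \<rightarrow>\<^sub>E (residue_class j ` carrier R))" by (intro finite_PiE) (auto simp: finite_residue_classes)
    ultimately have "card ({..<N} \<rightarrow>\<^sub>E ?S) \<le> card (({..<N} - {a}) \<rightarrow>\<^sub>E (residue_class j ` carrier R))"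
      by (rule card_inj_on_le)
    then show ?thesis using a by (simp add: card_PiE r_def s_def)
  qed
  \<comment> \<open>Chosen such that r j \<ge> j > (r k)^N, against the inequality r j \<le> (r k)^N
    derived below.\<close>
  define j where "j = r k ^ N + 1"
  have rj: "r j > 0" using card_residue_classes_ge[of j] by (simp add: r_def j_def)
  have "r j ^ N \<le> (r k * s j) ^ N" using card_residue_classes_le[of j k] by (intro power_mono) (auto simp: r_def s_def)
  also have "\<dots> \<le> r k ^ N * r j ^ (N - 1)" using bound[of j] by (simp add: power_mult_distrib)
  also have "r j ^ N = r j * r j ^ (N - 1)" using a by (cases N) auto
  finally have "r j \<le> r k ^ N" using rj by simp
  then show False using card_residue_classes_ge[of j] by (simp add: r_def j_def)
qed

section \<open>Reduction of matrices to the residue field\<close>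

definition red :: "'a \<Rightarrow> 'a set" where "red x = mm +> x"

lemma residue_field_eq: "residue_field R = R Quot mm"
proof -
  have "(THE m. maximalideal m R) = mm" 
    by (rule the_equality[where P = "\<lambda>m. maximalideal m R", OF mm_max mm_unique])
  then show ?thesis by (simp add: residue_field_def)
qed

sublocale F: field "residue_field R"
  unfolding residue_field_eq by (rule mm.quotient_is_field) (rule is_cring)

sublocale red: ring_hom_cring R "residue_field R" red
  unfolding residue_field_eq red_def by (rule mm.rcos_ring_hom_cring) (rule is_cring)

lemma carrier_residue_field: "carrier (residue_field R) = red ` carrier R"
  unfolding residue_field_eq red_def FactRing_def by (auto simp: A_RCOSETS_def')

lemma red_zero_iff: "x \<in> carrier R \<Longrightarrow> red x = \<zero>\<^bsub>residue_field R\<^esub> \<longleftrightarrow> x \<in> mm"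
  unfolding residue_field_eq red_def FactRing_def
  by (auto simp: mm.a_rcos_const dest: mm.rcos_const_imp_mem)

lemma red_eq_iff: "x \<in> carrier R \<Longrightarrow> y \<in> carrier R \<Longrightarrow> red x = red y \<longleftrightarrow> x \<ominus> y \<in> mm"
proof -
  assume xy: "x \<in> carrier R" "y \<in> carrier R"
  have "red (x \<ominus> y) = red x \<ominus>\<^bsub>residue_field R\<^esub> red y" using xy by (simp add: minus_eq F.minus_eq)
  moreover have "red x = red y \<longleftrightarrow> red x \<ominus>\<^bsub>residue_field R\<^esub> red y = \<zero>\<^bsub>residue_field R\<^esub>"
    using xy F.minus_equality[of "red x" "\<ominus>\<^bsub>residue_field R\<^esub> red y"]
    by (auto simp: F.minus_eq F.r_neg)
  ultimately show ?thesis using red_zero_iff[of "x \<ominus> y"] xy by simp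
qed

lemma finite_residue_field: "finite (carrier (residue_field R))"
proof -
  have "red x = red y" if yx: "pcong 1 y x" "y \<in> carrier R" for x y
  proof -
    obtain z where z: "z \<in> carrier R" "x = y \<oplus> [p] \<cdot> \<one> \<otimes> z" using yx by (auto simp: pcong_def)
    define e where "e = [p] \<cdot> \<one> \<otimes> z"
    have e: "e \<in> mm" using z p_in_mm by (simp add: e_def mm.I_r_closed)
    have "x \<ominus> y = e" unfolding z(2) e_def[symmetric] using mm_closed[OF e] yx(2) by algebra
    moreover have "x \<in> carrier R" using z yx by simp
    ultimately show ?thesis using red_eq_iff yx(2) e by metis
  qed
  note red_pcong = this
  obtain S where S: "finite S" "S \<subseteq> carrier R" "\<forall>r\<in>carrier R. \<exists>s\<in>S. \<exists>x\<in>carrier R. r = s \<oplus> pip 1 \<otimes> x"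
    using residues[of 1] by blast
  have "red r \<in> red ` S" if "r \<in> carrier R" for r
  proof -
    obtain s where s: "s \<in> S" "pcong 1 s r" using S(3) \<open>r \<in> carrier R\<close> unfolding pcong_def by blast
    then have "red r = red s" using red_pcong S(2) by blast
    then show ?thesis using s by blast
  qed
  then have "red ` carrier R \<subseteq> red ` S" by blast
  then show ?thesis unfolding carrier_residue_field using S(1) by (rule finite_subset[OF _ finite_imageI])
qed

definition mred :: "(nat \<Rightarrow> nat \<Rightarrow> 'a) \<Rightarrow> nat \<Rightarrow> nat \<Rightarrow> 'a set" where
  "mred A = (\<lambda>i j. red (A i j))"

lemma mred_closed: "A \<in> mats R N \<Longrightarrow> mred A \<in> mats (residue_field R) N"
  by (rule F.matsI) (auto simp: mred_def mats_carrier mats_zero)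

lemma mred_surj: assumes "h \<in> mats (residue_field R) N" shows "\<exists>A\<in>mats R N. mred A = h"
proof -
  have "\<exists>x\<in>carrier R. red x = h i j" for i j
    using F.mats_carrier[OF assms, of i j] carrier_residue_field by auto
  then obtain a where a: "\<And>i j. a i j \<in> carrier R" "\<And>i j. red (a i j) = h i j" by metis
  let ?A = "\<lambda>i j. if i < N \<and> j < N then a i j else \<zero>"
  have "?A \<in> mats R N" using a by (intro matsI) auto
  moreover have "mred ?A = h" using a F.mats_zero[OF assms] by (intro ext) (auto simp: mred_def)
  ultimately show ?thesis by blast
qed

lemma mred_mult: "A \<in> mats R N \<Longrightarrow> B \<in> mats R N \<Longrightarrow>
    mat_mult (residue_field R) N (mred A) (mred B) = mred (mat_mult R N A B)"
  by (intro ext) (auto simp: mat_mult_def mred_def mats_carrier Pi_def intro!: F.finsum_cong')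

lemma mred_one: "mred (mat_one R N) = mat_one (residue_field R) N"
  by (intro ext) (auto simp: mat_one_def mred_def)

lemma mred_eq_iff: "A \<in> mats R N \<Longrightarrow> B \<in> mats R N \<Longrightarrow> mred A = mred B \<longleftrightarrow> (\<forall>i<N. \<forall>j<N. A i j \<ominus> B i j \<in> mm)"
  using red_eq_iff[OF mats_carrier mats_carrier] mats_zero[of A N] mats_zero[of B N]
  unfolding mred_def fun_eq_iff by metis

lemma red_mat_vec:
  assumes A: "A \<in> mats R N" and v: "v \<in> vecs R N"
  shows "red (mat_vec R N A v i) = mat_vec (residue_field R) N (mred A) (\<lambda>j. red (v j)) i"
  using vecs_carrier[OF v] mats_carrier[OF A]
  by (auto simp: mat_vec_def mred_def Pi_def intro!: F.finsum_cong')

lemma red_vec_closed: "v \<in> vecs R N \<Longrightarrow> (\<lambda>j. red (v j)) \<in> vecs (residue_field R) N"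
  by (simp add: vecs_def)

text \<open>A lift \<open>B\<close> of the inverse residue matrix makes H B congruent to the
  identity, so every v is congruent to H (B v) modulo the maximal ideal, and Nakayama's lemma
  applies to the image of \<open>H\<close>.\<close>

lemma surj_if_mred_GL:
  assumes H: "H \<in> mats R N" "mred H \<in> GL (residue_field R) N"
  shows "mat_vec R N H ` vecs R N = vecs R N"
proof (rule nakayama_vecs)
  interpret V: Module.module R "vec_mod R N" by (rule module_vec_mod)
  show "submodule (mat_vec R N H ` vecs R N) R (vec_mod R N)"
    by (rule V.submodule_range[OF linear_mat_vec[OF H(1)]])
next
  fix v assume v: "v \<in> vecs R N"
  obtain h where h: "h \<in> mats (residue_field R) N" "mat_mult (residue_field R) N (mred H) h = mat_one (residue_field R) N"
    using H by (auto simp: GL_def)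
  obtain B where B: "B \<in> mats R N" "mred B = h" using mred_surj[OF h(1)] by blast
  define E where "E = mat_mult R N H B"
  have E: "E \<in> mats R N" using H B by (simp add: E_def)
  have "mred (mat_one R N) = mred E" unfolding E_def mred_one using h B mred_mult[OF H(1) B(1)] by simp
  then have E1: "mred E = mat_one (residue_field R) N" by (simp add: mred_one)
  have l: "mat_vec R N E v \<in> mat_vec R N H ` vecs R N"
    using mat_vec_mult[OF H(1) B(1) v] mat_vec_closed[OF B(1) v] unfolding E_def by simp
  have "v i \<ominus> mat_vec R N E v i \<in> mm" for i
  proof -
    have "red (mat_vec R N E v i) = red (v i)"
      using red_mat_vec[OF E v, of i] F.mat_vec_one[OF red_vec_closed[OF v]] by (simp add: E1)
    then show ?thesis
      using red_eq_iff[OF vecs_carrier[OF v] vecs_carrier[OF mat_vec_closed[OF E v]]] by metis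
  qed
  moreover have "(\<lambda>i. v i \<ominus> mat_vec R N E v i) \<in> vecs R N"
    using module.linear_diff(2)[OF module_vec_mod linear_mat_vec[OF E] v mat_vec_closed[OF E v]]
    using vecs_carrier[OF v] vecs_carrier[OF mat_vec_closed[OF E v]] vecs_zero[OF v] vecs_zero[OF mat_vec_closed[OF E v]]
    by (simp add: vecs_def r_neg minus_eq)
  ultimately show "\<exists>l\<in>mat_vec R N H ` vecs R N. (\<lambda>i. v i \<ominus> l i) \<in> mvecs R mm N"
    using l by (intro bexI[of _ "mat_vec R N E v"]) (auto simp: mvecs_def)
qed

text \<open>Over the residue field the right inverse has trivial kernel and is therefore invertible
  by finiteness. Its inverse then shows that \<open>mred H\<close> has trivial kernel as
  well.\<close>

lemma mred_GL_if_right_inverse: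
  assumes H: "H \<in> mats R N" "B \<in> mats R N" and eq: "mred (mat_mult R N H B) = mat_one (residue_field R) N"
  shows "mred H \<in> GL (residue_field R) N"
proof -
  note fin = finite_residue_field
  let ?A = "mred H" and ?B = "mred B" and ?F = "residue_field R"
  have A: "?A \<in> mats ?F N" and B: "?B \<in> mats ?F N" using H mred_closed by auto
  have AB: "mat_vec ?F N ?A (mat_vec ?F N ?B v) = v" if "v \<in> vecs ?F N" for v
    using F.mat_vec_mult[OF A B that] mred_mult[OF H] eq F.mat_vec_one[OF that] by simp
  have "?B \<in> GL ?F N"
    unfolding F.GL_iff_kernel[OF fin B]
  proof (intro ballI impI)
    fix v assume "v \<in> vecs ?F N" "mat_vec ?F N ?B v = (\<lambda>i. \<zero>\<^bsub>?F\<^esub>)"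
    then show "v = (\<lambda>i. \<zero>\<^bsub>?F\<^esub>)" using AB[of v] F.mat_vec_zero[OF A] by simp
  qed
  then obtain C where C: "C \<in> mats ?F N" "mat_mult ?F N ?B C = mat_one ?F N" by (auto simp: GL_def)
  show ?thesis
    unfolding F.GL_iff_kernel[OF fin A]
  proof (intro ballI impI)
    fix v assume v: "v \<in> vecs ?F N" "mat_vec ?F N ?A v = (\<lambda>i. \<zero>\<^bsub>?F\<^esub>)"
    let ?u = "mat_vec ?F N C v"
    have u: "?u \<in> vecs ?F N" using F.mat_vec_closed[OF C(1) v(1)] .
    have Bu: "mat_vec ?F N ?B ?u = v" using F.mat_vec_mult[OF B C(1) v(1)] C(2) F.mat_vec_one[OF v(1)] by simp
    then have "?u = (\<lambda>i. \<zero>\<^bsub>?F\<^esub>)" using AB[OF u] v(2) by simp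
    then show "v = (\<lambda>i. \<zero>\<^bsub>?F\<^esub>)" using Bu F.mat_vec_zero[OF B] by simp
  qed
qed

lemma mat_one_mult: "A \<in> mats R N \<Longrightarrow> mat_mult R N A (mat_one R N) = A"
  by (rule mat_eqI[where N = N]) (simp_all add: mat_vec_mult)

lemma mat_mult_assoc: "A \<in> mats R N \<Longrightarrow> B \<in> mats R N \<Longrightarrow> C \<in> mats R N \<Longrightarrow>
    mat_mult R N (mat_mult R N A B) C = mat_mult R N A (mat_mult R N B C)"
  by (rule mat_eqI[where N = N]) (simp_all add: mat_vec_mult)

text \<open>The columns of H - H' lie in the kernel of \<open>G\<close>, hence over the maximal
  ideal. So G H, which need not determine \<open>H\<close>, determines its residue matrix.\<close>

lemma mred_eq_if_mult_eq:
  assumes G: "G \<in> mats R N" and k: "\<And>v. v \<in> vecs R N \<Longrightarrow> vec_smult R (pip k) v \<in> mat_vec R N G ` vecs R N"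
    and H: "H \<in> mats R N" "H' \<in> mats R N" and eq: "mat_mult R N G H = mat_mult R N G H'"
  shows "mred H = mred H'"
  unfolding mred_eq_iff[OF H]
proof (intro allI impI)
  interpret V: Module.module R "vec_mod R N" by (rule module_vec_mod)
  fix i j assume ij: "i < N" "j < N"
  let ?u = "mat_vec R N H (unit_vec R j)" and ?w = "mat_vec R N H' (unit_vec R j)"
  have u: "?u \<in> vecs R N" "?w \<in> vecs R N" using H ij by auto
  have "mat_vec R N G ?u = mat_vec R N G ?w"
    using mat_vec_mult[OF G H(1) unit_vec_closed[OF ij(2)]] mat_vec_mult[OF G H(2) unit_vec_closed[OF ij(2)]] eq by simp
  from V.linear_diff[OF linear_mat_vec[OF G] u this]
  have "(\<lambda>i. ?u i \<ominus> ?w i) \<in> mvecs R mm N" by (intro kernel_in_mm[OF G k]) auto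
  then show "H i j \<ominus> H' i j \<in> mm" using ij mat_vec_unit[OF H(1) ij(2)] mat_vec_unit[OF H(2) ij(2)] by (simp add: mvecs_def)
qed

text \<open>If G H has the same image as \<open>G\<close>, then G = G H B for some \<open>B\<close>,
  and comparing G (H B) with G shows that H B is the identity over the residue field. The converse
  is the surjectivity of \<open>H\<close>.\<close>

lemma image_mult_eq_iff:
  assumes G: "G \<in> mats R N" and k: "\<And>v. v \<in> vecs R N \<Longrightarrow> vec_smult R (pip k) v \<in> mat_vec R N G ` vecs R N"
    and H: "H \<in> mats R N"
  shows "mat_vec R N (mat_mult R N G H) ` vecs R N = mat_vec R N G ` vecs R N \<longleftrightarrow> mred H \<in> GL (residue_field R) N"
proof
  assume "mat_vec R N (mat_mult R N G H) ` vecs R N = mat_vec R N G ` vecs R N"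
  then obtain B where B: "B \<in> mats R N" "G = mat_mult R N (mat_mult R N G H) B"
    using mat_factor[OF mat_mult_closed[OF G H] G] by auto
  then have "mat_mult R N G (mat_mult R N H B) = mat_mult R N G (mat_one R N)"
    using G H by (simp add: mat_mult_assoc mat_one_mult)
  then have "mred (mat_mult R N H B) = mred (mat_one R N)"
    using G H B by (intro mred_eq_if_mult_eq[OF G k]) auto
  then show "mred H \<in> GL (residue_field R) N"
    using mred_GL_if_right_inverse[OF H B(1)] by (simp add: mred_one)
next
  assume "mred H \<in> GL (residue_field R) N"
  then have "mat_vec R N H ` vecs R N = vecs R N" by (rule surj_if_mred_GL[OF H])
  then show "mat_vec R N (mat_mult R N G H) ` vecs R N = mat_vec R N G ` vecs R N"
    using mat_vec_mult[OF G H] by (metis (no_types, lifting) image_cong image_image)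
qed

text \<open>\<open>E h\<close> collects the products G H for which \<open>H\<close> has residue
  matrix h. These sets are disjoint, are translates of each other and exhaust the matrices with
  image in \<open>K\<close>; those with h invertible make up the matrices with image
  \<open>K\<close>. The ratio of the two measures is therefore the proportion of invertible
  h.\<close>

lemma measure_image_eq:
  assumes haar: "is_haar R p N \<mu>" and G: "G \<in> mats R N"
    and k: "\<And>v. v \<in> vecs R N \<Longrightarrow> vec_smult R (pip k) v \<in> mat_vec R N G ` vecs R N"
  defines "K \<equiv> mat_vec R N G ` vecs R N"
  shows "padic_open N {A \<in> mats R N. mat_vec R N A ` vecs R N = K} \<and>
    measure \<mu> {A \<in> mats R N. mat_vec R N A ` vecs R N = K} =
    measure \<mu> {A \<in> mats R N. mat_vec R N A ` vecs R N \<subseteq> K} *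
      (real (card (GL (residue_field R) N)) / real (card (mats (residue_field R) N)))"
proof -
  interpret prob_space \<mu> using haar by (simp add: is_haar_def)
  let ?F = "residue_field R"
  let ?B = "mats ?F N"
  note fin = F.card_mats(1)[OF finite_residue_field, of N]
  define E where "E = (\<lambda>h. {mat_mult R N G H | H. H \<in> mats R N \<and> mred H = h})"
  have Eop: "padic_open N (E h)" for h
    unfolding padic_open_def
  proof (intro conjI ballI exI)
    show "E h \<subseteq> mats R N" using G by (auto simp: E_def)
    fix A assume "A \<in> E h"
    then obtain H where H: "H \<in> mats R N" "mred H = h" "A = mat_mult R N G H" by (auto simp: E_def)
    \<comment> \<open>Since p^k C = G C' for some C', the perturbation p^(k+1) C equals G (p C'),
      and p C' vanishes over the residue field.\<close>
    show "pcoset R p N (Suc k) A \<subseteq> E h"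
    proof
      fix A' assume "A' \<in> pcoset R p N (Suc k) A"
      then obtain C where C: "C \<in> mats R N" "A' = mat_add R A (mat_smult R (pip (Suc k)) C)"
        by (auto simp: pcoset_def mat_smult_def)
      have "mat_vec R N (mat_smult R (pip k) C) ` vecs R N \<subseteq> K"
        using k C unfolding K_def by (auto simp: mat_vec_mat_smult)
      then obtain C' where C': "C' \<in> mats R N" "mat_smult R (pip k) C = mat_mult R N G C'"
        using mat_factor[OF G mat_smult_closed[OF pip_closed C(1)]] unfolding K_def by blast
      let ?H = "mat_add R H (mat_smult R ([p] \<cdot> \<one>) C')"
      have "mat_smult R (pip (Suc k)) C = mat_smult R ([p] \<cdot> \<one>) (mat_smult R (pip k) C)"
        using mats_carrier[OF C(1)] by (simp add: mat_smult_def fun_eq_iff m_ac)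
      then have "A' = mat_mult R N G ?H"
        using C C' G H by (simp add: mat_mult_add_right mat_mult_smult_right)
      moreover have "mred ?H = h"
      proof -
        have "red ([p] \<cdot> \<one> \<otimes> C' i j) = \<zero>\<^bsub>?F\<^esub>" for i j
          using mats_carrier[OF C'(1), of i j] p_in_mm by (subst red_zero_iff) (auto intro!: mm.I_r_closed)
        then have "mred ?H = mred H"
          using mats_carrier[OF C'(1)] mats_carrier[OF H(1)]
          by (intro ext) (simp add: mred_def mat_smult_def del: red.hom_mult)
        then show ?thesis using H by simp
      qed
      ultimately show "A' \<in> E h" using H C' by (auto simp: E_def)
    qed
  qed
  then have Es: "E h \<in> sets \<mu>" for h by (rule padic_open_sets[OF haar])
  have disj: "disjoint_family_on E ?B"
    unfolding disjoint_family_on_def E_def using mred_eq_if_mult_eq[OF G k] by blast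
  have un: "(\<Union>h\<in>?B. E h) = {A \<in> mats R N. mat_vec R N A ` vecs R N \<subseteq> K}"
  proof
    show "(\<Union>h\<in>?B. E h) \<subseteq> {A \<in> mats R N. mat_vec R N A ` vecs R N \<subseteq> K}"
      using G by (auto simp: E_def K_def mat_vec_mult)
    show "{A \<in> mats R N. mat_vec R N A ` vecs R N \<subseteq> K} \<subseteq> (\<Union>h\<in>?B. E h)"
    proof
      fix A assume "A \<in> {A \<in> mats R N. mat_vec R N A ` vecs R N \<subseteq> K}"
      then obtain H where "H \<in> mats R N" "A = mat_mult R N G H" using mat_factor[OF G] unfolding K_def by blast
      then show "A \<in> (\<Union>h\<in>?B. E h)" using mred_closed by (auto simp: E_def)
    qed
  qed
  have unGL: "(\<Union>h\<in>GL ?F N. E h) = {A \<in> mats R N. mat_vec R N A ` vecs R N = K}"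
  proof
    show "(\<Union>h\<in>GL ?F N. E h) \<subseteq> {A \<in> mats R N. mat_vec R N A ` vecs R N = K}"
    proof
      fix A assume "A \<in> (\<Union>h\<in>GL ?F N. E h)"
      then obtain H where H: "H \<in> mats R N" "mred H \<in> GL ?F N" "A = mat_mult R N G H" by (auto simp: E_def)
      then have "mat_vec R N A ` vecs R N = K" using image_mult_eq_iff[OF G k H(1)] by (simp add: K_def)
      then show "A \<in> {A \<in> mats R N. mat_vec R N A ` vecs R N = K}" using H G by simp
    qed
    show "{A \<in> mats R N. mat_vec R N A ` vecs R N = K} \<subseteq> (\<Union>h\<in>GL ?F N. E h)"
    proof
      fix A assume A: "A \<in> {A \<in> mats R N. mat_vec R N A ` vecs R N = K}"
      then obtain H where H: "H \<in> mats R N" "A = mat_mult R N G H" using mat_factor[OF G, of A] unfolding K_def by auto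
      then have "mred H \<in> GL ?F N" using image_mult_eq_iff[OF G k H(1)] A by (simp add: K_def)
      then show "A \<in> (\<Union>h\<in>GL ?F N. E h)" using H by (auto simp: E_def)
    qed
  qed
  define h0 where "h0 = mred (\<lambda>i j. \<zero>)"
  have h0: "h0 \<in> ?B" unfolding h0_def by (rule mred_closed) simp
  have tr: "\<exists>A\<in>mats R N. E h = mat_add R A ` E h0" if h: "h \<in> ?B" for h
  proof -
    obtain H where H: "H \<in> mats R N" "mred H = h" using mred_surj[OF h] by blast
    let ?A = "mat_mult R N G H"
    have "E h = mat_add R ?A ` E h0"
    proof
      show "E h \<subseteq> mat_add R ?A ` E h0"
      proof
        fix C assume "C \<in> E h"
        then obtain H' where H': "H' \<in> mats R N" "mred H' = h" "C = mat_mult R N G H'" by (auto simp: E_def)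
        let ?D = "mat_add R (mat_neg H) H'"
        have "C = mat_add R ?A (mat_mult R N G ?D)"
          using H H' G by (simp add: mat_add_neg_cancel' flip: mat_mult_add_right)
        moreover have "mred ?D = h0"
        proof -
          have "H' i j \<ominus> H i j \<in> mm" if "i < N" "j < N" for i j
            using mred_eq_iff[OF H'(1) H(1)] H H' that by simp
          then have "\<ominus> H i j \<oplus> H' i j \<ominus> \<zero> \<in> mm" if "i < N" "j < N" for i j
            using that mats_carrier[OF H(1), of i j] mats_carrier[OF H'(1), of i j] by (simp add: minus_eq a_comm)
          moreover have "?D \<in> mats R N" using H H' by simp
          ultimately show ?thesis
            unfolding h0_def using mred_eq_iff[of ?D N "\<lambda>i j. \<zero>"] by (simp add: mat_neg_def)
        qed
        moreover have "?D \<in> mats R N" using H H' by simp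
        ultimately show "C \<in> mat_add R ?A ` E h0" by (auto simp: E_def)
      qed
      show "mat_add R ?A ` E h0 \<subseteq> E h"
      proof
        fix C assume "C \<in> mat_add R ?A ` E h0"
        then obtain H' where H': "H' \<in> mats R N" "mred H' = h0" "C = mat_add R ?A (mat_mult R N G H')" by (auto simp: E_def)
        have "C = mat_mult R N G (mat_add R H H')" using H H' G by (simp add: mat_mult_add_right)
        moreover have "mred (mat_add R H H') = h"
        proof -
          have "red (H' i j) = \<zero>\<^bsub>?F\<^esub>" for i j using fun_cong[OF fun_cong[OF H'(2)]] by (simp add: h0_def mred_def)
          then have "mred (mat_add R H H') = mred H"
            using mats_carrier[OF H(1)] mats_carrier[OF H'(1)] by (intro ext) (simp add: mred_def)
          then show ?thesis using H by simp
        qed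
        moreover have "mat_add R H H' \<in> mats R N" using H H' by simp
        ultimately show "C \<in> E h" by (auto simp: E_def)
      qed
    qed
    then show ?thesis using G H by (intro bexI[of _ ?A]) auto
  qed
  have meas: "measure \<mu> (E h) = measure \<mu> (\<Union>h\<in>?B. E h) / card ?B" if "h \<in> ?B" for h
    using fin h0 Es disj tr that by (intro measure_equidistributed[OF haar, where E = E and ?b0.0 = h0]) auto
  have GLsub: "GL ?F N \<subseteq> ?B" by (auto simp: GL_def)
  have "measure \<mu> (\<Union>h\<in>GL ?F N. E h) = (\<Sum>h\<in>GL ?F N. measure \<mu> (E h))"
    using Es finite_subset[OF GLsub fin] disjoint_family_on_mono[OF GLsub disj]
    by (intro finite_measure_finite_Union) auto
  also have "\<dots> = (\<Sum>h\<in>GL ?F N. measure \<mu> (\<Union>h\<in>?B. E h) / card ?B)"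
    using meas GLsub by (intro sum.cong) auto
  finally have "measure \<mu> {A \<in> mats R N. mat_vec R N A ` vecs R N = K} =
    measure \<mu> {A \<in> mats R N. mat_vec R N A ` vecs R N \<subseteq> K} * (real (card (GL ?F N)) / real (card ?B))"
    unfolding un unGL by simp
  moreover have "padic_open N {A \<in> mats R N. mat_vec R N A ` vecs R N = K}"
    unfolding unGL[symmetric] by (rule padic_open_Un) (rule Eop)
  ultimately show ?thesis by blast
qed

end

section \<open>Presentations of a finite module by square matrices\<close>

text \<open>The homomorphism theorem without quotient modules: both maps identify the same vectors,
  so \<alpha> can be computed at any preimage, picked here by choice.\<close>

lemma (in cring) induced_iso:
  assumes M: "Module.module R M" "Module.module R M'"
    and lin: "module.linear_on R M N \<phi>" and lin': "module.linear_on R M' N \<psi>"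
    and sur: "\<phi> ` vecs R N = carrier M" "\<psi> ` vecs R N = carrier M'"
    and ker: "{v \<in> vecs R N. \<phi> v = \<zero>\<^bsub>M\<^esub>} = {v \<in> vecs R N. \<psi> v = \<zero>\<^bsub>M'\<^esub>}"
  shows "\<exists>\<alpha>. mod_linear R M M' \<alpha> \<and> bij_betw \<alpha> (carrier M) (carrier M') \<and> (\<forall>v\<in>vecs R N. \<alpha> (\<phi> v) = \<psi> v)"
proof -
  interpret M: Module.module R M by fact
  interpret M': Module.module R M' by fact
  note l = M.linear_onD[OF lin] and l' = M'.linear_onD[OF lin']
  have eq: "\<phi> u = \<phi> v \<longleftrightarrow> \<psi> u = \<psi> v" if uv: "u \<in> vecs R N" "v \<in> vecs R N" for u v
  proof -
    let ?d = "vec_add R u (vec_smult R (\<ominus> \<one>) v)"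
    have d: "?d \<in> vecs R N" using uv by simp
    have "\<phi> ?d = \<phi> u \<oplus>\<^bsub>M\<^esub> \<ominus>\<^bsub>M\<^esub> \<phi> v" using l uv by (simp add: M.smult_l_minus)
    then have 1: "\<phi> u = \<phi> v \<longleftrightarrow> \<phi> ?d = \<zero>\<^bsub>M\<^esub>"
      using l(1)[OF uv(1)] l(1)[OF uv(2)] M.M.minus_equality[of "\<phi> u" "\<ominus>\<^bsub>M\<^esub> \<phi> v"] by (auto simp: M.M.r_neg)
    have "\<psi> ?d = \<psi> u \<oplus>\<^bsub>M'\<^esub> \<ominus>\<^bsub>M'\<^esub> \<psi> v" using l' uv by (simp add: M'.smult_l_minus)
    then have 2: "\<psi> u = \<psi> v \<longleftrightarrow> \<psi> ?d = \<zero>\<^bsub>M'\<^esub>"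
      using l'(1)[OF uv(1)] l'(1)[OF uv(2)] M'.M.minus_equality[of "\<psi> u" "\<ominus>\<^bsub>M'\<^esub> \<psi> v"] by (auto simp: M'.M.r_neg)
    have "\<phi> ?d = \<zero>\<^bsub>M\<^esub> \<longleftrightarrow> \<psi> ?d = \<zero>\<^bsub>M'\<^esub>" using ker d by blast
    then show ?thesis using 1 2 by simp
  qed
  define s where "s = (\<lambda>m. SOME v. v \<in> vecs R N \<and> \<phi> v = m)"
  have s: "s m \<in> vecs R N \<and> \<phi> (s m) = m" if m: "m \<in> carrier M" for m
  proof -
    have "\<exists>v. v \<in> vecs R N \<and> \<phi> v = m" using sur(1) m by (metis (no_types, lifting) imageE)
    from someI_ex[OF this] show ?thesis by (simp add: s_def)
  qed
  define \<alpha> where "\<alpha> = (\<lambda>m. \<psi> (s m))"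
  have al: "\<alpha> (\<phi> v) = \<psi> v" if v: "v \<in> vecs R N" for v
    using eq[OF conjunct1[OF s[OF l(1)[OF v]]] v] s[OF l(1)[OF v]] by (simp add: \<alpha>_def)
  have rep: "\<exists>v\<in>vecs R N. m = \<phi> v" if "m \<in> carrier M" for m using s[OF that] by metis
  have "mod_linear R M M' \<alpha>"
    unfolding mod_linear_def
  proof (intro conjI ballI)
    show "\<alpha> ` carrier M \<subseteq> carrier M'"
    proof (rule image_subsetI)
      fix m assume "m \<in> carrier M"
      then obtain v where "v \<in> vecs R N" "m = \<phi> v" using rep by blast
      then show "\<alpha> m \<in> carrier M'" using al l'(1) by simp
    qed
    fix a b assume "a \<in> carrier M" "b \<in> carrier M"
    then obtain u w where uw: "u \<in> vecs R N" "w \<in> vecs R N" "a = \<phi> u" "b = \<phi> w" using rep by blast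
    then have "\<alpha> (a \<oplus>\<^bsub>M\<^esub> b) = \<alpha> (\<phi> (vec_add R u w))" using l(2) by simp
    also have "\<dots> = \<alpha> a \<oplus>\<^bsub>M'\<^esub> \<alpha> b" using uw al l'(2) by simp
    finally show "\<alpha> (a \<oplus>\<^bsub>M\<^esub> b) = \<alpha> a \<oplus>\<^bsub>M'\<^esub> \<alpha> b" .
  next
    fix r a assume ra: "r \<in> carrier R" "a \<in> carrier M"
    then obtain u where u: "u \<in> vecs R N" "a = \<phi> u" using rep by blast
    then have "\<alpha> (r \<odot>\<^bsub>M\<^esub> a) = \<alpha> (\<phi> (vec_smult R r u))" using l(3) ra by simp
    also have "\<dots> = r \<odot>\<^bsub>M'\<^esub> \<alpha> a" using u ra al l'(3) by simp
    finally show "\<alpha> (r \<odot>\<^bsub>M\<^esub> a) = r \<odot>\<^bsub>M'\<^esub> \<alpha> a" .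
  qed
  moreover have "bij_betw \<alpha> (carrier M) (carrier M')"
  proof (rule bij_betw_imageI)
    show "inj_on \<alpha> (carrier M)"
    proof (rule inj_onI)
      fix a b assume ab: "a \<in> carrier M" "b \<in> carrier M" "\<alpha> a = \<alpha> b"
      then obtain u w where uw: "u \<in> vecs R N" "w \<in> vecs R N" "a = \<phi> u" "b = \<phi> w" using rep by blast
      then show "a = b" using al eq ab by metis
    qed
    have "\<alpha> ` carrier M = \<alpha> ` (\<phi> ` vecs R N)" using sur(1) by simp
    also have "\<dots> = \<psi> ` vecs R N" unfolding image_image using al by (rule image_cong[OF refl])
    finally show "\<alpha> ` carrier M = carrier M'" using sur(2) by simp
  qed
  ultimately show ?thesis using al by blast
qed

context Module.module begin

text \<open>The surjections from \<open>R^N\<close> whose kernel is the image of a square matrix, as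
  tuples of generators. Extensionality outside the index range makes the set finite for finite
  \<open>M\<close>.\<close>

definition presentations :: "nat \<Rightarrow> (nat \<Rightarrow> 'c) set" where
  "presentations N = {x \<in> {..<N} \<rightarrow>\<^sub>E carrier M. lincomb N x ` vecs R N = carrier M \<and>
     (\<exists>G\<in>mats R N. {v \<in> vecs R N. lincomb N x v = \<zero>\<^bsub>M\<^esub>} = mat_vec R N G ` vecs R N)}"

definition ker :: "nat \<Rightarrow> (nat \<Rightarrow> 'c) \<Rightarrow> (nat \<Rightarrow> 'a) set" where
  "ker N x = {v \<in> vecs R N. lincomb N x v = \<zero>\<^bsub>M\<^esub>}"

lemma presentationsD:
  assumes "x \<in> presentations N"
  shows "x \<in> {..<N} \<rightarrow>\<^sub>E carrier M" "lincomb N x ` vecs R N = carrier M"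
    "\<exists>G\<in>mats R N. ker N x = mat_vec R N G ` vecs R N" "linear_on N (lincomb N x)"
  using assms by (auto simp: presentations_def ker_def intro!: lincomb_linear)

lemma coker_iso_iff_presentation:
  assumes G: "G \<in> mats R N"
  shows "coker_iso R N G M \<longleftrightarrow> (\<exists>x\<in>presentations N. ker N x = mat_vec R N G ` vecs R N)"
proof
  assume "coker_iso R N G M"
  then obtain \<phi> where \<phi>: "\<phi> ` vecs R N = carrier M"
     "\<forall>u\<in>vecs R N. \<forall>v\<in>vecs R N. \<phi> (vec_add R u v) = \<phi> u \<oplus>\<^bsub>M\<^esub> \<phi> v"
     "\<forall>r\<in>carrier R. \<forall>v\<in>vecs R N. \<phi> (vec_smult R r v) = r \<odot>\<^bsub>M\<^esub> \<phi> v"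
     "{v \<in> vecs R N. \<phi> v = \<zero>\<^bsub>M\<^esub>} = mat_vec R N G ` vecs R N" by (auto simp: coker_iso_def)
  then have lin: "linear_on N \<phi>" by (auto simp: linear_on_def)
  define x where "x = restrict (\<lambda>i. \<phi> (unit_vec R i)) {..<N}"
  have xc: "\<phi> (unit_vec R i) \<in> carrier M" if "i < N" for i
    using linear_onD(1)[OF lin R.unit_vec_closed[OF that]] .
  have eq: "lincomb N x v = \<phi> v" if "v \<in> vecs R N" for v
    unfolding linear_on_expand[OF lin that] by (rule lincomb_cong) (use that xc in \<open>auto simp: x_def\<close>)
  have "lincomb N x ` vecs R N = carrier M" using \<phi>(1) eq by (metis (no_types, lifting) image_cong)
  moreover have k: "ker N x = mat_vec R N G ` vecs R N" 
  proof -
    have "ker N x = {v \<in> vecs R N. \<phi> v = \<zero>\<^bsub>M\<^esub>}" unfolding ker_def using eq by (intro Collect_cong) auto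
    then show ?thesis using \<phi>(4) by simp
  qed
  moreover have "x \<in> {..<N} \<rightarrow>\<^sub>E carrier M" unfolding x_def restrict_PiE_iff using xc by blast
  ultimately have "x \<in> presentations N" using G unfolding presentations_def ker_def by blast
  then show "\<exists>x\<in>presentations N. ker N x = mat_vec R N G ` vecs R N" using k by blast
next
  assume "\<exists>x\<in>presentations N. ker N x = mat_vec R N G ` vecs R N"
  then obtain x where x: "x \<in> presentations N" "ker N x = mat_vec R N G ` vecs R N" by blast
  show "coker_iso R N G M"
    unfolding coker_iso_def
    by (rule exI[of _ "lincomb N x"])
      (use presentationsD[OF x(1)] x(2) linear_onD[OF presentationsD(4)[OF x(1)]] in \<open>auto simp: ker_def\<close>)
qed

lemma lincomb_mod_linear:
  assumes al: "mod_linear R M M \<alpha>" and x: "\<And>i. i < N \<Longrightarrow> x i \<in> carrier M" and v: "v \<in> vecs R N"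
  shows "\<alpha> (lincomb N x v) = lincomb N (\<lambda>i. \<alpha> (x i)) v"
proof -
  note l = linear_onD[OF lincomb_linear[of N x, OF x]]
  have lin: "linear_on N (\<lambda>v. \<alpha> (lincomb N x v))"
    unfolding linear_on_def using al l by (auto simp: mod_linear_def)
  have "\<alpha> (lincomb N x v) = lincomb N (\<lambda>i. \<alpha> (lincomb N x (unit_vec R i))) v"
    by (rule linear_on_expand[OF lin v])
  also have "\<dots> = lincomb N (\<lambda>i. \<alpha> (x i)) v"
  proof (rule lincomb_cong[OF _ _ v])
    fix i assume i: "i < N"
    show "\<alpha> (lincomb N x (unit_vec R i)) = \<alpha> (x i)" using lincomb_unit_vec[of N x i] x i by simp
    then show "\<alpha> (lincomb N x (unit_vec R i)) \<in> carrier M" using al x[OF i] by (auto simp: mod_linear_def)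
  qed
  finally show ?thesis .
qed

text \<open>The action of the automorphisms is free since the tuple generates \<open>M\<close>, and
  it is also transitive on the presentations with a given kernel, because two of them differ by the
  isomorphism that they induce. So every kernel arises from exactly |Aut M| presentations.\<close>

lemma card_aut_fiber:
  assumes x0: "x0 \<in> presentations N"
  shows "bij_betw (\<lambda>\<alpha>. restrict (\<lambda>i. \<alpha> (x0 i)) {..<N}) (aut R M) {x \<in> presentations N. ker N x = ker N x0}"
proof -
  note g0 = presentationsD[OF x0]
  have x0c: "x0 i \<in> carrier M" if "i < N" for i using PiE_mem[OF g0(1), of i] that by simp
  have lc: "lincomb N (restrict (\<lambda>i. \<alpha> (x0 i)) {..<N}) v = \<alpha> (lincomb N x0 v)"
    if "\<alpha> \<in> aut R M" "v \<in> vecs R N" for \<alpha> v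
  proof -
    have al: "mod_linear R M M \<alpha>" using that by (simp add: aut_def)
    have "\<alpha> (x0 i) \<in> carrier M" if "i < N" for i using al x0c[OF that] by (auto simp: mod_linear_def)
    then have "lincomb N (restrict (\<lambda>i. \<alpha> (x0 i)) {..<N}) v = lincomb N (\<lambda>i. \<alpha> (x0 i)) v"
      using that by (intro lincomb_cong) auto
    then show ?thesis using lincomb_mod_linear[OF al x0c that(2)] by simp
  qed
  have az: "\<alpha> \<zero>\<^bsub>M\<^esub> = \<zero>\<^bsub>M\<^esub>" if "\<alpha> \<in> aut R M" for \<alpha>
  proof -
    have "\<alpha> (\<zero> \<odot>\<^bsub>M\<^esub> \<zero>\<^bsub>M\<^esub>) = \<zero> \<odot>\<^bsub>M\<^esub> \<alpha> \<zero>\<^bsub>M\<^esub>"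
      using that R.zero_closed M.zero_closed unfolding aut_def mod_linear_def by blast
    moreover have "\<alpha> \<zero>\<^bsub>M\<^esub> \<in> carrier M" using that by (auto simp: aut_def mod_linear_def)
    moreover note smult_l_null
    ultimately have "\<alpha> \<zero>\<^bsub>M\<^esub> = \<zero>\<^bsub>M\<^esub>" by simp
    then show ?thesis .
  qed
  show ?thesis
  proof (rule bij_betw_imageI)
    show "inj_on (\<lambda>\<alpha>. restrict (\<lambda>i. \<alpha> (x0 i)) {..<N}) (aut R M)"
    proof (rule inj_onI)
      fix \<alpha> \<beta> assume ab: "\<alpha> \<in> aut R M" "\<beta> \<in> aut R M"
        "restrict (\<lambda>i. \<alpha> (x0 i)) {..<N} = restrict (\<lambda>i. \<beta> (x0 i)) {..<N}"
      have "\<alpha> (lincomb N x0 v) = \<beta> (lincomb N x0 v)" if "v \<in> vecs R N" for v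
        using lc[OF ab(1) that] lc[OF ab(2) that] ab(3) by simp
      then have "\<alpha> m = \<beta> m" if "m \<in> carrier M" for m using g0(2) that by (metis (no_types, lifting) imageE)
      then show "\<alpha> = \<beta>" using ab by (intro extensionalityI[of _ "carrier M"]) (auto simp: aut_def)
    qed
    show "(\<lambda>\<alpha>. restrict (\<lambda>i. \<alpha> (x0 i)) {..<N}) ` aut R M = {x \<in> presentations N. ker N x = ker N x0}"
    proof (intro equalityI subsetI)
      fix x assume "x \<in> (\<lambda>\<alpha>. restrict (\<lambda>i. \<alpha> (x0 i)) {..<N}) ` aut R M"
      then obtain \<alpha> where \<alpha>: "\<alpha> \<in> aut R M" "x = restrict (\<lambda>i. \<alpha> (x0 i)) {..<N}" by blast
      have bij: "bij_betw \<alpha> (carrier M) (carrier M)" using \<alpha> by (simp add: aut_def)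
      have eq: "lincomb N x v = \<alpha> (lincomb N x0 v)" if "v \<in> vecs R N" for v
        using lc[OF \<alpha>(1) that] \<alpha>(2) by simp
      have "lincomb N x ` vecs R N = \<alpha> ` (lincomb N x0 ` vecs R N)"
        unfolding image_image using eq by (rule image_cong[OF refl])
      then have sur: "lincomb N x ` vecs R N = carrier M" using g0(2) bij by (simp add: bij_betw_def)
      have k: "ker N x = ker N x0"
      proof -
        have "\<alpha> (lincomb N x0 v) = \<zero>\<^bsub>M\<^esub> \<longleftrightarrow> lincomb N x0 v = \<zero>\<^bsub>M\<^esub>" if "v \<in> vecs R N" for v
          using bij_betw_imp_inj_on[OF bij] az[OF \<alpha>(1)] linear_onD(1)[OF g0(4) that] M.zero_closed
          by (metis inj_onD)
        then have "lincomb N x v = \<zero>\<^bsub>M\<^esub> \<longleftrightarrow> lincomb N x0 v = \<zero>\<^bsub>M\<^esub>" if "v \<in> vecs R N" for v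
          unfolding eq[OF that] using that by blast
        then show ?thesis unfolding ker_def by blast
      qed
      have "x \<in> {..<N} \<rightarrow>\<^sub>E carrier M"
        unfolding \<alpha>(2) restrict_PiE_iff using x0c \<alpha>(1) by (auto simp: aut_def mod_linear_def)
      then show "x \<in> {x \<in> presentations N. ker N x = ker N x0}"
        using sur k g0(3) unfolding presentations_def ker_def by auto
    next
      fix x assume "x \<in> {x \<in> presentations N. ker N x = ker N x0}"
      then have x: "x \<in> presentations N" and kx: "ker N x = ker N x0" by auto
      note gx = presentationsD[OF x]
      obtain \<beta> where \<beta>: "mod_linear R M M \<beta>" "bij_betw \<beta> (carrier M) (carrier M)"
          "\<And>v. v \<in> vecs R N \<Longrightarrow> \<beta> (lincomb N x0 v) = lincomb N x v"
        using R.induced_iso[OF module_axioms module_axioms g0(4) gx(4) g0(2) gx(2)] kx unfolding ker_def by blast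
      define \<alpha> where "\<alpha> = restrict \<beta> (carrier M)"
      have al: "\<alpha> (lincomb N x0 v) = lincomb N x v" if "v \<in> vecs R N" for v
        using \<beta>(3)[OF that] linear_onD(1)[OF g0(4) that] by (simp add: \<alpha>_def)
      have "mod_linear R M M \<alpha>" using \<beta>(1) by (auto simp: mod_linear_def \<alpha>_def)
      moreover have "bij_betw \<alpha> (carrier M) (carrier M)"
        using \<beta>(2) by (subst bij_betw_cong[of _ _ \<beta>]) (auto simp: \<alpha>_def)
      ultimately have "\<alpha> \<in> aut R M" by (simp add: aut_def \<alpha>_def)
      moreover have "restrict (\<lambda>i. \<alpha> (x0 i)) {..<N} = x"
      proof (rule extensionalityI[of _ "{..<N}"])
        show "x \<in> extensional {..<N}" using gx(1) by (simp add: PiE_def)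
        have xc: "x i \<in> carrier M" if "i < N" for i using PiE_mem[OF gx(1), of i] that by simp
        fix i assume i: "i \<in> {..<N}"
        then have "\<alpha> (x0 i) = \<alpha> (lincomb N x0 (unit_vec R i))" using lincomb_unit_vec[of N x0 i] x0c by simp
        also have "\<dots> = x i" using al[OF R.unit_vec_closed] i lincomb_unit_vec[of N x i] xc by simp
        finally show "restrict (\<lambda>i. \<alpha> (x0 i)) {..<N} i = x i" using i by simp
      qed simp
      ultimately show "x \<in> (\<lambda>\<alpha>. restrict (\<lambda>i. \<alpha> (x0 i)) {..<N}) ` aut R M" by force
    qed
  qed
qed

text \<open>The generators outside the block are combinations of those in the block and can be eliminated, so the
  relations are generated by those of the block and one relation for each further generator.\<close>

lemma presentation_block:
  assumes sN: "s + n \<le> N" and x: "x \<in> {..<N} \<rightarrow>\<^sub>E carrier M"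
    and y: "restrict (\<lambda>j. x (s + j)) {..<n} \<in> presentations n"
  shows "x \<in> presentations N"
proof -
  define y where "y = restrict (\<lambda>j. x (s + j)) {..<n}"
  note gy = presentationsD[OF assms(3)[folded y_def]]
  have xc: "x i \<in> carrier M" if "i < N" for i using PiE_mem[OF x, of i] that by simp
  have yc: "y i \<in> carrier M" if "i < n" for i using PiE_mem[OF gy(1), of i] that by simp
  have linx: "linear_on N (lincomb N x)" by (rule lincomb_linear) (rule xc)
  note lx = linear_onD[OF linx] and ly = linear_onD[OF gy(4)]
  obtain G1 where G1: "G1 \<in> mats R n" "ker n y = mat_vec R n G1 ` vecs R n" using gy(3) by blast
  \<comment> \<open>\<open>un\<close> reads off the n coordinates of the block that starts at
    \<open>s\<close>, \<open>sh\<close> puts a vector into the block, and \<open>out\<close> erases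
    the block.\<close>
  define un where "un = (\<lambda>v j. if j < n then v (s + j) else \<zero>)"
  define sh where "sh = (\<lambda>w i. if s \<le> i \<and> i < s + n then w (i - s) else \<zero>)"
  define out where "out = (\<lambda>v i. if s \<le> i \<and> i < s + n then \<zero> else v i)"
  have unc: "un v \<in> vecs R n" if "v \<in> vecs R N" for v using R.vecs_carrier[OF that] by (simp add: un_def vecs_def)
  have shc: "sh w \<in> vecs R N" if "w \<in> vecs R n" for w
    using R.vecs_carrier[OF that] sN by (simp add: sh_def vecs_def)
  have outc: "out v \<in> vecs R N" if "v \<in> vecs R N" for v
    using R.vecs_carrier[OF that] R.vecs_zero[OF that] by (simp add: out_def vecs_def)
  have un_add: "un (vec_add R u v) = vec_add R (un u) (un v)" for u v by (auto simp: un_def fun_eq_iff)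
  have sh_add: "sh (vec_add R u v) = vec_add R (sh u) (sh v)" for u v by (auto simp: sh_def fun_eq_iff)
  have out_add: "out (vec_add R u v) = vec_add R (out u) (out v)" for u v by (auto simp: out_def fun_eq_iff)
  have un_sm: "un (vec_smult R r v) = vec_smult R r (un v)" if "r \<in> carrier R" for r v using that by (auto simp: un_def fun_eq_iff)
  have sh_sm: "sh (vec_smult R r v) = vec_smult R r (sh v)" if "r \<in> carrier R" for r v using that by (auto simp: sh_def fun_eq_iff)
  have out_sm: "out (vec_smult R r v) = vec_smult R r (out v)" if "r \<in> carrier R" for r v using that by (auto simp: out_def fun_eq_iff)
  have split: "vec_add R (out v) (sh (un v)) = v" if "v \<in> vecs R N" for v
  proof
    fix i
    show "vec_add R (out v) (sh (un v)) i = v i"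
      using R.vecs_carrier[OF that, of i] by (auto simp: out_def sh_def un_def)
  qed
  interpret Vn: Module.module R "vec_mod R n" by (rule R.module_vec_mod)
  interpret VN: Module.module R "vec_mod R N" by (rule R.module_vec_mod)
  have shlin: "linear_on n (\<lambda>w. lincomb N x (sh w))"
    unfolding linear_on_def using shc lx by (auto simp: sh_add sh_sm)
  have sh_eq: "lincomb N x (sh w) = lincomb n y w" if "w \<in> vecs R n" for w
  proof (rule R.linear_eqI[OF module_axioms shlin gy(4) _ that])
    fix j assume j: "j < n"
    have "sh (unit_vec R j) = unit_vec R (s + j)" using j by (auto simp: sh_def unit_vec_def fun_eq_iff)
    then show "lincomb N x (sh (unit_vec R j)) = lincomb n y (unit_vec R j)"
      using lincomb_unit_vec[of N x "s + j"] lincomb_unit_vec[of n y j] xc yc j sN by (simp add: y_def)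
  qed
  \<comment> \<open>\<open>a i\<close> expresses the generator \<open>x i\<close> through the block.
    The linear extension \<open>A\<close> gives each v a vector on the block that represents the
    same element of \<open>M\<close>.\<close>
  have "\<exists>w. w \<in> vecs R n \<and> lincomb n y w = x i" if "i < N" for i
    using gy(2) xc[OF that] by (metis (no_types, lifting) imageE)
  then obtain a where a: "\<And>i. i < N \<Longrightarrow> a i \<in> vecs R n" "\<And>i. i < N \<Longrightarrow> lincomb n y (a i) = x i" by metis
  define A where "A = Vn.lincomb N a"
  have Alin: "Vn.linear_on N A" unfolding A_def by (rule Vn.lincomb_linear) (use a in simp)
  note lA = Vn.linear_onD[OF Alin]
  have Aeq: "lincomb n y (A v) = lincomb N x v" if "v \<in> vecs R N" for v
  proof (rule R.linear_eqI[OF module_axioms R.linear_comp[OF module_axioms gy(4) Alin] linx _ that])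
    fix j assume j: "j < N"
    show "lincomb n y (A (unit_vec R j)) = lincomb N x (unit_vec R j)"
      unfolding A_def using Vn.lincomb_unit_vec[of N a j] lincomb_unit_vec[of N x j] a xc j by simp
  qed
  \<comment> \<open>In the relation \<open>f u\<close> the block of \<open>u\<close> contributes a
    relation among the block generators, taken from \<open>G1\<close>, and each outer entry
    contributes the relation that equates an outer generator with its expression through the
    block.\<close>
  define c where "c = (\<lambda>u. vec_add R (mat_vec R n G1 (un u)) (vec_smult R (\<ominus> \<one>) (A (out u))))"
  have cc: "c u \<in> vecs R n" if "u \<in> vecs R N" for u
    using lA(1)[OF outc[OF that]] unc[OF that] G1 by (simp add: c_def)
  define f where "f = (\<lambda>u. vec_add R (out u) (sh (c u)))"
  have c_add: "c (vec_add R u v) = vec_add R (c u) (c v)" if "u \<in> vecs R N" "v \<in> vecs R N" for u v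
  proof -
    have e: "mat_vec R n G1 (un (vec_add R u v)) = vec_add R (mat_vec R n G1 (un u)) (mat_vec R n G1 (un v))"
      using unc that G1 by (simp add: un_add R.mat_vec_add)
    have e': "A (out (vec_add R u v)) = vec_add R (A (out u)) (A (out v))"
      using lA(2)[OF outc outc, OF that] by (simp add: out_add)
    show ?thesis
    proof
      fix i
      have "mat_vec R n G1 (un u) i \<in> carrier R" "mat_vec R n G1 (un v) i \<in> carrier R"
        "A (out u) i \<in> carrier R" "A (out v) i \<in> carrier R"
        using lA(1)[OF outc] unc that G1 by (auto intro!: R.vecs_carrier[of _ n])
      then show "c (vec_add R u v) i = vec_add R (c u) (c v) i"
        unfolding c_def e e' by (simp add: R.r_distr R.a_ac)
    qed
  qed
  have c_sm: "c (vec_smult R r v) = vec_smult R r (c v)" if "r \<in> carrier R" "v \<in> vecs R N" for r v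
  proof -
    have e: "mat_vec R n G1 (un (vec_smult R r v)) = vec_smult R r (mat_vec R n G1 (un v))"
      using unc that G1 by (simp add: un_sm R.mat_vec_smult)
    have e': "A (out (vec_smult R r v)) = vec_smult R r (A (out v))"
      using lA(3)[OF that(1) outc[OF that(2)]] that by (simp add: out_sm)
    show ?thesis
    proof
      fix i
      have "mat_vec R n G1 (un v) i \<in> carrier R" "A (out v) i \<in> carrier R"
        using lA(1)[OF outc] unc that G1 by (auto intro!: R.vecs_carrier[of _ n])
      then show "c (vec_smult R r v) i = vec_smult R r (c v) i"
        unfolding c_def e e' using that by (simp add: R.r_distr R.m_lcomm)
    qed
  qed
  have flin: "VN.linear_on N f"
    unfolding VN.linear_on_def
  proof (intro conjI ballI)
    fix u v assume uv: "u \<in> vecs R N" "v \<in> vecs R N"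
    show "f u \<in> carrier (vec_mod R N)" using uv outc shc cc by (simp add: f_def)
    show "f (vec_add R u v) = f u \<oplus>\<^bsub>vec_mod R N\<^esub> f v"
    proof
      fix i
      have "out u i \<in> carrier R" "out v i \<in> carrier R" "sh (c u) i \<in> carrier R" "sh (c v) i \<in> carrier R"
        using uv outc shc cc by (auto intro!: R.vecs_carrier[of _ N])
      then show "f (vec_add R u v) i = (f u \<oplus>\<^bsub>vec_mod R N\<^esub> f v) i"
        using uv by (simp add: f_def c_add out_add sh_add R.a_ac)
    qed
  next
    fix r v assume uv: "r \<in> carrier R" "v \<in> vecs R N"
    show "f (vec_smult R r v) = r \<odot>\<^bsub>vec_mod R N\<^esub> f v"
    proof
      fix i
      have "out v i \<in> carrier R" "sh (c v) i \<in> carrier R"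
        using uv outc shc cc by (auto intro!: R.vecs_carrier[of _ N])
      then show "f (vec_smult R r v) i = (r \<odot>\<^bsub>vec_mod R N\<^esub> f v) i"
        using uv by (simp add: f_def c_sm out_sm sh_sm R.r_distr)
    qed
  qed
  then obtain G where G: "G \<in> mats R N" "\<And>v. v \<in> vecs R N \<Longrightarrow> mat_vec R N G v = f v"
    using R.linear_matrix by blast
  have fk: "lincomb N x (f u) = \<zero>\<^bsub>M\<^esub>" if u: "u \<in> vecs R N" for u
  proof -
    have g1: "mat_vec R n G1 (un u) \<in> vecs R n" "lincomb n y (mat_vec R n G1 (un u)) = \<zero>\<^bsub>M\<^esub>"
      using G1 unc[OF u] by (auto simp: ker_def)
    have Ao: "A (out u) \<in> vecs R n" using lA(1)[OF outc[OF u]] by simp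
    have "lincomb n y (c u) = \<zero>\<^bsub>M\<^esub> \<oplus>\<^bsub>M\<^esub> (\<ominus> \<one>) \<odot>\<^bsub>M\<^esub> lincomb n y (A (out u))"
      unfolding c_def using ly g1 Ao by simp
    also have "\<dots> = \<ominus>\<^bsub>M\<^esub> lincomb N x (out u)"
      unfolding Aeq[OF outc[OF u]] using lx(1)[OF outc[OF u]] by (simp add: smult_l_minus)
    finally have "lincomb n y (c u) = \<ominus>\<^bsub>M\<^esub> lincomb N x (out u)" .
    then show ?thesis unfolding f_def
      using lx(2)[OF outc[OF u] shc[OF cc[OF u]]] sh_eq[OF cc[OF u]] lx(1)[OF outc[OF u]] by (simp add: M.r_neg)
  qed
  have kf: "v \<in> f ` vecs R N" if v: "v \<in> vecs R N" and 0: "lincomb N x v = \<zero>\<^bsub>M\<^esub>" for v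
  proof -
    have Ao: "A (out v) \<in> vecs R n" using lA(1)[OF outc[OF v]] by simp
    \<comment> \<open>Replacing the outer generators in the relation \<open>v\<close> by their block
      expressions gives a relation of the block, hence G1 w for some w. The preimage of
      \<open>v\<close> has w as its block and the outer entries of \<open>v\<close>.\<close>
    let ?w = "vec_add R (un v) (A (out v))"
    have "lincomb n y ?w = lincomb N x (out v) \<oplus>\<^bsub>M\<^esub> lincomb N x (sh (un v))"
      using ly(2)[OF unc[OF v] Ao] Aeq[OF outc[OF v]] sh_eq[OF unc[OF v]]
        lx(1)[OF outc[OF v]] ly(1)[OF unc[OF v]] by (simp add: M.a_comm)
    also have "\<dots> = lincomb N x v" using lx(2)[OF outc[OF v] shc[OF unc[OF v]]] split[OF v] by simp
    finally have "?w \<in> ker n y" using 0 unc[OF v] Ao by (simp add: ker_def)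
    then obtain w where w: "w \<in> vecs R n" "?w = mat_vec R n G1 w" using G1(2) by blast
    define u where "u = vec_add R (out v) (sh w)"
    have u: "u \<in> vecs R N" using outc[OF v] shc[OF w(1)] by (simp add: u_def)
    have uo: "out u = out v"
      using R.vecs_carrier[OF outc[OF v]] by (auto simp: u_def out_def sh_def fun_eq_iff)
    have uu: "un u = w"
    proof
      fix j show "un u j = w j"
        using R.vecs_carrier[OF w(1), of j] R.vecs_zero[OF w(1), of j] by (auto simp: un_def u_def out_def sh_def)
    qed
    have "c u = un v"
    proof
      fix j
      have e: "mat_vec R n G1 w j = un v j \<oplus> A (out v) j" using fun_cong[OF w(2)] by simp
      have "un v j \<in> carrier R" "A (out v) j \<in> carrier R"
        using unc[OF v] Ao by (auto intro!: R.vecs_carrier[of _ n])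
      then show "c u j = un v j" unfolding c_def uo uu by (simp add: e R.l_minus R.a_assoc R.r_neg)
    qed
    then have "f u = v" using split[OF v] by (simp add: f_def uo)
    then show ?thesis using u by blast
  qed
  have "{v \<in> vecs R N. lincomb N x v = \<zero>\<^bsub>M\<^esub>} = mat_vec R N G ` vecs R N"
  proof (intro equalityI subsetI)
    fix v assume "v \<in> {v \<in> vecs R N. lincomb N x v = \<zero>\<^bsub>M\<^esub>}"
    then obtain u where "u \<in> vecs R N" "v = f u" using kf by blast
    then show "v \<in> mat_vec R N G ` vecs R N" using G by (metis imageI)
  next
    fix v assume "v \<in> mat_vec R N G ` vecs R N"
    then obtain u where "u \<in> vecs R N" "v = f u" using G by (metis (no_types, lifting) imageE)
    then show "v \<in> {v \<in> vecs R N. lincomb N x v = \<zero>\<^bsub>M\<^esub>}" using fk VN.linear_onD(1)[OF flin] by simp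
  qed
  moreover have "lincomb N x ` vecs R N = carrier M"
  proof
    show "lincomb N x ` vecs R N \<subseteq> carrier M" using lx(1) by blast
    show "carrier M \<subseteq> lincomb N x ` vecs R N"
    proof
      fix m assume "m \<in> carrier M"
      then obtain w where "w \<in> vecs R n" "m = lincomb n y w" using gy(2) by blast
      then show "m \<in> lincomb N x ` vecs R N" using sh_eq shc by (metis imageI)
    qed
  qed
  ultimately show ?thesis using x G unfolding presentations_def by blast
qed

end

section \<open>The measure of the matrices with a given cokernel\<close>

locale zp_fin_module = local_zp R p D mm + V: Module.module R M
  for R (structure) and p D mm and M (structure) +
  assumes fin: "finite (carrier M)"
begin

lemma one_minus_pip_unit: "0 < n \<Longrightarrow> \<one> \<ominus> pip n \<in> Units R"
proof -
  assume "0 < n"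
  then obtain i where "n = Suc i" by (cases n) auto
  then have "pip n \<in> mm" using p_in_mm by (simp add: mm.I_l_closed)
  then show ?thesis by (rule one_minus_mm_unit)
qed

text \<open>The powers of p give finitely many maps on \<open>M\<close>, so p^i and p^l agree on
  \<open>M\<close> for some i < l. Then (1 - p^(l-i)) p^i kills \<open>M\<close>, and the first
  factor is a unit.\<close>

lemma pip_kills: "\<exists>k. \<forall>x\<in>carrier M. pip k \<odot>\<^bsub>M\<^esub> x = \<zero>\<^bsub>M\<^esub>"
proof -
  let ?f = "\<lambda>i. restrict (\<lambda>x. pip i \<odot>\<^bsub>M\<^esub> x) (carrier M)"
  have "range ?f \<subseteq> carrier M \<rightarrow>\<^sub>E carrier M" by (auto simp: restrict_PiE_iff)
  then have "finite (range ?f)" using finite_PiE[OF fin, of "\<lambda>_. carrier M"] fin finite_subset by blast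
  then have "\<not> inj ?f" using finite_imageD by blast
  then obtain i l where il: "?f i = ?f l" "i < l" unfolding inj_def by (metis linorder_neqE_nat)
  have "pip i \<odot>\<^bsub>M\<^esub> x = \<zero>\<^bsub>M\<^esub>" if x: "x \<in> carrier M" for x
  proof -
    have eq: "pip i \<odot>\<^bsub>M\<^esub> x = pip l \<odot>\<^bsub>M\<^esub> x" using fun_cong[OF il(1), of x] x by simp
    define u where "u = \<one> \<ominus> pip (l - i)"
    have u: "u \<in> Units R" unfolding u_def using il by (intro one_minus_pip_unit) simp
    have uc: "u \<in> carrier R" using u by (rule Units_closed)
    have pl: "pip l = pip (l - i) \<otimes> pip i" using il pip_add[of "l - i" i] by simp
    have "u \<odot>\<^bsub>M\<^esub> (pip i \<odot>\<^bsub>M\<^esub> x) = pip i \<odot>\<^bsub>M\<^esub> x \<oplus>\<^bsub>M\<^esub> \<ominus>\<^bsub>M\<^esub> (pip l \<odot>\<^bsub>M\<^esub> x)"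
      unfolding u_def pl minus_eq using x by (simp add: V.smult_l_distr V.smult_l_minus V.smult_assoc1)
    also have "\<dots> = \<zero>\<^bsub>M\<^esub>" unfolding eq using x by (simp add: V.M.r_neg)
    finally have "inv u \<odot>\<^bsub>M\<^esub> (u \<odot>\<^bsub>M\<^esub> (pip i \<odot>\<^bsub>M\<^esub> x)) = \<zero>\<^bsub>M\<^esub>" using u by simp
    moreover have "inv u \<odot>\<^bsub>M\<^esub> (u \<odot>\<^bsub>M\<^esub> w) = w" if "w \<in> carrier M" for w
      using u uc that by (simp flip: V.smult_assoc1)
    ultimately show ?thesis using x by simp
  qed
  then show ?thesis by blast
qed

abbreviation tuples :: "nat \<Rightarrow> (nat \<Rightarrow> 'c) set" where "tuples N \<equiv> {..<N} \<rightarrow>\<^sub>E carrier M"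

lemma finite_tuples: "finite (tuples N)" by (intro finite_PiE) (auto simp: fin)

lemma card_tuples: "card (tuples N) = card (carrier M) ^ N" by (simp add: card_PiE)

lemma card_carrier_pos: "card (carrier M) > 0"
  using fin V.M.zero_closed by (auto simp: card_gt_0_iff)

lemma presentations_subset: "V.presentations N \<subseteq> tuples N" using V.presentationsD(1) by blast

lemma finite_presentations: "finite (V.presentations N)" using presentations_subset finite_tuples by (rule finite_subset)

text \<open>\<theta> maps a matrix to the images of its columns in \<open>M\<close>. It is additive,
  reaches all tuples by surjectivity, is locally constant since a power of p kills \<open>M\<close>,
  and its zero fibre is the event in question.\<close>

lemma measure_image_subset_ker:
  assumes haar: "is_haar R p N \<mu>" and x: "x \<in> tuples N" and sur: "V.lincomb N x ` vecs R N = carrier M"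
  shows "measure \<mu> {A \<in> mats R N. mat_vec R N A ` vecs R N \<subseteq> V.ker N x} = 1 / card (carrier M) ^ N"
proof -
  have xc: "x i \<in> carrier M" if "i < N" for i using PiE_mem[OF x, of i] that by simp
  have lin: "V.linear_on N (V.lincomb N x)" by (rule V.lincomb_linear) (rule xc)
  note l = V.linear_onD[OF lin]
  let ?\<phi> = "V.lincomb N x"
  define \<theta> where "\<theta> = (\<lambda>A. restrict (\<lambda>j. ?\<phi> (\<lambda>i. A i j)) {..<N})"
  define b0 where "b0 = restrict (\<lambda>j. \<zero>\<^bsub>M\<^esub>) {..<N}"
  have col: "(\<lambda>i. A i j) \<in> vecs R N" if "A \<in> mats R N" for A j
    using mats_carrier[OF that] mats_zero[OF that] by (simp add: vecs_def)
  obtain k where k: "\<And>x. x \<in> carrier M \<Longrightarrow> pip k \<odot>\<^bsub>M\<^esub> x = \<zero>\<^bsub>M\<^esub>" using pip_kills by blast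
  have add: "\<theta> (mat_add R A C) j = \<theta> A j \<oplus>\<^bsub>M\<^esub> \<theta> C j" if "A \<in> mats R N" "C \<in> mats R N" "j < N" for A C j
  proof -
    have "(\<lambda>i. mat_add R A C i j) = vec_add R (\<lambda>i. A i j) (\<lambda>i. C i j)" by (simp add: fun_eq_iff)
    then show ?thesis using that l(2)[OF col col, OF that(1,2)] by (simp add: \<theta>_def)
  qed
  have \<theta>c: "\<theta> A j \<in> carrier M" if "A \<in> mats R N" "j < N" for A j
    using that l(1)[OF col[OF that(1)]] by (simp add: \<theta>_def)
  have ext: "\<theta> A = b \<longleftrightarrow> (\<forall>j<N. \<theta> A j = b j)" if "b \<in> extensional {..<N}" for A b
    using that extensionalityI[of "\<theta> A" "{..<N}" b] by (auto simp: \<theta>_def)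
  have th_ext: "\<theta> A \<in> extensional {..<N}" for A by (simp add: \<theta>_def)
  have b0_ext: "b0 \<in> extensional {..<N}" by (simp add: b0_def)
  have b0_j: "b0 j = \<zero>\<^bsub>M\<^esub>" if "j < N" for j using that by (simp add: b0_def)
  have "measure \<mu> {A \<in> mats R N. \<theta> A = b0} = 1 / card (tuples N)"
  proof (rule measure_fiber[OF haar finite_tuples, where k = k and ?b0.0 = b0])
    show "\<theta> ` mats R N = tuples N"
    proof
      show "\<theta> ` mats R N \<subseteq> tuples N"
        unfolding \<theta>_def by (rule image_subsetI, unfold restrict_PiE_iff) (use l(1)[OF col] in blast)
      show "tuples N \<subseteq> \<theta> ` mats R N"
      proof
        fix b assume b: "b \<in> tuples N"
        have "\<exists>v. v \<in> vecs R N \<and> ?\<phi> v = b j" if "j < N" for j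
          using sur PiE_mem[OF b, of j] that by (metis (no_types, lifting) imageE lessThan_iff)
        then obtain v where v: "\<And>j. j < N \<Longrightarrow> v j \<in> vecs R N" "\<And>j. j < N \<Longrightarrow> ?\<phi> (v j) = b j" by metis
        define A where "A = (\<lambda>i j. if j < N then v j i else \<zero>)"
        have "A \<in> mats R N" by (rule matsI) (auto simp: A_def vecs_carrier[OF v(1)] vecs_zero[OF v(1)])
        moreover have "\<theta> A = b"
          using b v(2) by (subst ext) (auto simp: \<theta>_def A_def PiE_def)
        ultimately show "b \<in> \<theta> ` mats R N" by blast
      qed
    qed
    show "\<theta> C = \<theta> A" if A: "A \<in> mats R N" and C: "C \<in> pcoset R p N k A" for A C
    proof -
      obtain H where H: "H \<in> mats R N" "C = mat_add R A (mat_smult R (pip k) H)"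
        using C by (auto simp: pcoset_def mat_smult_def)
      have "\<theta> (mat_smult R (pip k) H) j = \<zero>\<^bsub>M\<^esub>" if "j < N" for j
      proof -
        have "(\<lambda>i. mat_smult R (pip k) H i j) = vec_smult R (pip k) (\<lambda>i. H i j)" by (simp add: mat_smult_def fun_eq_iff)
        then show ?thesis using l(3)[OF pip_closed col[OF H(1)]] k l(1)[OF col[OF H(1)]] that by (simp add: \<theta>_def)
      qed
      then show ?thesis unfolding ext[OF th_ext] H(2)
        using add[OF A mat_smult_closed[OF pip_closed H(1)]] \<theta>c[OF A] by simp
    qed
    show "\<theta> (mat_add R A C) = \<theta> A" if AC: "A \<in> mats R N" "C \<in> mats R N" "\<theta> C = b0" for A C
      unfolding ext[OF th_ext] using add[OF AC(1,2)] AC(3) \<theta>c[OF AC(1)] by (simp add: b0_j)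
    show "\<theta> C = b0" if AC: "A \<in> mats R N" "C \<in> mats R N" "\<theta> (mat_add R A C) = \<theta> A" for A C
      unfolding ext[OF b0_ext]
    proof (intro allI impI)
      fix j assume j: "j < N"
      have "\<theta> A j \<oplus>\<^bsub>M\<^esub> \<theta> C j = \<theta> A j" using add[OF AC(1,2) j] AC(3) by simp
      then show "\<theta> C j = b0 j" using \<theta>c[OF AC(1) j] \<theta>c[OF AC(2) j] b0_j[OF j]
        by (metis V.M.add.r_cancel_one V.M.a_comm)
    qed
    show "b0 \<in> tuples N" by (auto simp: b0_def)
    then show "b0 \<in> tuples N" .
  qed
  also have "{A \<in> mats R N. \<theta> A = b0} = {A \<in> mats R N. mat_vec R N A ` vecs R N \<subseteq> V.ker N x}"
  proof (intro Collect_cong conj_cong refl)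
    fix A assume A: "A \<in> mats R N"
    have linA: "V.linear_on N (\<lambda>v. ?\<phi> (mat_vec R N A v))"
      by (rule linear_comp[OF V.module_axioms lin linear_mat_vec[OF A]])
    have lin0: "V.linear_on N (\<lambda>v. \<zero>\<^bsub>M\<^esub>)" by (simp add: V.linear_on_def)
    have "\<theta> A = b0 \<longleftrightarrow> (\<forall>j<N. ?\<phi> (mat_vec R N A (unit_vec R j)) = \<zero>\<^bsub>M\<^esub>)"
      unfolding ext[OF b0_ext] using A by (simp add: b0_def \<theta>_def mat_vec_unit)
    also have "\<dots> \<longleftrightarrow> (\<forall>v\<in>vecs R N. ?\<phi> (mat_vec R N A v) = \<zero>\<^bsub>M\<^esub>)"
    proof
      assume u: "\<forall>j<N. ?\<phi> (mat_vec R N A (unit_vec R j)) = \<zero>\<^bsub>M\<^esub>"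
      show "\<forall>v\<in>vecs R N. ?\<phi> (mat_vec R N A v) = \<zero>\<^bsub>M\<^esub>"
      proof
        fix v assume v: "v \<in> vecs R N"
        show "?\<phi> (mat_vec R N A v) = \<zero>\<^bsub>M\<^esub>"
          by (rule linear_eqI[OF V.module_axioms linA lin0 _ v]) (use u in simp)
      qed
    qed simp
    also have "\<dots> \<longleftrightarrow> mat_vec R N A ` vecs R N \<subseteq> V.ker N x" using A by (auto simp: V.ker_def)
    finally show "\<theta> A = b0 \<longleftrightarrow> mat_vec R N A ` vecs R N \<subseteq> V.ker N x" .
  qed
  finally show ?thesis by (simp add: card_tuples)
qed

definition cN :: "nat \<Rightarrow> real" where
  "cN N = real (card (GL (residue_field R) N)) / real (card (mats (residue_field R) N))"

text \<open>Some p^k kills \<open>M\<close>, so p^k R^N lies in the kernel; this is the finite-index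
  condition of \<open>measure_image_eq\<close>.\<close>

lemma presentation_image:
  assumes haar: "is_haar R p N \<mu>" and x: "x \<in> V.presentations N"
  shows "padic_open N {A \<in> mats R N. V.ker N x = mat_vec R N A ` vecs R N}"
    "measure \<mu> {A \<in> mats R N. V.ker N x = mat_vec R N A ` vecs R N} = cN N / card (carrier M) ^ N"
proof -
  obtain G where G: "G \<in> mats R N" "V.ker N x = mat_vec R N G ` vecs R N" using V.presentationsD(3)[OF x] by blast
  obtain k where k: "\<And>x. x \<in> carrier M \<Longrightarrow> pip k \<odot>\<^bsub>M\<^esub> x = \<zero>\<^bsub>M\<^esub>" using pip_kills by blast
  note l = V.linear_onD[OF V.presentationsD(4)[OF x]]
  have kk: "vec_smult R (pip k) v \<in> mat_vec R N G ` vecs R N" if "v \<in> vecs R N" for v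
    unfolding G(2)[symmetric] V.ker_def using l(3)[OF pip_closed that] k l(1)[OF that] that by simp
  note m = measure_image_eq[OF haar G(1) kk, folded G(2)]
  have e: "{A \<in> mats R N. mat_vec R N A ` vecs R N = V.ker N x} = {A \<in> mats R N. V.ker N x = mat_vec R N A ` vecs R N}"
    by auto
  show "padic_open N {A \<in> mats R N. V.ker N x = mat_vec R N A ` vecs R N}" using m unfolding e by blast
  show "measure \<mu> {A \<in> mats R N. V.ker N x = mat_vec R N A ` vecs R N} = cN N / card (carrier M) ^ N"
    using m measure_image_subset_ker[OF haar V.presentationsD(1,2)[OF x]] unfolding e cN_def by simp
qed

lemma coker_iso_open: "is_haar R p N \<mu> \<Longrightarrow> padic_open N {G \<in> mats R N. coker_iso R N G M}"
proof -
  assume haar: "is_haar R p N \<mu>"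
  have "{G \<in> mats R N. coker_iso R N G M} = (\<Union>x\<in>V.presentations N. {A \<in> mats R N. V.ker N x = mat_vec R N A ` vecs R N})"
    using V.coker_iso_iff_presentation by auto
  then show ?thesis using presentation_image(1)[OF haar] by (simp add: padic_open_Un)
qed

lemma finite_aut: "finite (aut R M)" "card (aut R M) > 0"
proof -
  have "aut R M \<subseteq> carrier M \<rightarrow>\<^sub>E carrier M"
    by (auto simp: aut_def mod_linear_def PiE_def)
  then show f: "finite (aut R M)" using finite_PiE[OF fin, of "\<lambda>_. carrier M"] fin finite_subset by blast
  have "restrict id (carrier M) \<in> aut R M"
    by (auto simp: aut_def mod_linear_def intro!: bij_betwI[where g = id])
  then show "card (aut R M) > 0" using f by (auto simp: card_gt_0_iff)
qed

lemma measure_coker_iso: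
  assumes haar: "is_haar R p N \<mu>"
  shows "measure \<mu> {G \<in> mats R N. coker_iso R N G M} =
    cN N * (card (V.presentations N) / card (carrier M) ^ N) / card (aut R M)"
proof -
  interpret prob_space \<mu> using haar by (simp add: is_haar_def)
  define E where "E = (\<lambda>K. {A \<in> mats R N. K = mat_vec R N A ` vecs R N})"
  let ?K = "V.ker N ` V.presentations N"
  have un: "{G \<in> mats R N. coker_iso R N G M} = (\<Union>K\<in>?K. E K)"
    using V.coker_iso_iff_presentation by (auto simp: E_def)
  have Es: "E K \<in> sets \<mu>" if "K \<in> ?K" for K
    using that presentation_image(1)[OF haar] padic_open_sets[OF haar] by (auto simp: E_def)
  have "measure \<mu> (\<Union>K\<in>?K. E K) = (\<Sum>K\<in>?K. measure \<mu> (E K))"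
    using Es finite_presentations by (intro finite_measure_finite_Union) (auto simp: E_def disjoint_family_on_def)
  \<comment> \<open>Each kernel is shared by |Aut M| presentations, so this factor turns the sum
    over kernels into a sum over presentations.\<close>
  also have "real (card (aut R M)) * \<dots> = (\<Sum>K\<in>?K. \<Sum>x\<in>{x \<in> V.presentations N. V.ker N x = K}. measure \<mu> (E (V.ker N x)))"
  proof -
    have "real (card (aut R M)) * measure \<mu> (E K) = (\<Sum>x\<in>{x \<in> V.presentations N. V.ker N x = K}. measure \<mu> (E (V.ker N x)))"
      if "K \<in> ?K" for K
    proof -
      obtain x0 where x0: "x0 \<in> V.presentations N" "K = V.ker N x0" using \<open>K \<in> ?K\<close> by blast
      have "card {x \<in> V.presentations N. V.ker N x = K} = card (aut R M)"
        using bij_betw_same_card[OF V.card_aut_fiber[OF x0(1)]] x0(2) by simp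
      then show ?thesis by simp
    qed
    then show ?thesis unfolding sum_distrib_left by (rule sum.cong[OF refl])
  qed
  also have "\<dots> = (\<Sum>x\<in>V.presentations N. measure \<mu> (E (V.ker N x)))"
    by (rule sum.image_gen[OF finite_presentations, symmetric])
  also have "\<dots> = (\<Sum>x\<in>V.presentations N. cN N / card (carrier M) ^ N)"
    using presentation_image(2)[OF haar] by (intro sum.cong) (auto simp: E_def)
  finally have "measure \<mu> (\<Union>K\<in>?K. E K) * real (card (aut R M)) = cN N * (card (V.presentations N) / card (carrier M) ^ N)"
    by (simp add: mult.commute)
  then show ?thesis unfolding un using finite_aut(2) by (subst eq_divide_eq) auto
qed

text \<open>A tuple with a presentation as initial block is a presentation, so dropping the last
  entry of a bad tuple leaves a bad one. Hence the proportion of bad tuples does not increase with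
  N.\<close>

lemma bad_Suc: "card (tuples (Suc N) - V.presentations (Suc N)) \<le> card (tuples N - V.presentations N) * card (carrier M)"
proof -
  let ?h = "\<lambda>x. (restrict x {..<N}, x N)"
  have inj: "inj_on ?h (tuples (Suc N))"
  proof (rule inj_onI)
    fix x y assume xy: "x \<in> tuples (Suc N)" "y \<in> tuples (Suc N)" "?h x = ?h y"
    have "x i = y i" if "i < Suc N" for i
    proof (cases "i = N")
      case False
      then have "restrict x {..<N} i = restrict y {..<N} i" using xy(3) by simp
      then show ?thesis using False that by simp
    qed (use xy(3) in simp)
    then show "x = y" using xy(1,2) by (intro PiE_ext) auto
  qed
  have "?h ` (tuples (Suc N) - V.presentations (Suc N)) \<subseteq> (tuples N - V.presentations N) \<times> carrier M"
  proof (rule image_subsetI)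
    fix x assume x: "x \<in> tuples (Suc N) - V.presentations (Suc N)"
    then have xc: "x i \<in> carrier M" if "i < Suc N" for i using PiE_mem[of x "{..<Suc N}" "\<lambda>_. carrier M" i] that by simp
    have "restrict x {..<N} \<notin> V.presentations N"
      using V.presentation_block[of 0 N "Suc N" x] x by auto
    moreover have "restrict x {..<N} \<in> tuples N" unfolding restrict_PiE_iff using xc by simp
    ultimately show "?h x \<in> (tuples N - V.presentations N) \<times> carrier M" using xc by simp
  qed
  then have "card (tuples (Suc N) - V.presentations (Suc N)) \<le> card ((tuples N - V.presentations N) \<times> carrier M)"
    using inj_on_subset[OF inj] finite_tuples fin by (intro card_inj_on_le[of ?h]) auto
  then show ?thesis by (simp add: card_cartesian_product)
qed

text \<open>In a bad tuple the first N entries are bad and the last n are not the block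
  \<open>y\<close>. The two conditions concern disjoint sets of entries, which gives the product
  bound.\<close>

lemma bad_block:
  assumes y: "y \<in> V.presentations n"
  shows "card (tuples (N + n) - V.presentations (N + n)) \<le> card (tuples N - V.presentations N) * (card (carrier M) ^ n - 1)"
proof -
  let ?h = "\<lambda>x. (restrict x {..<N}, restrict (\<lambda>j. x (N + j)) {..<n})"
  have inj: "inj_on ?h (tuples (N + n))"
  proof (rule inj_onI)
    fix x z assume xz: "x \<in> tuples (N + n)" "z \<in> tuples (N + n)" "?h x = ?h z"
    have "x i = z i" if "i < N + n" for i
    proof (cases "i < N")
      case True
      then have "restrict x {..<N} i = restrict z {..<N} i" using xz(3) by simp
      then show ?thesis using True by simp
    next
      case False
      have "restrict (\<lambda>j. x (N + j)) {..<n} (i - N) = restrict (\<lambda>j. z (N + j)) {..<n} (i - N)" using xz(3) by simp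
      moreover have "i - N < n" "N + (i - N) = i" using False that by auto
      ultimately show ?thesis by simp
    qed
    then show "x = z" using xz(1,2) by (intro PiE_ext) auto
  qed
  have "?h ` (tuples (N + n) - V.presentations (N + n)) \<subseteq> (tuples N - V.presentations N) \<times> (tuples n - {y})"
  proof (rule image_subsetI)
    fix x assume x: "x \<in> tuples (N + n) - V.presentations (N + n)"
    then have xc: "x i \<in> carrier M" if "i < N + n" for i using PiE_mem[of x "{..<N + n}" "\<lambda>_. carrier M" i] that by simp
    have "restrict x {..<N} \<notin> V.presentations N"
      using V.presentation_block[of 0 N "N + n" x] x by auto
    moreover have "restrict (\<lambda>j. x (N + j)) {..<n} \<noteq> y"
      using V.presentation_block[of N n "N + n" x] x y by auto
    moreover have "restrict x {..<N} \<in> tuples N" unfolding restrict_PiE_iff using xc by simp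
    moreover have "restrict (\<lambda>j. x (N + j)) {..<n} \<in> tuples n" unfolding restrict_PiE_iff using xc by simp
    ultimately show "?h x \<in> (tuples N - V.presentations N) \<times> (tuples n - {y})" by simp
  qed
  then have "card (tuples (N + n) - V.presentations (N + n)) \<le> card ((tuples N - V.presentations N) \<times> (tuples n - {y}))"
    using inj_on_subset[OF inj] finite_tuples by (intro card_inj_on_le[of ?h]) auto
  also have "card (tuples n - {y}) = card (carrier M) ^ n - 1"
    using y presentations_subset finite_tuples by (subst card_Diff_singleton) (auto simp: card_tuples)
  ultimately show ?thesis by (simp add: card_cartesian_product)
qed

text \<open>The proportion b of tuples that are not presentations decreases to some l, and the block
  bound yields l \<le> l (1 - q^(-n)) in the limit, so l = 0.\<close>

lemma presentation_fraction_tendsto: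
  assumes y: "y \<in> V.presentations n"
  shows "(\<lambda>N. card (V.presentations N) / card (carrier M) ^ N) \<longlonglongrightarrow> 1"
proof -
  define q where "q = real (card (carrier M))"
  have q: "q \<ge> 1" using card_carrier_pos by (simp add: q_def)
  define b where "b = (\<lambda>N. card (tuples N - V.presentations N) / q ^ N)"
  have b0: "0 \<le> b N" for N using q by (simp add: b_def)
  have "b (Suc N) \<le> b N" for N
  proof -
    have "real (card (tuples (Suc N) - V.presentations (Suc N))) \<le> card (tuples N - V.presentations N) * q"
      using bad_Suc[of N] unfolding q_def by (metis of_nat_le_iff of_nat_mult)
    then show ?thesis using q by (simp add: b_def field_simps)
  qed
  then have "decseq b" by (rule decseq_SucI)
  then obtain l where l: "b \<longlonglongrightarrow> l" using decseq_convergent[OF \<open>decseq b\<close>, of 0] b0 by metis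
  have "b (N + n) \<le> b N * (1 - 1 / q ^ n)" for N
  proof -
    have "real (card (tuples (N + n) - V.presentations (N + n))) \<le> real (card (tuples N - V.presentations N) * (card (carrier M) ^ n - 1))"
      using bad_block[OF y, of N] by (simp only: of_nat_le_iff)
    also have "\<dots> = card (tuples N - V.presentations N) * (q ^ n - 1)"
      using card_carrier_pos by (simp add: q_def of_nat_diff Suc_leI)
    finally show ?thesis using q by (simp add: b_def field_simps power_add)
  qed
  moreover have "(\<lambda>N. b (N + n)) \<longlonglongrightarrow> l" using l by (rule LIMSEQ_ignore_initial_segment)
  moreover have "(\<lambda>N. b N * (1 - 1 / q ^ n)) \<longlonglongrightarrow> l * (1 - 1 / q ^ n)" using l by (intro tendsto_intros)
  ultimately have "l \<le> l * (1 - 1 / q ^ n)" by (intro LIMSEQ_le) auto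
  moreover have "l \<ge> 0" using l b0 by (intro LIMSEQ_le_const) auto
  moreover have "0 < 1 / q ^ n" using q by simp
  moreover have "l * (1 - 1 / q ^ n) = l - l * (1 / q ^ n)" by (simp add: right_diff_distrib)
  ultimately have "l * (1 / q ^ n) \<le> 0" by linarith
  then have "l = 0" using \<open>l \<ge> 0\<close> \<open>0 < 1 / q ^ n\<close> mult_pos_pos[of l "1 / q ^ n"] by linarith
  moreover have "card (V.presentations N) / card (carrier M) ^ N = 1 - b N" for N
  proof -
    have "card (V.presentations N) \<le> card (tuples N)" using presentations_subset finite_tuples by (rule card_mono[rotated])
    then have "real (card (tuples N - V.presentations N)) = q ^ N - card (V.presentations N)"
      using card_Diff_subset[OF finite_presentations presentations_subset, of N] by (simp add: of_nat_diff card_tuples q_def)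
    then show ?thesis using q by (simp add: b_def diff_divide_distrib q_def)
  qed
  ultimately show ?thesis using tendsto_diff[OF tendsto_const[of 1] l] by simp
qed

lemma presentation_fraction_le: "card (V.presentations N) / card (carrier M) ^ N \<le> 1"
proof -
  have "card (V.presentations N) \<le> card (tuples N)" using presentations_subset finite_tuples by (rule card_mono[rotated])
  then show ?thesis using card_carrier_pos by (simp add: card_tuples flip: of_nat_power)
qed

end

section \<open>Infinite sums\<close>

text \<open>Countable additivity for unordered sums. Finite partial sums are bounded by the measure
  of the union, and along an enumeration of \<open>I\<close> they exhaust it.\<close>

lemma (in finite_measure) has_sum_measure_UN:
  assumes I: "countable I" and X: "\<And>i. i \<in> I \<Longrightarrow> X i \<in> sets M" and disj: "disjoint_family_on X I"
  shows "((\<lambda>i. measure M (X i)) has_sum measure M (\<Union>i\<in>I. X i)) I"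
proof -
  let ?U = "\<Union>i\<in>I. X i"
  have U: "?U \<in> sets M" using I X by auto
  have fs: "(\<Sum>i\<in>F. measure M (X i)) = measure M (\<Union>i\<in>F. X i)" if "finite F" "F \<subseteq> I" for F
    using that X disj by (intro finite_measure_finite_Union[symmetric]) (auto intro: disjoint_family_on_mono)
  have le: "(\<Sum>i\<in>F. measure M (X i)) \<le> measure M ?U" if "finite F" "F \<subseteq> I" for F
    unfolding fs[OF that] using U that by (intro finite_measure_mono) auto
  have sm: "(\<lambda>i. measure M (X i)) summable_on I"
    by (rule nonneg_bdd_above_summable_on) (auto intro!: bdd_aboveI[of _ "measure M ?U"] le)
  have "infsum (\<lambda>i. measure M (X i)) I \<le> measure M ?U"
    using sm le by (rule infsum_le_finite_sums)
  moreover have "measure M ?U \<le> infsum (\<lambda>i. measure M (X i)) I"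
  proof (cases "I = {}")
    case False
    define F where "F = (\<lambda>n. from_nat_into I ` {..<n})"
    have F: "finite (F n)" "F n \<subseteq> I" for n using from_nat_into[OF False] by (auto simp: F_def)
    define A where "A = (\<lambda>n. \<Union>i\<in>F n. X i)"
    have "range A \<subseteq> sets M" using X F by (auto simp: A_def intro!: sets.finite_UN)
    moreover have "incseq A" by (force simp: incseq_def A_def F_def)
    ultimately have lim: "(\<lambda>n. measure M (A n)) \<longlonglongrightarrow> measure M (\<Union>n. A n)" by (rule finite_Lim_measure_incseq)
    have "?U \<subseteq> (\<Union>n. A n)"
    proof
      fix x assume "x \<in> ?U"
      then obtain i where i: "i \<in> I" "x \<in> X i" by blast
      obtain n where "i = from_nat_into I n" using i I by (metis from_nat_into_surj)
      then have "x \<in> A (Suc n)" using i by (auto simp: A_def F_def)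
      then show "x \<in> (\<Union>n. A n)" by blast
    qed
    moreover have "(\<Union>n. A n) \<subseteq> ?U" using F by (auto simp: A_def)
    ultimately have UA: "(\<Union>n. A n) = ?U" by blast
    have "measure M (A n) \<le> infsum (\<lambda>i. measure M (X i)) I" for n
      unfolding A_def fs[OF F, symmetric] using sm F by (intro finite_sum_le_infsum) auto
    then show ?thesis using lim unfolding UA by (intro LIMSEQ_le_const2) auto
  qed simp
  ultimately show ?thesis using sm has_sum_infsum by (metis antisym)
qed

text \<open>Dominated convergence for unordered sums: a finite set \<open>X\<close> carries the sum
  of \<open>w\<close> up to e/3; on \<open>X\<close> a finite sum converges, and outside
  \<open>X\<close> the tails of all sums involved are below e/3.\<close>

lemma infsum_tannery:
  fixes F :: "nat \<Rightarrow> 'a \<Rightarrow> real"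
  assumes bound: "\<And>N x. x \<in> A \<Longrightarrow> \<bar>F N x\<bar> \<le> w x" and w: "w summable_on A"
    and lim: "\<And>x. x \<in> A \<Longrightarrow> (\<lambda>N. F N x) \<longlonglongrightarrow> G x"
  shows "(\<lambda>N. infsum (F N) A) \<longlonglongrightarrow> infsum G A"
proof -
  have w0: "0 \<le> w x" if "x \<in> A" for x using bound[OF that, of 0] by linarith
  have G: "\<bar>G x\<bar> \<le> w x" if "x \<in> A" for x
    by (rule LIMSEQ_le_const2[OF tendsto_rabs[OF lim[OF that]]]) (use bound that in auto)
  have wa: "(\<lambda>x. norm (w x)) summable_on A" using w w0 by (subst summable_on_cong[of A _ w]) auto
  have abs: "(\<lambda>x. norm (f x)) summable_on A" if "\<And>x. x \<in> A \<Longrightarrow> \<bar>f x\<bar> \<le> w x" for f :: "'a \<Rightarrow> real"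
    using wa by (rule Infinite_Sum.abs_summable_on_comparison_test) (use that w0 in auto)
  have sm: "f summable_on A" if "\<And>x. x \<in> A \<Longrightarrow> \<bar>f x\<bar> \<le> w x" for f :: "'a \<Rightarrow> real"
    using abs[OF that] by (rule Infinite_Sum.abs_summable_summable)
  show ?thesis
  proof (rule LIMSEQ_I)
    fix e :: real assume e: "e > 0"
    have "((\<lambda>X. sum w X) \<longlongrightarrow> infsum w A) (finite_subsets_at_top A)" using w by (rule infsum_tendsto)
    then have "\<forall>\<^sub>F X in finite_subsets_at_top A. dist (sum w X) (infsum w A) < e / 3"
      using e by (intro tendstoD) auto
    then obtain X where X: "finite X" "X \<subseteq> A" "dist (sum w X) (infsum w A) < e / 3"
      unfolding eventually_finite_subsets_at_top by blast
    have split: "infsum f A = sum f X + infsum f (A - X)" if "f summable_on A" for f :: "'a \<Rightarrow> real"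
    proof -
      have "infsum f (X \<union> (A - X)) = infsum f X + infsum f (A - X)"
        using X that by (intro infsum_Un_disjoint) (auto intro: summable_on_subset_banach)
      then show ?thesis using X by (simp add: Un_absorb1)
    qed
    have tail: "\<bar>infsum f (A - X)\<bar> < e / 3" if f: "\<And>x. x \<in> A \<Longrightarrow> \<bar>f x\<bar> \<le> w x" for f :: "'a \<Rightarrow> real"
    proof -
      have s: "(\<lambda>x. norm (f x)) summable_on (A - X)" using abs[OF f] by (rule summable_on_subset_banach) auto
      have "\<bar>infsum f (A - X)\<bar> \<le> infsum (\<lambda>x. norm (f x)) (A - X)" using norm_infsum_bound[OF s] by simp
      also have "\<dots> \<le> infsum w (A - X)"
        using s w f by (intro infsum_mono) (auto intro: summable_on_subset_banach)
      also have "\<dots> < e / 3" using split[OF w] X(3) by (simp add: dist_real_def)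
      finally show ?thesis .
    qed
    have "(\<lambda>N. sum (F N) X) \<longlonglongrightarrow> sum G X" using X lim by (intro tendsto_sum) auto
    then obtain N0 where N0: "\<And>N. N \<ge> N0 \<Longrightarrow> \<bar>sum (F N) X - sum G X\<bar> < e / 3"
      using e LIMSEQ_D[of "\<lambda>N. sum (F N) X" "sum G X" "e / 3"] by auto
    have "norm (infsum (F N) A - infsum G A) < e" if "N \<ge> N0" for N
      using split[OF sm[of "F N", OF bound]] split[OF sm[of G, OF G]] tail[of "F N", OF bound] tail[of G, OF G] N0[OF that]
      unfolding real_norm_def by linarith
    then show "\<exists>N0. \<forall>N\<ge>N0. norm (infsum (F N) A - infsum G A) < e" by blast
  qed
qed

section \<open>Cokernels and isomorphism classes\<close>

text \<open>Transport of structure: every axiom of \<open>Q\<close> is the image under \<phi> of the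
  same axiom in \<open>R^N\<close>.\<close>

lemma module_surj_image:
  fixes R (structure) and Q (structure)
  assumes R: "cring R" and Q: "carrier Q = \<phi> ` vecs R N" "\<zero>\<^bsub>Q\<^esub> = \<phi> (\<lambda>i. \<zero>\<^bsub>R\<^esub>)"
    and add: "\<And>u v. u \<in> vecs R N \<Longrightarrow> v \<in> vecs R N \<Longrightarrow> \<phi> u \<oplus>\<^bsub>Q\<^esub> \<phi> v = \<phi> (vec_add R u v)"
    and sm: "\<And>r v. r \<in> carrier R \<Longrightarrow> v \<in> vecs R N \<Longrightarrow> r \<odot>\<^bsub>Q\<^esub> \<phi> v = \<phi> (vec_smult R r v)"
  shows "Module.module R Q"
proof -
  interpret cring R by (rule R)
  interpret V: Module.module R "vec_mod R N" by (rule module_vec_mod)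
  note Va = V.M.a_assoc V.M.a_comm V.smult_l_distr V.smult_r_distr V.smult_assoc1
  show ?thesis
  proof (rule moduleI[OF R])
    show "abelian_group Q"
    proof (rule abelian_groupI)
      fix x y z assume x: "x \<in> carrier Q" and y: "y \<in> carrier Q" and z: "z \<in> carrier Q"
      show "x \<oplus>\<^bsub>Q\<^esub> y \<oplus>\<^bsub>Q\<^esub> z = x \<oplus>\<^bsub>Q\<^esub> (y \<oplus>\<^bsub>Q\<^esub> z)"
        using x y z V.M.a_assoc by (auto simp: Q(1) add)
    next
      fix x y assume x: "x \<in> carrier Q" and y: "y \<in> carrier Q"
      show "x \<oplus>\<^bsub>Q\<^esub> y \<in> carrier Q" using x y by (auto simp: Q(1) add)
      show "x \<oplus>\<^bsub>Q\<^esub> y = y \<oplus>\<^bsub>Q\<^esub> x" using x y V.M.a_comm by (auto simp: Q(1) add)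
    next
      show "\<zero>\<^bsub>Q\<^esub> \<in> carrier Q" by (auto simp: Q)
      fix x assume x: "x \<in> carrier Q"
      then obtain v where v: "v \<in> vecs R N" "x = \<phi> v" by (auto simp: Q(1))
      show "\<zero>\<^bsub>Q\<^esub> \<oplus>\<^bsub>Q\<^esub> x = x" using v V.M.l_zero[of v] by (simp add: Q(2) add)
      let ?w = "\<ominus>\<^bsub>vec_mod R N\<^esub> v"
      have "?w \<in> vecs R N" using V.M.a_inv_closed[of v] v by simp
      then show "\<exists>y\<in>carrier Q. y \<oplus>\<^bsub>Q\<^esub> x = \<zero>\<^bsub>Q\<^esub>"
        using v V.M.l_neg[of v] by (intro bexI[of _ "\<phi> ?w"]) (auto simp: Q add)
    qed
  next
    fix a x assume "a \<in> carrier R" "x \<in> carrier Q"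
    then show "a \<odot>\<^bsub>Q\<^esub> x \<in> carrier Q" by (auto simp: Q(1) sm)
  next
    fix a b x assume ab: "a \<in> carrier R" "b \<in> carrier R" and "x \<in> carrier Q"
    then obtain v where v: "v \<in> vecs R N" "x = \<phi> v" by (auto simp: Q(1))
    show "(a \<oplus> b) \<odot>\<^bsub>Q\<^esub> x = a \<odot>\<^bsub>Q\<^esub> x \<oplus>\<^bsub>Q\<^esub> b \<odot>\<^bsub>Q\<^esub> x"
      using ab v V.smult_l_distr[OF ab, of v] by (simp add: sm add)
    show "a \<otimes> b \<odot>\<^bsub>Q\<^esub> x = a \<odot>\<^bsub>Q\<^esub> (b \<odot>\<^bsub>Q\<^esub> x)"
      using ab v V.smult_assoc1[OF ab, of v] by (simp add: sm)
  next
    fix a x y assume a: "a \<in> carrier R" and "x \<in> carrier Q" "y \<in> carrier Q"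
    then obtain u v where v: "u \<in> vecs R N" "x = \<phi> u" "v \<in> vecs R N" "y = \<phi> v" by (auto simp: Q(1))
    show "a \<odot>\<^bsub>Q\<^esub> (x \<oplus>\<^bsub>Q\<^esub> y) = a \<odot>\<^bsub>Q\<^esub> x \<oplus>\<^bsub>Q\<^esub> a \<odot>\<^bsub>Q\<^esub> y"
      using a v V.smult_r_distr[OF a, of u v] by (simp add: sm add)
  next
    fix x assume "x \<in> carrier Q"
    then obtain v where v: "v \<in> vecs R N" "x = \<phi> v" by (auto simp: Q(1))
    show "\<one> \<odot>\<^bsub>Q\<^esub> x = x" using v V.smult_one[of v] by (simp add: sm)
  qed
qed

section \<open>The cokernel as a module of cosets\<close>

definition coker_coset :: "('a, 'b) ring_scheme \<Rightarrow> nat \<Rightarrow> (nat \<Rightarrow> nat \<Rightarrow> 'a) \<Rightarrow> (nat \<Rightarrow> 'a) \<Rightarrow> (nat \<Rightarrow> 'a) set" where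
  "coker_coset R N G v = {w \<in> vecs R N. \<exists>u\<in>vecs R N. w = vec_add R v (mat_vec R N G u)}"

text \<open>The operations have to be given on cosets as sets, hence the chosen representatives. The
  type is that of the modules from which the isomorphism classes are formed, so the cokernel itself
  can be a member of a class.\<close>

definition coker_mod :: "('a, 'b) ring_scheme \<Rightarrow> nat \<Rightarrow> (nat \<Rightarrow> nat \<Rightarrow> 'a) \<Rightarrow> 'a rmod" where
  "coker_mod R N G = (let rep = (\<lambda>X. SOME v. v \<in> vecs R N \<and> coker_coset R N G v = X) in
     \<lparr>carrier = coker_set R N G, monoid.mult = (\<lambda>X Y. X), monoid.one = {},
      ring.zero = coker_coset R N G (\<lambda>i. \<zero>\<^bsub>R\<^esub>),
      ring.add = (\<lambda>X Y. coker_coset R N G (vec_add R (rep X) (rep Y))),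
      module.smult = (\<lambda>r X. coker_coset R N G (vec_smult R r (rep X)))\<rparr>)"

lemma coker_set_eq: "coker_set R N G = coker_coset R N G ` vecs R N"
  by (simp add: coker_set_def coker_coset_def)

lemma (in Module.module) coker_isoD:
  assumes "coker_iso R N G M"
  shows "\<exists>\<phi>. linear_on N \<phi> \<and> \<phi> ` vecs R N = carrier M \<and> {v \<in> vecs R N. \<phi> v = \<zero>\<^bsub>M\<^esub>} = mat_vec R N G ` vecs R N"
proof -
  obtain \<phi> where \<phi>: "\<phi> ` vecs R N = carrier M"
     "\<forall>u\<in>vecs R N. \<forall>v\<in>vecs R N. \<phi> (vec_add R u v) = \<phi> u \<oplus>\<^bsub>M\<^esub> \<phi> v"
     "\<forall>r\<in>carrier R. \<forall>v\<in>vecs R N. \<phi> (vec_smult R r v) = r \<odot>\<^bsub>M\<^esub> \<phi> v"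
     "{v \<in> vecs R N. \<phi> v = \<zero>\<^bsub>M\<^esub>} = mat_vec R N G ` vecs R N" using assms by (auto simp: coker_iso_def)
  then have "linear_on N \<phi>" by (auto simp: linear_on_def)
  then show ?thesis using \<phi> by blast
qed

context cring begin

lemma coker_coset_eq_iff:
  assumes G: "G \<in> mats R N" and u: "u \<in> vecs R N" and v: "v \<in> vecs R N"
  shows "coker_coset R N G u = coker_coset R N G v \<longleftrightarrow> (\<lambda>i. u i \<ominus> v i) \<in> mat_vec R N G ` vecs R N"
proof -
  interpret V: Module.module R "vec_mod R N" by (rule module_vec_mod)
  note uc = vecs_carrier[OF u] and vc = vecs_carrier[OF v]
  have sub: "submodule (mat_vec R N G ` vecs R N) R (vec_mod R N)"
    by (rule V.submodule_range[OF linear_mat_vec[OF G]])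
  have self: "u \<in> coker_coset R N G u" if "u \<in> vecs R N" for u
    using that G vecs_carrier[OF that] by (auto simp: coker_coset_def fun_eq_iff intro!: bexI[of _ "\<lambda>i. \<zero>"])
  have *: "coker_coset R N G u \<subseteq> coker_coset R N G v"
    if u: "u \<in> vecs R N" and v: "v \<in> vecs R N" and d: "(\<lambda>i. u i \<ominus> v i) \<in> mat_vec R N G ` vecs R N" for u v
  proof
    fix w assume "w \<in> coker_coset R N G u"
    then obtain a where a: "w \<in> vecs R N" "a \<in> vecs R N" "w = vec_add R u (mat_vec R N G a)" by (auto simp: coker_coset_def)
    obtain b where b: "b \<in> vecs R N" "(\<lambda>i. u i \<ominus> v i) = mat_vec R N G b" using d by blast
    have "w = vec_add R v (mat_vec R N G (vec_add R b a))"
    proof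
      fix i
      have c: "u i \<in> carrier R" "v i \<in> carrier R" "mat_vec R N G a i \<in> carrier R"
        using u v a G by (auto intro!: vecs_carrier[of _ N])
      have "mat_vec R N G b i = u i \<ominus> v i" using fun_cong[OF b(2), of i] by simp
      moreover have "v i \<oplus> ((u i \<ominus> v i) \<oplus> mat_vec R N G a i) = u i \<oplus> mat_vec R N G a i"
        using c by algebra
      ultimately show "w i = vec_add R v (mat_vec R N G (vec_add R b a)) i"
        using a b G by (simp add: mat_vec_add)
    qed
    then show "w \<in> coker_coset R N G v" using a b unfolding coker_coset_def by (metis (mono_tags, lifting) mem_Collect_eq vec_add_closed)
  qed
  show ?thesis
  proof
    assume "coker_coset R N G u = coker_coset R N G v"
    then have "u \<in> coker_coset R N G v" using self[OF u] by simp
    then obtain a where a: "a \<in> vecs R N" "u = vec_add R v (mat_vec R N G a)" by (auto simp: coker_coset_def)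
    have "(\<lambda>i. u i \<ominus> v i) = mat_vec R N G a"
    proof
      fix i
      have c: "v i \<in> carrier R" "mat_vec R N G a i \<in> carrier R"
        using v a G by (auto intro!: vecs_carrier[of _ N])
      have "u i = v i \<oplus> mat_vec R N G a i" using fun_cong[OF a(2), of i] by simp
      moreover have "(v i \<oplus> mat_vec R N G a i) \<ominus> v i = mat_vec R N G a i" using c by algebra
      ultimately show "u i \<ominus> v i = mat_vec R N G a i" by simp
    qed
    then show "(\<lambda>i. u i \<ominus> v i) \<in> mat_vec R N G ` vecs R N" using a by blast
  next
    assume d: "(\<lambda>i. u i \<ominus> v i) \<in> mat_vec R N G ` vecs R N"
    have "(\<lambda>i. v i \<ominus> u i) = vec_smult R (\<ominus> \<one>) (\<lambda>i. u i \<ominus> v i)"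
    proof
      fix i
      have "v i \<ominus> u i = (\<ominus> \<one>) \<otimes> (u i \<ominus> v i)" using uc[of i] vc[of i] by algebra
      then show "v i \<ominus> u i = vec_smult R (\<ominus> \<one>) (\<lambda>i. u i \<ominus> v i) i" by simp
    qed
    then have "(\<lambda>i. v i \<ominus> u i) \<in> mat_vec R N G ` vecs R N"
      using V.submoduleE(4)[OF sub, of "\<ominus> \<one>"] d by simp
    then show "coker_coset R N G u = coker_coset R N G v" using *[OF u v d] *[OF v u] by blast
  qed
qed

lemma coker_mod_ops:
  assumes G: "G \<in> mats R N"
  shows "carrier (coker_mod R N G) = coker_coset R N G ` vecs R N"
    "\<zero>\<^bsub>coker_mod R N G\<^esub> = coker_coset R N G (\<lambda>i. \<zero>)"
    "\<And>u v. u \<in> vecs R N \<Longrightarrow> v \<in> vecs R N \<Longrightarrow>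
      coker_coset R N G u \<oplus>\<^bsub>coker_mod R N G\<^esub> coker_coset R N G v = coker_coset R N G (vec_add R u v)"
    "\<And>r v. r \<in> carrier R \<Longrightarrow> v \<in> vecs R N \<Longrightarrow>
      r \<odot>\<^bsub>coker_mod R N G\<^esub> coker_coset R N G v = coker_coset R N G (vec_smult R r v)"
proof -
  interpret V: Module.module R "vec_mod R N" by (rule module_vec_mod)
  have sub: "submodule (mat_vec R N G ` vecs R N) R (vec_mod R N)"
    by (rule V.submodule_range[OF linear_mat_vec[OF G]])
  show "carrier (coker_mod R N G) = coker_coset R N G ` vecs R N" "\<zero>\<^bsub>coker_mod R N G\<^esub> = coker_coset R N G (\<lambda>i. \<zero>)"
    by (simp_all add: coker_mod_def Let_def coker_set_eq)
  define rep where "rep = (\<lambda>X. SOME v. v \<in> vecs R N \<and> coker_coset R N G v = X)"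
  have rep: "rep (coker_coset R N G v) \<in> vecs R N \<and> coker_coset R N G (rep (coker_coset R N G v)) = coker_coset R N G v" if v: "v \<in> vecs R N" for v
  proof -
    have "\<exists>u. u \<in> vecs R N \<and> coker_coset R N G u = coker_coset R N G v" using v by blast
    from someI_ex[OF this] show ?thesis by (simp add: rep_def)
  qed
  have repd: "(\<lambda>i. rep (coker_coset R N G v) i \<ominus> v i) \<in> mat_vec R N G ` vecs R N" if "v \<in> vecs R N" for v
    using rep[OF that] coker_coset_eq_iff[OF G _ that] by blast
  {
    fix u v assume u: "u \<in> vecs R N" and v: "v \<in> vecs R N"
    let ?a = "rep (coker_coset R N G u)" and ?b = "rep (coker_coset R N G v)"
    note c = vecs_carrier[OF u] vecs_carrier[OF v] vecs_carrier[OF conjunct1[OF rep[OF u]]] vecs_carrier[OF conjunct1[OF rep[OF v]]]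
    have "(\<lambda>i. vec_add R ?a ?b i \<ominus> vec_add R u v i) = vec_add R (\<lambda>i. ?a i \<ominus> u i) (\<lambda>i. ?b i \<ominus> v i)"
    proof
      fix i
      have "(?a i \<oplus> ?b i) \<ominus> (u i \<oplus> v i) = (?a i \<ominus> u i) \<oplus> (?b i \<ominus> v i)"
        using c(1)[of i] c(2)[of i] c(3)[of i] c(4)[of i] by algebra
      then show "vec_add R ?a ?b i \<ominus> vec_add R u v i = vec_add R (\<lambda>i. ?a i \<ominus> u i) (\<lambda>i. ?b i \<ominus> v i) i" by simp
    qed
    then have "(\<lambda>i. vec_add R ?a ?b i \<ominus> vec_add R u v i) \<in> mat_vec R N G ` vecs R N"
      using V.submoduleE(5)[OF sub repd[OF u] repd[OF v]] by simp
    then have "coker_coset R N G (vec_add R ?a ?b) = coker_coset R N G (vec_add R u v)"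
      using rep[OF u] rep[OF v] u v by (subst coker_coset_eq_iff[OF G]) auto
    then show "coker_coset R N G u \<oplus>\<^bsub>coker_mod R N G\<^esub> coker_coset R N G v = coker_coset R N G (vec_add R u v)"
      by (simp add: coker_mod_def Let_def rep_def)
  }
  {
    fix r v assume r: "r \<in> carrier R" and v: "v \<in> vecs R N"
    let ?b = "rep (coker_coset R N G v)"
    note c = vecs_carrier[OF v] vecs_carrier[OF conjunct1[OF rep[OF v]]]
    have "(\<lambda>i. vec_smult R r ?b i \<ominus> vec_smult R r v i) = vec_smult R r (\<lambda>i. ?b i \<ominus> v i)"
    proof
      fix i
      have "(r \<otimes> ?b i) \<ominus> (r \<otimes> v i) = r \<otimes> (?b i \<ominus> v i)" using c(1)[of i] c(2)[of i] r by algebra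
      then show "vec_smult R r ?b i \<ominus> vec_smult R r v i = vec_smult R r (\<lambda>i. ?b i \<ominus> v i) i" by simp
    qed
    then have "(\<lambda>i. vec_smult R r ?b i \<ominus> vec_smult R r v i) \<in> mat_vec R N G ` vecs R N"
      using V.submoduleE(4)[OF sub r repd[OF v]] by simp
    then have "coker_coset R N G (vec_smult R r ?b) = coker_coset R N G (vec_smult R r v)"
      using rep[OF v] r v by (subst coker_coset_eq_iff[OF G]) auto
    then show "r \<odot>\<^bsub>coker_mod R N G\<^esub> coker_coset R N G v = coker_coset R N G (vec_smult R r v)"
      by (simp add: coker_mod_def Let_def rep_def)
  }
qed

lemma module_coker_mod: "G \<in> mats R N \<Longrightarrow> Module.module R (coker_mod R N G)"
  by (rule module_surj_image[where \<phi> = "coker_coset R N G" and N = N]) (simp_all add: coker_mod_ops is_cring)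

lemma coker_iso_coker_mod:
  assumes G: "G \<in> mats R N" shows "coker_iso R N G (coker_mod R N G)"
proof -
  have "coker_coset R N G v = coker_coset R N G (\<lambda>i. \<zero>) \<longleftrightarrow> v \<in> mat_vec R N G ` vecs R N" if v: "v \<in> vecs R N" for v
  proof -
    have "(\<lambda>i. v i \<ominus> \<zero>) = v" using vecs_carrier[OF v] by (simp add: fun_eq_iff minus_eq)
    then show ?thesis using coker_coset_eq_iff[OF G v vec_zero_closed] by simp
  qed
  then have "{v \<in> vecs R N. coker_coset R N G v = \<zero>\<^bsub>coker_mod R N G\<^esub>} = mat_vec R N G ` vecs R N"
    unfolding coker_mod_ops(2)[OF G] using mat_vec_closed[OF G] by blast
  then show ?thesis unfolding coker_iso_def
    using G by (intro exI[of _ "coker_coset R N G"]) (simp add: coker_mod_ops)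
qed

lemma coker_iso_unique:
  assumes M: "Module.module R M" "Module.module R M'" and G: "G \<in> mats R N"
    and c: "coker_iso R N G M" "coker_iso R N G M'"
  shows "mod_iso R M M'"
proof -
  interpret M: Module.module R M by fact
  interpret M': Module.module R M' by fact
  obtain \<phi> where \<phi>: "\<phi> ` vecs R N = carrier M" "{v \<in> vecs R N. \<phi> v = \<zero>\<^bsub>M\<^esub>} = mat_vec R N G ` vecs R N"
    and lin: "M.linear_on N \<phi>" using M.coker_isoD[OF c(1)] by blast
  obtain \<psi> where \<psi>: "\<psi> ` vecs R N = carrier M'" "{v \<in> vecs R N. \<psi> v = \<zero>\<^bsub>M'\<^esub>} = mat_vec R N G ` vecs R N"
    and lin': "M'.linear_on N \<psi>" using M'.coker_isoD[OF c(2)] by blast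
  show ?thesis
    using induced_iso[OF M lin lin' \<phi>(1) \<psi>(1)] \<phi>(2) \<psi>(2) unfolding mod_iso_def by blast
qed

lemma mod_iso_coker:
  assumes M: "Module.module R M" "Module.module R M'" and iso: "mod_iso R M M'" and c: "coker_iso R N G M"
  shows "coker_iso R N G M'"
proof -
  interpret M: Module.module R M by fact
  interpret M': Module.module R M' by fact
  obtain \<alpha> where al: "mod_linear R M M' \<alpha>" "bij_betw \<alpha> (carrier M) (carrier M')" using iso by (auto simp: mod_iso_def)
  obtain \<phi> where \<phi>: "\<phi> ` vecs R N = carrier M" "{v \<in> vecs R N. \<phi> v = \<zero>\<^bsub>M\<^esub>} = mat_vec R N G ` vecs R N"
    and lin: "M.linear_on N \<phi>" using M.coker_isoD[OF c] by blast
  note l = M.linear_onD[OF lin]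
  have a0: "\<alpha> \<zero>\<^bsub>M\<^esub> = \<zero>\<^bsub>M'\<^esub>"
  proof -
    have "\<alpha> (\<zero> \<odot>\<^bsub>M\<^esub> \<zero>\<^bsub>M\<^esub>) = \<zero> \<odot>\<^bsub>M'\<^esub> \<alpha> \<zero>\<^bsub>M\<^esub>" using al(1) unfolding mod_linear_def by blast
    moreover have "\<alpha> \<zero>\<^bsub>M\<^esub> \<in> carrier M'" using al(1) by (auto simp: mod_linear_def)
    ultimately show ?thesis by simp
  qed
  have "(\<lambda>v. \<alpha> (\<phi> v)) ` vecs R N = \<alpha> ` (\<phi> ` vecs R N)" by (simp add: image_image)
  then have "(\<lambda>v. \<alpha> (\<phi> v)) ` vecs R N = carrier M'" using \<phi>(1) al(2) by (simp add: bij_betw_def)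
  moreover have "\<alpha> (\<phi> v) = \<zero>\<^bsub>M'\<^esub> \<longleftrightarrow> \<phi> v = \<zero>\<^bsub>M\<^esub>" if "v \<in> vecs R N" for v
    using a0 bij_betw_imp_inj_on[OF al(2)] l(1)[OF that] M.M.zero_closed by (metis inj_onD)
  then have "{v \<in> vecs R N. \<alpha> (\<phi> v) = \<zero>\<^bsub>M'\<^esub>} = mat_vec R N G ` vecs R N" using \<phi>(2) by blast
  moreover have "\<alpha> (\<phi> (vec_add R u v)) = \<alpha> (\<phi> u) \<oplus>\<^bsub>M'\<^esub> \<alpha> (\<phi> v)" if "u \<in> vecs R N" "v \<in> vecs R N" for u v
    using l that al(1) by (simp add: mod_linear_def)
  moreover have "\<alpha> (\<phi> (vec_smult R r v)) = r \<odot>\<^bsub>M'\<^esub> \<alpha> (\<phi> v)" if "r \<in> carrier R" "v \<in> vecs R N" for r v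
    using l that al(1) by (simp add: mod_linear_def)
  ultimately show ?thesis unfolding coker_iso_def by (intro exI[of _ "\<lambda>v. \<alpha> (\<phi> v)"]) blast
qed

section \<open>Isomorphism classes of finite modules\<close>

lemma mod_iso_refl: "mod_iso R M M"
  unfolding mod_iso_def by (rule exI[of _ id]) (simp add: mod_linear_def)

lemma mod_iso_trans: "mod_iso R M M' \<Longrightarrow> mod_iso R M' M'' \<Longrightarrow> mod_iso R M M''"
proof -
  assume "mod_iso R M M'" "mod_iso R M' M''"
  then obtain \<alpha> \<beta> where ab: "mod_linear R M M' \<alpha>" "bij_betw \<alpha> (carrier M) (carrier M')"
     "mod_linear R M' M'' \<beta>" "bij_betw \<beta> (carrier M') (carrier M'')" by (auto simp: mod_iso_def)
  have "bij_betw (\<beta> \<circ> \<alpha>) (carrier M) (carrier M'')" using ab by (auto intro: bij_betw_trans)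
  moreover have "mod_linear R M M'' (\<beta> \<circ> \<alpha>)" using ab(1,3) by (auto simp: mod_linear_def image_subset_iff)
  ultimately show ?thesis unfolding mod_iso_def by blast
qed

lemma mod_iso_sym:
  assumes M: "Module.module R M" and iso: "mod_iso R M M'" shows "mod_iso R M' M"
proof -
  interpret M: Module.module R M by fact
  obtain \<alpha> where al: "mod_linear R M M' \<alpha>" "bij_betw \<alpha> (carrier M) (carrier M')" using iso by (auto simp: mod_iso_def)
  define \<beta> where "\<beta> = the_inv_into (carrier M) \<alpha>"
  have inj: "inj_on \<alpha> (carrier M)" and im: "\<alpha> ` carrier M = carrier M'" using al(2) by (auto simp: bij_betw_def)
  have b: "\<beta> y \<in> carrier M" "\<alpha> (\<beta> y) = y" if "y \<in> carrier M'" for y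
    using the_inv_into_into[OF inj, of y "carrier M"] f_the_inv_into_f[OF inj, of y] that im by (auto simp: \<beta>_def)
  have ba: "\<beta> (\<alpha> x) = x" if "x \<in> carrier M" for x using the_inv_into_f_f[OF inj that] by (simp add: \<beta>_def)
  have "bij_betw \<beta> (carrier M') (carrier M)" unfolding \<beta>_def using al(2) by (rule bij_betw_the_inv_into)
  moreover have "mod_linear R M' M \<beta>"
    unfolding mod_linear_def
  proof (intro conjI ballI)
    show "\<beta> ` carrier M' \<subseteq> carrier M" using b by blast
    fix x y assume xy: "x \<in> carrier M'" "y \<in> carrier M'"
    have "\<alpha> (\<beta> x \<oplus>\<^bsub>M\<^esub> \<beta> y) = x \<oplus>\<^bsub>M'\<^esub> y" using al(1) b xy by (simp add: mod_linear_def)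
    then show "\<beta> (x \<oplus>\<^bsub>M'\<^esub> y) = \<beta> x \<oplus>\<^bsub>M\<^esub> \<beta> y" using ba[of "\<beta> x \<oplus>\<^bsub>M\<^esub> \<beta> y"] b xy by simp
  next
    fix r x assume rx: "r \<in> carrier R" "x \<in> carrier M'"
    have "\<alpha> (r \<odot>\<^bsub>M\<^esub> \<beta> x) = r \<odot>\<^bsub>M'\<^esub> x" using al(1) b rx by (simp add: mod_linear_def)
    then show "\<beta> (r \<odot>\<^bsub>M'\<^esub> x) = r \<odot>\<^bsub>M\<^esub> \<beta> x" using ba[of "r \<odot>\<^bsub>M\<^esub> \<beta> x"] b rx by simp
  qed
  ultimately show ?thesis unfolding mod_iso_def by blast
qed

lemma iso_class_eq:
  assumes "fin_module R M" "fin_module R M0" "M \<in> iso_class R M0"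
  shows "iso_class R M = iso_class R M0"
proof -
  have "mod_iso R M0 M" "mod_iso R M M0"
    using assms mod_iso_sym by (auto simp: iso_class_def fin_module_def)
  then have "mod_iso R M X \<longleftrightarrow> mod_iso R M0 X" for X :: "'a rmod"
    using mod_iso_trans[of M M0 X] mod_iso_trans[of M0 M X] by blast
  then show ?thesis by (simp add: iso_class_def)
qed

lemma S_classesD:
  assumes "C \<in> S_classes R" "M \<in> C"
  shows "fin_module R M" "C = iso_class R M"
proof -
  obtain M0 :: "'a rmod" where M0: "fin_module R M0" "C = iso_class R M0" using assms by (auto simp: S_classes_def)
  show f: "fin_module R M" using assms M0 by (simp add: iso_class_def)
  show "C = iso_class R M" using iso_class_eq[OF f M0(1)] assms M0 by simp
qed

text \<open>Isomorphic modules are cokernels of the same matrices, so the event attached to a class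
  can be tested on any of its members, and the formula for a single module applies.\<close>

lemma S_classes_coker_iso_iff:
  assumes C: "C \<in> S_classes R" "M \<in> C"
  shows "(\<exists>M\<in>C. coker_iso R N G M) \<longleftrightarrow> coker_iso R N G M"
proof
  assume "\<exists>M\<in>C. coker_iso R N G M"
  then obtain M' where M': "M' \<in> C" "coker_iso R N G M'" by blast
  note f = S_classesD[OF C] and f' = S_classesD[OF C(1) M'(1)]
  have "M \<in> iso_class R M'" using C f' by simp
  then have "mod_iso R M' M" by (simp add: iso_class_def)
  then show "coker_iso R N G M" using mod_iso_coker M' f(1) f'(1) by (auto simp: fin_module_def)
qed (use C in blast)

lemma S_classes_nonempty:
  assumes "C \<in> S_classes R" shows "\<exists>M. M \<in> C"
proof -
  obtain M0 :: "'a rmod" where "fin_module R M0" "C = iso_class R M0" using assms by (auto simp: S_classes_def)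
  then have "M0 \<in> C" using mod_iso_refl by (simp add: iso_class_def)
  then show ?thesis by blast
qed

lemma S_classes_disjoint:
  assumes C: "C \<in> S_classes R" "C' \<in> S_classes R" and G: "G \<in> mats R N"
    and "\<exists>M\<in>C. coker_iso R N G M" "\<exists>M\<in>C'. coker_iso R N G M"
  shows "C = C'"
proof -
  obtain M M' where M: "M \<in> C" "coker_iso R N G M" "M' \<in> C'" "coker_iso R N G M'" using assms by blast
  note f = S_classesD[OF C(1) M(1)] and f' = S_classesD[OF C(2) M(3)]
  have "mod_iso R M M'" using coker_iso_unique[OF _ _ G M(2,4)] f f' by (simp add: fin_module_def)
  then have "M' \<in> iso_class R M" using f'(1) by (simp add: iso_class_def)
  then show ?thesis using iso_class_eq[OF f'(1) f(1)] f f' by simp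
qed

text \<open>A finite cokernel is its own witness, as \<open>coker_mod\<close> has the right type.
  Conversely the cokernel is isomorphic to a member of a class and hence finite.\<close>

lemma finite_coker_iff:
  assumes G: "G \<in> mats R N"
  shows "finite (coker_set R N G) \<longleftrightarrow> (\<exists>C\<in>S_classes R. \<exists>M\<in>C. coker_iso R N G M)"
proof
  assume f: "finite (coker_set R N G)"
  let ?M = "coker_mod R N G"
  have fm: "fin_module R ?M"
    using f module_coker_mod[OF G] G by (simp add: fin_module_def coker_mod_ops coker_set_eq)
  then have "iso_class R ?M \<in> S_classes R" "?M \<in> iso_class R ?M"
    using mod_iso_refl by (auto simp: S_classes_def iso_class_def)
  then show "\<exists>C\<in>S_classes R. \<exists>M\<in>C. coker_iso R N G M" using coker_iso_coker_mod[OF G] by blast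
next
  assume "\<exists>C\<in>S_classes R. \<exists>M\<in>C. coker_iso R N G M"
  then obtain C M where C: "C \<in> S_classes R" "M \<in> C" "coker_iso R N G M" by blast
  note f = S_classesD(1)[OF C(1,2)]
  have "mod_iso R M (coker_mod R N G)"
    using coker_iso_unique[OF _ module_coker_mod[OF G] G C(3) coker_iso_coker_mod[OF G]] f by (simp add: fin_module_def)
  then obtain \<alpha> where "bij_betw \<alpha> (carrier M) (carrier (coker_mod R N G))" by (auto simp: mod_iso_def)
  then have "finite (carrier (coker_mod R N G))" using f bij_betw_finite by (auto simp: fin_module_def)
  then show "finite (coker_set R N G)" using G by (simp add: coker_mod_ops coker_set_eq)
qed

end

section \<open>Infinite cokernels form a null set\<close>

context local_zp begin

lemma vec_residues:
  "\<exists>S. finite S \<and> S \<subseteq> vecs R N \<and> card S \<le> (p ^ (k * D)) ^ N \<and>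
    (\<forall>v\<in>vecs R N. \<exists>s\<in>S. \<exists>b\<in>vecs R N. v = vec_add R s (vec_smult R (pip k) b))"
proof -
  obtain S where S: "finite S" "S \<subseteq> carrier R" "card S \<le> p ^ (k * D)"
    "\<forall>r\<in>carrier R. \<exists>s\<in>S. \<exists>x\<in>carrier R. r = s \<oplus> pip k \<otimes> x"
    using residues[of k] by blast
  let ?mk = "\<lambda>f i. if i < N then f i else \<zero>"
  let ?S = "?mk ` ({..<N} \<rightarrow>\<^sub>E S)"
  have "card ?S \<le> card ({..<N} \<rightarrow>\<^sub>E S)" by (rule card_image_le) (auto intro!: finite_PiE S)
  also have "\<dots> \<le> (p ^ (k * D)) ^ N" using S(3) by (simp add: card_PiE power_mono)
  finally have "card ?S \<le> (p ^ (k * D)) ^ N" .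
  moreover have "finite ?S" by (intro finite_imageI finite_PiE) (auto simp: S)
  moreover have "?S \<subseteq> vecs R N"
  proof (rule image_subsetI)
    fix f assume f: "f \<in> {..<N} \<rightarrow>\<^sub>E S"
    then have "f i \<in> carrier R" if "i < N" for i using PiE_mem[OF f, of i] that S(2) by auto
    then show "?mk f \<in> vecs R N" by (simp add: vecs_def)
  qed
  moreover have "\<exists>s\<in>?S. \<exists>b\<in>vecs R N. v = vec_add R s (vec_smult R (pip k) b)" if v: "v \<in> vecs R N" for v
  proof -
    have "\<forall>i. \<exists>s x. s \<in> S \<and> x \<in> carrier R \<and> v i = s \<oplus> pip k \<otimes> x" using S(4) vecs_carrier[OF v] by blast
    then obtain s x where sx: "\<And>i. s i \<in> S" "\<And>i. x i \<in> carrier R" "\<And>i. v i = s i \<oplus> pip k \<otimes> x i" by metis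
    let ?f = "restrict s {..<N}" and ?b = "\<lambda>i. if i < N then x i else \<zero>"
    have "?f \<in> {..<N} \<rightarrow>\<^sub>E S" unfolding restrict_PiE_iff using sx by simp
    moreover have "?b \<in> vecs R N" using sx by (simp add: vecs_def)
    moreover have "v = vec_add R (?mk ?f) (vec_smult R (pip k) ?b)"
      using sx(3) vecs_zero[OF v] by (intro ext) (simp add: not_less)
    ultimately show ?thesis by (intro bexI[of _ "?mk ?f"] bexI[of _ ?b] imageI)
  qed
  ultimately show ?thesis by (intro exI[of _ ?S] conjI ballI)
qed

lemma class_open:
  assumes haar: "is_haar R p N \<mu>" and C: "C \<in> S_classes R"
  shows "padic_open N {G \<in> mats R N. \<exists>M\<in>C. coker_iso R N G M}"
proof -
  obtain M where M: "M \<in> C" using S_classes_nonempty[OF C] by blast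
  then have "fin_module R M" using S_classesD[OF C] by simp
  then interpret M: zp_fin_module R p D mm M
    by (intro zp_fin_module.intro zp_fin_module_axioms.intro local_zp_axioms) (auto simp: fin_module_def)
  show ?thesis using M.coker_iso_open[OF haar] by (simp add: S_classes_coker_iso_iff[OF C M])
qed

text \<open>Suppose that p^i R^N lies in the image of \<open>H\<close> plus p^(i+1) R^N. The vectors
  v with p^i v in the image form a submodule that covers R^N modulo p, so Nakayama's lemma puts all
  of p^i R^N into the image. Finitely many residues modulo p^i then represent all cosets.\<close>

lemma strict_if_infinite_coker:
  assumes G: "G \<in> mats R N" and H: "H \<in> mats R N"
    and sh: "\<And>v. v \<in> vecs R N \<Longrightarrow> mat_vec R N H v = zp_endo.shift R (vec_mod R N) (mat_vec R N G) t v"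
    and inf: "infinite (coker_set R N H)"
  shows "zp_endo.strict R p (vec_mod R N) (mat_vec R N G) t"
proof (rule ccontr)
  interpret E: zp_endo R p D mm "vec_mod R N" "mat_vec R N G"
    by (intro zp_endo.intro zp_endo_axioms.intro local_zp_axioms module_vec_mod)
      (use G in \<open>auto simp: mat_vec_add mat_vec_smult\<close>)
  note sh = sh[folded E.shift_def]
  assume "\<not> E.strict t"
  then obtain i where i: "\<And>a. a \<in> vecs R N \<Longrightarrow> vec_smult R (pip i) a \<in> E.img t (Suc i)"
    by (auto simp: E.strict_def)
  let ?I = "mat_vec R N H ` vecs R N"
  have subI: "submodule ?I R (vec_mod R N)" by (rule E.V.submodule_range[OF linear_mat_vec[OF H]])
  define L where "L = {v \<in> vecs R N. vec_smult R (pip i) v \<in> ?I}"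
  have "submodule L R (vec_mod R N)"
  proof (rule E.V.submoduleI)
    show "L \<subseteq> carrier (vec_mod R N)" by (auto simp: L_def)
    show "\<zero>\<^bsub>vec_mod R N\<^esub> \<in> L"
      using E.V.submodule_zero[OF subI] by (simp add: L_def vec_smult_def)
    show "a \<oplus>\<^bsub>vec_mod R N\<^esub> b \<in> L" if "a \<in> L" "b \<in> L" for a b
    proof -
      have ab: "a \<in> vecs R N" "b \<in> vecs R N" "vec_smult R (pip i) a \<in> ?I" "vec_smult R (pip i) b \<in> ?I"
        using that by (auto simp: L_def)
      have "vec_smult R (pip i) (vec_add R a b) = vec_add R (vec_smult R (pip i) a) (vec_smult R (pip i) b)"
        using E.V.smult_r_distr[of "pip i" a b] ab by simp
      then show ?thesis using ab E.V.submoduleE(5)[OF subI ab(3,4)] by (simp add: L_def)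
    qed
    show sm: "r \<odot>\<^bsub>vec_mod R N\<^esub> b \<in> L" if "r \<in> carrier R" "b \<in> L" for r b
    proof -
      have b: "b \<in> vecs R N" "vec_smult R (pip i) b \<in> ?I" using that by (auto simp: L_def)
      have "vec_smult R (pip i) (vec_smult R r b) = vec_smult R r (vec_smult R (pip i) b)"
        using E.V.smult_assoc1[of "pip i" r b] E.V.smult_assoc1[of r "pip i" b] b that by (simp add: m_comm)
      then show ?thesis using b that E.V.submoduleE(4)[OF subI that(1) b(2)] by (simp add: L_def)
    qed
    show "\<ominus>\<^bsub>vec_mod R N\<^esub> a \<in> L" if "a \<in> L" for a
    proof -
      have "a \<in> vecs R N" using that by (simp add: L_def)
      then have "\<ominus>\<^bsub>vec_mod R N\<^esub> a = (\<ominus> \<one>) \<odot>\<^bsub>vec_mod R N\<^esub> a"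
        using E.V.smult_l_minus[of \<one> a] E.V.smult_one[of a] by simp
      then show ?thesis using sm[of "\<ominus> \<one>" a] that by simp
    qed
  qed
  then have "L = vecs R N"
  proof (rule nakayama_vecs)
    fix v assume v: "v \<in> vecs R N"
    obtain a b where ab: "a \<in> vecs R N" "b \<in> vecs R N"
        "vec_smult R (pip i) v = vec_add R (mat_vec R N H a) (vec_smult R (pip (Suc i)) b)"
      using i[OF v] sh by (auto simp: E.img_def)
    \<comment> \<open>From p^i v = H a + p^(i+1) b follows p^i (v - p b) = H a, so v - p b is in
      \<open>L\<close>.\<close>
    define l where "l = vec_add R v (vec_smult R (\<ominus> ([p] \<cdot> \<one>)) b)"
    have l: "l \<in> vecs R N" using v ab by (simp add: l_def)
    have "vec_smult R (pip i) l = mat_vec R N H a"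
    proof
      fix k
      have c: "v k \<in> carrier R" "b k \<in> carrier R" "mat_vec R N H a k \<in> carrier R"
        using v ab H by (auto intro!: vecs_carrier[of _ N])
      have e: "pip i \<otimes> v k = mat_vec R N H a k \<oplus> pip i \<otimes> [p] \<cdot> \<one> \<otimes> b k"
        using fun_cong[OF ab(3), of k] by simp
      define q where "q = [p] \<cdot> \<one>"
      define s where "s = pip i"
      have qs: "q \<in> carrier R" "s \<in> carrier R" by (auto simp: q_def s_def)
      have "s \<otimes> (v k \<oplus> \<ominus> q \<otimes> b k) = s \<otimes> v k \<ominus> s \<otimes> q \<otimes> b k" using c qs by algebra
      also have "\<dots> = (mat_vec R N H a k \<oplus> s \<otimes> q \<otimes> b k) \<ominus> s \<otimes> q \<otimes> b k" using e by (simp add: q_def s_def)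
      also have "\<dots> = mat_vec R N H a k" using c qs by algebra
      finally show "vec_smult R (pip i) l k = mat_vec R N H a k" by (simp add: l_def q_def s_def)
    qed
    then have "l \<in> L" using l ab by (auto simp: L_def)
    moreover have "(\<lambda>k. v k \<ominus> l k) \<in> mvecs R mm N"
    proof -
      have "v k \<ominus> l k = [p] \<cdot> \<one> \<otimes> b k" for k
      proof -
        define q where "q = [p] \<cdot> \<one>"
        have "q \<in> carrier R" by (simp add: q_def)
        then have "v k \<ominus> (v k \<oplus> \<ominus> q \<otimes> b k) = q \<otimes> b k"
          using vecs_carrier[OF v, of k] vecs_carrier[OF ab(2), of k] by algebra
        then show ?thesis by (simp add: l_def q_def)
      qed
      then have "(\<lambda>k. v k \<ominus> l k) = vec_smult R ([p] \<cdot> \<one>) b" by (simp add: fun_eq_iff)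
      then show ?thesis using ab(2) vecs_carrier[OF ab(2)] p_in_mm by (auto simp: mvecs_def mm.I_r_closed)
    qed
    ultimately show "\<exists>l\<in>L. (\<lambda>i. v i \<ominus> l i) \<in> mvecs R mm N" by blast
  qed
  then have pI: "vec_smult R (pip i) v \<in> ?I" if "v \<in> vecs R N" for v using that by (auto simp: L_def)
  obtain S where S: "finite S" "S \<subseteq> vecs R N" "\<forall>v\<in>vecs R N. \<exists>s\<in>S. \<exists>b\<in>vecs R N. v = vec_add R s (vec_smult R (pip i) b)"
    using vec_residues[of N i] by blast
  have "coker_coset R N H ` vecs R N \<subseteq> coker_coset R N H ` S"
  proof
    fix X assume "X \<in> coker_coset R N H ` vecs R N"
    then obtain v where v: "v \<in> vecs R N" "X = coker_coset R N H v" by blast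
    then obtain s b where s: "s \<in> S" "b \<in> vecs R N" "v = vec_add R s (vec_smult R (pip i) b)" using S(3) by blast
    have sv: "s \<in> vecs R N" using s S by blast
    have "(\<lambda>k. v k \<ominus> s k) = vec_smult R (pip i) b"
    proof
      fix k
      have "vec_smult R (pip i) b k \<in> carrier R" using vecs_carrier[OF s(2), of k] by simp
      then have "(s k \<oplus> vec_smult R (pip i) b k) \<ominus> s k = vec_smult R (pip i) b k"
        using vecs_carrier[OF sv, of k] by algebra
      then show "v k \<ominus> s k = vec_smult R (pip i) b k" unfolding s(3) by simp
    qed
    then have "coker_coset R N H v = coker_coset R N H s" using coker_coset_eq_iff[OF H v(1) sv] pI[OF s(2)] by simp
    then show "X \<in> coker_coset R N H ` S" using v s by blast
  qed
  then have "finite (coker_set R N H)" using S(1) unfolding coker_set_eq by (rule finite_subset[OF _ finite_imageI])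
  then show False using inf by simp
qed

text \<open>The bound does not depend on \<open>G\<close>, so it holds pointwise when the number of
  such shifts is integrated over all matrices.\<close>

lemma card_infinite_coker_le:
  assumes G: "G \<in> mats R N" and T: "finite T"
    and inf: "\<And>t::nat. t \<in> T \<Longrightarrow> infinite (coker_set R N (mat_add R (mat_smult R ([t] \<cdot> \<one>) (mat_one R N)) G))"
  shows "card T \<le> (p ^ D) ^ N"
proof -
  interpret E: zp_endo R p D mm "vec_mod R N" "mat_vec R N G"
    by (intro zp_endo.intro zp_endo_axioms.intro local_zp_axioms module_vec_mod)
      (use G in \<open>auto simp: mat_vec_add mat_vec_smult\<close>)
  have "card (int ` T) \<le> (p ^ D) ^ N"
  proof (rule E.card_strict_le)
    fix J
    obtain S where "finite S" "S \<subseteq> vecs R N" "card S \<le> (p ^ (J * D)) ^ N"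
       "\<forall>v\<in>vecs R N. \<exists>s\<in>S. \<exists>b\<in>vecs R N. v = vec_add R s (vec_smult R (pip J) b)"
      using vec_residues[of N J] by blast
    then show "\<exists>S\<subseteq>carrier (vec_mod R N). finite S \<and> card S \<le> ((p ^ D) ^ N) ^ J \<and>
       (\<forall>v\<in>carrier (vec_mod R N). \<exists>s\<in>S. \<exists>b\<in>carrier (vec_mod R N). v = s \<oplus>\<^bsub>vec_mod R N\<^esub> pip J \<odot>\<^bsub>vec_mod R N\<^esub> b)"
      by (intro exI[of _ S]) (auto simp: mult_ac simp flip: power_mult)
  next
    fix t' assume "t' \<in> int ` T"
    then obtain t where t: "t \<in> T" "t' = int t" by blast
    let ?H = "mat_add R (mat_smult R ([t] \<cdot> \<one>) (mat_one R N)) G"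
    show "E.strict t'"
    proof (rule strict_if_infinite_coker[OF G _ _ inf[OF t(1)]])
      show "?H \<in> mats R N" using G by simp
      fix v assume v: "v \<in> vecs R N"
      show "mat_vec R N ?H v = E.shift t' v"
        using G v E.V.M.a_comm[of "mat_vec R N G v" "vec_smult R ([t] \<cdot> \<one>) v"]
        by (simp add: E.shift_def mat_vec_mat_add mat_vec_mat_smult t(2) of_nat_int)
    qed
  qed (use T in simp)
  then show ?thesis by (simp add: card_image)
qed

lemma finite_coker_open:
  assumes haar: "is_haar R p N \<mu>"
  shows "padic_open N {G \<in> mats R N. finite (coker_set R N G)}"
proof -
  have "{G \<in> mats R N. finite (coker_set R N G)} = (\<Union>C\<in>S_classes R. {G \<in> mats R N. \<exists>M\<in>C. coker_iso R N G M})"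
    using finite_coker_iff by auto
  moreover have "padic_open N {G \<in> mats R N. \<exists>M\<in>C. coker_iso R N G M}" if "C \<in> S_classes R" for C
    using class_open[OF haar that] .
  ultimately show ?thesis by (simp add: padic_open_Un)
qed

lemma infinite_coker_null:
  assumes haar: "is_haar R p N \<mu>"
  shows "{G \<in> mats R N. infinite (coker_set R N G)} \<in> sets \<mu>"
    "emeasure \<mu> {G \<in> mats R N. infinite (coker_set R N G)} = 0"
proof -
  interpret prob_space \<mu> using haar by (simp add: is_haar_def)
  let ?Z = "{G \<in> mats R N. infinite (coker_set R N G)}"
  have sp: "space \<mu> = mats R N" using haar by (simp add: is_haar_def)
  have "{G \<in> mats R N. finite (coker_set R N G)} \<in> sets \<mu>"
    by (rule padic_open_sets[OF haar finite_coker_open[OF haar]])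
  then have "space \<mu> - {G \<in> mats R N. finite (coker_set R N G)} \<in> sets \<mu>" by (rule sets.compl_sets)
  moreover have "space \<mu> - {G \<in> mats R N. finite (coker_set R N G)} = ?Z" using sp by auto
  ultimately show Z: "?Z \<in> sets \<mu>" by simp
  define A where "A = (\<lambda>t::nat. mat_smult R ([t] \<cdot> \<one>) (mat_one R N))"
  have A: "A t \<in> mats R N" for t by (simp add: A_def)
  define Zt where "Zt = (\<lambda>t. mat_add R (mat_neg (A t)) ` ?Z)"
  have Zt_iff: "G \<in> Zt t \<longleftrightarrow> G \<in> mats R N \<and> mat_add R (A t) G \<in> ?Z" for G t
  proof
    assume "G \<in> Zt t"
    then obtain H where "H \<in> ?Z" "G = mat_add R (mat_neg (A t)) H" by (auto simp: Zt_def)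
    then show "G \<in> mats R N \<and> mat_add R (A t) G \<in> ?Z" using A[of t] by (simp add: mat_add_neg_cancel')
  next
    assume G: "G \<in> mats R N \<and> mat_add R (A t) G \<in> ?Z"
    then have "G = mat_add R (mat_neg (A t)) (mat_add R (A t) G)" using A[of t] by (simp add: mat_add_neg_cancel)
    then show "G \<in> Zt t" using G unfolding Zt_def by blast
  qed
  have Zts: "Zt t \<in> sets \<mu>" for t
  proof -
    have "\<forall>A\<in>mats R N. \<forall>E\<in>sets \<mu>. mat_add R A ` E \<in> sets \<mu>" using haar unfolding is_haar_def by blast
    then show ?thesis unfolding Zt_def using Z mat_neg_closed[OF A] by blast
  qed
  have mZt: "measure \<mu> (Zt t) = measure \<mu> ?Z" for t
    unfolding Zt_def by (rule measure_translate[OF haar _ Z]) (simp add: A)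
  have ind: "integrable \<mu> (indicator (Zt t) :: _ \<Rightarrow> real)" for t
    using Zts by (intro integrable_real_indicator) (auto simp: less_top[symmetric])
  \<comment> \<open>Integrates the number of t < n for which the shift of G by t has an infinite
    cokernel. The integrand is bounded pointwise, while each of the n terms integrates to the
    measure of \<open>?Z\<close>.\<close>
  have "real n * measure \<mu> ?Z \<le> real ((p ^ D) ^ N)" for n
  proof -
    have "(\<Sum>t<n. indicator (Zt t) G :: real) \<le> real ((p ^ D) ^ N)" if G: "G \<in> space \<mu>" for G
    proof -
      have "(\<Sum>t<n. indicator (Zt t) G :: real) = card {t \<in> {..<n}. G \<in> Zt t}"
        by (simp add: indicator_def sum.If_cases Int_def)
      moreover have "card {t \<in> {..<n}. G \<in> Zt t} \<le> (p ^ D) ^ N"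
        using G sp by (intro card_infinite_coker_le[of G N]) (auto simp: Zt_iff A_def)
      ultimately show ?thesis by (simp only: of_nat_le_iff)
    qed
    then have ae: "AE G in \<mu>. (\<Sum>t<n. indicator (Zt t) G :: real) \<le> real ((p ^ D) ^ N)" by (rule AE_I2)
    have int: "integrable \<mu> (\<lambda>G. \<Sum>t<n. indicator (Zt t) G :: real)"
      by (rule Bochner_Integration.integrable_sum) (rule ind)
    have "expectation (\<lambda>G. \<Sum>t<n. indicator (Zt t) G :: real) \<le> real ((p ^ D) ^ N)"
      by (rule integral_le_const[OF int ae])
    also have "expectation (\<lambda>G. \<Sum>t<n. indicator (Zt t) G :: real) = (\<Sum>t<n. measure \<mu> (Zt t))"
    proof -
      have "expectation (\<lambda>G. \<Sum>t<n. indicator (Zt t) G :: real) = (\<Sum>t<n. expectation (indicator (Zt t)))"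
        by (rule Bochner_Integration.integral_sum) (rule ind)
      moreover have "expectation (indicator (Zt t)) = measure \<mu> (Zt t)" for t
        using sets.sets_into_space[OF Zts[of t]] by (simp add: Int_absorb2)
      ultimately show ?thesis by simp
    qed
    finally show ?thesis by (simp add: mZt)
  qed
  note bound = this
  have "measure \<mu> ?Z \<le> 0"
  proof (rule ccontr)
    assume "\<not> measure \<mu> ?Z \<le> 0"
    then obtain n where "real ((p ^ D) ^ N) < real n * measure \<mu> ?Z"
      using reals_Archimedean3[of "measure \<mu> ?Z"] by (auto simp: not_le)
    then show False using bound[of n] by linarith
  qed
  then show "emeasure \<mu> ?Z = 0" by (simp add: emeasure_eq_measure measure_le_0_iff)
qed

end

section \<open>Convergence of the cokernel distributions\<close>

context local_zp begin

text \<open>Each class that occurs has a nonempty open event, which contains one of the countably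
  many cosets. Events of different classes are disjoint, so for each N this coset determines the
  class.\<close>

lemma countable_coker_classes:
  assumes haar: "\<And>N. is_haar R p N (\<mu> N)"
  shows "countable {C \<in> S_classes R. \<exists>N. \<exists>G\<in>mats R N. \<exists>M\<in>C. coker_iso R N G M}" (is "countable ?T")
proof -
  define E :: "nat \<Rightarrow> 'a rmod set \<Rightarrow> (nat \<Rightarrow> nat \<Rightarrow> 'a) set" where "E = (\<lambda>N C. {G \<in> mats R N. \<exists>M\<in>C. coker_iso R N G M})"
  have "countable {C \<in> S_classes R. E N C \<noteq> {}}" for N
  proof -
    let ?A = "{C \<in> S_classes R. E N C \<noteq> {}}"
    have "\<exists>P k A. P = pcoset R p N k A \<and> A \<in> mats R N \<and> A \<in> P \<and> P \<subseteq> E N C"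
      if C: "C \<in> ?A" for C
    proof -
      obtain A where A: "A \<in> E N C" using C by blast
      have "padic_open N (E N C)" using class_open[OF haar] C by (simp add: E_def)
      then obtain k where "pcoset R p N k A \<subseteq> E N C" using A by (auto simp: padic_open_def)
      moreover have "A \<in> mats R N" using A by (simp add: E_def)
      ultimately show ?thesis using pcoset_self by blast
    qed
    then have "\<forall>C\<in>?A. \<exists>P k A. P = pcoset R p N k A \<and> A \<in> mats R N \<and> A \<in> P \<and> P \<subseteq> E N C" by blast
    from bchoice[OF this] obtain P where
      "\<forall>C\<in>?A. \<exists>k A. P C = pcoset R p N k A \<and> A \<in> mats R N \<and> A \<in> P C \<and> P C \<subseteq> E N C" ..
    then have P: "\<exists>k A. P C = pcoset R p N k A \<and> A \<in> mats R N \<and> A \<in> P C \<and> P C \<subseteq> E N C" if "C \<in> ?A" for C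
      using that by (rule bspec)
    have "inj_on P ?A"
    proof (rule inj_onI)
      fix C C' assume C: "C \<in> ?A" "C' \<in> ?A" "P C = P C'"
      obtain A where A: "A \<in> P C" "A \<in> E N C" using P[OF C(1)] by blast
      have "A \<in> E N C'" using A(1) P[OF C(2)] C(3) by auto
      then show "C = C'" using S_classes_disjoint[of C C' A N] A C by (auto simp: E_def)
    qed
    moreover have "P ` ?A \<subseteq> {pcoset R p N k A | k A. A \<in> mats R N}" using P by blast
    then have "countable (P ` ?A)" using countable_pcosets countable_subset by blast
    ultimately show "countable ?A" using countable_image_inj_on by blast
  qed
  then have "countable (\<Union>N. {C \<in> S_classes R. E N C \<noteq> {}})" by simp
  moreover have "?T \<subseteq> (\<Union>N. {C \<in> S_classes R. E N C \<noteq> {}})" unfolding E_def by blast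
  ultimately show ?thesis using countable_subset by blast
qed

text \<open>Countable additivity is applied to the countably many classes that occur as cokernels
  for some N; on all other classes the event is empty. The union of the events is the complement of
  the null set of infinite cokernels.\<close>

lemma has_sum_coker_measure:
  assumes haar: "\<And>N. is_haar R p N (\<mu> N)"
  shows "((\<lambda>C. measure (\<mu> N) {G \<in> mats R N. \<exists>M\<in>C. coker_iso R N G M}) has_sum 1) (S_classes R)"
proof -
  interpret prob_space "\<mu> N" using haar[of N] by (simp add: is_haar_def)
  let ?T = "{C \<in> S_classes R. \<exists>N. \<exists>G\<in>mats R N. \<exists>M\<in>C. coker_iso R N G M}"
  define E :: "'a rmod set \<Rightarrow> (nat \<Rightarrow> nat \<Rightarrow> 'a) set" where "E = (\<lambda>C. {G \<in> mats R N. \<exists>M\<in>C. coker_iso R N G M})"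
  have Es: "E C \<in> sets (\<mu> N)" if "C \<in> S_classes R" for C
    unfolding E_def by (rule padic_open_sets[OF haar class_open[OF haar that]])
  have "disjoint_family_on E ?T"
    unfolding disjoint_family_on_def E_def using S_classes_disjoint by blast
  then have hs: "((\<lambda>C. measure (\<mu> N) (E C)) has_sum measure (\<mu> N) (\<Union>C\<in>?T. E C)) ?T"
    using countable_coker_classes[OF haar] Es by (intro has_sum_measure_UN) auto
  let ?Z = "{G \<in> mats R N. infinite (coker_set R N G)}"
  note Z = infinite_coker_null[OF haar[of N]]
  have "(\<Union>C\<in>?T. E C) = space (\<mu> N) - ?Z"
  proof -
    have sp: "space (\<mu> N) = mats R N" using haar[of N] by (simp add: is_haar_def)
    show ?thesis
    proof (rule Set.set_eqI)
      fix G
      show "G \<in> (\<Union>C\<in>?T. E C) \<longleftrightarrow> G \<in> space (\<mu> N) - ?Z"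
      proof (cases "G \<in> mats R N")
        case True
        then have "(\<exists>C\<in>?T. \<exists>M\<in>C. coker_iso R N G M) \<longleftrightarrow> (\<exists>C\<in>S_classes R. \<exists>M\<in>C. coker_iso R N G M)"
          by (intro iffI) (elim bexE, (auto)[1], blast)
        then show ?thesis using True finite_coker_iff[OF True] by (simp add: sp E_def)
      next
        case False
        then show ?thesis by (simp add: sp E_def)
      qed
    qed
  qed
  then have "measure (\<mu> N) (\<Union>C\<in>?T. E C) = 1"
    using prob_compl[OF Z(1)] Z(2) by (simp add: measure_def)
  then have "((\<lambda>C. measure (\<mu> N) (E C)) has_sum 1) ?T" using hs by simp
  moreover have "measure (\<mu> N) (E C) = 0" if "C \<in> S_classes R - ?T" for C
  proof -
    have "E C = {}" using that unfolding E_def by blast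
    then show ?thesis by simp
  qed
  then have "((\<lambda>C. measure (\<mu> N) (E C)) has_sum 1) ?T \<longleftrightarrow> ((\<lambda>C. measure (\<mu> N) (E C)) has_sum 1) (S_classes R)"
    by (intro has_sum_cong_neutral) auto
  ultimately have "((\<lambda>C. measure (\<mu> N) (E C)) has_sum 1) (S_classes R)" by simp
  then show ?thesis by (simp add: E_def)
qed

text \<open>Stated for any family of Haar measures, so that the argument is independent of the
  construction of \<open>haar\<close>.\<close>

theorem coker_measure_limit:
  assumes haar: "\<And>N. is_haar R p N (\<mu> N)"
  shows "\<exists>c::real.
       (\<lambda>n. real (card (GL (residue_field R) n)) / real (card (mats (residue_field R) n))) \<longlonglongrightarrow> c \<and>
       (\<lambda>i. 1 - 1 / real (card (carrier (residue_field R))) ^ Suc i) has_prod c \<and>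
       (\<exists>\<mu>R :: 'a rmod set \<Rightarrow> real.
          (\<forall>C\<in>S_classes R. \<mu>R C \<ge> 0) \<and> \<mu>R summable_on S_classes R \<and>
          infsum \<mu>R (S_classes R) = 1 \<and>
          (\<forall>C\<in>S_classes R. \<mu>R C \<noteq> 0 \<longrightarrow> (\<exists>M\<in>C. in_T R M)) \<and>
          (\<forall>C\<in>S_classes R. \<forall>M\<in>C. in_T R M \<longrightarrow> \<mu>R C = c / real (card (aut R M))) \<and>
          (\<forall>f :: 'a rmod set \<Rightarrow> real. bounded (f ` S_classes R) \<longrightarrow>
             (\<lambda>N. \<Sum>\<^sub>\<infinity>C\<in>S_classes R. f C *
                     measure (\<mu> N) {G \<in> mats R N. \<exists>M\<in>C. coker_iso R N G M})
             \<longlonglongrightarrow> (\<Sum>\<^sub>\<infinity>C\<in>S_classes R. f C * \<mu>R C)))"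
proof -
  let ?F = "residue_field R" and ?S = "S_classes R :: 'a rmod set set"
  define cN where "cN = (\<lambda>n. real (card (GL ?F n)) / real (card (mats ?F n)))"
  define m :: "nat \<Rightarrow> 'a rmod set \<Rightarrow> real" where "m = (\<lambda>N C. measure (\<mu> N) {G \<in> mats R N. \<exists>M\<in>C. coker_iso R N G M})"
  have cN: "cN n = (\<Prod>i<n. 1 - 1 / real (card (carrier ?F)) ^ Suc i)" for n
    unfolding cN_def by (rule F.GL_ratio[OF finite_residue_field])
  obtain c where c: "c > 0" "(\<lambda>i. 1 - 1 / real (card (carrier ?F)) ^ Suc i) has_prod c"
    using F.GL_product[OF finite_residue_field] by blast
  have clim: "cN \<longlonglongrightarrow> c"
  proof -
    have "(\<lambda>n. \<Prod>i\<le>n. 1 - 1 / real (card (carrier ?F)) ^ Suc i) \<longlonglongrightarrow> c"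
      using c(2) by (rule has_prod_imp_tendsto)
    then have "(\<lambda>n. cN (Suc n)) \<longlonglongrightarrow> c" unfolding cN lessThan_Suc_atMost .
    then show ?thesis by (rule LIMSEQ_imp_Suc)
  qed
  have cN01: "0 \<le> cN n" "cN n \<le> 1" for n
  proof -
    show "0 \<le> cN n" by (simp add: cN_def)
    have "card (GL ?F n) \<le> card (mats ?F n)"
      by (rule card_mono) (auto simp: GL_def F.card_mats[OF finite_residue_field])
    then show "cN n \<le> 1" by (cases "card (mats ?F n) = 0") (auto simp: cN_def divide_le_eq_1)
  qed
  have m0: "0 \<le> m N C" for N C by (simp add: m_def)
  have T: "(\<lambda>N. m N C) \<longlonglongrightarrow> c / real (card (aut R M)) \<and> (\<forall>N. m N C \<le> 1 / real (card (aut R M)))"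
    if C: "C \<in> ?S" and M: "M \<in> C" "in_T R M" for C M
  proof -
    have fM: "fin_module R M" using S_classesD[OF C M(1)] by simp
    interpret M: zp_fin_module R p D mm M
      by (intro zp_fin_module.intro zp_fin_module_axioms.intro local_zp_axioms) (use fM in \<open>auto simp: fin_module_def\<close>)
    have m: "m N C = cN N * (card (M.V.presentations N) / card (carrier M) ^ N) / card (aut R M)" for N
      unfolding m_def S_classes_coker_iso_iff[OF C M(1)] M.measure_coker_iso[OF haar] by (simp add: M.cN_def cN_def)
    obtain n G where G: "G \<in> mats R n" "coker_iso R n G M" using M(2) by (auto simp: in_T_def)
    then obtain y where "y \<in> M.V.presentations n" using M.V.coker_iso_iff_presentation[OF G(1)] by blast
    then have "(\<lambda>N. cN N * (card (M.V.presentations N) / card (carrier M) ^ N) / card (aut R M)) \<longlonglongrightarrow> c * 1 / card (aut R M)"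
      using clim M.finite_aut by (intro tendsto_intros M.presentation_fraction_tendsto) auto
    moreover have "cN N * (card (M.V.presentations N) / card (carrier M) ^ N) / card (aut R M) \<le> 1 / card (aut R M)" for N
      using mult_mono[OF cN01(2)[of N] M.presentation_fraction_le[of N]] M.card_carrier_pos
      by (intro divide_right_mono) auto
    ultimately show ?thesis unfolding m by simp
  qed
  have nT: "m N C = 0" if C: "C \<in> ?S" and nT: "\<not> (\<exists>M\<in>C. in_T R M)" for N C
  proof -
    have "{G \<in> mats R N. \<exists>M\<in>C. coker_iso R N G M} = {}"
      using nT S_classesD(1)[OF C] by (auto simp: in_T_def)
    then show ?thesis unfolding m_def by (simp only: measure_empty)
  qed
  \<comment> \<open>\<open>lim\<close> is total; convergence is supplied by \<open>T\<close> for
    classes of cokernels and by \<open>nT\<close> for all others.\<close>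
  define \<nu> where "\<nu> = (\<lambda>C. lim (\<lambda>N. m N C))"
  have \<nu>T: "\<nu> C = c / real (card (aut R M))" if "C \<in> ?S" "M \<in> C" "in_T R M" for C M
    unfolding \<nu>_def using T[OF that] by (intro limI) blast
  have \<nu>nT: "\<nu> C = 0" if "C \<in> ?S" "\<not> (\<exists>M\<in>C. in_T R M)" for C
    unfolding \<nu>_def using nT[OF that] by (intro limI) simp
  \<comment> \<open>The bound 1 / |Aut M| equals \<nu> C / c, so the limit itself, divided by c > 0,
    dominates all \<open>m N\<close> uniformly in N. On classes outside the support both sides
    vanish.\<close>
  have lim: "(\<lambda>N. m N C) \<longlonglongrightarrow> \<nu> C" and le: "m N C \<le> \<nu> C / c" if C: "C \<in> ?S" for C N
  proof -
    have "(\<lambda>N. m N C) \<longlonglongrightarrow> \<nu> C \<and> (\<forall>N. m N C \<le> \<nu> C / c)"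
    proof (cases "\<exists>M\<in>C. in_T R M")
      case True
      then obtain M where M: "M \<in> C" "in_T R M" by blast
      show ?thesis using T[OF C M] \<nu>T[OF C M] c(1) by simp
    next
      case False
      then show ?thesis using nT[OF C False] \<nu>nT[OF C False] by simp
    qed
    then show "(\<lambda>N. m N C) \<longlonglongrightarrow> \<nu> C" "m N C \<le> \<nu> C / c" by auto
  qed
  have \<nu>0: "0 \<le> \<nu> C" if "C \<in> ?S" for C
    using lim[OF that] m0 by (intro LIMSEQ_le_const) auto
  note hs = has_sum_coker_measure[OF haar, folded m_def]
  have hs': "(m N has_sum 1) ?S" for N using hs[of N] by (simp add: m_def)
  \<comment> \<open>Fatou's lemma for sums: each finite partial sum of \<nu> is a limit of partial
    sums of probabilities and hence at most 1.\<close>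
  have sm: "\<nu> summable_on ?S"
  proof (rule nonneg_bdd_above_summable_on[OF \<nu>0])
    show "bdd_above (sum \<nu> ` {F. F \<subseteq> ?S \<and> finite F})"
    proof (rule bdd_aboveI2)
      fix F assume F: "F \<in> {F. F \<subseteq> ?S \<and> finite F}"
      have "(\<lambda>N. sum (m N) F) \<longlonglongrightarrow> sum \<nu> F" using F lim by (intro tendsto_sum) auto
      moreover have "sum (m N) F \<le> 1" for N
        using finite_sum_le_infsum[of "m N" ?S F] hs'[of N] F m0 has_sum_imp_summable infsumI by fastforce
      ultimately show "sum \<nu> F \<le> 1" by (intro LIMSEQ_le_const2) auto
    qed
  qed
  have conv: "(\<lambda>N. \<Sum>\<^sub>\<infinity>C\<in>?S. f C * m N C) \<longlonglongrightarrow> (\<Sum>\<^sub>\<infinity>C\<in>?S. f C * \<nu> C)" if f: "bounded (f ` ?S)" for f :: "'a rmod set \<Rightarrow> real"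
  proof -
    obtain B where B: "\<And>C. C \<in> ?S \<Longrightarrow> \<bar>f C\<bar> \<le> B" using f by (auto simp: bounded_iff)
    show ?thesis
    proof (rule infsum_tannery[where w = "\<lambda>C. (B / c) * \<nu> C"])
      show "(\<lambda>C. (B / c) * \<nu> C) summable_on ?S" using sm by (rule summable_on_cmult_right)
      fix C assume C: "C \<in> ?S"
      show "(\<lambda>N. f C * m N C) \<longlonglongrightarrow> f C * \<nu> C" using lim[OF C] by (intro tendsto_intros)
      fix N
      have "\<bar>f C * m N C\<bar> \<le> B * (\<nu> C / c)"
        unfolding abs_mult using B[OF C] le[OF C, of N] m0[of N C] by (intro mult_mono) auto
      then show "\<bar>f C * m N C\<bar> \<le> B / c * \<nu> C" by simp
    qed
  qed
  \<comment> \<open>The constant test function 1 transfers the total mass 1 from every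
    \<open>m N\<close> to \<nu>.\<close>
  have "(\<lambda>N. \<Sum>\<^sub>\<infinity>C\<in>?S. 1 * m N C) \<longlonglongrightarrow> (\<Sum>\<^sub>\<infinity>C\<in>?S. 1 * \<nu> C)"
    by (rule conv) (auto intro: bounded_subset[of "{1}"])
  moreover have "(\<Sum>\<^sub>\<infinity>C\<in>?S. 1 * m N C) = 1" for N using hs'[of N] by (simp add: infsumI)
  ultimately have one: "infsum \<nu> ?S = 1" by (simp add: LIMSEQ_const_iff)
  have supp: "\<exists>M\<in>C. in_T R M" if "C \<in> ?S" "\<nu> C \<noteq> 0" for C using \<nu>nT that by blast
  show ?thesis
  proof (intro exI[of _ c] conjI exI[of _ \<nu>])
    show "(\<lambda>n. real (card (GL ?F n)) / real (card (mats ?F n))) \<longlonglongrightarrow> c" using clim unfolding cN_def .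
    show "\<forall>f :: 'a rmod set \<Rightarrow> real. bounded (f ` ?S) \<longrightarrow>
             (\<lambda>N. \<Sum>\<^sub>\<infinity>C\<in>?S. f C * measure (\<mu> N) {G \<in> mats R N. \<exists>M\<in>C. coker_iso R N G M})
             \<longlonglongrightarrow> (\<Sum>\<^sub>\<infinity>C\<in>?S. f C * \<nu> C)"
      using conv unfolding m_def by blast
  qed (use c sm one supp \<nu>0 \<nu>T in auto)
qed

end

section \<open>The p-adic integers in the base ring\<close>

lemma padic_simps:
  "carrier (padic_int p) = {x. \<forall>k. 0 \<le> x k \<and> x k < int p ^ k \<and> x (Suc k) mod (int p ^ k) = x k}"
  "x \<otimes>\<^bsub>padic_int p\<^esub> y = (\<lambda>k. (x k * y k) mod (int p ^ k))"
  "\<one>\<^bsub>padic_int p\<^esub> = (\<lambda>k. 1 mod (int p ^ k))"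
  "\<zero>\<^bsub>padic_int p\<^esub> = (\<lambda>k. 0)"
  "x \<oplus>\<^bsub>padic_int p\<^esub> y = (\<lambda>k. (x k + y k) mod (int p ^ k))"
  by (simp_all add: padic_int_def)

text \<open>Compatible residues that need not be reduced. Sums, products and truncated series of
  p-adic integers are formed in the integers and reduced afterwards.\<close>

definition coherent :: "nat \<Rightarrow> (nat \<Rightarrow> int) \<Rightarrow> bool" where
  "coherent p f \<longleftrightarrow> (\<forall>k. f (Suc k) mod int p ^ k = f k mod int p ^ k)"

lemma coherent_padic:
  assumes "p > 0" "coherent p f"
  shows "(\<lambda>k. f k mod int p ^ k) \<in> carrier (padic_int p)"
  using assms by (simp add: padic_simps coherent_def mod_mod_cancel le_imp_power_dvd)

lemma padic_coherent: "x \<in> carrier (padic_int p) \<Longrightarrow> coherent p x"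
  by (auto simp: padic_simps coherent_def)

lemma padic_mod_self: "x \<in> carrier (padic_int p) \<Longrightarrow> x k mod int p ^ k = x k"
  by (auto simp: padic_simps)

lemma padic_level:
  assumes "x \<in> carrier (padic_int p)" shows "x (j + k) mod int p ^ k = x k"
proof (induction j)
  case 0
  then show ?case using padic_mod_self[OF assms] by simp
next
  case (Suc j)
  have "x (Suc (j + k)) mod int p ^ (j + k) = x (j + k)" using assms by (simp add: padic_simps)
  then have "x (Suc (j + k)) mod int p ^ k = x (j + k) mod int p ^ k"
    by (metis le_add2 le_imp_power_dvd mod_mod_cancel)
  then show ?case using Suc by simp
qed

lemma padic_bounds: "x \<in> carrier (padic_int p) \<Longrightarrow> 0 \<le> x k" "x \<in> carrier (padic_int p) \<Longrightarrow> x k < int p ^ k"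
  by (auto simp: padic_simps)

lemma padic_add_closed:
  assumes p: "p > 0" and "x \<in> carrier (padic_int p)" "y \<in> carrier (padic_int p)"
  shows "x \<oplus>\<^bsub>padic_int p\<^esub> y \<in> carrier (padic_int p)"
proof -
  have "coherent p (\<lambda>k. x k + y k)"
    using padic_coherent[OF assms(2)] padic_coherent[OF assms(3)] unfolding coherent_def by (metis mod_add_cong)
  then show ?thesis using coherent_padic[OF p] by (simp add: padic_simps(5))
qed

lemma padic_mult_closed:
  assumes p: "p > 0" and "x \<in> carrier (padic_int p)" "y \<in> carrier (padic_int p)"
  shows "x \<otimes>\<^bsub>padic_int p\<^esub> y \<in> carrier (padic_int p)"
proof -
  have "coherent p (\<lambda>k. x k * y k)"
    using padic_coherent[OF assms(2)] padic_coherent[OF assms(3)] unfolding coherent_def by (metis mod_mult_cong)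
  then show ?thesis using coherent_padic[OF p] by (simp add: padic_simps(2))
qed

definition padic_of_int :: "nat \<Rightarrow> int \<Rightarrow> nat \<Rightarrow> int" where
  "padic_of_int p n = (\<lambda>k. n mod int p ^ k)"

lemma padic_of_int_closed: "p > 0 \<Longrightarrow> padic_of_int p n \<in> carrier (padic_int p)"
  unfolding padic_of_int_def by (rule coherent_padic) (simp_all add: coherent_def)

text \<open>The cofactor y has the digits of \<open>x\<close> shifted by k places: its residue
  modulo p^j is that of the quotient of \<open>x (j + k)\<close> by p^k.\<close>

lemma padic_split:
  assumes p: "p > 0" and x: "x \<in> carrier (padic_int p)"
  shows "\<exists>y\<in>carrier (padic_int p). x = padic_of_int p (x k) \<oplus>\<^bsub>padic_int p\<^esub> (padic_of_int p (int p ^ k) \<otimes>\<^bsub>padic_int p\<^esub> y)"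
proof -
  define f where "f = (\<lambda>j. x (j + k) div int p ^ k)"
  have xk: "x (j + k) = x k + int p ^ k * f j" for j
    using padic_level[OF x, of j k] mult_div_mod_eq[of "int p ^ k" "x (j + k)"] by (simp add: f_def)
  have "coherent p f"
    unfolding coherent_def
  proof
    fix j
    have "x (Suc j + k) mod int p ^ (j + k) = x (j + k)" using x by (simp add: padic_simps)
    then have "x (j + k) div int p ^ k = (x (Suc j + k) mod (int p ^ k * int p ^ j)) div int p ^ k"
      by (simp add: power_add mult.commute)
    also have "\<dots> = f (Suc j) mod int p ^ j"
      using p by (simp add: f_def zmod_zmult2_eq)
    finally show "f (Suc j) mod int p ^ j = f j mod int p ^ j" by (simp add: f_def)
  qed
  then have y: "(\<lambda>j. f j mod int p ^ j) \<in> carrier (padic_int p)" by (rule coherent_padic[OF p])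
  have "x = padic_of_int p (x k) \<oplus>\<^bsub>padic_int p\<^esub> (padic_of_int p (int p ^ k) \<otimes>\<^bsub>padic_int p\<^esub> (\<lambda>j. f j mod int p ^ j))"
  proof
    fix j
    have "x j = x (j + k) mod int p ^ j" using padic_level[OF x, of k j] by (simp add: add.commute)
    also have "\<dots> = (x k + int p ^ k * f j) mod int p ^ j" by (simp only: xk)
    finally show "x j = (padic_of_int p (x k) \<oplus>\<^bsub>padic_int p\<^esub> (padic_of_int p (int p ^ k) \<otimes>\<^bsub>padic_int p\<^esub> (\<lambda>j. f j mod int p ^ j))) j"
      by (simp add: padic_simps padic_of_int_def mod_simps)
  qed
  then show ?thesis using y by blast
qed

text \<open>The inverse of 1 - p a, given by the geometric series. Modulo p^k the terms from the
  k-th on vanish, so the partial sum with k terms gives the component at level k.\<close>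

lemma padic_geometric:
  assumes p: "p > 0" and a: "a \<in> carrier (padic_int p)"
  shows "\<exists>y\<in>carrier (padic_int p). y = \<one>\<^bsub>padic_int p\<^esub> \<oplus>\<^bsub>padic_int p\<^esub> ((padic_of_int p (int p) \<otimes>\<^bsub>padic_int p\<^esub> a) \<otimes>\<^bsub>padic_int p\<^esub> y)"
proof -
  define f where "f = (\<lambda>k. \<Sum>i<k. (int p * a k) ^ i)"
  have step: "(1 + int p * a k * f k) mod int p ^ k = f k mod int p ^ k" for k
  proof -
    have "1 + int p * a k * f k = f k + int p ^ k * a k ^ k"
      unfolding f_def sum_distrib_left
      using sum.lessThan_Suc_shift[of "\<lambda>i. (int p * a k) ^ i" k] by (simp add: power_mult_distrib)
    then show ?thesis by simp
  qed
  have "coherent p f"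
    unfolding coherent_def
  proof
    fix k
    have "a (Suc k) mod int p ^ k = a k mod int p ^ k" using padic_coherent[OF a] by (simp add: coherent_def)
    then have "(int p * a (Suc k)) mod int p ^ k = (int p * a k) mod int p ^ k" by (rule mod_mult_cong[OF refl])
    then have e: "(int p * a (Suc k)) ^ i mod int p ^ k = (int p * a k) ^ i mod int p ^ k" for i
      by (metis power_mod)
    have "f (Suc k) mod int p ^ k = (f k + (int p * a k) ^ k) mod int p ^ k"
    proof -
      have "f (Suc k) mod int p ^ k = (\<Sum>i<Suc k. (int p * a (Suc k)) ^ i mod int p ^ k) mod int p ^ k"
        unfolding f_def by (rule mod_sum_eq[symmetric])
      also have "\<dots> = (\<Sum>i<Suc k. (int p * a k) ^ i) mod int p ^ k" unfolding e by (rule mod_sum_eq)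
      finally show ?thesis by (simp add: f_def)
    qed
    also have "\<dots> = f k mod int p ^ k" by (simp add: power_mult_distrib)
    finally show "f (Suc k) mod int p ^ k = f k mod int p ^ k" .
  qed
  then have y: "(\<lambda>j. f j mod int p ^ j) \<in> carrier (padic_int p)" by (rule coherent_padic[OF p])
  have "(\<lambda>j. f j mod int p ^ j) = \<one>\<^bsub>padic_int p\<^esub> \<oplus>\<^bsub>padic_int p\<^esub> ((padic_of_int p (int p) \<otimes>\<^bsub>padic_int p\<^esub> a) \<otimes>\<^bsub>padic_int p\<^esub> (\<lambda>j. f j mod int p ^ j))"
    using step by (intro ext) (simp add: padic_simps padic_of_int_def mod_simps)
  then show ?thesis using y by blast
qed

section \<open>Base p expansions\<close>

lemma digit_sum_less:
  assumes "\<And>l. l < k \<Longrightarrow> d l < (p::nat)" shows "(\<Sum>l<k. d l * p ^ l) < p ^ k"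
  using assms
proof (induction k)
  case (Suc k)
  then have "(\<Sum>l<k. d l * p ^ l) < p ^ k" "d k + 1 \<le> p" by (auto simp: Suc_le_eq)
  then have "(\<Sum>l<Suc k. d l * p ^ l) < p ^ k + d k * p ^ k" by simp
  also have "\<dots> = (d k + 1) * p ^ k" by simp
  also have "\<dots> \<le> p * p ^ k" using \<open>d k + 1 \<le> p\<close> by (rule mult_le_mono1)
  finally show ?case by simp
qed simp

lemma digit_sum_eq_iff:
  assumes "\<And>l. l < k \<Longrightarrow> d l < (p::nat)" "a < p ^ k"
  shows "(\<Sum>l<k. d l * p ^ l) = a \<longleftrightarrow> (\<forall>l<k. d l = a div p ^ l mod p)"
  using assms
proof (induction k arbitrary: a d)
  case 0
  then show ?case by simp
next
  case (Suc k)
  have p: "p > 0" using Suc.prems(1)[of 0] by simp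
  have e: "(\<Sum>l<Suc k. d l * p ^ l) = d 0 + p * (\<Sum>l<k. d (Suc l) * p ^ l)"
    unfolding sum.lessThan_Suc_shift by (simp add: sum_distrib_left mult_ac)
  have d0: "d 0 < p" using Suc.prems(1) by simp
  have ap: "a div p < p ^ k" using Suc.prems(2) p by (simp add: less_mult_imp_div_less mult.commute)
  have "(\<Sum>l<Suc k. d l * p ^ l) = a \<longleftrightarrow> d 0 = a mod p \<and> (\<Sum>l<k. d (Suc l) * p ^ l) = a div p"
  proof
    assume "(\<Sum>l<Suc k. d l * p ^ l) = a"
    then have "a = d 0 + p * (\<Sum>l<k. d (Suc l) * p ^ l)" using e by simp
    then show "d 0 = a mod p \<and> (\<Sum>l<k. d (Suc l) * p ^ l) = a div p" using d0 p by simp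
  next
    assume "d 0 = a mod p \<and> (\<Sum>l<k. d (Suc l) * p ^ l) = a div p"
    then show "(\<Sum>l<Suc k. d l * p ^ l) = a" unfolding e by (simp add: mod_mult_div_eq)
  qed
  also have "(\<Sum>l<k. d (Suc l) * p ^ l) = a div p \<longleftrightarrow> (\<forall>l<k. d (Suc l) = a div p div p ^ l mod p)"
    using Suc.IH[of "\<lambda>l. d (Suc l)" "a div p"] Suc.prems(1) ap by simp
  also have "d 0 = a mod p \<and> (\<forall>l<k. d (Suc l) = a div p div p ^ l mod p) \<longleftrightarrow> (\<forall>l<Suc k. d l = a div p ^ l mod p)"
    unfolding All_less_Suc2 by (simp add: div_mult2_eq)
  finally show ?case .
qed

section \<open>Deriving the local setting for a finite algebra over the p-adic integers\<close>

locale zp_finite = cring R for R (structure) +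
  fixes p :: nat and \<iota> :: "(nat \<Rightarrow> int) \<Rightarrow> 'a" and S :: "'a set" and mm :: "'a set"
  assumes prime_p: "prime p"
    and iota: "\<iota> \<in> ring_hom (padic_int p) R" and inj: "inj_on \<iota> (carrier (padic_int p))"
    and S: "finite S" "S \<subseteq> carrier R"
    and span: "\<And>r. r \<in> carrier R \<Longrightarrow> \<exists>a. (\<forall>s\<in>S. a s \<in> carrier (padic_int p)) \<and> r = finsum R (\<lambda>s. \<iota> (a s) \<otimes> s) S"
    and mm_max: "maximalideal mm R"
    and mm_unique: "\<And>I. maximalideal I R \<Longrightarrow> I = mm"
begin

abbreviation Zp :: "(nat \<Rightarrow> int) set" where "Zp \<equiv> carrier (padic_int p)"

lemma p_pos: "p > 0" using prime_p by (rule prime_gt_0_nat)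

lemma iota_closed [simp]: "x \<in> Zp \<Longrightarrow> \<iota> x \<in> carrier R" using iota by (rule ring_hom_closed)

lemma iota_add: "x \<in> Zp \<Longrightarrow> y \<in> Zp \<Longrightarrow> \<iota> (x \<oplus>\<^bsub>padic_int p\<^esub> y) = \<iota> x \<oplus> \<iota> y" using iota by (rule ring_hom_add)

lemma iota_mult: "x \<in> Zp \<Longrightarrow> y \<in> Zp \<Longrightarrow> \<iota> (x \<otimes>\<^bsub>padic_int p\<^esub> y) = \<iota> x \<otimes> \<iota> y" using iota by (rule ring_hom_mult)

lemma iota_one: "\<iota> \<one>\<^bsub>padic_int p\<^esub> = \<one>" using iota by (rule ring_hom_one)

lemma padic_of_int_1: "padic_of_int p 1 = \<one>\<^bsub>padic_int p\<^esub>" by (simp add: padic_of_int_def padic_simps)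

lemma padic_of_int_add: "padic_of_int p (a + b) = padic_of_int p a \<oplus>\<^bsub>padic_int p\<^esub> padic_of_int p b"
  by (simp add: padic_of_int_def padic_simps mod_simps)

lemma iota_of_int: "\<iota> (padic_of_int p (int n)) = [n] \<cdot> \<one>"
proof (induction n)
  case 0
  note z = padic_of_int_closed[OF p_pos, of 0]
  have "padic_of_int p 0 = padic_of_int p 0 \<oplus>\<^bsub>padic_int p\<^esub> padic_of_int p 0" using padic_of_int_add[of 0 0] by simp
  then have "\<iota> (padic_of_int p 0) = \<iota> (padic_of_int p 0) \<oplus> \<iota> (padic_of_int p 0)" using iota_add[OF z z] by simp
  then have "\<iota> (padic_of_int p 0) = \<zero>" using iota_closed[OF z] by (metis add.r_cancel_one)
  then show ?case by simp
next
  case (Suc n)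
  have "\<iota> (padic_of_int p (int (Suc n))) = \<iota> (padic_of_int p (int n)) \<oplus> \<one>"
    using padic_of_int_add[of "int n" 1] iota_add[OF padic_of_int_closed padic_of_int_closed, OF p_pos p_pos, of "int n" 1]
    by (simp add: padic_of_int_1 iota_one add.commute)
  then show ?case using Suc by simp
qed

lemma of_nat_times: "[(a * b :: nat)] \<cdot> \<one> = ([a] \<cdot> \<one>) \<otimes> ([b] \<cdot> \<one>)"
proof -
  have "([a] \<cdot> \<one>) \<otimes> ([b] \<cdot> \<one>) = [a] \<cdot> ([b] \<cdot> \<one>)"
    using add_pow_ldistr[of \<one> "[b] \<cdot> \<one>" a] by simp
  also have "\<dots> = [(a * b)] \<cdot> \<one>" by (metis add.nat_pow_pow mult.commute one_closed)
  finally show ?thesis by simp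
qed

lemma of_nat_power_p: "[(p ^ k)] \<cdot> \<one> = ([p] \<cdot> \<one>) [^] k"
  by (induction k) (simp_all add: of_nat_times m_comm)

lemma iota_split:
  assumes x: "x \<in> Zp"
  shows "\<exists>y\<in>carrier R. \<iota> x = [(nat (x k))] \<cdot> \<one> \<oplus> ([p] \<cdot> \<one>) [^] k \<otimes> y"
proof -
  obtain y where y: "y \<in> Zp" "x = padic_of_int p (x k) \<oplus>\<^bsub>padic_int p\<^esub> (padic_of_int p (int p ^ k) \<otimes>\<^bsub>padic_int p\<^esub> y)"
    using padic_split[OF p_pos x] by blast
  note c = padic_of_int_closed[OF p_pos]
  have "\<iota> x = \<iota> (padic_of_int p (x k)) \<oplus> \<iota> (padic_of_int p (int p ^ k)) \<otimes> \<iota> y"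
    by (subst y(2)) (simp add: iota_add iota_mult c y(1) padic_mult_closed p_pos)
  also have "\<iota> (padic_of_int p (x k)) = [(nat (x k))] \<cdot> \<one>" using iota_of_int[of "nat (x k)"] padic_bounds(1)[OF x, of k] by simp
  also have "\<iota> (padic_of_int p (int p ^ k)) = ([p] \<cdot> \<one>) [^] k" using iota_of_int[of "p ^ k"] of_nat_power_p by simp
  finally show ?thesis using y(1) by auto
qed

text \<open>As \<iota> is injective, p^k would be zero in the p-adic integers, but its component at
  level k + 1 is p^k itself.\<close>

lemma p_not_nilpotent: "([p] \<cdot> \<one>) [^] (k::nat) \<noteq> \<zero>"
proof
  assume "([p] \<cdot> \<one>) [^] k = \<zero>"
  then have "\<iota> (padic_of_int p (int (p ^ k))) = \<iota> (padic_of_int p (int 0))" unfolding iota_of_int of_nat_power_p by simp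
  then have "padic_of_int p (int (p ^ k)) = padic_of_int p (int 0)" using inj padic_of_int_closed[OF p_pos] by (auto dest: inj_onD)
  from fun_cong[OF this, of "Suc k"] have "int (p ^ k) mod int p ^ Suc k = 0" by (simp add: padic_of_int_def)
  moreover have "int (p ^ k) mod int p ^ Suc k = int (p ^ k)"
    using prime_gt_1_nat[OF prime_p] by (intro mod_pos_pos_trivial) (auto simp: p_pos)
  ultimately show False using p_pos by simp
qed

text \<open>Otherwise \<open>p\<close> is a unit, and a generator \<open>s\<close> of a minimal generating set has the form \<open>p\<close> times a combination
  of the generators. As \<open>1 - p a\<close> is invertible in the \<open>p\<close>-adic integers, \<open>s\<close> is superfluous.\<close>

lemma p_in_mm: "[p] \<cdot> \<one> \<in> mm"
proof (rule ccontr)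
  assume "[p] \<cdot> \<one> \<notin> mm"
  then have U: "[p] \<cdot> \<one> \<in> Units R" using nonunit_in_maximal[of "[p] \<cdot> \<one>"] mm_unique by auto
  define q where "q = [p] \<cdot> \<one>"
  have q: "q \<in> Units R" "q \<in> carrier R" using U by (auto simp: q_def)
  \<comment> \<open>Coefficients are taken in the image of the p-adic integers in \<open>R\<close>,
    which is closed under sums and products. A generating set of least cardinality is then
    used.\<close>
  define gen where "gen = (\<lambda>T. finite T \<and> T \<subseteq> carrier R \<and>
    (\<forall>r\<in>carrier R. \<exists>z. (\<forall>t\<in>T. z t \<in> \<iota> ` Zp) \<and> r = finsum R (\<lambda>t. z t \<otimes> t) T))"
  have "gen S"
    unfolding gen_def
  proof (intro conjI ballI S)
    fix r assume "r \<in> carrier R"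
    then obtain a where "\<forall>s\<in>S. a s \<in> Zp" "r = finsum R (\<lambda>s. \<iota> (a s) \<otimes> s) S" using span by blast
    then show "\<exists>z. (\<forall>t\<in>S. z t \<in> \<iota> ` Zp) \<and> r = finsum R (\<lambda>t. z t \<otimes> t) S"
      by (intro exI[of _ "\<lambda>s. \<iota> (a s)"]) auto
  qed
  then obtain T where T: "gen T" and min: "\<And>T'. gen T' \<Longrightarrow> card T \<le> card T'"
    using ex_has_least_nat[of gen S card] by blast
  have Tf: "finite T" "T \<subseteq> carrier R" using T by (auto simp: gen_def)
  have Tr: "\<exists>z. (\<forall>t\<in>T. z t \<in> \<iota> ` Zp) \<and> r = finsum R (\<lambda>t. z t \<otimes> t) T" if "r \<in> carrier R" for r
    using T that by (auto simp: gen_def)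
  have Zc: "z \<in> carrier R" if "z \<in> \<iota> ` Zp" for z using that by auto
  have Zadd: "z \<oplus> w \<in> \<iota> ` Zp" if "z \<in> \<iota> ` Zp" "w \<in> \<iota> ` Zp" for z w
  proof -
    from \<open>z \<in> \<iota> ` Zp\<close> \<open>w \<in> \<iota> ` Zp\<close> obtain a b where ab: "a \<in> Zp" "z = \<iota> a" "b \<in> Zp" "w = \<iota> b" by blast
    then show ?thesis using padic_add_closed[OF p_pos ab(1,3)] iota_add[OF ab(1,3)] by (metis imageI)
  qed
  have Zmult: "z \<otimes> w \<in> \<iota> ` Zp" if "z \<in> \<iota> ` Zp" "w \<in> \<iota> ` Zp" for z w
  proof -
    from \<open>z \<in> \<iota> ` Zp\<close> \<open>w \<in> \<iota> ` Zp\<close> obtain a b where ab: "a \<in> Zp" "z = \<iota> a" "b \<in> Zp" "w = \<iota> b" by blast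
    then show ?thesis using padic_mult_closed[OF p_pos ab(1,3)] iota_mult[OF ab(1,3)] by (metis imageI)
  qed
  have qZ: "q \<in> \<iota> ` Zp" unfolding q_def iota_of_int[symmetric] using padic_of_int_closed[OF p_pos] by (rule imageI)
  have "T \<noteq> {}"
  proof
    assume "T = {}"
    then have "\<one> = \<zero>" using Tr[of \<one>] by auto
    then have "([p] \<cdot> \<one>) [^] (0::nat) = \<zero>" by simp
    then show False using p_not_nilpotent by blast
  qed
  then obtain s where s: "s \<in> T" by blast
  have sc: "s \<in> carrier R" using s Tf by blast
  define T' where "T' = T - {s}"
  have T': "finite T'" "T' \<subseteq> carrier R" "s \<notin> T'" "T = insert s T'" using Tf s by (auto simp: T'_def)
  obtain a where a: "\<And>t. t \<in> T \<Longrightarrow> a t \<in> \<iota> ` Zp" "inv q \<otimes> s = finsum R (\<lambda>t. a t \<otimes> t) T"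
    using Tr[of "inv q \<otimes> s"] q sc by auto
  obtain x where x: "x \<in> Zp" "a s = \<iota> x" using a(1)[OF s] by blast
  \<comment> \<open>The inverse of 1 - p x, where x maps to the coefficient of \<open>s\<close> in
    the expansion of s / p.\<close>
  obtain y where y: "y \<in> Zp" "y = \<one>\<^bsub>padic_int p\<^esub> \<oplus>\<^bsub>padic_int p\<^esub> ((padic_of_int p (int p) \<otimes>\<^bsub>padic_int p\<^esub> x) \<otimes>\<^bsub>padic_int p\<^esub> y)"
    using padic_geometric[OF p_pos x(1)] by blast
  define v where "v = \<iota> y"
  have v: "v \<in> carrier R" "v \<in> \<iota> ` Zp" using y(1) by (auto simp: v_def)
  have as: "a s \<in> carrier R" using Zc a(1) s by blast
  have oneZ: "\<one>\<^bsub>padic_int p\<^esub> \<in> Zp" using padic_of_int_closed[OF p_pos, of 1] by (simp add: padic_of_int_1)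
  have "\<iota> y = \<one> \<oplus> (\<iota> (padic_of_int p (int p)) \<otimes> \<iota> x) \<otimes> \<iota> y"
  proof -
    note m1 = padic_mult_closed[OF p_pos padic_of_int_closed[OF p_pos] x(1), of "int p"]
    note m2 = padic_mult_closed[OF p_pos m1 y(1)]
    have "\<iota> y = \<iota> (\<one>\<^bsub>padic_int p\<^esub> \<oplus>\<^bsub>padic_int p\<^esub> ((padic_of_int p (int p) \<otimes>\<^bsub>padic_int p\<^esub> x) \<otimes>\<^bsub>padic_int p\<^esub> y))"
      using y(2) by simp
    also have "\<dots> = \<one> \<oplus> \<iota> ((padic_of_int p (int p) \<otimes>\<^bsub>padic_int p\<^esub> x) \<otimes>\<^bsub>padic_int p\<^esub> y)"
      using iota_add[OF oneZ m2] by (simp add: iota_one)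
    also have "\<dots> = \<one> \<oplus> (\<iota> (padic_of_int p (int p)) \<otimes> \<iota> x) \<otimes> \<iota> y"
      using iota_mult[OF m1 y(1)] iota_mult[OF padic_of_int_closed[OF p_pos] x(1)] by simp
    finally show ?thesis .
  qed
  then have veq: "v = \<one> \<oplus> (q \<otimes> a s) \<otimes> v" unfolding v_def iota_of_int q_def x(2) .
  have tc: "a t \<otimes> t \<in> carrier R" if "t \<in> T" for t using Zc[OF a(1)[OF that]] that Tf by auto
  define w where "w = finsum R (\<lambda>t. a t \<otimes> t) T'"
  have wc: "w \<in> carrier R" unfolding w_def using tc T' by (intro finsum_closed) auto
  have "inv q \<otimes> s = a s \<otimes> s \<oplus> w"
    unfolding a(2) w_def T'(4) using T' tc sc as by (subst finsum_insert) auto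
  then have "q \<otimes> (inv q \<otimes> s) = q \<otimes> (a s \<otimes> s \<oplus> w)" by simp
  moreover have "q \<otimes> (inv q \<otimes> s) = s" using q sc by (simp flip: m_assoc)
  ultimately have s1: "s = q \<otimes> (a s \<otimes> s \<oplus> w)" by simp
  \<comment> \<open>With s = q (a_s s + w), where w gathers the other generators, and v (1 - q a_s)
    = 1 one obtains s = v q w, free of s on the right.\<close>
  have "s = (v \<ominus> (q \<otimes> a s) \<otimes> v) \<otimes> s"
  proof -
    define e where "e = (q \<otimes> a s) \<otimes> v"
    have e: "e \<in> carrier R" using q as v by (simp add: e_def)
    have "v = \<one> \<oplus> e" using veq by (simp add: e_def)
    then have "v \<ominus> e = \<one>" using e by algebra
    then show ?thesis using sc by (simp add: e_def)
  qed
  also have "\<dots> = v \<otimes> s \<ominus> (q \<otimes> a s \<otimes> v) \<otimes> s" using v q as sc by algebra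
  also have "v \<otimes> s = v \<otimes> (q \<otimes> (a s \<otimes> s \<oplus> w))" using s1 by simp
  also have "v \<otimes> (q \<otimes> (a s \<otimes> s \<oplus> w)) \<ominus> (q \<otimes> a s \<otimes> v) \<otimes> s = (v \<otimes> q) \<otimes> w"
    using v(1) q(2) as sc wc by algebra
  finally have s2: "s = (v \<otimes> q) \<otimes> w" .
  have "gen T'"
    unfolding gen_def
  proof (intro conjI ballI T')
    fix r assume "r \<in> carrier R"
    then obtain z where z: "\<And>t. t \<in> T \<Longrightarrow> z t \<in> \<iota> ` Zp" "r = finsum R (\<lambda>t. z t \<otimes> t) T" using Tr by blast
    define g where "g = z s \<otimes> (v \<otimes> q)"
    have gZ: "g \<in> \<iota> ` Zp" unfolding g_def using z(1)[OF s] v(2) qZ by (intro Zmult)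
    have gc: "g \<in> carrier R" by (rule Zc[OF gZ])
    have zc: "z t \<in> carrier R" "a t \<in> carrier R" "t \<in> carrier R" if "t \<in> T" for t
      using Zc[OF z(1)[OF that]] Zc[OF a(1)[OF that]] that Tf by auto
    have T'T: "t \<in> T" if "t \<in> T'" for t using that T'(4) by blast
    have "r = z s \<otimes> s \<oplus> finsum R (\<lambda>t. z t \<otimes> t) T'"
      unfolding z(2) T'(4) using T' zc by (subst finsum_insert) auto
    also have "z s \<otimes> s = g \<otimes> w" using zc[OF s] v(1) q(2) wc unfolding g_def by (subst s2) (simp add: m_assoc)
    also have "g \<otimes> w = finsum R (\<lambda>t. g \<otimes> (a t \<otimes> t)) T'"
      unfolding w_def using gc tc T'T T' by (intro finsum_rdistr) auto
    also have "\<dots> \<oplus> finsum R (\<lambda>t. z t \<otimes> t) T' = finsum R (\<lambda>t. g \<otimes> (a t \<otimes> t) \<oplus> z t \<otimes> t) T'"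
      using gc zc T'T T' by (subst finsum_addf) auto
    also have "\<dots> = finsum R (\<lambda>t. (g \<otimes> a t \<oplus> z t) \<otimes> t) T'"
      using gc zc T'T T' by (intro finsum_cong') (auto simp: l_distr m_assoc)
    finally have "r = finsum R (\<lambda>t. (g \<otimes> a t \<oplus> z t) \<otimes> t) T'" .
    moreover have "\<forall>t\<in>T'. g \<otimes> a t \<oplus> z t \<in> \<iota> ` Zp" using gZ a(1) z(1) T'T by (auto intro!: Zadd Zmult)
    ultimately show "\<exists>z. (\<forall>t\<in>T'. z t \<in> \<iota> ` Zp) \<and> r = finsum R (\<lambda>t. z t \<otimes> t) T'"
      by (intro exI[of _ "\<lambda>t. g \<otimes> a t \<oplus> z t"]) blast
  qed
  then have "card T \<le> card T'" by (rule min)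
  then show False using T' by simp
qed

definition lift :: "nat \<Rightarrow> ('a \<Rightarrow> nat) \<Rightarrow> 'a" where
  "lift k f = finsum R (\<lambda>s. ([(f s)] \<cdot> \<one>) \<otimes> s) S"

lemma lift_closed: "lift k f \<in> carrier R"
  unfolding lift_def using S by (intro finsum_closed) auto

lemma iota_sum_split:
  assumes a: "\<And>s. s \<in> S \<Longrightarrow> a s \<in> Zp"
  shows "\<exists>y\<in>carrier R. finsum R (\<lambda>s. \<iota> (a s) \<otimes> s) S = lift k (\<lambda>s. nat (a s k)) \<oplus> ([p] \<cdot> \<one>) [^] k \<otimes> y"
proof -
  have "\<forall>s\<in>S. \<exists>y. y \<in> carrier R \<and> \<iota> (a s) = [(nat (a s k))] \<cdot> \<one> \<oplus> ([p] \<cdot> \<one>) [^] k \<otimes> y"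
    using iota_split[OF a] by blast
  from bchoice[OF this] obtain y where y: "\<And>s. s \<in> S \<Longrightarrow> y s \<in> carrier R"
    "\<And>s. s \<in> S \<Longrightarrow> \<iota> (a s) = [(nat (a s k))] \<cdot> \<one> \<oplus> ([p] \<cdot> \<one>) [^] k \<otimes> y s" by blast
  have Sc: "s \<in> carrier R" if "s \<in> S" for s using S that by blast
  have "finsum R (\<lambda>s. \<iota> (a s) \<otimes> s) S =
    finsum R (\<lambda>s. ([(nat (a s k))] \<cdot> \<one>) \<otimes> s \<oplus> ([p] \<cdot> \<one>) [^] k \<otimes> (y s \<otimes> s)) S"
    using y Sc by (intro finsum_cong') (auto simp: l_distr m_assoc)
  also have "\<dots> = lift k (\<lambda>s. nat (a s k)) \<oplus> finsum R (\<lambda>s. ([p] \<cdot> \<one>) [^] k \<otimes> (y s \<otimes> s)) S"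
    unfolding lift_def using y Sc by (intro finsum_addf) auto
  also have "finsum R (\<lambda>s. ([p] \<cdot> \<one>) [^] k \<otimes> (y s \<otimes> s)) S = ([p] \<cdot> \<one>) [^] k \<otimes> finsum R (\<lambda>s. y s \<otimes> s) S"
    using y Sc S(1) by (intro finsum_rdistr[symmetric]) auto
  finally show ?thesis using y Sc by (intro bexI[of _ "finsum R (\<lambda>s. y s \<otimes> s) S"]) (auto intro!: finsum_closed)
qed

lemma lift_cong: "(\<And>s. s \<in> S \<Longrightarrow> f s = g s) \<Longrightarrow> lift k f = lift k g"
  unfolding lift_def using S by (intro finsum_cong') auto

text \<open>Truncating the p-adic coefficients of a combination of the generators modulo p^k changes
  it by a multiple of p^k, and there are p^(k |S|) truncated families. This is how the number of
  generators becomes the constant \<open>D\<close> of \<open>local_zp\<close>.\<close>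

lemma residue_representatives:
  "\<exists>A. finite A \<and> A \<subseteq> carrier R \<and> card A \<le> p ^ (k * card S) \<and>
        (\<forall>r\<in>carrier R. \<exists>s\<in>A. \<exists>x\<in>carrier R. r = s \<oplus> ([p] \<cdot> \<one>) [^] k \<otimes> x)"
proof -
  let ?A = "lift k ` (S \<rightarrow>\<^sub>E {..<p ^ k})"
  have "finite ?A" by (intro finite_imageI finite_PiE) (auto simp: S)
  moreover have "?A \<subseteq> carrier R" using lift_closed by blast
  moreover have "card ?A \<le> p ^ (k * card S)"
  proof -
    have "card ?A \<le> card (S \<rightarrow>\<^sub>E {..<p ^ k})" by (rule card_image_le) (intro finite_PiE, auto simp: S)
    then show ?thesis by (simp add: card_PiE S power_mult)
  qed
  moreover have "\<exists>s\<in>?A. \<exists>x\<in>carrier R. r = s \<oplus> ([p] \<cdot> \<one>) [^] k \<otimes> x" if r: "r \<in> carrier R" for r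
  proof -
    obtain a where a: "\<And>s. s \<in> S \<Longrightarrow> a s \<in> Zp" "r = finsum R (\<lambda>s. \<iota> (a s) \<otimes> s) S" using span[OF r] by blast
    let ?f = "restrict (\<lambda>s. nat (a s k)) S"
    have "nat (a s k) < p ^ k" if "s \<in> S" for s
      using padic_bounds[OF a(1)[OF that], of k] by (simp add: nat_less_iff)
    then have f: "?f \<in> S \<rightarrow>\<^sub>E {..<p ^ k}" unfolding restrict_PiE_iff by simp
    have "lift k (\<lambda>s. nat (a s k)) = lift k ?f" by (rule lift_cong) simp
    moreover obtain y where y: "y \<in> carrier R"
      "finsum R (\<lambda>s. \<iota> (a s) \<otimes> s) S = lift k (\<lambda>s. nat (a s k)) \<oplus> ([p] \<cdot> \<one>) [^] k \<otimes> y"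
      using iota_sum_split[of a k, OF a(1)] by blast
    ultimately have "r = lift k ?f \<oplus> ([p] \<cdot> \<one>) [^] k \<otimes> y" unfolding a(2) by (simp only:)
    then have "\<exists>x\<in>carrier R. r = lift k ?f \<oplus> ([p] \<cdot> \<one>) [^] k \<otimes> x" using y(1) by blast
    moreover have "lift k ?f \<in> ?A" using f by (rule imageI)
    ultimately show ?thesis by blast
  qed
  ultimately show ?thesis by (intro exI[of _ ?A] conjI ballI)
qed

sublocale local_zp R p "card S" mm
  by (rule local_zp.intro[OF is_cring local_zp_axioms.intro[OF prime_p mm_max mm_unique p_in_mm
      residue_representatives p_not_nilpotent]])

end

section \<open>Existence and uniqueness of Haar measure\<close>

context local_zp begin

text \<open>Cosets are balls of an ultrametric: two of them are nested or disjoint. Together with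
  the empty set they form a generator closed under intersection, and a finite measure is determined
  by its values there.\<close>

lemma haar_generator_eq:
  assumes \<mu>: "space \<mu> = mats R N" "sets \<mu> = sigma_sets (mats R N) {pcoset R p N k A | k A. A \<in> mats R N}"
    and \<nu>: "sets \<nu> = sigma_sets (mats R N) {pcoset R p N k A | k A. A \<in> mats R N}"
    and fin: "emeasure \<mu> (mats R N) \<noteq> \<infinity>"
    and eq: "\<And>k A. A \<in> mats R N \<Longrightarrow> emeasure \<mu> (pcoset R p N k A) = emeasure \<nu> (pcoset R p N k A)"
  shows "\<mu> = \<nu>"
proof -
  let ?E = "insert {} {pcoset R p N k A | k A. A \<in> mats R N}"
  have full: "pcoset R p N 0 (\<lambda>i j. \<zero>) = mats R N"
  proof -
    have "pcong 0 \<zero> a" if "a \<in> carrier R" for a unfolding pcong_def using that by (intro bexI[of _ a]) auto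
    then show ?thesis using mats_carrier[of _ N] by (auto simp: pcoset_iff)
  qed
  have sub: "?E \<subseteq> Pow (mats R N)" using pcoset_subset by auto
  have sig: "sigma_sets (mats R N) {pcoset R p N k A | k A. A \<in> mats R N} = sigma_sets (mats R N) ?E"
  proof (rule sigma_sets_eqI)
    fix a assume "a \<in> {pcoset R p N k A | k A. A \<in> mats R N}"
    then show "a \<in> sigma_sets (mats R N) ?E" by (intro sigma_sets.Basic) simp
  next
    fix b assume "b \<in> ?E"
    then show "b \<in> sigma_sets (mats R N) {pcoset R p N k A | k A. A \<in> mats R N}"
      by (auto intro: sigma_sets.Empty sigma_sets.Basic)
  qed
  have "Int_stable ?E"
  proof (rule Int_stableI)
    fix P Q assume PQ: "P \<in> ?E" "Q \<in> ?E"
    show "P \<inter> Q \<in> ?E"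
    proof (cases "P \<inter> Q = {}")
      case True
      then show ?thesis by simp
    next
      case False
      then obtain C where C: "C \<in> P" "C \<in> Q" by blast
      obtain k A where P: "A \<in> mats R N" "P = pcoset R p N k A" using PQ(1) C(1) by auto
      obtain l B where Q: "B \<in> mats R N" "Q = pcoset R p N l B" using PQ(2) C(2) by auto
      have Cm: "C \<in> mats R N" using C(1) P pcoset_subset by blast
      have "P = pcoset R p N k C"
        unfolding P(2) by (rule pcoset_eq[OF P(1) C(1)[unfolded P(2)], symmetric])
      moreover have "Q = pcoset R p N l C"
        unfolding Q(2) by (rule pcoset_eq[OF Q(1) C(2)[unfolded Q(2)], symmetric])
      ultimately have "P \<inter> Q = P \<or> P \<inter> Q = Q" using pcoset_mono[OF Cm, of k l] pcoset_mono[OF Cm, of l k]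
        by (cases "k \<le> l") (auto simp: Int_absorb1 Int_absorb2)
      then show ?thesis using PQ by (elim disjE) (simp_all only:)
    qed
  qed
  then show ?thesis
  proof (rule measure_eqI_generator_eq[where \<Omega> = "mats R N" and A = "\<lambda>_. mats R N"])
    show "?E \<subseteq> Pow (mats R N)" by (rule sub)
    show "emeasure \<mu> X = emeasure \<nu> X" if "X \<in> ?E" for X using eq that by auto
    show "sets \<mu> = sigma_sets (mats R N) ?E" "sets \<nu> = sigma_sets (mats R N) ?E" using \<mu>(2) \<nu> sig by auto
    have "mats R N \<in> ?E" using full mat_zero_closed[of N] by (metis (mono_tags, lifting) insertCI mem_Collect_eq)
    then show "range (\<lambda>_. mats R N) \<subseteq> ?E" by auto
  qed (use fin in auto)
qed

text \<open>The finitely many cosets of one level partition the space and are translates of each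
  other, so invariance leaves no choice for their mass.\<close>

lemma haar_pcoset:
  assumes haar: "is_haar R p N \<mu>" and A: "A \<in> mats R N"
  shows "measure \<mu> (pcoset R p N k A) = 1 / card (pcoset R p N k ` mats R N)"
proof -
  let ?B = "pcoset R p N k ` mats R N"
  have un: "(\<Union>P\<in>?B. P) = mats R N" using pcoset_self pcoset_subset by blast
  have "measure \<mu> (pcoset R p N k A) = measure \<mu> (\<Union>P\<in>?B. P) / card ?B"
  proof (rule measure_equidistributed[OF haar finite_pcosets, where E = "\<lambda>P. P" and ?b0.0 = "pcoset R p N k A"])
    show "b \<in> sets \<mu>" if b: "b \<in> ?B" for b
    proof (rule padic_open_sets[OF haar])
      obtain C where C: "C \<in> mats R N" "b = pcoset R p N k C" using b by blast
      then show "padic_open N b" unfolding padic_open_def using pcoset_eq pcoset_subset by blast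
    qed
    show "disjoint_family_on (\<lambda>P. P) ?B" unfolding disjoint_family_on_def
    proof (intro ballI impI)
      fix P Q assume PQ: "P \<in> ?B" "Q \<in> ?B" "P \<noteq> Q"
      then obtain C D where "C \<in> mats R N" "P = pcoset R p N k C" "D \<in> mats R N" "Q = pcoset R p N k D" by blast
      then show "P \<inter> Q = {}" using pcoset_eq PQ(3) by (metis disjoint_iff)
    qed
    show "\<exists>T\<in>mats R N. b = mat_add R T ` pcoset R p N k A" if b: "b \<in> ?B" for b
    proof -
      obtain C where C: "C \<in> mats R N" "b = pcoset R p N k C" using b by blast
      let ?T = "mat_add R C (mat_neg A)"
      have T: "?T \<in> mats R N" using A C by simp
      have "mat_add R ?T A = C"
        using A C mats_carrier[OF A] mats_carrier[OF C(1)]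
        by (simp add: fun_eq_iff mat_neg_def a_assoc l_neg)
      then have "b = mat_add R ?T ` pcoset R p N k A" using translate_pcoset[OF A T] C(2) by simp
      then show ?thesis using T by blast
    qed
  qed (use A in auto)
  then show ?thesis using un measure_mats[OF haar] by simp
qed

lemma haar_unique:
  assumes "is_haar R p N \<mu>" "is_haar R p N \<nu>"
  shows "\<mu> = \<nu>"
proof (rule haar_generator_eq)
  interpret M: prob_space \<mu> using assms by (simp add: is_haar_def)
  interpret N: prob_space \<nu> using assms by (simp add: is_haar_def)
  show "emeasure \<mu> (pcoset R p N k A) = emeasure \<nu> (pcoset R p N k A)" if "A \<in> mats R N" for k A
    using haar_pcoset[OF assms(1) that] haar_pcoset[OF assms(2) that]
    by (simp add: M.emeasure_eq_measure N.emeasure_eq_measure)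
  show "emeasure \<mu> (mats R N) \<noteq> \<infinity>" by simp
qed (use assms in \<open>simp_all add: is_haar_def\<close>)

text \<open>If all cosets of a given level have equal mass, the distribution of \<mu> under a
  translation agrees with \<mu> on cosets, hence everywhere. This reduces invariance to a
  count.\<close>

lemma is_haarI:
  assumes prob: "prob_space \<mu>" and sp: "space \<mu> = mats R N"
    and st: "sets \<mu> = sigma_sets (mats R N) {pcoset R p N k A | k A. A \<in> mats R N}"
    and inv: "\<And>k A B. A \<in> mats R N \<Longrightarrow> B \<in> mats R N \<Longrightarrow>
      emeasure \<mu> (pcoset R p N k A) = emeasure \<mu> (pcoset R p N k B)"
  shows "is_haar R p N \<mu>"
proof -
  interpret prob_space \<mu> by (rule prob)
  let ?PC = "{pcoset R p N k A | k A. A \<in> mats R N}"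
  have PC: "?PC \<subseteq> Pow (mats R N)" using pcoset_subset by auto
  have pcs: "pcoset R p N k A \<in> sets \<mu>" if "A \<in> mats R N" for k A
    unfolding st using that by (intro sigma_sets.Basic) auto
  have vim: "mat_add R T -` X \<inter> mats R N = mat_add R (mat_neg T) ` X" if T: "T \<in> mats R N" and X: "X \<subseteq> mats R N" for T X
  proof (intro equalityI subsetI)
    fix B assume "B \<in> mat_add R T -` X \<inter> mats R N"
    then have "B \<in> mats R N" "mat_add R T B \<in> X" by auto
    moreover have "B = mat_add R (mat_neg T) (mat_add R T B)"
      using T \<open>B \<in> mats R N\<close> by (simp add: mat_add_neg_cancel)
    ultimately show "B \<in> mat_add R (mat_neg T) ` X" by blast
  next
    fix B assume "B \<in> mat_add R (mat_neg T) ` X"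
    then obtain C where C: "C \<in> X" "B = mat_add R (mat_neg T) C" by blast
    then have "mat_add R T B = C" using T X by (simp add: mat_add_neg_cancel' subset_iff)
    then show "B \<in> mat_add R T -` X \<inter> mats R N" using C T X by auto
  qed
  have meas: "mat_add R T \<in> measurable \<mu> \<mu>" if T: "T \<in> mats R N" for T
  proof (rule measurableI)
    show "mat_add R T x \<in> space \<mu>" if "x \<in> space \<mu>" for x using that T sp by simp
    fix X assume "X \<in> sets \<mu>"
    then have "X \<in> sigma_sets (mats R N) ?PC" using st by simp
    then show "mat_add R T -` X \<inter> space \<mu> \<in> sets \<mu>"
    proof (induction rule: sigma_sets.induct)
      case (Basic a)
      then obtain k A where a: "A \<in> mats R N" "a = pcoset R p N k A" by blast
      show ?case
        unfolding sp a(2) vim[OF T pcoset_subset[OF a(1)]] translate_pcoset[OF a(1) mat_neg_closed[OF T]]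
        by (rule pcs) (use T a in simp)
    next
      case Empty
      then show ?case by simp
    next
      case (Compl a)
      have "mat_add R T -` (mats R N - a) \<inter> space \<mu> = space \<mu> - (mat_add R T -` a \<inter> space \<mu>)"
        using T sp by auto
      then show ?case using sets.compl_sets[OF Compl.IH] by (simp only:)
    next
      case (Union a)
      have e: "mat_add R T -` (\<Union>i. a i) \<inter> space \<mu> = (\<Union>i. mat_add R T -` a i \<inter> space \<mu>)" by blast
      have "range (\<lambda>i. mat_add R T -` a i \<inter> space \<mu>) \<subseteq> sets \<mu>" using Union.IH by blast
      then show ?case unfolding e by (rule sets.countable_UN)
    qed
  qed
  have main: "mat_add R A ` E \<in> sets \<mu> \<and> emeasure \<mu> (mat_add R A ` E) = emeasure \<mu> E"
    if A: "A \<in> mats R N" and E: "E \<in> sets \<mu>" for A E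
  proof -
    note nA = mat_neg_closed[OF A]
    have nn: "mat_neg (mat_neg A) = A" using mats_carrier[OF A] by (simp add: mat_neg_def)
    have Es: "E \<subseteq> mats R N" using sets.sets_into_space[OF E] sp by simp
    have im: "mat_add R A ` E = mat_add R (mat_neg A) -` E \<inter> space \<mu>"
      using vim[OF nA Es] nn sp by simp
    have 1: "mat_add R A ` E \<in> sets \<mu>" unfolding im using meas[OF nA] E by (rule measurable_sets)
    have "\<mu> = distr \<mu> \<mu> (mat_add R (mat_neg A))"
    proof (rule haar_generator_eq)
      fix k B assume B: "B \<in> mats R N"
      have "emeasure (distr \<mu> \<mu> (mat_add R (mat_neg A))) (pcoset R p N k B) =
        emeasure \<mu> (mat_add R (mat_neg A) -` pcoset R p N k B \<inter> space \<mu>)"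
        using meas[OF nA] pcs[OF B] by (rule emeasure_distr)
      also have "\<dots> = emeasure \<mu> (pcoset R p N k (mat_add R A B))"
        unfolding sp vim[OF nA pcoset_subset[OF B]] nn translate_pcoset[OF B A] ..
      also have "\<dots> = emeasure \<mu> (pcoset R p N k B)" using A B by (intro inv) auto
      finally show "emeasure \<mu> (pcoset R p N k B) = emeasure (distr \<mu> \<mu> (mat_add R (mat_neg A))) (pcoset R p N k B)" ..
    qed (use sp st in auto)
    then have "emeasure \<mu> E = emeasure (distr \<mu> \<mu> (mat_add R (mat_neg A))) E" by simp
    also have "\<dots> = emeasure \<mu> (mat_add R A ` E)"
      unfolding im using meas[OF nA] E by (rule emeasure_distr)
    finally show ?thesis using 1 by simp
  qed
  show ?thesis unfolding is_haar_def using prob sp st main by blast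
qed

end

section \<open>Construction of Haar measure from random digits\<close>

context zp_finite begin

abbreviation idx :: "nat \<Rightarrow> (nat \<times> nat \<times> 'a) set" where "idx N \<equiv> {..<N} \<times> {..<N} \<times> S"

text \<open>Haar measure is the distribution of a random matrix whose entries are combinations of the generators of
  \<open>R\<close> with independent \<open>p\<close>-adic coefficients, given by independent uniformly distributed base \<open>p\<close> digits.\<close>

definition digits :: "nat \<Rightarrow> ((nat \<times> nat \<times> 'a) \<times> nat \<Rightarrow> nat) measure" where
  "digits N = PiM (idx N \<times> UNIV) (\<lambda>_. uniform_count_measure {..<p})"

text \<open>The coefficients modulo p^k: one natural number, formed from the first k digits, for
  each matrix entry and generator.\<close>

definition level :: "nat \<Rightarrow> ((nat \<times> nat \<times> 'a) \<times> nat \<Rightarrow> nat) \<Rightarrow> (nat \<times> nat \<times> 'a) \<Rightarrow> nat" where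
  "level k \<omega> = (\<lambda>e. \<Sum>l<k. \<omega> (e, l) * p ^ l)"

definition random_matrix :: "nat \<Rightarrow> ((nat \<times> nat \<times> 'a) \<times> nat \<Rightarrow> nat) \<Rightarrow> nat \<Rightarrow> nat \<Rightarrow> 'a" where
  "random_matrix N \<omega> = (\<lambda>i j. if i < N \<and> j < N
     then finsum R (\<lambda>s. \<iota> (\<lambda>k. int (level k \<omega> (i, j, s))) \<otimes> s) S else \<zero>)"

definition lift_matrix :: "nat \<Rightarrow> nat \<Rightarrow> ((nat \<times> nat \<times> 'a) \<Rightarrow> nat) \<Rightarrow> nat \<Rightarrow> nat \<Rightarrow> 'a" where
  "lift_matrix N k a = (\<lambda>i j. if i < N \<and> j < N then lift k (\<lambda>s. a (i, j, s)) else \<zero>)"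

lemma lift_matrix_closed: "lift_matrix N k a \<in> mats R N"
  by (simp add: mats_def lift_matrix_def lift_closed)

lemma space_digits: "\<omega> \<in> space (digits N) \<Longrightarrow> e \<in> idx N \<Longrightarrow> \<omega> (e, l) < p"
  unfolding digits_def space_PiM by (auto simp: PiE_def Pi_def space_uniform_count_measure)

lemma level_less: "\<omega> \<in> space (digits N) \<Longrightarrow> e \<in> idx N \<Longrightarrow> level k \<omega> e < p ^ k"
  unfolding level_def by (rule digit_sum_less) (rule space_digits)

lemma level_padic:
  assumes "\<omega> \<in> space (digits N)" "e \<in> idx N"
  shows "(\<lambda>k. int (level k \<omega> e)) \<in> Zp"
proof -
  have "int (level (Suc k) \<omega> e) mod int p ^ k = int (level k \<omega> e)" for k
  proof -
    have "level (Suc k) \<omega> e mod p ^ k = level k \<omega> e mod p ^ k" by (simp add: level_def)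
    also have "\<dots> = level k \<omega> e" using level_less[OF assms] by simp
    finally show ?thesis by (metis of_nat_mod of_nat_power)
  qed
  then show ?thesis using level_less[OF assms] by (simp add: padic_simps)
qed

lemma random_matrix_closed:
  assumes "\<omega> \<in> space (digits N)" shows "random_matrix N \<omega> \<in> mats R N"
proof (rule matsI)
  fix i j assume ij: "i < N" "j < N"
  have "\<iota> (\<lambda>k. int (level k \<omega> (i, j, s))) \<otimes> s \<in> carrier R" if "s \<in> S" for s
    using iota_closed[OF level_padic[OF assms, of "(i, j, s)"]] ij that S by auto
  then show "random_matrix N \<omega> i j \<in> carrier R"
    using ij S by (simp add: random_matrix_def)
qed (auto simp: random_matrix_def)

lemma random_matrix_level:
  assumes \<omega>: "\<omega> \<in> space (digits N)"
  shows "random_matrix N \<omega> \<in> pcoset R p N k (lift_matrix N k (level k \<omega>))"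
proof -
  have "pcong k (lift_matrix N k (level k \<omega>) i j) (random_matrix N \<omega> i j)" if ij: "i < N" "j < N" for i j
  proof -
    have "\<And>s. s \<in> S \<Longrightarrow> (\<lambda>k. int (level k \<omega> (i, j, s))) \<in> Zp" using level_padic[OF \<omega>] ij by simp
    from iota_sum_split[of "\<lambda>s k. int (level k \<omega> (i, j, s))" k, OF this]
    show ?thesis using ij by (auto simp: pcong_def random_matrix_def lift_matrix_def)
  qed
  then show ?thesis unfolding pcoset_iff[OF lift_matrix_closed] using random_matrix_closed[OF \<omega>] by blast
qed

lemma lift_matrix_level_cong:
  "(\<And>e. e \<in> idx N \<Longrightarrow> a e = b e) \<Longrightarrow> lift_matrix N k a = lift_matrix N k b"
  unfolding lift_matrix_def by (intro ext) (auto intro!: lift_cong)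

sublocale digit: product_prob_space "\<lambda>_. uniform_count_measure {..<p}" "idx N \<times> (UNIV :: nat set)" for N
  by (intro product_prob_spaceI prob_space_uniform_count_measure) (use p_pos in auto)

text \<open>Prescribing residues modulo p^k prescribes the first k digits of every coefficient, and
  these digits are independent and uniform.\<close>

lemma emeasure_level:
  assumes a: "a \<in> idx N \<rightarrow>\<^sub>E {..<p ^ k}"
  shows "{\<omega> \<in> space (digits N). \<forall>e\<in>idx N. level k \<omega> e = a e} \<in> sets (digits N)"
    "emeasure (digits N) {\<omega> \<in> space (digits N). \<forall>e\<in>idx N. level k \<omega> e = a e} = (ennreal (1 / p)) ^ card (idx N \<times> {..<k})"
proof -
  let ?M = "uniform_count_measure {..<p}"
  let ?X = "\<lambda>(e, l). {a e div p ^ l mod p}"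
  have fin: "finite (idx N \<times> {..<k})" using S by simp
  have X: "?X i \<in> sets ?M" for i
    using p_pos by (auto simp: sets_uniform_count_measure split: prod.split)
  have eq: "{\<omega> \<in> space (digits N). \<forall>e\<in>idx N. level k \<omega> e = a e} =
      {\<omega> \<in> space (PiM (idx N \<times> UNIV) (\<lambda>_. ?M)). \<forall>i\<in>idx N \<times> {..<k}. \<omega> i \<in> ?X i}"
  proof (intro Collect_cong conj_cong)
    fix \<omega> assume "\<omega> \<in> space (PiM (idx N \<times> (UNIV :: nat set)) (\<lambda>_. ?M))"
    then have \<omega>: "\<omega> \<in> space (digits N)" by (simp add: digits_def)
    have "level k \<omega> e = a e \<longleftrightarrow> (\<forall>l<k. \<omega> (e, l) = a e div p ^ l mod p)" if e: "e \<in> idx N" for e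
      unfolding level_def using space_digits[OF \<omega> e] PiE_mem[OF a e] by (intro digit_sum_eq_iff) auto
    then show "(\<forall>e\<in>idx N. level k \<omega> e = a e) \<longleftrightarrow> (\<forall>i\<in>idx N \<times> {..<k}. \<omega> i \<in> ?X i)" by auto
  qed (simp add: digits_def)
  show "{\<omega> \<in> space (digits N). \<forall>e\<in>idx N. level k \<omega> e = a e} \<in> sets (digits N)"
    unfolding eq unfolding digits_def
  proof (rule sets.sets_Collect_finite_All[OF _ fin])
    fix i assume "i \<in> idx N \<times> {..<k}"
    then have "(\<lambda>\<omega>. \<omega> i) \<in> measurable (PiM (idx N \<times> (UNIV :: nat set)) (\<lambda>_. ?M)) ?M"
      by (intro measurable_component_singleton) auto
    from measurable_sets[OF this X[of i]]
    show "{\<omega> \<in> space (PiM (idx N \<times> (UNIV :: nat set)) (\<lambda>_. ?M)). \<omega> i \<in> ?X i} \<in> sets (PiM (idx N \<times> UNIV) (\<lambda>_. ?M))"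
      by (simp add: vimage_def Int_def conj_commute)
  qed
  have "emeasure (digits N) {\<omega> \<in> space (digits N). \<forall>e\<in>idx N. level k \<omega> e = a e} = (\<Prod>i\<in>idx N \<times> {..<k}. emeasure ?M (?X i))"
    unfolding eq unfolding digits_def by (rule digit.emeasure_PiM_Collect) (use fin X in auto)
  also have "\<dots> = (\<Prod>i\<in>idx N \<times> {..<k}. ennreal (1 / p))"
    using p_pos by (intro prod.cong) (auto simp: emeasure_uniform_count_measure split: prod.split)
  finally show "emeasure (digits N) {\<omega> \<in> space (digits N). \<forall>e\<in>idx N. level k \<omega> e = a e} = (ennreal (1 / p)) ^ card (idx N \<times> {..<k})"
    by simp
qed

text \<open>Coefficient families modulo p^k that represent the coset. There may be several, since
  the generators may satisfy relations.\<close>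

definition lifts :: "nat \<Rightarrow> nat \<Rightarrow> (nat \<Rightarrow> nat \<Rightarrow> 'a) \<Rightarrow> ((nat \<times> nat \<times> 'a) \<Rightarrow> nat) set" where
  "lifts N k A = {a \<in> idx N \<rightarrow>\<^sub>E {..<p ^ k}. lift_matrix N k a \<in> pcoset R p N k A}"

lemma finite_lifts: "finite (lifts N k A)"
  unfolding lifts_def by (rule finite_subset[OF Collect_subset finite_PiE]) (use S in auto)

text \<open>Modulo p^k the random matrix depends on the first k digits only, so membership in a
  coset of level k is decided by the truncated coefficients.\<close>

lemma vimage_pcoset:
  assumes A: "A \<in> mats R N"
  shows "random_matrix N -` pcoset R p N k A \<inter> space (digits N) =
    (\<Union>a\<in>lifts N k A. {\<omega> \<in> space (digits N). \<forall>e\<in>idx N. level k \<omega> e = a e})"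
proof -
  have iff: "random_matrix N \<omega> \<in> pcoset R p N k A \<longleftrightarrow> lift_matrix N k (level k \<omega>) \<in> pcoset R p N k A"
    if \<omega>: "\<omega> \<in> space (digits N)" for \<omega>
  proof -
    let ?L = "lift_matrix N k (level k \<omega>)"
    have L: "pcoset R p N k (random_matrix N \<omega>) = pcoset R p N k ?L"
      by (rule pcoset_eq[OF lift_matrix_closed random_matrix_level[OF \<omega>]])
    show ?thesis
      using pcoset_eq[OF A] L pcoset_self[OF lift_matrix_closed] pcoset_self[OF random_matrix_closed[OF \<omega>]] by metis
  qed
  show ?thesis
  proof (intro equalityI subsetI)
    fix \<omega> assume "\<omega> \<in> random_matrix N -` pcoset R p N k A \<inter> space (digits N)"
    then have \<omega>: "\<omega> \<in> space (digits N)" "lift_matrix N k (level k \<omega>) \<in> pcoset R p N k A" using iff by auto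
    let ?a = "restrict (level k \<omega>) (idx N)"
    have "lift_matrix N k ?a = lift_matrix N k (level k \<omega>)" by (rule lift_matrix_level_cong) simp
    moreover have "?a \<in> idx N \<rightarrow>\<^sub>E {..<p ^ k}" unfolding restrict_PiE_iff using level_less[OF \<omega>(1)] by simp
    ultimately have "?a \<in> lifts N k A" using \<omega>(2) by (simp add: lifts_def)
    then show "\<omega> \<in> (\<Union>a\<in>lifts N k A. {\<omega> \<in> space (digits N). \<forall>e\<in>idx N. level k \<omega> e = a e})"
      using \<omega>(1) by (intro UN_I[of ?a]) auto
  next
    fix \<omega> assume "\<omega> \<in> (\<Union>a\<in>lifts N k A. {\<omega> \<in> space (digits N). \<forall>e\<in>idx N. level k \<omega> e = a e})"
    then obtain a where a: "a \<in> lifts N k A" "\<omega> \<in> space (digits N)" "\<forall>e\<in>idx N. level k \<omega> e = a e" by blast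
    have "lift_matrix N k (level k \<omega>) = lift_matrix N k a" using a(3) by (intro lift_matrix_level_cong) blast
    then have "lift_matrix N k (level k \<omega>) \<in> pcoset R p N k A" using a(1) by (simp add: lifts_def)
    then show "\<omega> \<in> random_matrix N -` pcoset R p N k A \<inter> space (digits N)" using iff[OF a(2)] a(2) by simp
  qed
qed

lemma pcong_of_nat: "m mod p ^ k = n mod p ^ k \<Longrightarrow> pcong k ([m] \<cdot> \<one>) ([n] \<cdot> \<one>)"
proof -
  have 1: "pcong k ([(n mod p ^ k)] \<cdot> \<one>) ([n] \<cdot> \<one>)" for n
  proof -
    have "[n] \<cdot> \<one> = [(n mod p ^ k + p ^ k * (n div p ^ k))] \<cdot> \<one>" by simp
    also have "\<dots> = [(n mod p ^ k)] \<cdot> \<one> \<oplus> [(p ^ k * (n div p ^ k))] \<cdot> \<one>"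
      by (rule add.nat_pow_mult[symmetric]) simp
    also have "[(p ^ k * (n div p ^ k))] \<cdot> \<one> = pip k \<otimes> ([(n div p ^ k)] \<cdot> \<one>)"
      unfolding of_nat_times of_nat_power_p ..
    finally show ?thesis unfolding pcong_def by (intro bexI[of _ "[(n div p ^ k)] \<cdot> \<one>"]) auto
  qed
  assume "m mod p ^ k = n mod p ^ k"
  then show ?thesis using pcong_trans[OF _ pcong_sym[OF _ 1[of m]] ] 1[of n] by simp
qed

text \<open>Adding fixed coefficients of B - A modulo p^k maps the families for \<open>A\<close>
  injectively to those for \<open>B\<close>. By symmetry all cosets of a level have equally many
  families.\<close>

lemma card_lifts_le:
  assumes A: "A \<in> mats R N" and B: "B \<in> mats R N"
  shows "card (lifts N k A) \<le> card (lifts N k B)"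
proof -
  define C where "C = mat_add R (mat_neg A) B"
  have C: "C \<in> mats R N" using A B by (simp add: C_def)
  have AC: "mat_add R A C = B" using A B by (simp add: C_def mat_add_neg_cancel')
  have "\<forall>i j. \<exists>a. (\<forall>s\<in>S. a s \<in> Zp) \<and> C i j = finsum R (\<lambda>s. \<iota> (a s) \<otimes> s) S"
    using span[OF mats_carrier[OF C]] by blast
  then obtain c where c: "\<And>i j s. s \<in> S \<Longrightarrow> c i j s \<in> Zp" "\<And>i j. C i j = finsum R (\<lambda>s. \<iota> (c i j s) \<otimes> s) S"
    by metis
  define b where "b = (\<lambda>(i, j, s). nat (c i j s k))"
  have Cb: "pcong k (lift k (\<lambda>s. b (i, j, s))) (C i j)" for i j
    using iota_sum_split[of "c i j" k, OF c(1)] unfolding c(2) pcong_def b_def by simp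
  let ?g = "\<lambda>a. restrict (\<lambda>e. (a e + b e) mod p ^ k) (idx N)"
  have lift_add: "pcong k (lift k (\<lambda>s. a (i, j, s)) \<oplus> lift k (\<lambda>s. b (i, j, s))) (lift k (\<lambda>s. ?g a (i, j, s)))"
    if ij: "i < N" "j < N" for a i j
  proof -
    have Sc: "s \<in> carrier R" if "s \<in> S" for s using S that by blast
    have "lift k (\<lambda>s. a (i, j, s)) \<oplus> lift k (\<lambda>s. b (i, j, s)) =
      finsum R (\<lambda>s. ([a (i, j, s)] \<cdot> \<one>) \<otimes> s \<oplus> ([b (i, j, s)] \<cdot> \<one>) \<otimes> s) S"
      unfolding lift_def using Sc by (intro finsum_addf[symmetric]) auto
    also have "\<dots> = finsum R (\<lambda>s. s \<otimes> ([(a (i, j, s) + b (i, j, s))] \<cdot> \<one>)) S"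
    proof (rule finsum_cong'[OF refl])
      fix s assume s: "s \<in> S"
      have "[(a (i, j, s) + b (i, j, s))] \<cdot> \<one> = [a (i, j, s)] \<cdot> \<one> \<oplus> [b (i, j, s)] \<cdot> \<one>"
        by (rule add.nat_pow_mult[symmetric]) simp
      then show "([a (i, j, s)] \<cdot> \<one>) \<otimes> s \<oplus> ([b (i, j, s)] \<cdot> \<one>) \<otimes> s = s \<otimes> ([(a (i, j, s) + b (i, j, s))] \<cdot> \<one>)"
        using Sc[OF s] by (simp add: r_distr m_comm)
    qed (use Sc in auto)
    finally have 1: "lift k (\<lambda>s. a (i, j, s)) \<oplus> lift k (\<lambda>s. b (i, j, s)) =
      finsum R (\<lambda>s. s \<otimes> ([(a (i, j, s) + b (i, j, s))] \<cdot> \<one>)) S" .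
    have 2: "lift k (\<lambda>s. ?g a (i, j, s)) = finsum R (\<lambda>s. s \<otimes> ([(?g a (i, j, s))] \<cdot> \<one>)) S"
      unfolding lift_def using Sc by (intro finsum_cong') (auto simp: m_comm)
    show ?thesis unfolding 1 2
    proof (rule pcong_finsum[OF S(1)])
      fix s assume s: "s \<in> S"
      have "pcong k ([(a (i, j, s) + b (i, j, s))] \<cdot> \<one>) ([(?g a (i, j, s))] \<cdot> \<one>)"
        by (rule pcong_of_nat) (use ij s in simp)
      then show "pcong k (s \<otimes> ([(a (i, j, s) + b (i, j, s))] \<cdot> \<one>)) (s \<otimes> ([(?g a (i, j, s))] \<cdot> \<one>))"
        using Sc[OF s] by (intro pcong_mult) auto
    qed (use Sc in auto)
  qed
  have "?g ` lifts N k A \<subseteq> lifts N k B"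
  proof (rule image_subsetI)
    fix a assume a: "a \<in> lifts N k A"
    have "?g a \<in> idx N \<rightarrow>\<^sub>E {..<p ^ k}" unfolding restrict_PiE_iff using p_pos by simp
    moreover have "lift_matrix N k (?g a) \<in> pcoset R p N k B"
      unfolding pcoset_iff[OF B]
    proof (intro conjI allI impI lift_matrix_closed)
      fix i j assume ij: "i < N" "j < N"
      have cl: "A i j \<in> carrier R" "C i j \<in> carrier R" using mats_carrier A C by auto
      have "pcong k (A i j) (lift k (\<lambda>s. a (i, j, s)))"
        using a ij unfolding lifts_def by (simp add: pcoset_iff[OF A] lift_matrix_def)
      moreover have "pcong k (C i j) (lift k (\<lambda>s. b (i, j, s)))" using pcong_sym[OF lift_closed Cb] .
      ultimately have "pcong k (A i j \<oplus> C i j) (lift k (\<lambda>s. a (i, j, s)) \<oplus> lift k (\<lambda>s. b (i, j, s)))"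
        using cl by (intro pcong_add) auto
      then have "pcong k (A i j \<oplus> C i j) (lift k (\<lambda>s. ?g a (i, j, s)))"
        using pcong_trans[OF _ _ lift_add[OF ij]] cl by simp
      moreover have "A i j \<oplus> C i j = B i j" using fun_cong[OF fun_cong[OF AC, of i], of j] by simp
      ultimately show "pcong k (B i j) (lift_matrix N k (?g a) i j)" using ij by (simp add: lift_matrix_def)
    qed
    ultimately show "?g a \<in> lifts N k B" by (simp add: lifts_def)
  qed
  moreover have "inj_on ?g (lifts N k A)"
  proof (rule inj_onI)
    fix a a' assume aa: "a \<in> lifts N k A" "a' \<in> lifts N k A" "?g a = ?g a'"
    have P: "a \<in> idx N \<rightarrow>\<^sub>E {..<p ^ k}" "a' \<in> idx N \<rightarrow>\<^sub>E {..<p ^ k}" using aa by (auto simp: lifts_def)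
    have "a e = a' e" if e: "e \<in> idx N" for e
    proof -
      have "(a e + b e) mod p ^ k = (a' e + b e) mod p ^ k" using fun_cong[OF aa(3), of e] e by simp
      then have "a e mod p ^ k = a' e mod p ^ k" by (simp add: nat_mod_eq_iff)
      then show ?thesis using PiE_mem[OF P(1) e] PiE_mem[OF P(2) e] by simp
    qed
    then show "a = a'" by (rule PiE_ext[OF P])
  qed
  ultimately show ?thesis using finite_lifts by (intro card_inj_on_le[of ?g]) auto
qed

text \<open>A coset of level k receives the mass p^(-k m) for each coefficient family that
  represents it, with m the number of coefficients, and the number of these families is the same for
  all cosets of the level.\<close>

lemma haar_exists: "\<exists>\<mu>. is_haar R p N \<mu>"
proof -
  let ?PC = "{pcoset R p N k A | k A. A \<in> mats R N}"
  define \<mu> where "\<mu> = distr (digits N) (sigma (mats R N) ?PC) (random_matrix N)"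
  have PC: "?PC \<subseteq> Pow (mats R N)" using pcoset_subset by auto
  have dis: "disjoint_family_on (\<lambda>a. {\<omega> \<in> space (digits N). \<forall>e\<in>idx N. level k \<omega> e = a e}) (lifts N k A)" for k A
    unfolding disjoint_family_on_def
  proof (intro ballI impI)
    fix a a' assume aa: "a \<in> lifts N k A" "a' \<in> lifts N k A" "a \<noteq> a'"
    have P: "a \<in> idx N \<rightarrow>\<^sub>E {..<p ^ k}" "a' \<in> idx N \<rightarrow>\<^sub>E {..<p ^ k}" using aa by (auto simp: lifts_def)
    have "\<exists>e\<in>idx N. a e \<noteq> a' e" using PiE_ext[OF P] aa(3) by blast
    then show "{\<omega> \<in> space (digits N). \<forall>e\<in>idx N. level k \<omega> e = a e} \<inter>
      {\<omega> \<in> space (digits N). \<forall>e\<in>idx N. level k \<omega> e = a' e} = {}" by auto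
  qed
  have lv: "a \<in> idx N \<rightarrow>\<^sub>E {..<p ^ k}" if "a \<in> lifts N k A" for a k A using that by (simp add: lifts_def)
  have meas: "random_matrix N \<in> measurable (digits N) (sigma (mats R N) ?PC)"
  proof (rule measurable_measure_of[OF PC])
    show "random_matrix N \<in> space (digits N) \<rightarrow> mats R N" using random_matrix_closed by blast
    fix P assume "P \<in> ?PC"
    then obtain k A where A: "A \<in> mats R N" "P = pcoset R p N k A" by blast
    show "random_matrix N -` P \<inter> space (digits N) \<in> sets (digits N)"
      unfolding A(2) vimage_pcoset[OF A(1)] by (intro sets.finite_UN finite_lifts emeasure_level(1) lv)
  qed
  have em: "emeasure \<mu> (pcoset R p N k A) = of_nat (card (lifts N k A)) * ennreal (1 / p) ^ card (idx N \<times> {..<k})"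
    if A: "A \<in> mats R N" for k A
  proof -
    have "pcoset R p N k A \<in> sets (sigma (mats R N) ?PC)"
      unfolding sets_measure_of[OF PC] using A by (intro sigma_sets.Basic) blast
    then have "emeasure \<mu> (pcoset R p N k A) = emeasure (digits N) (random_matrix N -` pcoset R p N k A \<inter> space (digits N))"
      unfolding \<mu>_def by (rule emeasure_distr[OF meas])
    also have "\<dots> = (\<Sum>a\<in>lifts N k A. emeasure (digits N) {\<omega> \<in> space (digits N). \<forall>e\<in>idx N. level k \<omega> e = a e})"
      unfolding vimage_pcoset[OF A]
    proof (rule sum_emeasure[symmetric, OF _ dis finite_lifts])
      show "(\<lambda>a. {\<omega> \<in> space (digits N). \<forall>e\<in>idx N. level k \<omega> e = a e}) ` lifts N k A \<subseteq> sets (digits N)"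
        by (rule image_subsetI) (intro emeasure_level(1) lv)
    qed
    also have "\<dots> = (\<Sum>a\<in>lifts N k A. ennreal (1 / p) ^ card (idx N \<times> {..<k}))"
      by (intro sum.cong refl emeasure_level(2) lv)
    finally show ?thesis by simp
  qed
  have "is_haar R p N \<mu>"
  proof (rule is_haarI)
    have "prob_space (digits N)" unfolding digits_def by (rule digit.P.prob_space_axioms)
    then show "prob_space \<mu>" unfolding \<mu>_def by (rule prob_space.prob_space_distr[OF _ meas])
    show "space \<mu> = mats R N" "sets \<mu> = sigma_sets (mats R N) ?PC"
      unfolding \<mu>_def by (simp_all add: space_measure_of[OF PC] sets_measure_of[OF PC])
    fix k A B assume AB: "A \<in> mats R N" "B \<in> mats R N"
    have "card (lifts N k A) = card (lifts N k B)" using card_lifts_le[OF AB] card_lifts_le[OF AB(2,1)] by (rule antisym)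
    then show "emeasure \<mu> (pcoset R p N k A) = emeasure \<mu> (pcoset R p N k B)" using em AB by simp
  qed
  then show ?thesis by blast
qed

lemma is_haar_haar: "is_haar R p N (haar R p N)"
proof -
  obtain \<mu> where \<mu>: "is_haar R p N \<mu>" using haar_exists by blast
  have "haar R p N = \<mu>" unfolding haar_def using \<mu> haar_unique by (intro the_equality)
  then show ?thesis using \<mu> by simp
qed

end

theorem theorem2p3:
  fixes p :: nat and R :: "'a ring"
  assumes "prime p" and "local_ring R" and "finite_Zp_algebra p R"
  shows
   "(\<forall>N\<ge>1. {G \<in> mats R N. infinite (coker_set R N G)} \<in> sets (haar R p N) \<and>
           emeasure (haar R p N) {G \<in> mats R N. infinite (coker_set R N G)} = 0) \<and>
    (\<forall>N\<ge>1. \<forall>C\<in>S_classes R. {G \<in> mats R N. \<exists>M\<in>C. coker_iso R N G M} \<in> sets (haar R p N)) \<and>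
    (\<exists>c::real.
       (\<lambda>n. real (card (GL (residue_field R) n)) / real (card (mats (residue_field R) n)))
          \<longlonglongrightarrow> c \<and>
       (\<lambda>i. 1 - 1 / real (card (carrier (residue_field R))) ^ Suc i) has_prod c \<and>
       (\<exists>\<mu>R :: 'a rmod set \<Rightarrow> real.
          (\<forall>C\<in>S_classes R. \<mu>R C \<ge> 0) \<and> \<mu>R summable_on S_classes R \<and>
          infsum \<mu>R (S_classes R) = 1 \<and>
          (\<forall>C\<in>S_classes R. \<mu>R C \<noteq> 0 \<longrightarrow> (\<exists>M\<in>C. in_T R M)) \<and>
          (\<forall>C\<in>S_classes R. \<forall>M\<in>C. in_T R M \<longrightarrow> \<mu>R C = c / real (card (aut R M))) \<and>
          (\<forall>f :: 'a rmod set \<Rightarrow> real. bounded (f ` S_classes R) \<longrightarrow>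
             (\<lambda>N. \<Sum>\<^sub>\<infinity>C\<in>S_classes R. f C *
                     measure (haar R p N) {G \<in> mats R N. \<exists>M\<in>C. coker_iso R N G M})
             \<longlonglongrightarrow> (\<Sum>\<^sub>\<infinity>C\<in>S_classes R. f C * \<mu>R C))))"
proof -
  obtain \<iota> S where \<iota>: "\<iota> \<in> ring_hom (padic_int p) R" "inj_on \<iota> (carrier (padic_int p))"
    and S: "finite S" "S \<subseteq> carrier R" "\<forall>r\<in>carrier R. \<exists>a. (\<forall>s\<in>S. a s \<in> carrier (padic_int p)) \<and>
                r = finsum R (\<lambda>s. \<iota> (a s) \<otimes>\<^bsub>R\<^esub> s) S"
    using assms(3) unfolding finite_Zp_algebra_def by blast
  obtain mm where mm: "maximalideal mm R" "\<And>I. maximalideal I R \<Longrightarrow> I = mm"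
    using assms(2) unfolding local_ring_def by blast
  have R: "cring R" using assms(2) by (simp add: local_ring_def)
  interpret zp_finite R p \<iota> S mm
    by (rule zp_finite.intro[OF R zp_finite_axioms.intro[OF assms(1) \<iota> S(1,2) S(3)[rule_format] mm]])
  show ?thesis
  proof (intro conjI allI impI ballI)
    fix N
    show "{G \<in> mats R N. infinite (coker_set R N G)} \<in> sets (haar R p N)"
      "emeasure (haar R p N) {G \<in> mats R N. infinite (coker_set R N G)} = 0"
      by (rule infinite_coker_null[OF is_haar_haar])+
    fix C assume "C \<in> S_classes R"
    then show "{G \<in> mats R N. \<exists>M\<in>C. coker_iso R N G M} \<in> sets (haar R p N)"
      by (rule padic_open_sets[OF is_haar_haar class_open[OF is_haar_haar]])
  qed (rule coker_measure_limit[OF is_haar_haar])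
qed

end
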